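(* The adjunctions $L\dashv i^*$ are equivalences of homotopy theories \[ L\colon(\Gamma\text{-}\mathrm{Cat},\mathcal S)\rightleftarrows(\mathcal G_*\text{-}\mathrm{Cat},\mathcal S^{\,i})\colon i^* \quad\text{and}\quad L\colon(\Gamma\text{-}\mathrm{sSet},\mathcal S)\rightleftarrows(\mathcal G_*\text{-}\mathrm{sSet},\mathcal S^{\,i})\colon i^*. \] That is, in each case both $L$ and $i^*$ are relative functors and equivalences of homotopy theories.
   Context: **Homotopy theories.** A relative category $(\mathcal C,\mathcal W)$ is a category $\mathcal C$ with a subcategory $\mathcal W$ containing all objects. A relative functor $(\mathcal C,\mathcal W)\to(\mathcal C',\mathcal W')$ is a functor $\mathcal C\to\mathcal C'$ sending $\mathcal W$ into $\mathcal W'$. For $n\ge 0$ let $(\mathcal C,\mathcal W)^{\Delta[n]}$ be the category whose objects are functors $\{0<\cdots<n\}\to\mathcal C$ and whose morphisms are natural transformations with all components in $\mathcal W$. The classification diagram $N^{cl}(\mathcal C,\mathcal W)$ is the bisimplicial set whose $n$-th simplicial set is the nerve of $(\mathcal C,\mathcal W)^{\Delta[n]}$. A relative functor $F$ is an equivalence of homotopy theories if $\mathsf R(N^{cl}F)$ is a weak equivalence in Rezk's complete Segal space model structure on bisimplicial sets, with $\mathsf R$ a fibrant replacement. A functor $F\colon\mathcal C\to\mathcal C'$ creates $\mathcal W$ from $\mathcal W'$ if $\mathcal W=F^{-1}(\mathcal W')$. **Indexing categories.** $\mathcal F$ has objects the pointed sets $\underline n=\{0,\dots,n\}$, $n\ge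 0$ (basepoint $0$), and morphisms the pointed maps; $\underline 0$ is a zero object. The category $\mathcal G$ has a zero object $*$. Its objects are tuples $\langle\underline n\rangle=(\underline n_1,\dots,\underline n_q)$ with $q\ge 0$ (including the empty tuple $\langle\rangle$) together with $*$, where a tuple is identified with $*$ if some $\underline n_i=\underline 0$. A morphism $(\underline n_1,\dots,\underline n_q)\to(\underline m_1,\dots,\underline m_p)$ is a pair $(f,\langle\psi\rangle)$ with $f\colon\{1,\dots,q\}\to\{1,\dots,p\}$ an injection and $\psi_j\colon\underline n_{f^{-1}(j)}\to\underline m_j$ in $\mathcal F$ for $1\le j\le p$, where $\underline n_\varnothing=\underline 1$; all pairs having some $\psi_j$ that factors through $\underline 0$ are identified with the zero morphism. Composition is $(g,\langle\phi\rangle)(f,\langle\psi\rangle)=(gf,\langle\phi\rangle\circ g_*\langle\psi\rangle)$, where $g_*\langle\psi\rangle$ has $k$-th entry $\psi_{g^{-1}(k)}$, with $\psi_\varnothing=1_{\underline 1}$. The functor $i\colon\mathcal F\to\mathcal G$ sends $\underline n$ to the length-one tuple $(\underline n)$ and $\psi$ to $(1,(\psi))$. **Diagrams.** $\Gamma\text{-}\mathrm{Cat}$ (resp. $\Gamma\text{-}\mathrm{sSet}$) is the category of functors from $\mathcal F$ to small categories (resp. simplicial sets) sending $\underline 0$ to the chosen terminal object, with natural transformations. $\mathcal G_*\text{-}\mathrm{Cat}$ and $\mathcal G_*\text{-}\mathrm{sSet}$ are the analogous categories of functors on $\mathcal G$ sending $*$ to the chosen terminal object. $i^*$ denotes precomposition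 with $i$. $N_*$ is the levelwise nerve. **The left adjoint $L$.** For $X$ in $\Gamma\text{-}\mathrm{Cat}$ or $\Gamma\text{-}\mathrm{sSet}$ and $t\in\mathcal G$, \[ (LX)t=\int^{\underline n\in\mathcal F}\bigvee_{\mathcal G^\flat(i(\underline n),t)}X\underline n , \] a coend in small categories, respectively simplicial sets. Here $\mathcal G^\flat(a,b)$ is the set of nonzero morphisms $a\to b$ (those not factoring through $*$); each $X\underline n$ is pointed by $X(\underline 0\to\underline n)$; the wedge is the pushout along basepoints, with empty wedge the chosen terminal object; and whenever composition on the indexing set yields a zero morphism, the corresponding summand is sent to the basepoint. Functoriality in $t$ and $X$ is the evident one. **Stable equivalences.** $\mathrm{Sp}_{\ge0}$ is the category of connective symmetric spectra of simplicial sets and $\mathcal S\subset\mathrm{Sp}_{\ge0}$ its stable equivalences. $K^{F}\colon\Gamma\text{-}\mathrm{sSet}\to\mathrm{Sp}_{\ge0}$ is the usual prolongation: with $S^1=\Delta[1]/\partial\Delta[1]$ and $(S^1)_p=\underline p$, the $m$-th simplicial set of $K^FX$ is $p\mapsto X(\underline p^{\wedge m})_p$, with $\Sigma_m$ permuting smash factors and structure maps induced by the pointed maps $\underline 1\to\underline p$ corresponding to the $p$-simplices of $S^1$. The subcategory $\mathcal S$ of stable equivalences in $\Gamma\text{-}\mathrm{sSet}$ is created by $K^F$, and $\mathcal S$ in $\Gamma\text{-}\mathrm{Cat}$ is created by $N_*\colon\Gamma\text{-}\mathrm{Cat}\to\Gamma\text{-}\mathrm{sSet}$. In $\mathcal G_*\text{-}\mathrm{Cat}$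 and $\mathcal G_*\text{-}\mathrm{sSet}$, $\mathcal S^{\,i}=(i^* )^{-1}(\mathcal S)$ (the $i^*$-stable equivalences). *)

theory Defs
  imports "HOL-Analysis.Analysis" "HOL-Homology.Simplices"
begin

section \<open>Categories, functors, natural transformations\<close>

record ('o, 'm) cat =
  Ob :: "'o set"
  Ar :: "'m set"
  Dom :: "'m \<Rightarrow> 'o"
  Cod :: "'m \<Rightarrow> 'o"
  Id :: "'o \<Rightarrow> 'm"
  Comp :: "'m \<Rightarrow> 'm \<Rightarrow> 'm"  \<comment> \<open>\<open>Comp C g f\<close> is \<open>g\<close> after \<open>f\<close>\<close>

record ('o, 'm, 'p, 'n) ftor =
  OMap :: "'o \<Rightarrow> 'p"
  AMap :: "'m \<Rightarrow> 'n"

text \<open>Arrows of concrete categories carry their source and target.\<close>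

datatype ('o, 'c) arr = Arr (src: 'o) (tgt: 'o) (mor: 'c)

definition Hom :: "('o, 'm, 'z) cat_scheme \<Rightarrow> 'o \<Rightarrow> 'o \<Rightarrow> 'm set" where
  "Hom C a b = {f \<in> Ar C. Dom C f = a \<and> Cod C f = b}"

definition category :: "('o, 'm) cat \<Rightarrow> bool" where
  "category C \<longleftrightarrow>
     (\<forall>f\<in>Ar C. Dom C f \<in> Ob C \<and> Cod C f \<in> Ob C) \<and>
     (\<forall>a\<in>Ob C. Id C a \<in> Hom C a a) \<and>
     (\<forall>f\<in>Ar C. \<forall>g\<in>Ar C. Dom C g = Cod C f \<longrightarrow> Comp C g f \<in> Hom C (Dom C f) (Cod C g)) \<and>
     (\<forall>f\<in>Ar C. Comp C f (Id C (Dom C f)) = f \<and> Comp C (Id C (Cod C f)) f = f) \<and>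
     (\<forall>f\<in>Ar C. \<forall>g\<in>Ar C. \<forall>h\<in>Ar C. Dom C g = Cod C f \<longrightarrow> Dom C h = Cod C g \<longrightarrow>
        Comp C h (Comp C g f) = Comp C (Comp C h g) f)"

text \<open>Functors take the value \<open>undefined\<close> outside the source category, so that equality of
  functors is extensional.\<close>

definition is_ftor :: "('o, 'm) cat \<Rightarrow> ('p, 'n) cat \<Rightarrow> ('o, 'm, 'p, 'n) ftor \<Rightarrow> bool" where
  "is_ftor C D F \<longleftrightarrow>
     OMap F \<in> Ob C \<rightarrow>\<^sub>E Ob D \<and> AMap F \<in> Ar C \<rightarrow>\<^sub>E Ar D \<and>
     (\<forall>f\<in>Ar C. Dom D (AMap F f) = OMap F (Dom C f) \<and> Cod D (AMap F f) = OMap F (Cod C f)) \<and>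
     (\<forall>a\<in>Ob C. AMap F (Id C a) = Id D (OMap F a)) \<and>
     (\<forall>f\<in>Ar C. \<forall>g\<in>Ar C. Dom C g = Cod C f \<longrightarrow>
        AMap F (Comp C g f) = Comp D (AMap F g) (AMap F f))"

definition fid :: "('o, 'm) cat \<Rightarrow> ('o, 'm, 'o, 'm) ftor" where
  "fid C = \<lparr>OMap = \<lambda>a\<in>Ob C. a, AMap = \<lambda>f\<in>Ar C. f\<rparr>"

definition ftor_comp ::
  "('o, 'm) cat \<Rightarrow> ('p, 'n, 'q, 'k) ftor \<Rightarrow> ('o, 'm, 'p, 'n) ftor \<Rightarrow> ('o, 'm, 'q, 'k) ftor" where
  "ftor_comp C G F = \<lparr>OMap = \<lambda>a\<in>Ob C. OMap G (OMap F a), AMap = \<lambda>f\<in>Ar C. AMap G (AMap F f)\<rparr>"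

definition nat_trans ::
  "('o, 'm) cat \<Rightarrow> ('p, 'n) cat \<Rightarrow> ('o, 'm, 'p, 'n) ftor \<Rightarrow> ('o, 'm, 'p, 'n) ftor \<Rightarrow> ('o \<Rightarrow> 'n) \<Rightarrow> bool"
  where
  "nat_trans C D F G \<alpha> \<longleftrightarrow>
     \<alpha> \<in> extensional (Ob C) \<and>
     (\<forall>a\<in>Ob C. \<alpha> a \<in> Hom D (OMap F a) (OMap G a)) \<and>
     (\<forall>f\<in>Ar C. Comp D (AMap G f) (\<alpha> (Dom C f)) = Comp D (\<alpha> (Cod C f)) (AMap F f))"

definition opp :: "('o, 'm) cat \<Rightarrow> ('o, 'm) cat" where
  "opp C = \<lparr>Ob = Ob C, Ar = Ar C, Dom = Cod C, Cod = Dom C, Id = Id C, Comp = \<lambda>g f. Comp C f g\<rparr>"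

definition prod_cat :: "('o, 'm) cat \<Rightarrow> ('p, 'n) cat \<Rightarrow> ('o \<times> 'p, 'm \<times> 'n) cat" where
  "prod_cat C D = \<lparr>Ob = Ob C \<times> Ob D, Ar = Ar C \<times> Ar D,
     Dom = map_prod (Dom C) (Dom D), Cod = map_prod (Cod C) (Cod D),
     Id = map_prod (Id C) (Id D),
     Comp = \<lambda>(g, g') (f, f'). (Comp C g f, Comp D g' f')\<rparr>"

text \<open>Functors \<open>J \<rightarrow> C\<close>, with the natural transformations all of whose components lie in \<open>W\<close>.\<close>

definition ftor_cat ::
  "('o, 'm) cat \<Rightarrow> ('p, 'n) cat \<Rightarrow> 'n set
    \<Rightarrow> (('o, 'm, 'p, 'n) ftor, (('o, 'm, 'p, 'n) ftor, 'o \<Rightarrow> 'n) arr) cat" where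
  "ftor_cat J C W = \<lparr>
     Ob = {X. is_ftor J C X},
     Ar = {Arr X Y \<alpha> | X Y \<alpha>. is_ftor J C X \<and> is_ftor J C Y \<and> nat_trans J C X Y \<alpha> \<and>
                              (\<forall>j\<in>Ob J. \<alpha> j \<in> W)},
     Dom = src, Cod = tgt,
     Id = \<lambda>X. Arr X X (\<lambda>j\<in>Ob J. Id C (OMap X j)),
     Comp = \<lambda>b a. Arr (src a) (tgt b) (\<lambda>j\<in>Ob J. Comp C (mor b j) (mor a j))\<rparr>"

text \<open>The full subcategory of the diagrams \<open>J \<rightarrow> C\<close> that send the object \<open>z\<close> to \<open>T\<close>.\<close>

definition pdiag ::
  "('o, 'm) cat \<Rightarrow> 'o \<Rightarrow> ('p, 'n) cat \<Rightarrow> 'p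
    \<Rightarrow> (('o, 'm, 'p, 'n) ftor, (('o, 'm, 'p, 'n) ftor, 'o \<Rightarrow> 'n) arr) cat" where
  "pdiag J z C T = (ftor_cat J C (Ar C))\<lparr>
     Ob := {X. is_ftor J C X \<and> OMap X z = T},
     Ar := {a \<in> Ar (ftor_cat J C (Ar C)). OMap (src a) z = T \<and> OMap (tgt a) z = T}\<rparr>"

definition terminal_object :: "('o, 'm) cat \<Rightarrow> 'o \<Rightarrow> bool" where
  "terminal_object C T \<longleftrightarrow> T \<in> Ob C \<and> (\<forall>a\<in>Ob C. \<exists>!f. f \<in> Hom C a T)"

definition adjunction ::
  "('o, 'm) cat \<Rightarrow> ('p, 'n) cat \<Rightarrow> ('o, 'm, 'p, 'n) ftor \<Rightarrow> ('p, 'n, 'o, 'm) ftor \<Rightarrow> bool" where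
  "adjunction C D F G \<longleftrightarrow> is_ftor C D F \<and> is_ftor D C G \<and>
     (\<exists>\<eta> \<epsilon>. nat_trans C C (fid C) (ftor_comp C G F) \<eta> \<and> nat_trans D D (ftor_comp D F G) (fid D) \<epsilon> \<and>
       (\<forall>a\<in>Ob C. Comp D (\<epsilon> (OMap F a)) (AMap F (\<eta> a)) = Id D (OMap F a)) \<and>
       (\<forall>b\<in>Ob D. Comp C (AMap G (\<epsilon> b)) (\<eta> (OMap G b)) = Id C (OMap G b)))"


section \<open>Simplicial sets\<close>

text \<open>\<open>dhom m n\<close> is the set of morphisms \<open>[m] \<rightarrow> [n]\<close> of the simplex category, and
  \<open>act X m n \<theta> : X\<^sub>n \<rightarrow> X\<^sub>m\<close> is the operator of \<open>\<theta> : [m] \<rightarrow> [n]\<close>.\<close>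

definition dhom :: "nat \<Rightarrow> nat \<Rightarrow> (nat \<Rightarrow> nat) set" where
  "dhom m n = {\<theta> \<in> {..m} \<rightarrow>\<^sub>E {..n}. mono_on {..m} \<theta>}"

record 'a sset =
  spx :: "nat \<Rightarrow> 'a set"
  act :: "nat \<Rightarrow> nat \<Rightarrow> (nat \<Rightarrow> nat) \<Rightarrow> 'a \<Rightarrow> 'a"

definition is_sset :: "'a sset \<Rightarrow> bool" where
  "is_sset X \<longleftrightarrow>
     (\<forall>m n. \<forall>\<theta>\<in>dhom m n. act X m n \<theta> \<in> spx X n \<rightarrow> spx X m) \<and>
     (\<forall>n. \<forall>x\<in>spx X n. act X n n (\<lambda>i\<in>{..n}. i) x = x) \<and>
     (\<forall>k m n. \<forall>\<phi>\<in>dhom k m. \<forall>\<theta>\<in>dhom m n. \<forall>x\<in>spx X n.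
        act X k n (compose {..k} \<theta> \<phi>) x = act X k m \<phi> (act X m n \<theta> x))"

definition smaps :: "'a sset \<Rightarrow> 'b sset \<Rightarrow> (nat \<Rightarrow> 'a \<Rightarrow> 'b) set" where
  "smaps X Y = {f. (\<forall>n. f n \<in> spx X n \<rightarrow>\<^sub>E spx Y n) \<and>
     (\<forall>m n. \<forall>\<theta>\<in>dhom m n. \<forall>x\<in>spx X n. f m (act X m n \<theta> x) = act Y m n \<theta> (f n x))}"

definition sid :: "'a sset \<Rightarrow> nat \<Rightarrow> 'a \<Rightarrow> 'a" where
  "sid X = (\<lambda>k. \<lambda>x\<in>spx X k. x)"

definition smap_comp :: "'a sset \<Rightarrow> (nat \<Rightarrow> 'b \<Rightarrow> 'c) \<Rightarrow> (nat \<Rightarrow> 'a \<Rightarrow> 'b) \<Rightarrow> nat \<Rightarrow> 'a \<Rightarrow> 'c" where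
  "smap_comp X g f = (\<lambda>k. compose (spx X k) (g k) (f k))"

definition sprod :: "'a sset \<Rightarrow> 'b sset \<Rightarrow> ('a \<times> 'b) sset" where
  "sprod X Y = \<lparr>spx = \<lambda>k. spx X k \<times> spx Y k, act = \<lambda>m n \<theta>. map_prod (act X m n \<theta>) (act Y m n \<theta>)\<rparr>"

definition Delta :: "nat \<Rightarrow> (nat \<Rightarrow> nat) sset" where
  "Delta n = \<lparr>spx = \<lambda>k. dhom k n, act = \<lambda>m k \<theta> \<sigma>. compose {..m} \<sigma> \<theta>\<rparr>"

definition boundary :: "nat \<Rightarrow> (nat \<Rightarrow> nat) sset" where
  "boundary n = (Delta n)\<lparr>spx := \<lambda>k. {\<sigma> \<in> dhom k n. \<sigma> ` {..k} \<noteq> {..n}}\<rparr>"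

definition horn :: "nat \<Rightarrow> nat \<Rightarrow> (nat \<Rightarrow> nat) sset" where
  "horn n r = (Delta n)\<lparr>spx := \<lambda>k. {\<sigma> \<in> dhom k n. \<not> {..n} - {r} \<subseteq> \<sigma> ` {..k}}\<rparr>"

definition kan_fibration :: "'a sset \<Rightarrow> 'b sset \<Rightarrow> (nat \<Rightarrow> 'a \<Rightarrow> 'b) \<Rightarrow> bool" where
  "kan_fibration X Y p \<longleftrightarrow> p \<in> smaps X Y \<and>
     (\<forall>n\<ge>1. \<forall>r\<le>n. \<forall>u\<in>smaps (horn n r) X. \<forall>v\<in>smaps (Delta n) Y.
        (\<forall>k. \<forall>\<sigma>\<in>spx (horn n r) k. p k (u k \<sigma>) = v k \<sigma>) \<longrightarrow>
        (\<exists>w\<in>smaps (Delta n) X.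
           (\<forall>k. \<forall>\<sigma>\<in>spx (horn n r) k. w k \<sigma> = u k \<sigma>) \<and>
           (\<forall>k. \<forall>\<sigma>\<in>spx (Delta n) k. p k (w k \<sigma>) = v k \<sigma>)))"

definition kan_complex :: "'a sset \<Rightarrow> bool" where
  "kan_complex X \<longleftrightarrow> is_sset X \<and>
     (\<forall>n\<ge>1. \<forall>r\<le>n. \<forall>u\<in>smaps (horn n r) X. \<exists>w\<in>smaps (Delta n) X.
        \<forall>k. \<forall>\<sigma>\<in>spx (horn n r) k. w k \<sigma> = u k \<sigma>)"


subsection \<open>Geometric realization and weak equivalences\<close>

definition quotient_topology :: "'a topology \<Rightarrow> ('a \<Rightarrow> 'b) \<Rightarrow> 'b topology" where
  "quotient_topology X q =
     topology (\<lambda>U. U \<subseteq> q ` topspace X \<and> openin X {x \<in> topspace X. q x \<in> U})"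

text \<open>The disjoint union of the spaces \<open>X\<^sub>n \<times> |\<Delta>\<^sup>n|\<close>, with \<open>X\<^sub>n\<close> discrete.\<close>

definition rsum :: "'a sset \<Rightarrow> (nat \<times> 'a \<times> (nat \<Rightarrow> real)) topology" where
  "rsum X = sum_topology (\<lambda>n. prod_topology (discrete_topology (spx X n))
     (subtopology (powertop_real UNIV) (standard_simplex n))) UNIV"

definition pushpt :: "nat \<Rightarrow> (nat \<Rightarrow> nat) \<Rightarrow> (nat \<Rightarrow> real) \<Rightarrow> nat \<Rightarrow> real" where
  "pushpt m \<theta> t = (\<lambda>j. \<Sum>i | i \<le> m \<and> \<theta> i = j. t i)"

definition rglue ::
  "'a sset \<Rightarrow> nat \<times> 'a \<times> (nat \<Rightarrow> real) \<Rightarrow> nat \<times> 'a \<times> (nat \<Rightarrow> real) \<Rightarrow> bool" where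
  "rglue X p q \<longleftrightarrow> (\<exists>m n x t. \<exists>\<theta>\<in>dhom m n. x \<in> spx X n \<and> t \<in> standard_simplex m \<and>
     p = (n, x, pushpt m \<theta> t) \<and> q = (m, act X m n \<theta> x, t))"

definition rclass :: "'a sset \<Rightarrow> nat \<times> 'a \<times> (nat \<Rightarrow> real) \<Rightarrow> (nat \<times> 'a \<times> (nat \<Rightarrow> real)) set" where
  "rclass X p = {q. equivclp (rglue X) p q}"

definition realization :: "'a sset \<Rightarrow> (nat \<times> 'a \<times> (nat \<Rightarrow> real)) set topology" where
  "realization X = quotient_topology (rsum X) (rclass X)"

text \<open>The classes of the images of the representatives of \<open>c\<close> all coincide, so that their
  union is the image of the point \<open>c\<close> under \<open>|f|\<close>.\<close>

definition realization_map ::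
  "'b sset \<Rightarrow> (nat \<Rightarrow> 'a \<Rightarrow> 'b) \<Rightarrow> (nat \<times> 'a \<times> (nat \<Rightarrow> real)) set
    \<Rightarrow> (nat \<times> 'b \<times> (nat \<Rightarrow> real)) set" where
  "realization_map Y f c = (\<Union>(n, x, t)\<in>c. rclass Y (n, f n x, t))"

definition homotopy_equivalence_map :: "'a topology \<Rightarrow> 'b topology \<Rightarrow> ('a \<Rightarrow> 'b) \<Rightarrow> bool" where
  "homotopy_equivalence_map A B f \<longleftrightarrow> continuous_map A B f \<and>
     (\<exists>g. continuous_map B A g \<and>
        homotopic_with (\<lambda>_. True) A A (g \<circ> f) id \<and> homotopic_with (\<lambda>_. True) B B (f \<circ> g) id)"

definition weak_equivalence :: "'a sset \<Rightarrow> 'b sset \<Rightarrow> (nat \<Rightarrow> 'a \<Rightarrow> 'b) \<Rightarrow> bool" where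
  "weak_equivalence X Y f \<longleftrightarrow> f \<in> smaps X Y \<and>
     homotopy_equivalence_map (realization X) (realization Y) (realization_map Y f)"


subsection \<open>Nerves\<close>

definition ordcat :: "nat \<Rightarrow> (nat, nat \<times> nat) cat" where
  "ordcat n = \<lparr>Ob = {..n}, Ar = {(i, j). i \<le> j \<and> j \<le> n}, Dom = fst, Cod = snd,
     Id = \<lambda>i. (i, i), Comp = \<lambda>(_, k) (i, _). (i, k)\<rparr>"

definition ordftor :: "nat \<Rightarrow> (nat \<Rightarrow> nat) \<Rightarrow> (nat, nat \<times> nat, nat, nat \<times> nat) ftor" where
  "ordftor m \<theta> = \<lparr>OMap = \<lambda>i\<in>{..m}. \<theta> i, AMap = \<lambda>(i, j)\<in>Ar (ordcat m). (\<theta> i, \<theta> j)\<rparr>"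

definition nerve :: "('o, 'm) cat \<Rightarrow> (nat, nat \<times> nat, 'o, 'm) ftor sset" where
  "nerve C = \<lparr>spx = \<lambda>k. {\<sigma>. is_ftor (ordcat k) C \<sigma>},
     act = \<lambda>m n \<theta> \<sigma>. ftor_comp (ordcat m) \<sigma> (ordftor m \<theta>)\<rparr>"

definition nerve_map ::
  "('o, 'm) cat \<Rightarrow> ('o, 'm, 'p, 'n) ftor \<Rightarrow> nat \<Rightarrow> (nat, nat \<times> nat, 'o, 'm) ftor
    \<Rightarrow> (nat, nat \<times> nat, 'p, 'n) ftor" where
  "nerve_map C F = (\<lambda>k. \<lambda>\<sigma>\<in>spx (nerve C) k. ftor_comp (ordcat k) F \<sigma>)"


section \<open>Bisimplicial sets and complete Segal spaces\<close>

text \<open>\<open>lev X n\<close> is the \<open>n\<close>-th simplicial set of \<open>X\<close>, and \<open>hact X m n \<theta>\<close> is the simplicial map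
  \<open>lev X n \<rightarrow> lev X m\<close> given by \<open>\<theta> : [m] \<rightarrow> [n]\<close>.\<close>

record 'a bsset =
  lev :: "nat \<Rightarrow> 'a sset"
  hact :: "nat \<Rightarrow> nat \<Rightarrow> (nat \<Rightarrow> nat) \<Rightarrow> nat \<Rightarrow> 'a \<Rightarrow> 'a"

definition is_bsset :: "'a bsset \<Rightarrow> bool" where
  "is_bsset X \<longleftrightarrow> (\<forall>n. is_sset (lev X n)) \<and>
     (\<forall>m n. \<forall>\<theta>\<in>dhom m n. hact X m n \<theta> \<in> smaps (lev X n) (lev X m)) \<and>
     (\<forall>n k. \<forall>x\<in>spx (lev X n) k. hact X n n (\<lambda>i\<in>{..n}. i) k x = x) \<and>
     (\<forall>l m n k. \<forall>\<phi>\<in>dhom l m. \<forall>\<theta>\<in>dhom m n. \<forall>x\<in>spx (lev X n) k.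
        hact X l n (compose {..l} \<theta> \<phi>) k x = hact X l m \<phi> k (hact X m n \<theta> k x))"

definition bmaps :: "'a bsset \<Rightarrow> 'b bsset \<Rightarrow> (nat \<Rightarrow> nat \<Rightarrow> 'a \<Rightarrow> 'b) set" where
  "bmaps X Y = {f. (\<forall>n. f n \<in> smaps (lev X n) (lev Y n)) \<and>
     (\<forall>m n k. \<forall>\<theta>\<in>dhom m n. \<forall>x\<in>spx (lev X n) k.
        f m k (hact X m n \<theta> k x) = hact Y m n \<theta> k (f n k x))}"

text \<open>The product with the simplicial set \<open>K\<close> regarded as a constant simplicial object, and
  the simplicial mapping space that it gives rise to.\<close>

definition btimes :: "'a bsset \<Rightarrow> 'b sset \<Rightarrow> ('a \<times> 'b) bsset" where
  "btimes X K = \<lparr>lev = \<lambda>n. sprod (lev X n) K,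
     hact = \<lambda>m n \<theta> k. \<lambda>(x, s)\<in>spx (lev X n) k \<times> spx K k. (hact X m n \<theta> k x, s)\<rparr>"

definition bmap_space ::
  "'a bsset \<Rightarrow> 'w bsset \<Rightarrow> (nat \<Rightarrow> nat \<Rightarrow> 'a \<times> (nat \<Rightarrow> nat) \<Rightarrow> 'w) sset" where
  "bmap_space X W = \<lparr>spx = \<lambda>k. bmaps (btimes X (Delta k)) W,
     act = \<lambda>k q \<alpha> h. \<lambda>n j. \<lambda>(x, \<sigma>)\<in>spx (lev X n) j \<times> dhom j k. h n j (x, compose {..j} \<alpha> \<sigma>)\<rparr>"

definition bmap_precomp ::
  "'a bsset \<Rightarrow> 'b bsset \<Rightarrow> 'w bsset \<Rightarrow> (nat \<Rightarrow> nat \<Rightarrow> 'a \<Rightarrow> 'b) \<Rightarrow>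
    nat \<Rightarrow> (nat \<Rightarrow> nat \<Rightarrow> 'b \<times> (nat \<Rightarrow> nat) \<Rightarrow> 'w) \<Rightarrow> nat \<Rightarrow> nat \<Rightarrow> 'a \<times> (nat \<Rightarrow> nat) \<Rightarrow> 'w" where
  "bmap_precomp X Y W f = (\<lambda>k. \<lambda>h\<in>spx (bmap_space Y W) k.
     \<lambda>n j. \<lambda>(x, \<sigma>)\<in>spx (lev X n) j \<times> dhom j k. h n j (f n j x, \<sigma>))"

text \<open>The matching object \<open>M\<^sub>n W\<close> has as its \<open>k\<close>-simplices the maps from the boundary of
  \<open>\<Delta>[n]\<close> to the simplicial set \<open>m \<mapsto> (W\<^sub>m)\<^sub>k\<close>.\<close>

definition column :: "'w bsset \<Rightarrow> nat \<Rightarrow> 'w sset" where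
  "column W k = \<lparr>spx = \<lambda>m. spx (lev W m) k, act = \<lambda>m n \<theta>. hact W m n \<theta> k\<rparr>"

definition matching :: "'w bsset \<Rightarrow> nat \<Rightarrow> (nat \<Rightarrow> (nat \<Rightarrow> nat) \<Rightarrow> 'w) sset" where
  "matching W n = \<lparr>spx = \<lambda>k. smaps (boundary n) (column W k),
     act = \<lambda>q p \<alpha> u. \<lambda>m. \<lambda>\<theta>\<in>spx (boundary n) m. act (lev W m) q p \<alpha> (u m \<theta>)\<rparr>"

definition reedy_fibrant :: "'w bsset \<Rightarrow> bool" where
  "reedy_fibrant W \<longleftrightarrow> (\<forall>n. kan_fibration (lev W n) (matching W n)
     (\<lambda>k. \<lambda>w\<in>spx (lev W n) k. \<lambda>m. \<lambda>\<theta>\<in>spx (boundary n) m. hact W m n \<theta> k w))"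

text \<open>The edge from \<open>a\<close> to \<open>b\<close>, and the vertex \<open>a\<close>, of a point of \<open>W\<^sub>n\<close>.\<close>

definition seg_edge :: "'w bsset \<Rightarrow> nat \<Rightarrow> nat \<Rightarrow> nat \<Rightarrow> nat \<Rightarrow> 'w \<Rightarrow> 'w" where
  "seg_edge W n a b = hact W 1 n (\<lambda>i\<in>{..1}. if i = 0 then a else b)"

definition seg_vertex :: "'w bsset \<Rightarrow> nat \<Rightarrow> nat \<Rightarrow> nat \<Rightarrow> 'w \<Rightarrow> 'w" where
  "seg_vertex W n a = hact W 0 n (\<lambda>i\<in>{..0}. a)"

definition seg_id :: "'w bsset \<Rightarrow> nat \<Rightarrow> 'w \<Rightarrow> 'w" where
  "seg_id W = hact W 1 0 (\<lambda>i\<in>{..1}. 0)"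

text \<open>The iterated fibre product \<open>W\<^sub>1 \<times>\<^bsub>W\<^sub>0\<^esub> \<dots> \<times>\<^bsub>W\<^sub>0\<^esub> W\<^sub>1\<close> with \<open>n\<close> factors.\<close>

definition segal_prod :: "'w bsset \<Rightarrow> nat \<Rightarrow> (nat \<Rightarrow> 'w) sset" where
  "segal_prod W n = \<lparr>
     spx = \<lambda>k. {w \<in> {..<n} \<rightarrow>\<^sub>E spx (lev W 1) k.
       \<forall>i. Suc i < n \<longrightarrow> seg_vertex W 1 1 k (w i) = seg_vertex W 1 0 k (w (Suc i))},
     act = \<lambda>q p \<alpha> w. \<lambda>i\<in>{..<n}. act (lev W 1) q p \<alpha> (w i)\<rparr>"

definition segal_space :: "'w bsset \<Rightarrow> bool" where
  "segal_space W \<longleftrightarrow> is_bsset W \<and> reedy_fibrant W \<and>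
     (\<forall>n\<ge>2. weak_equivalence (lev W n) (segal_prod W n)
        (\<lambda>k. \<lambda>w\<in>spx (lev W n) k. \<lambda>i\<in>{..<n}. seg_edge W n i (Suc i) k w))"

text \<open>\<open>u\<close> and \<open>v\<close> lie in the same component of the mapping space \<open>map(x, y)\<close>, that is, of the
  fibre of \<open>W\<^sub>1 \<rightarrow> W\<^sub>0 \<times> W\<^sub>0\<close> over \<open>(x, y)\<close>; \<open>e\<close> is a 1-simplex of this fibre.\<close>

definition whomotopic :: "'w bsset \<Rightarrow> 'w \<Rightarrow> 'w \<Rightarrow> 'w \<Rightarrow> 'w \<Rightarrow> bool" where
  "whomotopic W x y = equivclp (\<lambda>u v. \<exists>e\<in>spx (lev W 1) 1.
     seg_vertex W 1 0 1 e = act (lev W 0) 1 0 (\<lambda>i\<in>{..1}. 0) x \<and>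
     seg_vertex W 1 1 1 e = act (lev W 0) 1 0 (\<lambda>i\<in>{..1}. 0) y \<and>
     act (lev W 1) 0 1 (\<lambda>i\<in>{..0}. 0) e = u \<and> act (lev W 1) 0 1 (\<lambda>i\<in>{..0}. 1) e = v)"

text \<open>A point \<open>g : x \<rightarrow> y\<close> of \<open>W\<^sub>1\<close> is a homotopy equivalence if it has a homotopy right inverse
  and a homotopy left inverse, a composite being the edge from \<open>0\<close> to \<open>2\<close> of a point of \<open>W\<^sub>2\<close>.\<close>

definition hoequivalence :: "'w bsset \<Rightarrow> 'w \<Rightarrow> bool" where
  "hoequivalence W g \<longleftrightarrow> g \<in> spx (lev W 1) 0 \<and>
     (let x = seg_vertex W 1 0 0 g; y = seg_vertex W 1 1 0 g in
      (\<exists>c\<in>spx (lev W 2) 0. seg_edge W 2 1 2 0 c = g \<and> seg_vertex W 2 0 0 c = y \<and>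
         whomotopic W y y (seg_edge W 2 0 2 0 c) (seg_id W 0 y)) \<and>
      (\<exists>c\<in>spx (lev W 2) 0. seg_edge W 2 0 1 0 c = g \<and> seg_vertex W 2 2 0 c = x \<and>
         whomotopic W x x (seg_edge W 2 0 2 0 c) (seg_id W 0 x)))"

text \<open>The subspace of \<open>W\<^sub>1\<close> consisting of the components of the homotopy equivalences.\<close>

definition hoequiv_space :: "'w bsset \<Rightarrow> 'w sset" where
  "hoequiv_space W = (lev W 1)\<lparr>spx := \<lambda>k. {w \<in> spx (lev W 1) k.
     \<forall>i\<le>k. hoequivalence W (act (lev W 1) 0 k (\<lambda>_\<in>{..0}. i) w)}\<rparr>"

definition complete_segal_space :: "'w bsset \<Rightarrow> bool" where
  "complete_segal_space W \<longleftrightarrow> segal_space W \<and>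
     weak_equivalence (lev W 0) (hoequiv_space W) (\<lambda>k. \<lambda>x\<in>spx (lev W 0) k. seg_id W k x)"

text \<open>The weak equivalences of Rezk's model structure: the maps that induce weak equivalences of
  mapping spaces into every complete Segal space.  The complete Segal spaces have their
  simplices in the type \<open>'w\<close>; a statement about weak equivalences is meant to hold for all \<open>'w\<close>.\<close>

definition css_weak_equivalence ::
  "'w itself \<Rightarrow> 'a bsset \<Rightarrow> 'b bsset \<Rightarrow> (nat \<Rightarrow> nat \<Rightarrow> 'a \<Rightarrow> 'b) \<Rightarrow> bool" where
  "css_weak_equivalence _ X Y f \<longleftrightarrow> f \<in> bmaps X Y \<and>
     (\<forall>W :: 'w bsset. complete_segal_space W \<longrightarrow>
        weak_equivalence (bmap_space Y W) (bmap_space X W) (bmap_precomp X Y W f))"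


section \<open>Relative categories and homotopy theories\<close>

definition relative_category :: "('o, 'm) cat \<Rightarrow> 'm set \<Rightarrow> bool" where
  "relative_category C W \<longleftrightarrow> category C \<and> W \<subseteq> Ar C \<and> (\<forall>a\<in>Ob C. Id C a \<in> W) \<and>
     (\<forall>f\<in>W. \<forall>g\<in>W. Dom C g = Cod C f \<longrightarrow> Comp C g f \<in> W)"

definition relative_functor ::
  "('o, 'm) cat \<Rightarrow> 'm set \<Rightarrow> ('p, 'n) cat \<Rightarrow> 'n set \<Rightarrow> ('o, 'm, 'p, 'n) ftor \<Rightarrow> bool" where
  "relative_functor C W D V F \<longleftrightarrow>
     relative_category C W \<and> relative_category D V \<and> is_ftor C D F \<and> AMap F ` W \<subseteq> V"

definition created :: "('o, 'm) cat \<Rightarrow> ('o, 'm, 'p, 'n) ftor \<Rightarrow> 'n set \<Rightarrow> 'm set" where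
  "created C F V = {f \<in> Ar C. AMap F f \<in> V}"

type_synonym ('o, 'm) chain_ob = "(nat, nat \<times> nat, 'o, 'm) ftor"
type_synonym ('o, 'm) chain_ar = "(('o, 'm) chain_ob, nat \<Rightarrow> 'm) arr"

definition chain_cat ::
  "('o, 'm) cat \<Rightarrow> 'm set \<Rightarrow> nat \<Rightarrow> (('o, 'm) chain_ob, ('o, 'm) chain_ar) cat" where
  "chain_cat C W n = ftor_cat (ordcat n) C W"

definition chain_pull ::
  "nat \<Rightarrow> (nat \<Rightarrow> nat) \<Rightarrow>
    (('o, 'm) chain_ob, ('o, 'm) chain_ar, ('o, 'm) chain_ob, ('o, 'm) chain_ar) ftor" where
  "chain_pull m \<theta> = (let pull = (\<lambda>X. ftor_comp (ordcat m) X (ordftor m \<theta>)) in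
     \<lparr>OMap = pull, AMap = \<lambda>a. Arr (pull (src a)) (pull (tgt a)) (\<lambda>i\<in>{..m}. mor a (\<theta> i))\<rparr>)"

definition chain_push ::
  "nat \<Rightarrow> ('o, 'm, 'p, 'n) ftor \<Rightarrow>
    (('o, 'm) chain_ob, ('o, 'm) chain_ar, ('p, 'n) chain_ob, ('p, 'n) chain_ar) ftor" where
  "chain_push n F = (let push = (\<lambda>X. ftor_comp (ordcat n) F X) in
     \<lparr>OMap = push, AMap = \<lambda>a. Arr (push (src a)) (push (tgt a)) (\<lambda>i\<in>{..n}. AMap F (mor a i))\<rparr>)"

definition Ncl ::
  "('o, 'm) cat \<Rightarrow> 'm set \<Rightarrow> (nat, nat \<times> nat, ('o, 'm) chain_ob, ('o, 'm) chain_ar) ftor bsset" where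
  "Ncl C W = \<lparr>lev = \<lambda>n. nerve (chain_cat C W n),
     hact = \<lambda>m n \<theta>. nerve_map (chain_cat C W n) (chain_pull m \<theta>)\<rparr>"

definition Ncl_map ::
  "('o, 'm) cat \<Rightarrow> 'm set \<Rightarrow> ('o, 'm, 'p, 'n) ftor \<Rightarrow> nat \<Rightarrow> nat \<Rightarrow>
    (nat, nat \<times> nat, ('o, 'm) chain_ob, ('o, 'm) chain_ar) ftor \<Rightarrow>
    (nat, nat \<times> nat, ('p, 'n) chain_ob, ('p, 'n) chain_ar) ftor" where
  "Ncl_map C W F = (\<lambda>n. nerve_map (chain_cat C W n) (chain_push n F))"

text \<open>The maps from a bisimplicial set to its fibrant replacement are weak equivalences, so
  that by two out of three a fibrant replacement of a map is a weak equivalence if and only if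
  the map itself is one.\<close>

definition equivalence_of_homotopy_theories ::
  "'w itself \<Rightarrow> ('o, 'm) cat \<Rightarrow> 'm set \<Rightarrow> ('p, 'n) cat \<Rightarrow> 'n set \<Rightarrow> ('o, 'm, 'p, 'n) ftor \<Rightarrow> bool"
  where
  "equivalence_of_homotopy_theories w C W D V F \<longleftrightarrow>
     css_weak_equivalence w (Ncl C W) (Ncl D V) (Ncl_map C W F)"


section \<open>Small categories and small simplicial sets\<close>

text \<open>A universe of small sets inside a type.  In an infinite type the subsets of cardinality less
  than \<open>\<kappa>\<close> form a universe, for every uncountable regular cardinal \<open>\<kappa>\<close>; if \<open>\<kappa>\<close> is
  inaccessible and the type has at least \<open>\<kappa>\<close> elements, then these are, up to bijection, the sets in
  a Grothendieck universe.  The set of all subsets of an infinite type is a universe as well.\<close>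

definition universe :: "'u set set \<Rightarrow> bool" where
  "universe \<U> \<longleftrightarrow> (\<exists>A\<in>\<U>. infinite A) \<and> (\<forall>A\<in>\<U>. \<forall>B\<subseteq>A. B \<in> \<U>) \<and>
     (\<forall>A\<in>\<U>. \<forall>f :: 'u \<Rightarrow> 'u. f ` A \<in> \<U>) \<and>
     (\<forall>A\<in>\<U>. \<forall>B :: 'u \<Rightarrow> 'u set. (\<forall>a\<in>A. B a \<in> \<U>) \<longrightarrow> (\<Union>a\<in>A. B a) \<in> \<U>)"

text \<open>The operations of the objects of the categories \<open>CAT\<close> and \<open>SSET\<close> are \<open>undefined\<close> off
  their domains, so that equality of objects does not depend on junk values.\<close>

definition small_category :: "'u set set \<Rightarrow> ('u, 'u) cat \<Rightarrow> bool" where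
  "small_category \<U> C \<longleftrightarrow> category C \<and> Ob C \<in> \<U> \<and> Ar C \<in> \<U> \<and>
     Dom C \<in> extensional (Ar C) \<and> Cod C \<in> extensional (Ar C) \<and> Id C \<in> extensional (Ob C) \<and>
     (\<forall>g f. \<not> (g \<in> Ar C \<and> f \<in> Ar C \<and> Dom C g = Cod C f) \<longrightarrow> Comp C g f = undefined)"

type_synonym 'u small_cat = "('u, 'u) cat"
type_synonym 'u small_ftor = "('u small_cat, ('u, 'u, 'u, 'u) ftor) arr"

definition CAT :: "'u set set \<Rightarrow> ('u small_cat, 'u small_ftor) cat" where
  "CAT \<U> = \<lparr>Ob = {C. small_category \<U> C},
     Ar = {Arr C D F | C D F. small_category \<U> C \<and> small_category \<U> D \<and> is_ftor C D F},
     Dom = src, Cod = tgt, Id = \<lambda>C. Arr C C (fid C),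
     Comp = \<lambda>b a. Arr (src a) (tgt b) (ftor_comp (src a) (mor b) (mor a))\<rparr>"

definition small_sset :: "'a set set \<Rightarrow> 'a sset \<Rightarrow> bool" where
  "small_sset \<U> X \<longleftrightarrow> is_sset X \<and> (\<forall>n. spx X n \<in> \<U>) \<and>
     (\<forall>m n \<theta> x. \<not> (\<theta> \<in> dhom m n \<and> x \<in> spx X n) \<longrightarrow> act X m n \<theta> x = undefined)"

type_synonym 'a sset_map = "('a sset, nat \<Rightarrow> 'a \<Rightarrow> 'a) arr"

definition SSET :: "'a set set \<Rightarrow> ('a sset, 'a sset_map) cat" where
  "SSET \<U> = \<lparr>Ob = {X. small_sset \<U> X},
     Ar = {Arr X Y f | X Y f. small_sset \<U> X \<and> small_sset \<U> Y \<and> f \<in> smaps X Y},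
     Dom = src, Cod = tgt, Id = \<lambda>X. Arr X X (sid X),
     Comp = \<lambda>b a. Arr (src a) (tgt b) (smap_comp (src a) (mor b) (mor a))\<rparr>"


section \<open>The indexing categories\<close>

definition pmaps :: "nat \<Rightarrow> nat \<Rightarrow> (nat \<Rightarrow> nat) set" where
  "pmaps m n = {\<phi> \<in> {..m} \<rightarrow>\<^sub>E {..n}. \<phi> 0 = 0}"

definition pzero :: "nat \<Rightarrow> nat \<Rightarrow> nat" where
  "pzero m = (\<lambda>x\<in>{..m}. 0)"

type_synonym fin_ar = "(nat, nat \<Rightarrow> nat) arr"

definition FF :: "(nat, fin_ar) cat" where
  "FF = \<lparr>Ob = UNIV, Ar = {Arr m n \<phi> | m n \<phi>. \<phi> \<in> pmaps m n}, Dom = src, Cod = tgt,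
     Id = \<lambda>n. Arr n n (\<lambda>x\<in>{..n}. x),
     Comp = \<lambda>b a. Arr (src a) (tgt b) (compose {..src a} (mor b) (mor a))\<rparr>"

text \<open>Since a tuple with an entry \<open>0\<close> is identified with the zero object \<open>Star\<close>, the other
  objects of \<open>GG\<close> are the tuples of positive numbers.  The positions in a tuple of length \<open>q\<close> are
  numbered \<open>0, \<dots>, q - 1\<close>.  A morphism is \<open>None\<close> (zero) or \<open>Some (f, \<psi>)\<close> with no \<open>\<psi> j\<close> zero.\<close>

datatype gobj = Star | Tup "nat list"

type_synonym gmor = "((nat \<Rightarrow> nat) \<times> (nat \<Rightarrow> nat \<Rightarrow> nat)) option"
type_synonym gar = "(gobj, gmor) arr"

text \<open>The number \<open>n\<close> with subscript \<open>f\<^sup>-\<^sup>1(j)\<close>; it is \<open>1\<close> if \<open>j\<close> is not in the image of \<open>f\<close>.\<close>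

definition gsrc :: "nat list \<Rightarrow> (nat \<Rightarrow> nat) \<Rightarrow> nat \<Rightarrow> nat" where
  "gsrc ns f j = (if j \<in> f ` {..<length ns} then ns ! inv_into {..<length ns} f j else 1)"

definition gpairs :: "nat list \<Rightarrow> nat list \<Rightarrow> ((nat \<Rightarrow> nat) \<times> (nat \<Rightarrow> nat \<Rightarrow> nat)) set" where
  "gpairs ns ms = {(f, \<psi>). f \<in> {..<length ns} \<rightarrow>\<^sub>E {..<length ms} \<and> inj_on f {..<length ns} \<and>
     \<psi> \<in> extensional {..<length ms} \<and>
     (\<forall>j<length ms. \<psi> j \<in> pmaps (gsrc ns f j) (ms ! j) \<and> \<psi> j \<noteq> pzero (gsrc ns f j))}"

fun ghom :: "gobj \<Rightarrow> gobj \<Rightarrow> gmor set" where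
  "ghom (Tup ns) (Tup ms) = insert None (Some ` gpairs ns ms)"
| "ghom s t = {None}"

fun gid :: "gobj \<Rightarrow> gmor" where
  "gid Star = None"
| "gid (Tup ns) = Some (\<lambda>i\<in>{..<length ns}. i, \<lambda>j\<in>{..<length ns}. \<lambda>x\<in>{..ns ! j}. x)"

fun gcomp :: "gar \<Rightarrow> gar \<Rightarrow> gmor" where
  "gcomp (Arr (Tup ms) (Tup ls) (Some (g, \<phi>))) (Arr (Tup ns) _ (Some (f, \<psi>))) =
     (let h = compose {..<length ns} g f;
          \<psi>' = (\<lambda>k. if k \<in> g ` {..<length ms} then \<psi> (inv_into {..<length ms} g k)
                     else (\<lambda>x\<in>{..1}. x));
          \<omega> = (\<lambda>k\<in>{..<length ls}. compose {..gsrc ns h k} (\<phi> k) (\<psi>' k))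
      in if \<exists>k<length ls. \<omega> k = pzero (gsrc ns h k) then None else Some (h, \<omega>))"
| "gcomp _ _ = None"

definition GG :: "(gobj, gar) cat" where
  "GG = (let obs = insert Star {Tup ns | ns. \<forall>n\<in>set ns. 0 < n} in
     \<lparr>Ob = obs, Ar = {Arr s t x | s t x. s \<in> obs \<and> t \<in> obs \<and> x \<in> ghom s t},
      Dom = src, Cod = tgt, Id = \<lambda>s. Arr s s (gid s),
      Comp = \<lambda>b a. Arr (src a) (tgt b) (gcomp b a)\<rparr>)"

definition Gflat :: "gobj \<Rightarrow> gobj \<Rightarrow> gar set" where
  "Gflat s t = {h \<in> Hom GG s t. mor h \<noteq> None}"

definition i_ob :: "nat \<Rightarrow> gobj" where
  "i_ob n = (if n = 0 then Star else Tup [n])"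

definition i_ar :: "fin_ar \<Rightarrow> gar" where
  "i_ar a = Arr (i_ob (src a)) (i_ob (tgt a))
     (if mor a = pzero (src a) then None else Some (\<lambda>k\<in>{..<1}. k, \<lambda>k\<in>{..<1}. mor a))"

definition ifun :: "(nat, fin_ar, gobj, gar) ftor" where
  "ifun = \<lparr>OMap = \<lambda>n\<in>Ob FF. i_ob n, AMap = \<lambda>a\<in>Ar FF. i_ar a\<rparr>"


section \<open>Diagrams, \<open>i\<^sup>*\<close>, and the left adjoint \<open>L\<close>\<close>

type_synonym ('o, 'm) gamma_ob = "(nat, fin_ar, 'o, 'm) ftor"
type_synonym ('o, 'm) gamma_ar = "(('o, 'm) gamma_ob, nat \<Rightarrow> 'm) arr"
type_synonym ('o, 'm) gstar_ob = "(gobj, gar, 'o, 'm) ftor"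
type_synonym ('o, 'm) gstar_ar = "(('o, 'm) gstar_ob, gobj \<Rightarrow> 'm) arr"

text \<open>\<open>C\<close> is the category of small categories or of small simplicial sets and \<open>T\<close> is its chosen
  terminal object.\<close>

definition Gamma_diag :: "('o, 'm) cat \<Rightarrow> 'o \<Rightarrow> (('o, 'm) gamma_ob, ('o, 'm) gamma_ar) cat" where
  "Gamma_diag C T = pdiag FF 0 C T"

definition Gstar_diag :: "('o, 'm) cat \<Rightarrow> 'o \<Rightarrow> (('o, 'm) gstar_ob, ('o, 'm) gstar_ar) cat" where
  "Gstar_diag C T = pdiag GG Star C T"

definition i_pull ::
  "('o, 'm) cat \<Rightarrow> 'o
    \<Rightarrow> (('o, 'm) gstar_ob, ('o, 'm) gstar_ar, ('o, 'm) gamma_ob, ('o, 'm) gamma_ar) ftor" where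
  "i_pull C T = \<lparr>OMap = \<lambda>Y\<in>Ob (Gstar_diag C T). ftor_comp FF Y ifun,
     AMap = \<lambda>a\<in>Ar (Gstar_diag C T). Arr (ftor_comp FF (src a) ifun) (ftor_comp FF (tgt a) ifun)
                                    (\<lambda>n\<in>Ob FF. mor a (i_ob n))\<rparr>"

definition basepoint :: "('o, 'm) gamma_ob \<Rightarrow> nat \<Rightarrow> 'm" where
  "basepoint X n = AMap X (Arr 0 n (pzero 0))"

definition collapse :: "('o, 'm) gamma_ob \<Rightarrow> nat \<Rightarrow> 'm" where
  "collapse X n = AMap X (Arr n 0 (pzero n))"

text \<open>\<open>V\<close>, with the inclusions \<open>inc h\<close> and the basepoint \<open>pt\<close>, is the wedge over \<open>h \<in> H\<close> of copies of
  \<open>A\<close>, pointed by \<open>b : T \<rightarrow> A\<close>: a pushout along the basepoints, and \<open>T\<close> itself if \<open>H\<close> is empty.\<close>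

definition is_wedge ::
  "('o, 'm) cat \<Rightarrow> 'o \<Rightarrow> 'h set \<Rightarrow> 'o \<Rightarrow> 'm \<Rightarrow> 'o \<Rightarrow> ('h \<Rightarrow> 'm) \<Rightarrow> 'm \<Rightarrow> bool" where
  "is_wedge C T H A b V inc pt \<longleftrightarrow>
     V \<in> Ob C \<and> pt \<in> Hom C T V \<and> (\<forall>h\<in>H. inc h \<in> Hom C A V \<and> Comp C (inc h) b = pt) \<and>
     (\<forall>Z\<in>Ob C. \<forall>q\<in>Hom C T Z. \<forall>j. (\<forall>h\<in>H. j h \<in> Hom C A Z \<and> Comp C (j h) b = q) \<longrightarrow>
        (\<exists>!u. u \<in> Hom C V Z \<and> Comp C u pt = q \<and> (\<forall>h\<in>H. Comp C u (inc h) = j h))) \<and>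
     (H = {} \<longrightarrow> V = T)"

definition is_cowedge ::
  "('j, 'k) cat \<Rightarrow> ('o, 'm) cat \<Rightarrow> ('j \<times> 'j, 'k \<times> 'k, 'o, 'm) ftor \<Rightarrow> 'o \<Rightarrow> ('j \<Rightarrow> 'm) \<Rightarrow> bool" where
  "is_cowedge J C S E \<omega> \<longleftrightarrow> E \<in> Ob C \<and> (\<forall>n\<in>Ob J. \<omega> n \<in> Hom C (OMap S (n, n)) E) \<and>
     (\<forall>a\<in>Ar J. Comp C (\<omega> (Dom J a)) (AMap S (a, Id J (Dom J a))) =
               Comp C (\<omega> (Cod J a)) (AMap S (Id J (Cod J a), a)))"

definition is_coend ::
  "('j, 'k) cat \<Rightarrow> ('o, 'm) cat \<Rightarrow> ('j \<times> 'j, 'k \<times> 'k, 'o, 'm) ftor \<Rightarrow> 'o \<Rightarrow> ('j \<Rightarrow> 'm) \<Rightarrow> bool" where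
  "is_coend J C S E \<omega> \<longleftrightarrow> is_cowedge J C S E \<omega> \<and>
     (\<forall>Z \<zeta>. is_cowedge J C S Z \<zeta> \<longrightarrow>
        (\<exists>!u. u \<in> Hom C E Z \<and> (\<forall>n\<in>Ob J. Comp C u (\<omega> n) = \<zeta> n)))"

text \<open>A choice of wedges that make up the integrand: \<open>S (n, m)\<close> is the wedge of copies of \<open>X m\<close>
  over the nonzero morphisms \<open>h : i n \<rightarrow> t\<close>, with inclusions \<open>inc (n, m) h\<close> and basepoint
  \<open>pt (n, m)\<close>.\<close>

definition is_integrand ::
  "('o, 'm) cat \<Rightarrow> 'o \<Rightarrow> ('o, 'm) gamma_ob \<Rightarrow> gobj \<Rightarrow> (nat \<times> nat, fin_ar \<times> fin_ar, 'o, 'm) ftor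
    \<Rightarrow> (nat \<times> nat \<Rightarrow> gar \<Rightarrow> 'm) \<Rightarrow> (nat \<times> nat \<Rightarrow> 'm) \<Rightarrow> bool" where
  "is_integrand C T X t S inc pt \<longleftrightarrow> is_ftor (prod_cat (opp FF) FF) C S \<and>
     (\<forall>n m. is_wedge C T (Gflat (i_ob n) t) (OMap X m) (basepoint X m)
        (OMap S (n, m)) (inc (n, m)) (pt (n, m))) \<and>
     (\<forall>a\<in>Ar FF. \<forall>b\<in>Ar FF.
        Comp C (AMap S (a, b)) (pt (tgt a, src b)) = pt (src a, tgt b) \<and>
        (\<forall>h\<in>Gflat (i_ob (tgt a)) t. let h' = Comp GG h (i_ar a) in
          Comp C (AMap S (a, b)) (inc (tgt a, src b) h) =
            (if h' \<in> Gflat (i_ob (src a)) t then Comp C (inc (src a, tgt b) h') (AMap X b)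
             else Comp C (pt (src a, tgt b)) (collapse X (src b)))))"

text \<open>Since the inclusions and the basepoint of a wedge are jointly epimorphic, and so are the
  components of a coend, the last two clauses determine \<open>L\<close> on morphisms.\<close>

definition is_L ::
  "('o, 'm) cat \<Rightarrow> 'o
    \<Rightarrow> (('o, 'm) gamma_ob, ('o, 'm) gamma_ar, ('o, 'm) gstar_ob, ('o, 'm) gstar_ar) ftor \<Rightarrow> bool"
  where
  "is_L C T L \<longleftrightarrow> is_ftor (Gamma_diag C T) (Gstar_diag C T) L \<and>
     (\<exists>S inc pt \<omega>.
       (\<forall>X\<in>Ob (Gamma_diag C T). \<forall>t\<in>Ob GG.
          is_integrand C T X t (S X t) (inc X t) (pt X t) \<and>
          is_coend FF C (S X t) (OMap (OMap L X) t) (\<omega> X t)) \<and>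
       (\<forall>X\<in>Ob (Gamma_diag C T). \<forall>g\<in>Ar GG. \<forall>n. let s = src g; t = tgt g; Lg = AMap (OMap L X) g in
          Comp C Lg (Comp C (\<omega> X s n) (pt X s (n, n))) = Comp C (\<omega> X t n) (pt X t (n, n)) \<and>
          (\<forall>h\<in>Gflat (i_ob n) s. let h' = Comp GG g h in
             Comp C Lg (Comp C (\<omega> X s n) (inc X s (n, n) h)) =
             Comp C (\<omega> X t n)
               (if h' \<in> Gflat (i_ob n) t then inc X t (n, n) h'
                else Comp C (pt X t (n, n)) (collapse X n)))) \<and>
       (\<forall>x\<in>Ar (Gamma_diag C T). \<forall>t\<in>Ob GG. \<forall>n. let X = src x; Y = tgt x; Lx = mor (AMap L x) t in
          Comp C Lx (Comp C (\<omega> X t n) (pt X t (n, n))) = Comp C (\<omega> Y t n) (pt Y t (n, n)) \<and>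
          (\<forall>h\<in>Gflat (i_ob n) t.
             Comp C Lx (Comp C (\<omega> X t n) (inc X t (n, n) h)) =
             Comp C (\<omega> Y t n) (Comp C (inc Y t (n, n) h) (mor x n)))))"

definition LL ::
  "('o, 'm) cat \<Rightarrow> 'o
    \<Rightarrow> (('o, 'm) gamma_ob, ('o, 'm) gamma_ar, ('o, 'm) gstar_ob, ('o, 'm) gstar_ar) ftor" where
  "LL C T = (SOME L. is_L C T L)"


section \<open>Symmetric spectra\<close>

text \<open>The simplicial circle \<open>\<Delta>[1]/\<partial>\<Delta>[1]\<close> with set of \<open>p\<close>-simplices \<open>{0, \<dots>, p}\<close>: the number \<open>i \<ge> 1\<close>
  stands for the map \<open>[p] \<rightarrow> [1]\<close> with value \<open>1\<close> exactly on \<open>{i, \<dots>, p}\<close>, and \<open>0\<close> is the basepoint.\<close>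

definition circ_act :: "nat \<Rightarrow> nat \<Rightarrow> (nat \<Rightarrow> nat) \<Rightarrow> nat \<Rightarrow> nat" where
  "circ_act q p \<theta> = (\<lambda>i\<in>{..p}. if i \<le> \<theta> 0 \<or> \<theta> q < i then 0 else LEAST j. i \<le> \<theta> j)"

definition circle :: "nat sset" where
  "circle = \<lparr>spx = \<lambda>p. {..p}, act = circ_act\<rparr>"

text \<open>\<open>sp A n\<close> is the \<open>n\<close>-th simplicial set of the spectrum, \<open>bp A n\<close> its base vertex, \<open>sig A n \<pi>\<close> the
  action of a permutation of \<open>{..<n}\<close>, and \<open>str A n k s x\<close> the structure map
  \<open>S\<^sup>1 \<and> A\<^sub>n \<rightarrow> A\<^bsub>n+1\<^esub>\<close> on \<open>k\<close>-simplices.\<close>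

record 'a symsp =
  sp :: "nat \<Rightarrow> 'a sset"
  bp :: "nat \<Rightarrow> 'a"
  sig :: "nat \<Rightarrow> (nat \<Rightarrow> nat) \<Rightarrow> nat \<Rightarrow> 'a \<Rightarrow> 'a"
  str :: "nat \<Rightarrow> nat \<Rightarrow> nat \<Rightarrow> 'a \<Rightarrow> 'a"

definition base :: "'a symsp \<Rightarrow> nat \<Rightarrow> nat \<Rightarrow> 'a" where
  "base A n k = act (sp A n) k 0 (\<lambda>_\<in>{..k}. 0) (bp A n)"

text \<open>The iterated structure map \<open>S\<^sup>p \<and> A\<^sub>n \<rightarrow> A\<^bsub>p+n\<^esub>\<close>, on \<open>s\<^sub>1 \<and> \<dots> \<and> s\<^sub>p \<and> x\<close>.\<close>

fun strs :: "'a symsp \<Rightarrow> nat \<Rightarrow> nat \<Rightarrow> nat list \<Rightarrow> 'a \<Rightarrow> 'a" where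
  "strs A n k [] x = x"
| "strs A n k (s # ss) x = str A (length ss + n) k s (strs A n k ss x)"

definition block_perm :: "nat \<Rightarrow> (nat \<Rightarrow> nat) \<Rightarrow> nat \<Rightarrow> (nat \<Rightarrow> nat) \<Rightarrow> nat \<Rightarrow> nat" where
  "block_perm p \<tau> n \<rho> = (\<lambda>i. if i < p then \<tau> i else if i < p + n then p + \<rho> (i - p) else i)"

definition is_symsp :: "'a symsp \<Rightarrow> bool" where
  "is_symsp A \<longleftrightarrow>
     (\<forall>n. is_sset (sp A n) \<and> bp A n \<in> spx (sp A n) 0) \<and>
     (\<forall>n \<pi>. \<pi> permutes {..<n} \<longrightarrow> sig A n \<pi> \<in> smaps (sp A n) (sp A n) \<and> sig A n \<pi> 0 (bp A n) = bp A n) \<and>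
     (\<forall>n k. \<forall>x\<in>spx (sp A n) k. sig A n id k x = x) \<and>
     (\<forall>n k \<pi> \<rho>. \<forall>x\<in>spx (sp A n) k. \<pi> permutes {..<n} \<longrightarrow> \<rho> permutes {..<n} \<longrightarrow>
        sig A n (\<pi> \<circ> \<rho>) k x = sig A n \<pi> k (sig A n \<rho> k x)) \<and>
     (\<forall>n k. \<forall>s\<le>k. \<forall>x\<in>spx (sp A n) k. str A n k s x \<in> spx (sp A (Suc n)) k) \<and>
     (\<forall>n q p. \<forall>\<theta>\<in>dhom q p. \<forall>s\<le>p. \<forall>x\<in>spx (sp A n) p.
        str A n q (circ_act q p \<theta> s) (act (sp A n) q p \<theta> x) =
        act (sp A (Suc n)) q p \<theta> (str A n p s x)) \<and>
     (\<forall>n k. \<forall>x\<in>spx (sp A n) k. str A n k 0 x = base A (Suc n) k) \<and>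
     (\<forall>n k. \<forall>s\<le>k. str A n k s (base A n k) = base A (Suc n) k) \<and>
     (\<forall>p n k \<tau> \<rho> ss. \<forall>x\<in>spx (sp A n) k.
        \<tau> permutes {..<p} \<longrightarrow> \<rho> permutes {..<n} \<longrightarrow> length ss = p \<longrightarrow> set ss \<subseteq> {..k} \<longrightarrow>
        strs A n k (map (\<lambda>i. ss ! inv_into UNIV \<tau> i) [0..<p]) (sig A n \<rho> k x) =
        sig A (p + n) (block_perm p \<tau> n \<rho>) k (strs A n k ss x))"

definition spmaps :: "'a symsp \<Rightarrow> 'b symsp \<Rightarrow> (nat \<Rightarrow> nat \<Rightarrow> 'a \<Rightarrow> 'b) set" where
  "spmaps A B = {f.
     (\<forall>n. f n \<in> smaps (sp A n) (sp B n) \<and> f n 0 (bp A n) = bp B n) \<and>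
     (\<forall>n k \<pi>. \<forall>x\<in>spx (sp A n) k. \<pi> permutes {..<n} \<longrightarrow>
        f n k (sig A n \<pi> k x) = sig B n \<pi> k (f n k x)) \<and>
     (\<forall>n k. \<forall>s\<le>k. \<forall>x\<in>spx (sp A n) k. f (Suc n) k (str A n k s x) = str B n k s (f n k x))}"

definition spcomp ::
  "'a symsp \<Rightarrow> (nat \<Rightarrow> nat \<Rightarrow> 'b \<Rightarrow> 'c) \<Rightarrow> (nat \<Rightarrow> nat \<Rightarrow> 'a \<Rightarrow> 'b) \<Rightarrow> nat \<Rightarrow> nat \<Rightarrow> 'a \<Rightarrow> 'c" where
  "spcomp A g f = (\<lambda>n. smap_comp (sp A n) (g n) (f n))"

text \<open>A simplicial homotopy from \<open>f\<close> to \<open>g\<close>, that is, a map of symmetric spectra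
  \<open>A \<and> \<Delta>[1]\<^sub>+ \<rightarrow> E\<close>.\<close>

definition sphomotopy ::
  "'a symsp \<Rightarrow> 'e symsp \<Rightarrow> (nat \<Rightarrow> nat \<Rightarrow> 'a \<Rightarrow> 'e) \<Rightarrow> (nat \<Rightarrow> nat \<Rightarrow> 'a \<Rightarrow> 'e) \<Rightarrow> bool" where
  "sphomotopy A E f g \<longleftrightarrow> f \<in> spmaps A E \<and> g \<in> spmaps A E \<and> (\<exists>H.
     (\<forall>n. H n \<in> smaps (sprod (sp A n) (Delta 1)) (sp E n)) \<and>
     (\<forall>n k. \<forall>\<theta>\<in>dhom k 1. H n k (base A n k, \<theta>) = base E n k) \<and>
     (\<forall>n k \<pi>. \<forall>x\<in>spx (sp A n) k. \<forall>\<theta>\<in>dhom k 1. \<pi> permutes {..<n} \<longrightarrow>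
        H n k (sig A n \<pi> k x, \<theta>) = sig E n \<pi> k (H n k (x, \<theta>))) \<and>
     (\<forall>n k. \<forall>s\<le>k. \<forall>x\<in>spx (sp A n) k. \<forall>\<theta>\<in>dhom k 1.
        H (Suc n) k (str A n k s x, \<theta>) = str E n k s (H n k (x, \<theta>))) \<and>
     (\<forall>n k. \<forall>x\<in>spx (sp A n) k.
        H n k (x, \<lambda>_\<in>{..k}. 0) = f n k x \<and> H n k (x, \<lambda>_\<in>{..k}. 1) = g n k x))"

definition sphomotopic ::
  "'a symsp \<Rightarrow> 'e symsp \<Rightarrow> (nat \<Rightarrow> nat \<Rightarrow> 'a \<Rightarrow> 'e) \<Rightarrow> (nat \<Rightarrow> nat \<Rightarrow> 'a \<Rightarrow> 'e) \<Rightarrow> bool" where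
  "sphomotopic A E = equivclp (sphomotopy A E)"

text \<open>Extension along the monomorphisms that are level equivalences.  The spectra \<open>A\<close> and \<open>B\<close> may be
  restricted to an infinite type, since this class of maps is generated by the ones between
  countable spectra.\<close>

definition injective_symsp :: "'e symsp \<Rightarrow> bool" where
  "injective_symsp E \<longleftrightarrow>
     (\<forall>(A :: 'e symsp) (B :: 'e symsp). \<forall>f\<in>spmaps A B. \<forall>g\<in>spmaps A E.
        is_symsp A \<longrightarrow> is_symsp B \<longrightarrow> (\<forall>n k. inj_on (f n k) (spx (sp A n) k)) \<longrightarrow>
        (\<forall>n. weak_equivalence (sp A n) (sp B n) (f n)) \<longrightarrow>
        (\<exists>h\<in>spmaps B E. spcomp A h f = g))"

text \<open>The pointed mapping space \<open>Map\<^sub>*(S\<^sup>1, E\<^sub>n)\<close>.\<close>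

definition loop_space :: "'e symsp \<Rightarrow> nat \<Rightarrow> (nat \<Rightarrow> nat \<times> (nat \<Rightarrow> nat) \<Rightarrow> 'e) sset" where
  "loop_space E n = \<lparr>
     spx = \<lambda>k. {h \<in> smaps (sprod circle (Delta k)) (sp E n).
       \<forall>j. \<forall>\<sigma>\<in>dhom j k. h j (0, \<sigma>) = base E n j},
     act = \<lambda>k q \<alpha> h. \<lambda>j. \<lambda>(s, \<sigma>)\<in>{..j} \<times> dhom j k. h j (s, compose {..j} \<alpha> \<sigma>)\<rparr>"

definition omega_spectrum :: "'e symsp \<Rightarrow> bool" where
  "omega_spectrum E \<longleftrightarrow> is_symsp E \<and> (\<forall>n. kan_complex (sp E n) \<and>
     weak_equivalence (sp E n) (loop_space E (Suc n))
       (\<lambda>k. \<lambda>x\<in>spx (sp E n) k. \<lambda>j. \<lambda>(s, \<sigma>)\<in>{..j} \<times> dhom j k.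
          str E n j s (act (sp E n) j k \<sigma> x)))"

text \<open>\<open>f\<close> induces a bijection \<open>[B, E] \<rightarrow> [A, E]\<close> for all injective \<open>\<Omega>\<close>-spectra \<open>E\<close>.  For infinite \<open>'a\<close>
  it suffices that the simplices of \<open>E\<close> are taken in the type \<open>'a set\<close>: by the small object argument
  every symmetric spectrum with simplices in \<open>'a\<close> is stably equivalent to an injective
  \<open>\<Omega>\<close>-spectrum of cardinality at most that of \<open>'a set\<close>.\<close>

definition stable_equivalence :: "'a symsp \<Rightarrow> 'a symsp \<Rightarrow> (nat \<Rightarrow> nat \<Rightarrow> 'a \<Rightarrow> 'a) \<Rightarrow> bool" where
  "stable_equivalence A B f \<longleftrightarrow> f \<in> spmaps A B \<and>
     (\<forall>E :: 'a set symsp. injective_symsp E \<longrightarrow> omega_spectrum E \<longrightarrow>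
        (\<forall>u\<in>spmaps A E. \<exists>v\<in>spmaps B E. sphomotopic A E (spcomp A v f) u) \<and>
        (\<forall>v\<in>spmaps B E. \<forall>v'\<in>spmaps B E.
           sphomotopic A E (spcomp A v f) (spcomp A v' f) \<longrightarrow> sphomotopic B E v v'))"


section \<open>The spectrum of a \<open>\<Gamma_diag>\<close>-simplicial set\<close>

text \<open>The nonzero elements of the \<open>m\<close>-fold smash power of \<open>{0, \<dots>, p}\<close> are the \<open>m\<close>-tuples of elements
  of \<open>{1, \<dots>, p}\<close>.  They are numbered \<open>1, \<dots>, p ^ m\<close> in lexicographic order.\<close>

definition smash_dec :: "nat \<Rightarrow> nat \<Rightarrow> nat \<Rightarrow> nat \<Rightarrow> nat" where
  "smash_dec m p x = (\<lambda>i. (x - 1) div p ^ (m - 1 - i) mod p + 1)"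

definition smash_enc :: "nat \<Rightarrow> nat \<Rightarrow> (nat \<Rightarrow> nat) \<Rightarrow> nat" where
  "smash_enc m q v = (if \<exists>i<m. v i = 0 then 0 else 1 + (\<Sum>i<m. (v i - 1) * q ^ (m - 1 - i)))"

definition smash_pow :: "nat \<Rightarrow> nat \<Rightarrow> nat \<Rightarrow> (nat \<Rightarrow> nat) \<Rightarrow> nat \<Rightarrow> nat" where
  "smash_pow m p q \<phi> =
     (\<lambda>x\<in>{..p ^ m}. if x = 0 then 0 else smash_enc m q (\<lambda>i. \<phi> (smash_dec m p x i)))"

definition smash_perm :: "nat \<Rightarrow> nat \<Rightarrow> (nat \<Rightarrow> nat) \<Rightarrow> nat \<Rightarrow> nat" where
  "smash_perm m p \<pi> =
     (\<lambda>x\<in>{..p ^ m}. if x = 0 then 0 else smash_enc m p (\<lambda>i. smash_dec m p x (inv_into UNIV \<pi> i)))"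

text \<open>The map \<open>x \<mapsto> s \<and> x\<close>, the smash product of the map \<open>1 \<mapsto> s\<close> with an identity map.\<close>

definition smash_cons :: "nat \<Rightarrow> nat \<Rightarrow> nat \<Rightarrow> nat \<Rightarrow> nat" where
  "smash_cons m p s = (\<lambda>x\<in>{..p ^ m}. if s = 0 \<or> x = 0 then 0 else (s - 1) * p ^ m + x)"

definition KF :: "('a sset, 'a sset_map) gamma_ob \<Rightarrow> 'a symsp" where
  "KF X = (let X_at = (\<lambda>a b \<phi>. mor (AMap X (Arr a b \<phi>))) in \<lparr>
     sp = \<lambda>m. \<lparr>spx = \<lambda>p. spx (OMap X (p ^ m)) p,
       act = \<lambda>q p \<theta> x. act (OMap X (q ^ m)) q p \<theta>
                (X_at (p ^ m) (q ^ m) (smash_pow m p q (circ_act q p \<theta>)) p x)\<rparr>,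
     bp = \<lambda>m. X_at 0 (0 ^ m) (pzero 0) 0 (THE x. x \<in> spx (OMap X 0) 0),
     sig = \<lambda>m \<pi> p. \<lambda>x\<in>spx (OMap X (p ^ m)) p. X_at (p ^ m) (p ^ m) (smash_perm m p \<pi>) p x,
     str = \<lambda>m p s x. X_at (p ^ m) (p ^ Suc m) (smash_cons m p s) p x\<rparr>)"

definition KF_map :: "('a sset, 'a sset_map) gamma_ar \<Rightarrow> nat \<Rightarrow> nat \<Rightarrow> 'a \<Rightarrow> 'a" where
  "KF_map f = (\<lambda>m p. mor (mor f (p ^ m)) p)"

text \<open>The morphisms of \<open>\<Gamma_diag>\<close>-simplicial sets that \<open>K\<^sup>F\<close> sends to stable equivalences.  These do not
  depend on a universe, because connective spectra form a full subcategory and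
  \<open>K\<^sup>F\<close> is given by a formula.\<close>

definition gamma_stable :: "('a sset, 'a sset_map) gamma_ar set" where
  "gamma_stable = {f. stable_equivalence (KF (src f)) (KF (tgt f)) (KF_map f)}"

definition nerve_ar ::
  "'u small_ftor \<Rightarrow> (nat, nat \<times> nat, 'u, 'u) ftor sset_map" where
  "nerve_ar a = Arr (nerve (src a)) (nerve (tgt a)) (nerve_map (src a) (mor a))"

definition nerve_gamma ::
  "('u small_cat, 'u small_ftor) gamma_ob
    \<Rightarrow> ((nat, nat \<times> nat, 'u, 'u) ftor sset, (nat, nat \<times> nat, 'u, 'u) ftor sset_map) gamma_ob" where
  "nerve_gamma X = \<lparr>OMap = \<lambda>n\<in>Ob FF. nerve (OMap X n), AMap = \<lambda>a\<in>Ar FF. nerve_ar (AMap X a)\<rparr>"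

definition nerve_gamma_ar ::
  "('u small_cat, 'u small_ftor) gamma_ar
    \<Rightarrow> ((nat, nat \<times> nat, 'u, 'u) ftor sset, (nat, nat \<times> nat, 'u, 'u) ftor sset_map) gamma_ar" where
  "nerve_gamma_ar f = Arr (nerve_gamma (src f)) (nerve_gamma (tgt f)) (\<lambda>n\<in>Ob FF. nerve_ar (mor f n))"

definition S_sset ::
  "'a set set \<Rightarrow> 'a sset \<Rightarrow> ('a sset, 'a sset_map) gamma_ar set" where
  "S_sset \<U> T = {f \<in> Ar (Gamma_diag (SSET \<U>) T). f \<in> gamma_stable}"

definition S_cat ::
  "'u set set \<Rightarrow> 'u small_cat \<Rightarrow> ('u small_cat, 'u small_ftor) gamma_ar set" where
  "S_cat \<U> T = {f \<in> Ar (Gamma_diag (CAT \<U>) T). nerve_gamma_ar f \<in> gamma_stable}"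

definition Si_sset ::
  "'a set set \<Rightarrow> 'a sset \<Rightarrow> ('a sset, 'a sset_map) gstar_ar set" where
  "Si_sset \<U> T = created (Gstar_diag (SSET \<U>) T) (i_pull (SSET \<U>) T) (S_sset \<U> T)"

definition Si_cat ::
  "'u set set \<Rightarrow> 'u small_cat \<Rightarrow> ('u small_cat, 'u small_ftor) gstar_ar set" where
  "Si_cat \<U> T = created (Gstar_diag (CAT \<U>) T) (i_pull (CAT \<U>) T) (S_cat \<U> T)"


section \<open>Adjunctions that are equivalences of homotopy theories\<close>

definition adjoint_equivalence_of_homotopy_theories ::
  "'w itself \<Rightarrow> ('o, 'm) cat \<Rightarrow> 'm set \<Rightarrow> ('p, 'n) cat \<Rightarrow> 'n set
    \<Rightarrow> ('o, 'm, 'p, 'n) ftor \<Rightarrow> ('p, 'n, 'o, 'm) ftor \<Rightarrow> bool" where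
  "adjoint_equivalence_of_homotopy_theories w C W D V F G \<longleftrightarrow>
     adjunction C D F G \<and>
     relative_functor C W D V F \<and> relative_functor D V C W G \<and>
     equivalence_of_homotopy_theories w C W D V F \<and>
     equivalence_of_homotopy_theories w D V C W G"

end

theory Submission
  imports Defs
begin

text \<open>
  Let \<open>\<eta>\<close> and \<open>\<epsilon>\<close> be the unit and the counit of \<open>L \<stileturn> i\<^sup>*\<close>.  The functor \<open>i\<close> is fully faithful: the
  nonzero morphisms \<open>i m \<rightarrow> i n\<close> are the nonzero pointed maps \<open>m \<rightarrow> n\<close>.  Hence \<open>\<eta>\<close>
  is invertible, as for every left Kan extension along a fully faithful functor.  The triangle
  identity \<open>i\<^sup>*\<epsilon> \<circ> \<eta>i\<^sup>* = 1\<close> then makes \<open>i\<^sup>*\<epsilon>\<close> invertible, so that \<open>\<epsilon>\<close> is an \<open>i\<^sup>*\<close>-stable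
  equivalence in every component.  By naturality of \<open>\<eta>\<close> the morphism \<open>i\<^sup>*L x\<close> is conjugate to \<open>x\<close>, so that
  \<open>L\<close> preserves the equivalences.  These arguments rest on the fact that the stable equivalences contain
  the isomorphisms and are closed under composition
  (\<open>stable_equivalence_iso\<close>, \<open>stable_equivalence_comp\<close>, \<open>adjoint_equivalence_of_spectrum_functor\<close>).

  Thus \<open>L\<close> and \<open>i\<^sup>*\<close> are relative functors that are inverse to each other up to natural
  transformations with components in the classes of equivalences.  All such functors are
  equivalences of homotopy theories.  Indeed, a natural transformation
  of relative functors of this kind gives a homotopy between the induced maps of
  classification diagrams, constant in the horizontal direction
  (\<open>bihomotopy_of_natural_transformation\<close>).  Precomposition turns it into a simplicial homotopy
  between maps of mapping spaces into any bisimplicial set (\<open>simplicial_homotopy_precomp\<close>), and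
  realization into a homotopy of continuous maps (\<open>homotopic_realization\<close>).  So \<open>L\<close> and \<open>i\<^sup>*\<close> induce
  homotopy equivalences of mapping spaces into every complete Segal space
  (\<open>css_weak_equivalence_of_bihomotopy_inverse\<close>, \<open>equivalences_of_natural_transformations\<close>).

  For the realization of a simplicial homotopy the prism \<open>\<Delta>\<^sup>n \<times> [0,1]\<close> is cut into \<open>n + 1\<close> simplices.
  In terms of the partial sums of barycentric coordinates, the cutting and its compatibility with
  all the operators of the simplex category become statements about the insertion of a number into a
  monotone sequence.

  The functor \<open>L\<close> is specified by coends of wedges.  A map out of such a coend is a cocone indexed by the
  nonzero morphisms \<open>i n \<rightarrow> t\<close> (\<open>ucocone_of_coend\<close>, \<open>coend_of_ucocone\<close>), and the adjunction follows
  formally from this universal property (\<open>lan_adjunction\<close>).  The cocones range over a countable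
  diagram.  Therefore \<open>L\<close> exists as soon as countable colimits of small categories and of small simplicial
  sets exist (\<open>is_L_LL\<close>, \<open>has_countable_colimits_CAT\<close>, \<open>has_countable_colimits_SSET\<close>).  Instead of generating
  an equivalence relation, the colimits identify two elements if all compatible families of
  morphisms into small objects agree on them.
\<close>

section \<open>Simplicial homotopies and geometric realization\<close>

lemma istopology_quotient:
  "istopology (\<lambda>U. U \<subseteq> q ` topspace X \<and> openin X {x \<in> topspace X. q x \<in> U})"
proof -
  have 1: "{x \<in> topspace X. q x \<in> S \<inter> T} = {x \<in> topspace X. q x \<in> S} \<inter> {x \<in> topspace X. q x \<in> T}" for S T
    by auto
  have 2: "{x \<in> topspace X. q x \<in> \<Union>\<K>} = (\<Union>K\<in>\<K>. {x \<in> topspace X. q x \<in> K})" for \<K>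
    by auto
  show ?thesis
    unfolding istopology_def 1 2 by (auto intro!: openin_Int openin_Union)
qed

lemma openin_quotient_topology:
  "openin (quotient_topology X q) U \<longleftrightarrow> U \<subseteq> q ` topspace X \<and> openin X {x \<in> topspace X. q x \<in> U}"
  unfolding quotient_topology_def by (simp add: istopology_quotient)

lemma topspace_quotient_topology: "topspace (quotient_topology X q) = q ` topspace X"
proof
  show "topspace (quotient_topology X q) \<subseteq> q ` topspace X"
    using openin_quotient_topology[of X q] openin_topspace by blast
  have "{x \<in> topspace X. q x \<in> q ` topspace X} = topspace X" by auto
  then have "openin (quotient_topology X q) (q ` topspace X)"
    by (simp add: openin_quotient_topology)
  then show "q ` topspace X \<subseteq> topspace (quotient_topology X q)"
    by (rule openin_subset)
qed

lemma quotient_map_quotient_topology: "quotient_map X (quotient_topology X q) q"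
  unfolding quotient_map_def by (auto simp: topspace_quotient_topology openin_quotient_topology)

lemma quotient_map_rclass: "quotient_map (rsum X) (realization X) (rclass X)"
  unfolding realization_def by (rule quotient_map_quotient_topology)

lemma topspace_rsum: "topspace (rsum X) = {(n, x, t). x \<in> spx X n \<and> t \<in> standard_simplex n}"
  by (auto simp: rsum_def topspace_standard_simplex)

lemma topspace_realization: "topspace (realization X) = rclass X ` topspace (rsum X)"
  unfolding realization_def by (rule topspace_quotient_topology)

lemma rclass_eqI: "equivclp (rglue X) p q \<Longrightarrow> rclass X p = rclass X q"
  unfolding rclass_def using equivp_evquivclp[of "rglue X"]
  by (metis (no_types, lifting) Collect_cong equivp_def)

lemma rclass_self: "p \<in> rclass X p"
  by (simp add: rclass_def)

lemma rclass_glue: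
  assumes "\<theta> \<in> dhom m n" "x \<in> spx X n" "t \<in> standard_simplex m"
  shows "rclass X (n, x, pushpt m \<theta> t) = rclass X (m, act X m n \<theta> x, t)"
  by (rule rclass_eqI, rule r_into_equivclp) (unfold rglue_def, use assms in blast)

lemma respects_equivclp:
  assumes "\<And>p q. r p q \<Longrightarrow> f p = f q" "equivclp r p q"
  shows "f p = f q"
  using assms(2) by (induction rule: equivclp_induct) (use assms(1) in fastforce)+

lemma rclass_lift:
  assumes "\<And>p q. rglue X p q \<Longrightarrow> f p = f q" "rclass X p = rclass X q"
  shows "f p = f q"
proof -
  have "equivclp (rglue X) p q"
    using rclass_self[of q X] assms(2) by (metis mem_Collect_eq rclass_def)
  from respects_equivclp[of "rglue X" f, OF assms(1) this] show ?thesis .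
qed

subsection \<open>Simplices and partial sums\<close>

text \<open>A point of a standard simplex is determined by the partial sums of its coordinates.  On these the
  operators of the simplex category act by reindexing, because the preimage of an initial segment under a
  monotone map is an initial segment.\<close>

definition psum :: "(nat \<Rightarrow> real) \<Rightarrow> nat \<Rightarrow> real" where
  "psum t j = (\<Sum>i<j. t i)"

lemma psum_0 [simp]: "psum t 0 = 0" and psum_Suc [simp]: "psum t (Suc j) = psum t j + t j"
  by (simp_all add: psum_def)

lemma psum_ext: "(\<And>j. psum t j = psum t' j) \<Longrightarrow> t = t'"
  by (rule ext) (metis psum_Suc add_diff_cancel_left')

lemma psum_mono: "(\<And>i. 0 \<le> t i) \<Longrightarrow> a \<le> b \<Longrightarrow> psum t a \<le> psum t b"
  unfolding psum_def by (rule sum_mono2) auto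

lemma standard_simplex_psum:
  "t \<in> standard_simplex n \<longleftrightarrow> (\<forall>i. 0 \<le> t i) \<and> (\<forall>i>n. t i = 0) \<and> psum t (Suc n) = 1"
proof -
  have "t i \<le> 1" if "\<forall>i. 0 \<le> t i" "\<forall>i>n. t i = 0" "psum t (Suc n) = 1" for i
  proof (cases "i \<le> n")
    case True
    have "t i \<le> psum t (Suc n)"
      unfolding psum_def by (rule member_le_sum) (use True that in auto)
    then show ?thesis using that by simp
  qed (use that in auto)
  moreover have "sum t {..n} = psum t (Suc n)"
    unfolding psum_def by (simp add: lessThan_Suc_atMost)
  ultimately show ?thesis unfolding standard_simplex_def by auto
qed

lemma dhomD: "\<theta> \<in> dhom m n \<Longrightarrow> i \<le> m \<Longrightarrow> \<theta> i \<le> n"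
  "\<theta> \<in> dhom m n \<Longrightarrow> i \<le> i' \<Longrightarrow> i' \<le> m \<Longrightarrow> \<theta> i \<le> \<theta> i'"
  "\<theta> \<in> dhom m n \<Longrightarrow> \<not> i \<le> m \<Longrightarrow> \<theta> i = undefined"
  by (auto simp: dhom_def PiE_iff mono_on_def extensional_def)

lemma dhomI: "(\<And>i. i \<le> m \<Longrightarrow> \<theta> i \<le> n) \<Longrightarrow> (\<And>i i'. i \<le> i' \<Longrightarrow> i' \<le> m \<Longrightarrow> \<theta> i \<le> \<theta> i')
  \<Longrightarrow> (\<And>i. m < i \<Longrightarrow> \<theta> i = undefined) \<Longrightarrow> \<theta> \<in> dhom m n"
  unfolding dhom_def PiE_iff mono_on_def extensional_def by auto

lemma dhom_compose: "\<phi> \<in> dhom k m \<Longrightarrow> \<theta> \<in> dhom m n \<Longrightarrow> compose {..k} \<theta> \<phi> \<in> dhom k n"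
  by (rule dhomI) (auto simp: compose_def dhomD)

lemma dhom_ident: "(\<lambda>i\<in>{..n}. i) \<in> dhom n n"
  by (rule dhomI) auto

lemma psum_pushpt:
  assumes "\<And>i. i \<le> m \<Longrightarrow> \<theta> i < k \<longleftrightarrow> i < c" "c \<le> Suc m"
  shows "psum (pushpt m \<theta> t) k = psum t c"
proof -
  have "psum (pushpt m \<theta> t) k = (\<Sum>j<k. \<Sum>i | i \<in> {..m} \<and> \<theta> i = j. t i)"
    by (simp add: psum_def pushpt_def)
  also have "\<dots> = (\<Sum>j<k. \<Sum>i | i \<in> {i. i \<le> m \<and> \<theta> i < k} \<and> \<theta> i = j. t i)"
    by (intro sum.cong) auto
  also have "\<dots> = (\<Sum>i\<in>{i. i \<le> m \<and> \<theta> i < k}. t i)"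
    by (rule sum.group) auto
  also have "{i. i \<le> m \<and> \<theta> i < k} = {..<c}"
    using assms by auto
  finally show ?thesis by (simp add: psum_def)
qed

lemma dhom_threshold:
  assumes "\<theta> \<in> dhom m n"
  obtains c where "c \<le> Suc m" "\<And>i. i \<le> m \<Longrightarrow> \<theta> i < k \<longleftrightarrow> i < c"
proof -
  define c where "c = (LEAST i. m < i \<or> k \<le> \<theta> i)"
  have *: "m < c \<or> k \<le> \<theta> c" unfolding c_def by (rule LeastI[of _ "Suc m"]) simp
  have "c \<le> Suc m" unfolding c_def by (rule Least_le) simp
  moreover have "\<theta> i < k \<longleftrightarrow> i < c" if "i \<le> m" for i
  proof
    assume "\<theta> i < k"
    show "i < c"
    proof (rule ccontr)
      assume "\<not> i < c"
      then have "k \<le> \<theta> c" "\<theta> c \<le> \<theta> i" using * that dhomD(2)[OF assms, of c i] by auto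
      then show False using \<open>\<theta> i < k\<close> by simp
    qed
  next
    assume "i < c"
    then show "\<theta> i < k" using not_less_Least[of i "\<lambda>i. m < i \<or> k \<le> \<theta> i"] by (auto simp: c_def)
  qed
  ultimately show ?thesis by (rule that)
qed

lemma pushpt_simplex:
  assumes "\<theta> \<in> dhom m n" "t \<in> standard_simplex m"
  shows "pushpt m \<theta> t \<in> standard_simplex n"
proof -
  have "psum (pushpt m \<theta> t) (Suc n) = psum t (Suc m)"
    by (rule psum_pushpt) (use dhomD[OF assms(1)] in \<open>auto simp: less_Suc_eq_le\<close>)
  moreover have "pushpt m \<theta> t i = 0" if "n < i" for i
    unfolding pushpt_def by (rule sum.neutral) (use dhomD[OF assms(1)] that in fastforce)
  ultimately show ?thesis
    using assms(2) unfolding standard_simplex_psum by (auto simp: pushpt_def intro!: sum_nonneg)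
qed

subsection \<open>Prism decomposition\<close>

text \<open>The pairs for which \<open>1 - s\<close> can be inserted between the partial sums with indices \<open>j\<close> and \<open>j + 1\<close>.
  These are the simplices of the prism, and \<open>prism_pt\<close> gives the barycentric coordinates of a point
  in the \<open>j\<close>-th one: its partial sums are those of \<open>t\<close>, with \<open>1 - s\<close> inserted.\<close>

definition region :: "nat \<Rightarrow> ((nat \<Rightarrow> real) \<times> real) set" where
  "region j = {(t, s). psum t j \<le> 1 - s \<and> 1 - s \<le> psum t (Suc j)}"

definition prism_pt :: "nat \<Rightarrow> (nat \<Rightarrow> real) \<Rightarrow> real \<Rightarrow> nat \<Rightarrow> real" where
  "prism_pt j t s = (\<lambda>i. if i < j then t i else if i = j then (1 - s) - psum t j
     else if i = Suc j then psum t (Suc j) - (1 - s) else t (i - 1))"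

text \<open>The \<open>j\<close>-th simplex of the prism is the pair of the degeneracy \<open>dgn n j : [n + 1] \<rightarrow> [n]\<close> and of the
  map \<open>cut (n + 1) (j + 1) : [n + 1] \<rightarrow> [1]\<close>.\<close>

definition dgn :: "nat \<Rightarrow> nat \<Rightarrow> nat \<Rightarrow> nat" where
  "dgn n j = (\<lambda>i\<in>{..Suc n}. if i \<le> j then i else i - 1)"

definition face :: "nat \<Rightarrow> nat \<Rightarrow> nat \<Rightarrow> nat" where
  "face n j = (\<lambda>i\<in>{..n}. if i < j then i else Suc i)"

definition cut :: "nat \<Rightarrow> nat \<Rightarrow> nat \<Rightarrow> nat" where
  "cut n j = (\<lambda>i\<in>{..n}. if i < j then 0 else 1)"

lemma psum_prism_pt:
  "psum (prism_pt j t s) k = (if k \<le> j then psum t k else if k = Suc j then 1 - s else psum t (k - 1))"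
proof (induction k)
  case (Suc k)
  consider "k < j" | "k = j" | "k = Suc j" | "k > Suc j" by linarith
  then show ?case
  proof cases
    case 4
    then obtain k' where "k = Suc k'" by (cases k) auto
    then show ?thesis using Suc 4 by (auto simp: prism_pt_def)
  qed (use Suc in \<open>auto simp: prism_pt_def\<close>)
qed simp

lemma prism_pt_simplex:
  assumes "t \<in> standard_simplex n" "j \<le> n" "(t, s) \<in> region j"
  shows "prism_pt j t s \<in> standard_simplex (Suc n)"
  unfolding standard_simplex_psum
proof (intro conjI allI impI)
  show "psum (prism_pt j t s) (Suc (Suc n)) = 1"
    unfolding psum_prism_pt using assms by (auto simp: standard_simplex_psum)
qed (use assms in \<open>auto simp: prism_pt_def standard_simplex_psum region_def\<close>)

lemma dgn_dhom: "j \<le> n \<Longrightarrow> dgn n j \<in> dhom (Suc n) n"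
  by (rule dhomI) (auto simp: dgn_def)

lemma face_dhom: "face n j \<in> dhom n (Suc n)"
  by (rule dhomI) (auto simp: face_def)

lemma cut_dhom: "cut n j \<in> dhom n (Suc 0)"
  by (rule dhomI) (auto simp: cut_def)

lemma psum_face: "j \<le> Suc n \<Longrightarrow> t \<in> standard_simplex n \<Longrightarrow> psum (pushpt n (face n j) t) k = (if k \<le> j then psum t k else psum t (k - 1))"
proof -
  assume j: "j \<le> Suc n" and t: "t \<in> standard_simplex n"
  have const: "psum t k = 1" if "Suc n \<le> k" for k
    using that
  proof (induction k rule: dec_induct)
    case base then show ?case using t by (auto simp: standard_simplex_psum)
  next
    case (step k) then show ?case using t by (auto simp: standard_simplex_psum)
  qed
  define c where "c = min (Suc n) (if k \<le> j then k else k - 1)"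
  have "psum (pushpt n (face n j) t) k = psum t c"
    by (rule psum_pushpt) (use j in \<open>auto simp: face_def c_def split: if_splits\<close>)
  also have "\<dots> = (if k \<le> j then psum t k else psum t (k - 1))"
    using const by (auto simp: c_def min_def simp del: psum_Suc)
  finally show ?thesis .
qed

lemma region_exists:
  assumes t: "t \<in> standard_simplex n" and "0 \<le> s" "s \<le> 1"
  obtains j where "j \<le> n" "(t, s) \<in> region j"
proof -
  define j where "j = (LEAST j. 1 - s \<le> psum t (Suc j))"
  have n: "1 - s \<le> psum t (Suc n)" using assms by (simp add: standard_simplex_psum)
  have le: "1 - s \<le> psum t (Suc j)" unfolding j_def by (rule LeastI[of _ n]) (rule n)
  have "j \<le> n" unfolding j_def by (rule Least_le) (rule n)
  moreover have "psum t j \<le> 1 - s"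
  proof (cases j)
    case (Suc i)
    then have "\<not> 1 - s \<le> psum t (Suc i)" using not_less_Least[of i "\<lambda>j. 1 - s \<le> psum t (Suc j)"]
      by (simp add: j_def)
    then show ?thesis using Suc by simp
  qed (use assms in auto)
  ultimately show ?thesis using le that by (auto simp: region_def)
qed

text \<open>The map that \<open>\<theta>\<close> induces from the \<open>j\<close>-th simplex of the prism over \<open>\<Delta>\<^sup>m\<close> to the \<open>\<theta> j\<close>-th simplex
  of the prism over \<open>\<Delta>\<^sup>n\<close>.\<close>

definition shift :: "nat \<Rightarrow> (nat \<Rightarrow> nat) \<Rightarrow> nat \<Rightarrow> nat \<Rightarrow> nat" where
  "shift m \<theta> j = (\<lambda>i\<in>{..Suc m}. if i \<le> j then \<theta> i else Suc (\<theta> (i - 1)))"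

lemma shift_dhom:
  assumes "\<theta> \<in> dhom m n" "j \<le> m"
  shows "shift m \<theta> j \<in> dhom (Suc m) (Suc n)"
proof (rule dhomI)
  fix i i' assume "i \<le> i'" "i' \<le> Suc m"
  then show "shift m \<theta> j i \<le> shift m \<theta> j i'"
    using assms(2) dhomD(2)[OF assms(1), of i i'] dhomD(2)[OF assms(1), of "i - 1" "i' - 1"]
      dhomD(2)[OF assms(1), of "i" "i' - 1"]
    by (auto simp: shift_def intro: le_SucI)
qed (use assms dhomD(1)[OF assms(1)] in \<open>auto simp: shift_def intro: le_SucI\<close>)

lemma region_pushpt:
  assumes \<theta>: "\<theta> \<in> dhom m n" and t: "t \<in> standard_simplex m" and j: "j \<le> m" and r: "(t, s) \<in> region j"
  shows "(pushpt m \<theta> t, s) \<in> region (\<theta> j)"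
proof -
  have nn: "\<And>i. 0 \<le> t i" using t by (simp add: standard_simplex_psum)
  obtain c where c: "c \<le> Suc m" "\<And>i. i \<le> m \<Longrightarrow> \<theta> i < \<theta> j \<longleftrightarrow> i < c"
    using dhom_threshold[OF \<theta>] by blast
  obtain d where d: "d \<le> Suc m" "\<And>i. i \<le> m \<Longrightarrow> \<theta> i < Suc (\<theta> j) \<longleftrightarrow> i < d"
    using dhom_threshold[OF \<theta>] by blast
  have "c \<le> j" "Suc j \<le> d" using c(2)[OF j] d(2)[OF j] by auto
  then have "psum t c \<le> psum t j" "psum t (Suc j) \<le> psum t d"
    using psum_mono[of t, OF nn] by blast+
  moreover have "psum (pushpt m \<theta> t) (\<theta> j) = psum t c" "psum (pushpt m \<theta> t) (Suc (\<theta> j)) = psum t d"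
    using psum_pushpt c d by blast+
  ultimately show ?thesis using r by (auto simp: region_def simp del: psum_Suc)
qed

text \<open>Both points have the same partial sums: reindexing and the insertion of \<open>1 - s\<close> commute.\<close>

lemma prism_pt_pushpt:
  assumes \<theta>: "\<theta> \<in> dhom m n" and j: "j \<le> m"
  shows "pushpt (Suc m) (shift m \<theta> j) (prism_pt j t s) = prism_pt (\<theta> j) (pushpt m \<theta> t) s"
proof (rule psum_ext)
  fix k
  consider "k \<le> \<theta> j" | "k = Suc (\<theta> j)" | l where "k = Suc l" "\<theta> j < l"
    by (metis Suc_lessI linorder_not_less less_Suc_eq_le not0_implies_Suc zero_le)
  then show "psum (pushpt (Suc m) (shift m \<theta> j) (prism_pt j t s)) k
    = psum (prism_pt (\<theta> j) (pushpt m \<theta> t) s) k"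
  proof cases
    case 1
    obtain c where c: "c \<le> Suc m" "\<And>i. i \<le> m \<Longrightarrow> \<theta> i < k \<longleftrightarrow> i < c"
      using dhom_threshold[OF \<theta>] by blast
    have "c \<le> j" using c(2)[OF j] 1 by auto
    have "psum (pushpt (Suc m) (shift m \<theta> j) (prism_pt j t s)) k = psum (prism_pt j t s) c"
    proof (rule psum_pushpt)
      fix i assume "i \<le> Suc m"
      then show "shift m \<theta> j i < k \<longleftrightarrow> i < c"
      proof (cases "i \<le> j")
        case True
        then show ?thesis using c(2)[of i] j by (simp add: shift_def)
      next
        case False
        then have "\<theta> j \<le> \<theta> (i - 1)" by (intro dhomD(2)[OF \<theta>]) (use \<open>i \<le> Suc m\<close> in auto)
        then show ?thesis using False \<open>i \<le> Suc m\<close> \<open>c \<le> j\<close> 1 by (simp add: shift_def)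
      qed
    qed (use c in auto)
    then show ?thesis using 1 \<open>c \<le> j\<close> psum_pushpt[OF c(2) c(1)] by (simp add: psum_prism_pt)
  next
    case 2
    have "psum (pushpt (Suc m) (shift m \<theta> j) (prism_pt j t s)) k = psum (prism_pt j t s) (Suc j)"
    proof (rule psum_pushpt)
      fix i assume "i \<le> Suc m"
      then show "shift m \<theta> j i < k \<longleftrightarrow> i < Suc j"
      proof (cases "i \<le> j")
        case True
        then have "\<theta> i \<le> \<theta> j" using j by (intro dhomD(2)[OF \<theta>])
        then show ?thesis using True 2 j by (simp add: shift_def)
      next
        case False
        then have "\<theta> j \<le> \<theta> (i - 1)" by (intro dhomD(2)[OF \<theta>]) (use \<open>i \<le> Suc m\<close> in auto)
        then show ?thesis using False \<open>i \<le> Suc m\<close> 2 by (simp add: shift_def)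
      qed
    qed (use j in auto)
    then show ?thesis using 2 by (simp add: psum_prism_pt del: psum_Suc)
  next
    case 3
    obtain c where c: "c \<le> Suc m" "\<And>i. i \<le> m \<Longrightarrow> \<theta> i < l \<longleftrightarrow> i < c"
      using dhom_threshold[OF \<theta>] by blast
    have "j < c" using c(2)[OF j] 3 by auto
    have "psum (pushpt (Suc m) (shift m \<theta> j) (prism_pt j t s)) k = psum (prism_pt j t s) (Suc c)"
    proof (rule psum_pushpt)
      fix i assume "i \<le> Suc m"
      then show "shift m \<theta> j i < k \<longleftrightarrow> i < Suc c"
      proof (cases "i \<le> j")
        case True
        then have "\<theta> i \<le> \<theta> j" using j by (intro dhomD(2)[OF \<theta>])
        then show ?thesis using True 3 j \<open>j < c\<close> by (simp add: shift_def)
      next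
        case False
        then obtain l where "i = Suc l" by (cases i) auto
        then show ?thesis using False \<open>i \<le> Suc m\<close> c(2)[of l] 3 by (simp add: shift_def)
      qed
    qed (use c in auto)
    then show ?thesis using 3 \<open>j < c\<close> psum_pushpt[OF c(2) c(1), where t = t]
      by (simp add: psum_prism_pt del: psum_Suc)
  qed
qed


subsection \<open>Continuous maps out of a realization\<close>

abbreviation simplex_top :: "nat \<Rightarrow> (nat \<Rightarrow> real) topology" where
  "simplex_top n \<equiv> subtopology (powertop_real UNIV) (standard_simplex n)"

lemma openin_rsum_piece:
  assumes "x \<in> spx X n" "openin (simplex_top n) A"
  shows "openin (rsum X) ({n} \<times> {x} \<times> A)"
proof -
  have "{y. (i, y) \<in> {n} \<times> {x} \<times> A} = (if i = n then {x} \<times> A else {})" for i by auto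
  moreover have "A \<subseteq> standard_simplex n"
    using openin_subset[OF assms(2)] by (simp add: topspace_standard_simplex)
  ultimately show ?thesis
    unfolding rsum_def openin_sum_topology
    using assms by (auto simp: topspace_standard_simplex openin_prod_Times_iff)
qed

lemma continuous_map_rsum_piece:
  assumes "x \<in> spx X n"
  shows "continuous_map (simplex_top n) (rsum X) (\<lambda>t. (n, x, t))"
proof -
  have "continuous_map (simplex_top n) (prod_topology (discrete_topology (spx X n)) (simplex_top n)) (\<lambda>t. (x, t))"
    using assms by (simp add: continuous_map_pairedI)
  moreover have "continuous_map (prod_topology (discrete_topology (spx X n)) (simplex_top n)) (rsum X) (\<lambda>y. (n, y))"
    unfolding rsum_def by (rule continuous_map_component_injection) simp
  ultimately show ?thesis
    using continuous_map_compose[of _ _ "\<lambda>t. (x, t)" _ "\<lambda>y. (n, y)"] by (simp add: comp_def)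
qed

text \<open>The space \<open>J \<times> (\<Coprod>\<^sub>n X\<^sub>n \<times> \<Delta>\<^sup>n)\<close> is the disjoint union of the open subspaces \<open>J \<times> {x} \<times> \<Delta>\<^sup>n\<close>, since each
  \<open>X\<^sub>n\<close> is discrete.\<close>

lemma continuous_map_from_prod_rsum:
  assumes "\<And>n x. x \<in> spx X n \<Longrightarrow> continuous_map (prod_topology J (simplex_top n)) Z (\<lambda>(s, t). f (s, (n, x, t)))"
  shows "continuous_map (prod_topology J (rsum X)) Z f"
  unfolding continuous_map_def
proof (intro conjI allI impI)
  show "f \<in> topspace (prod_topology J (rsum X)) \<rightarrow> topspace Z"
  proof
    fix p assume "p \<in> topspace (prod_topology J (rsum X))"
    then obtain s n x t where p: "p = (s, (n, x, t))" "s \<in> topspace J" "x \<in> spx X n" "t \<in> standard_simplex n"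
      by (auto simp: topspace_rsum)
    then have "(case (s, t) of (s, t) \<Rightarrow> f (s, (n, x, t))) \<in> topspace Z"
      using assms[of x n] unfolding continuous_map_def
      by (auto simp: topspace_standard_simplex Pi_iff)
    then show "f p \<in> topspace Z" using p by simp
  qed
  fix V assume V: "openin Z V"
  show "openin (prod_topology J (rsum X)) {p \<in> topspace (prod_topology J (rsum X)). f p \<in> V}"
    unfolding openin_prod_topology_alt
  proof (intro allI impI)
    fix s p assume "(s, p) \<in> {p \<in> topspace (prod_topology J (rsum X)). f p \<in> V}"
    then obtain n x t where p: "p = (n, x, t)" "s \<in> topspace J" "x \<in> spx X n" "t \<in> standard_simplex n"
      and fV: "f (s, (n, x, t)) \<in> V"
      by (auto simp: topspace_rsum)
    define S where "S = {q \<in> topspace (prod_topology J (simplex_top n)). (\<lambda>(s, t). f (s, (n, x, t))) q \<in> V}"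
    have "openin (prod_topology J (simplex_top n)) S"
      unfolding S_def using assms[OF p(3)] V unfolding continuous_map_def by blast
    moreover have "(s, t) \<in> S"
      using p fV by (simp add: topspace_standard_simplex S_def)
    ultimately obtain A B where AB: "openin J A" "openin (simplex_top n) B" "s \<in> A" "t \<in> B" "A \<times> B \<subseteq> S"
      unfolding openin_prod_topology_alt by meson
    have "openin (rsum X) ({n} \<times> {x} \<times> B)" using openin_rsum_piece[OF p(3)] AB by blast
    moreover have "A \<times> ({n} \<times> {x} \<times> B) \<subseteq> {p \<in> topspace (prod_topology J (rsum X)). f p \<in> V}"
      using AB(5) p(3) by (auto simp: S_def topspace_rsum topspace_standard_simplex)
    ultimately show "\<exists>U W. openin J U \<and> openin (rsum X) W \<and> s \<in> U \<and> p \<in> W \<and>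
        U \<times> W \<subseteq> {p \<in> topspace (prod_topology J (rsum X)). f p \<in> V}"
      using AB(1,3,4) p(1) by (intro exI[of _ A] exI[of _ "{n} \<times> {x} \<times> B"]) simp
  qed
qed

lemma continuous_map_from_rsum:
  assumes "\<And>n x. x \<in> spx X n \<Longrightarrow> continuous_map (simplex_top n) Z (\<lambda>t. f (n, x, t))"
  shows "continuous_map (rsum X) Z f"
proof -
  have "continuous_map (prod_topology (discrete_topology {()}) (rsum X)) Z (\<lambda>(s, p). f p)"
  proof (rule continuous_map_from_prod_rsum)
    fix n x assume "x \<in> spx X n"
    then have "continuous_map (prod_topology (discrete_topology {()}) (simplex_top n)) Z ((\<lambda>t. f (n, x, t)) \<circ> snd)"
      by (intro continuous_map_compose[OF continuous_map_snd] assms)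
    then show "continuous_map (prod_topology (discrete_topology {()}) (simplex_top n)) Z
        (\<lambda>(s, t). case (s, (n, x, t)) of (s, p) \<Rightarrow> f p)"
      by (simp add: comp_def case_prod_unfold)
  qed
  moreover have "continuous_map (rsum X) (prod_topology (discrete_topology {()}) (rsum X)) (\<lambda>p. ((), p))"
    by (simp add: continuous_map_pairedI)
  ultimately show ?thesis
    using continuous_map_compose[of _ _ "\<lambda>p. ((), p)" _ "\<lambda>(s, p). f p"] by (simp add: comp_def)
qed

lemma smapsD:
  "f \<in> smaps X Y \<Longrightarrow> x \<in> spx X n \<Longrightarrow> f n x \<in> spx Y n"
  "f \<in> smaps X Y \<Longrightarrow> \<theta> \<in> dhom m n \<Longrightarrow> x \<in> spx X n \<Longrightarrow> f m (act X m n \<theta> x) = act Y m n \<theta> (f n x)"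
  "f \<in> smaps X Y \<Longrightarrow> x \<notin> spx X n \<Longrightarrow> f n x = undefined"
  by (auto simp: smaps_def PiE_iff extensional_def)

lemma smapsI:
  "(\<And>n x. x \<in> spx X n \<Longrightarrow> f n x \<in> spx Y n) \<Longrightarrow> (\<And>n x. x \<notin> spx X n \<Longrightarrow> f n x = undefined)
   \<Longrightarrow> (\<And>m n \<theta> x. \<theta> \<in> dhom m n \<Longrightarrow> x \<in> spx X n \<Longrightarrow> f m (act X m n \<theta> x) = act Y m n \<theta> (f n x))
   \<Longrightarrow> f \<in> smaps X Y"
  by (auto simp: smaps_def PiE_iff extensional_def)

lemma realization_map_rclass:
  assumes "f \<in> smaps X Y"
  shows "realization_map Y f (rclass X (n, x, t)) = rclass Y (n, f n x, t)"
proof -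
  have eq: "(case p of (n, x, t) \<Rightarrow> rclass Y (n, f n x, t)) = (case q of (n, x, t) \<Rightarrow> rclass Y (n, f n x, t))"
    if glue: "rglue X p q" for p q
  proof -
    obtain m n x t \<theta> where "\<theta> \<in> dhom m n" "x \<in> spx X n" "t \<in> standard_simplex m"
      "p = (n, x, pushpt m \<theta> t)" "q = (m, act X m n \<theta> x, t)"
      using glue unfolding rglue_def by blast
    then show ?thesis using assms by (simp add: rclass_glue smapsD)
  qed
  have "(case q of (n, x, t) \<Rightarrow> rclass Y (n, f n x, t)) = rclass Y (n, f n x, t)"
    if "q \<in> rclass X (n, x, t)" for q
  proof -
    have "equivclp (rglue X) (n, x, t) q" using that by (simp add: rclass_def)
    from respects_equivclp[of "rglue X" "\<lambda>p. case p of (n, x, t) \<Rightarrow> rclass Y (n, f n x, t)", OF eq this]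
    show ?thesis by simp
  qed
  then show ?thesis unfolding realization_map_def using rclass_self[of "(n, x, t)" X] by blast
qed

lemma continuous_map_realization_map:
  assumes "f \<in> smaps X Y"
  shows "continuous_map (realization X) (realization Y) (realization_map Y f)"
proof (rule continuous_compose_quotient_map[OF quotient_map_rclass], rule continuous_map_from_rsum)
  fix n x assume "x \<in> spx X n"
  then have "continuous_map (simplex_top n) (rsum Y) (\<lambda>t. (n, f n x, t))"
    by (intro continuous_map_rsum_piece smapsD(1)[OF assms])
  then have "continuous_map (simplex_top n) (realization Y) (rclass Y \<circ> (\<lambda>t. (n, f n x, t)))"
    by (rule continuous_map_compose[OF _ quotient_imp_continuous_map[OF quotient_map_rclass]])
  then show "continuous_map (simplex_top n) (realization Y) (\<lambda>t. (realization_map Y f \<circ> rclass X) (n, x, t))"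
    by (simp add: comp_def realization_map_rclass[OF assms])
qed

subsection \<open>The homotopy between the realizations of homotopic maps\<close>

locale simplicial_homotopy =
  fixes K :: "'a sset" and L :: "'b sset" and H u v
  assumes K: "is_sset K" and H: "H \<in> smaps (sprod K (Delta 1)) L"
    and H0: "\<And>n x. x \<in> spx K n \<Longrightarrow> H n (x, \<lambda>_\<in>{..n}. 0) = u n x"
    and H1: "\<And>n x. x \<in> spx K n \<Longrightarrow> H n (x, \<lambda>_\<in>{..n}. 1) = v n x"
begin

text \<open>The homotopy on the \<open>j\<close>-th simplex of the prism over the simplex \<open>x\<close>.\<close>

definition pv :: "nat \<Rightarrow> nat \<times> 'a \<times> (nat \<Rightarrow> real) \<Rightarrow> real \<Rightarrow> (nat \<times> 'b \<times> (nat \<Rightarrow> real)) set" where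
  "pv j = (\<lambda>(n, x, t) s. rclass L (Suc n, H (Suc n) (act K (Suc n) n (dgn n j) x, cut (Suc n) (Suc j)), prism_pt j t s))"

lemma act_K: "\<theta> \<in> dhom m n \<Longrightarrow> x \<in> spx K n \<Longrightarrow> act K m n \<theta> x \<in> spx K m"
  using K by (auto simp: is_sset_def)

lemma act_act_K: "\<phi> \<in> dhom k m \<Longrightarrow> \<theta> \<in> dhom m n \<Longrightarrow> x \<in> spx K n \<Longrightarrow>
  act K k m \<phi> (act K m n \<theta> x) = act K k n (compose {..k} \<theta> \<phi>) x"
  using K unfolding is_sset_def by metis

lemma act_H: "\<theta> \<in> dhom m n \<Longrightarrow> x \<in> spx K n \<Longrightarrow> \<sigma> \<in> dhom n (Suc 0) \<Longrightarrow>
  act L m n \<theta> (H n (x, \<sigma>)) = H m (act K m n \<theta> x, compose {..m} \<sigma> \<theta>)"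
  using smapsD(2)[OF H, of \<theta> m n "(x, \<sigma>)"] by (simp add: sprod_def Delta_def)

lemma H_in: "x \<in> spx K n \<Longrightarrow> \<sigma> \<in> dhom n (Suc 0) \<Longrightarrow> H n (x, \<sigma>) \<in> spx L n"
  using smapsD(1)[OF H, of "(x, \<sigma>)" n] by (simp add: sprod_def Delta_def)

text \<open>On the two faces with \<open>1 - s = psum t i\<close>, which the \<open>j\<close>-th simplex shares with its neighbours, the
  value is independent of \<open>j\<close>.  For \<open>i = 0\<close> and \<open>i = n + 1\<close> these are the ends of the prism.\<close>

lemma pv_face:
  assumes x: "x \<in> spx K n" and t: "t \<in> standard_simplex n" and j: "j \<le> n" and i: "i = j \<or> i = Suc j"
    and s: "1 - s = psum t i"
  shows "pv j (n, x, t) s = rclass L (n, H n (x, compose {..n} (cut (Suc n) (Suc j)) (face n i)), t)"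
proof -
  have "prism_pt j t s = pushpt n (face n i) t"
  proof (rule psum_ext)
    fix k show "psum (prism_pt j t s) k = psum (pushpt n (face n i) t) k"
      using i s t j by (subst psum_face) (auto simp: psum_prism_pt le_Suc_eq simp del: psum_Suc)
  qed
  then have "pv j (n, x, t) s = rclass L (n, act L n (Suc n) (face n i)
      (H (Suc n) (act K (Suc n) n (dgn n j) x, cut (Suc n) (Suc j))), t)"
    using t x j by (simp add: pv_def rclass_glue face_dhom H_in act_K dgn_dhom cut_dhom)
  also have "act L n (Suc n) (face n i) (H (Suc n) (act K (Suc n) n (dgn n j) x, cut (Suc n) (Suc j))) =
      H n (act K n n (compose {..n} (dgn n j) (face n i)) x, compose {..n} (cut (Suc n) (Suc j)) (face n i))"
    using x j by (simp add: act_H act_act_K face_dhom act_K dgn_dhom cut_dhom)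
  also have "compose {..n} (dgn n j) (face n i) = (\<lambda>i\<in>{..n}. i)"
    using i j by (auto simp: fun_eq_iff compose_def dgn_def face_def)
  also have "act K n n (\<lambda>i\<in>{..n}. i) x = x" using K x by (simp add: is_sset_def)
  finally show ?thesis .
qed

lemma pv_adjacent:
  assumes x: "x \<in> spx K n" and t: "t \<in> standard_simplex n" and j: "Suc j \<le> n"
    and s: "(t, s) \<in> region j" "(t, s) \<in> region (Suc j)"
  shows "pv j (n, x, t) s = pv (Suc j) (n, x, t) s"
proof -
  have s': "1 - s = psum t (Suc j)" using s by (auto simp: region_def)
  have "compose {..n} (cut (Suc n) (Suc j)) (face n (Suc j)) = compose {..n} (cut (Suc n) (Suc (Suc j))) (face n (Suc j))"
    by (auto simp: fun_eq_iff compose_def cut_def face_def)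
  then show ?thesis
    using pv_face[OF x t _ _ s', of j] pv_face[OF x t _ _ s', of "Suc j"] j by simp
qed

lemma pv_eq_le:
  assumes x: "x \<in> spx K n" and t: "t \<in> standard_simplex n" and "j \<le> j'" "j' \<le> n"
    and s: "(t, s) \<in> region j" "(t, s) \<in> region j'"
  shows "pv j (n, x, t) s = pv j' (n, x, t) s"
  using assms(3,4,6)
proof (induction j' rule: dec_induct)
  case (step i)
  have nn: "\<And>i. 0 \<le> t i" using t by (simp add: standard_simplex_psum)
  have "psum t i \<le> psum t (Suc i)" using nn by simp
  moreover have "psum t (Suc j) \<le> psum t (Suc i)" using psum_mono[OF nn, of "Suc j" "Suc i"] step by simp
  ultimately have "(t, s) \<in> region i" using s(1) step.prems
    unfolding region_def by (auto simp del: psum_Suc)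
  then show ?case using step pv_adjacent[OF x t, of i s] by simp
qed simp

lemma pv_eq:
  assumes "x \<in> spx K n" "t \<in> standard_simplex n" "j \<le> n" "j' \<le> n" "(t, s) \<in> region j" "(t, s) \<in> region j'"
  shows "pv j (n, x, t) s = pv j' (n, x, t) s"
proof (cases "j \<le> j'")
  case True
  then show ?thesis using assms by (intro pv_eq_le)
next
  case False
  then have "j' \<le> j" by simp
  then show ?thesis using assms by (intro pv_eq_le[symmetric])
qed

lemma pv_glue:
  assumes \<theta>: "\<theta> \<in> dhom m n" and x: "x \<in> spx K n" and t: "t \<in> standard_simplex m" and j: "j \<le> m" and r: "(t, s) \<in> region j"
  shows "pv (\<theta> j) (n, x, pushpt m \<theta> t) s = pv j (m, act K m n \<theta> x, t) s"
proof -
  have j': "\<theta> j \<le> n" using \<theta> j by (rule dhomD)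
  have "pv (\<theta> j) (n, x, pushpt m \<theta> t) s = rclass L (Suc m, act L (Suc m) (Suc n) (shift m \<theta> j)
      (H (Suc n) (act K (Suc n) n (dgn n (\<theta> j)) x, cut (Suc n) (Suc (\<theta> j)))), prism_pt j t s)"
    unfolding pv_def using x t j j' r \<theta>
    by (simp add: prism_pt_pushpt[symmetric] rclass_glue shift_dhom H_in act_K dgn_dhom cut_dhom prism_pt_simplex)
  also have "act L (Suc m) (Suc n) (shift m \<theta> j)
      (H (Suc n) (act K (Suc n) n (dgn n (\<theta> j)) x, cut (Suc n) (Suc (\<theta> j))))
    = H (Suc m) (act K (Suc m) n (compose {..Suc m} (dgn n (\<theta> j)) (shift m \<theta> j)) x,
        compose {..Suc m} (cut (Suc n) (Suc (\<theta> j))) (shift m \<theta> j))"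
    using x j j' \<theta> by (simp add: act_H act_act_K shift_dhom act_K dgn_dhom cut_dhom)
  also have "compose {..Suc m} (dgn n (\<theta> j)) (shift m \<theta> j) = compose {..Suc m} \<theta> (dgn m j)"
  proof (rule ext)
    fix i
    show "compose {..Suc m} (dgn n (\<theta> j)) (shift m \<theta> j) i = compose {..Suc m} \<theta> (dgn m j) i"
    proof (cases "i \<le> j")
      case True
      then show ?thesis using j dhomD(2)[OF \<theta>, of i j] dhomD(1)[OF \<theta>, of i]
        by (simp add: compose_def dgn_def shift_def)
    next
      case False
      show ?thesis
      proof (cases "i \<le> Suc m")
        case True
        with False have "\<theta> j \<le> \<theta> (i - 1)" "\<theta> (i - 1) \<le> n" using dhomD(2)[OF \<theta>, of j "i - 1"] dhomD(1)[OF \<theta>, of "i - 1"] by auto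
        then show ?thesis using True False by (simp add: compose_def dgn_def shift_def)
      qed (simp add: compose_def)
    qed
  qed
  also have "compose {..Suc m} (cut (Suc n) (Suc (\<theta> j))) (shift m \<theta> j) = cut (Suc m) (Suc j)"
  proof (rule ext)
    fix i
    show "compose {..Suc m} (cut (Suc n) (Suc (\<theta> j))) (shift m \<theta> j) i = cut (Suc m) (Suc j) i"
    proof (cases "i \<le> j")
      case True
      then show ?thesis using j dhomD(2)[OF \<theta>, of i j] dhomD(1)[OF \<theta>, of i]
        by (simp add: compose_def cut_def shift_def)
    next
      case False
      show ?thesis
      proof (cases "i \<le> Suc m")
        case True
        with False have "\<theta> j \<le> \<theta> (i - 1)" "\<theta> (i - 1) \<le> n" using dhomD(2)[OF \<theta>, of j "i - 1"] dhomD(1)[OF \<theta>, of "i - 1"] by auto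
        then show ?thesis using True False by (simp add: compose_def cut_def shift_def)
      qed (simp add: compose_def cut_def)
    qed
  qed
  also have "act K (Suc m) n (compose {..Suc m} \<theta> (dgn m j)) x = act K (Suc m) m (dgn m j) (act K m n \<theta> x)"
    using x j \<theta> by (simp add: act_act_K dgn_dhom)
  finally show ?thesis by (simp add: pv_def)
qed

text \<open>By \<open>pv_eq\<close> the value does not depend on the chosen simplex of the prism.\<close>

definition hpt :: "real \<times> (nat \<times> 'a \<times> (nat \<Rightarrow> real)) \<Rightarrow> (nat \<times> 'b \<times> (nat \<Rightarrow> real)) set" where
  "hpt = (\<lambda>(s, (n, x, t)). pv (SOME j. j \<le> n \<and> (t, s) \<in> region j) (n, x, t) s)"

lemma hpt_eq:
  assumes "x \<in> spx K n" "t \<in> standard_simplex n" "j \<le> n" "(t, s) \<in> region j"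
  shows "hpt (s, (n, x, t)) = pv j (n, x, t) s"
proof -
  define i where "i = (SOME j. j \<le> n \<and> (t, s) \<in> region j)"
  have "i \<le> n \<and> (t, s) \<in> region i" unfolding i_def by (rule someI[of _ j]) (use assms in simp)
  then show ?thesis unfolding hpt_def using assms pv_eq[of x n t i j s] by (simp add: i_def)
qed

lemma continuous_map_psum: "continuous_map (powertop_real UNIV) euclideanreal (\<lambda>t. psum t j)"
  unfolding psum_def by (intro continuous_map_sum continuous_map_product_projection) auto

text \<open>The simplices of the prism are a finite closed cover, on each of which the map is given by
  \<open>prism_pt\<close> and hence continuous.\<close>

lemma continuous_map_hpt:
  "continuous_map (prod_topology (top_of_set {0..1}) (rsum K)) (realization L) hpt"
proof (rule continuous_map_from_prod_rsum)
  fix n x assume x: "x \<in> spx K n"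
  let ?P = "prod_topology (top_of_set {0..1::real}) (simplex_top n)"
  let ?T = "\<lambda>j. {p \<in> topspace ?P. psum (snd p) j \<le> 1 - fst p \<and> 1 - fst p \<le> psum (snd p) (Suc j)}"
  have T: "(s, t) \<in> ?T j \<longleftrightarrow> s \<in> {0..1} \<and> t \<in> standard_simplex n \<and> (t, s) \<in> region j" for s t j
    by (auto simp: region_def topspace_standard_simplex)
  have ps: "continuous_map ?P euclideanreal (\<lambda>p. psum (snd p) j)" for j
    using continuous_map_compose[OF continuous_map_snd[of "top_of_set {0..1::real}" "simplex_top n"]
        continuous_map_from_subtopology[OF continuous_map_psum[of j]]]
    by (simp add: comp_def)
  have cs: "continuous_map ?P euclideanreal (\<lambda>p. 1 - fst p)"
    using continuous_map_compose[OF continuous_map_fst[of "top_of_set {0..1::real}" "simplex_top n"]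
        continuous_map_from_subtopology[of euclideanreal euclideanreal "\<lambda>s. 1 - s" "{0..1}"]]
    by (simp add: comp_def continuous_intros)
  have ct: "continuous_map ?P euclideanreal (\<lambda>p. snd p i)" for i
    using continuous_map_compose[OF continuous_map_snd[of "top_of_set {0..1::real}" "simplex_top n"]
        continuous_map_from_subtopology[OF continuous_map_product_projection[of i UNIV "\<lambda>_. euclideanreal"]]]
    by (simp add: comp_def)
  show "continuous_map ?P (realization L) (\<lambda>(s, t). hpt (s, n, x, t))"
  proof (rule pasting_lemma_closed[where I = "{..n}" and T = ?T and f = "\<lambda>j (s, t). pv j (n, x, t) s"])
    fix j assume "j \<in> {..n}"
    then have j: "j \<le> n" by simp
    have "?T j = {p \<in> topspace ?P. psum (snd p) j \<le> 1 - fst p} \<inter> {p \<in> topspace ?P. 1 - fst p \<le> psum (snd p) (Suc j)}"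
      by auto
    moreover have "closedin ?P {p \<in> topspace ?P. psum (snd p) j \<le> 1 - fst p}"
      using closedin_continuous_map_preimage[OF continuous_map_diff[OF cs ps[of j]], of "{0..}"]
      by simp
    moreover have "closedin ?P {p \<in> topspace ?P. 1 - fst p \<le> psum (snd p) (Suc j)}"
      using closedin_continuous_map_preimage[OF continuous_map_diff[OF ps[of "Suc j"] cs], of "{0..}"]
      by (simp del: psum_Suc)
    ultimately show "closedin ?P (?T j)" by (metis (no_types, lifting) closedin_Int)
    let ?y = "H (Suc n) (act K (Suc n) n (dgn n j) x, cut (Suc n) (Suc j))"
    have y: "?y \<in> spx L (Suc n)" using x j by (intro H_in act_K dgn_dhom cut_dhom)
    have "continuous_map ?P euclideanreal (\<lambda>p. prism_pt j (snd p) (fst p) i)" for i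
      unfolding prism_pt_def using ps cs ct
      by (cases "i < j"; cases "i = j"; cases "i = Suc j") (simp_all add: continuous_map_diff del: psum_Suc)
    then have "continuous_map ?P (powertop_real UNIV) (\<lambda>p. prism_pt j (snd p) (fst p))"
      by (simp add: continuous_map_componentwise_UNIV)
    then have "continuous_map (subtopology ?P (?T j)) (simplex_top (Suc n)) (\<lambda>p. prism_pt j (snd p) (fst p))"
      by (intro continuous_map_into_subtopology continuous_map_from_subtopology)
        (use j in \<open>auto intro!: prism_pt_simplex simp: region_def topspace_standard_simplex simp del: psum_Suc\<close>)
    from continuous_map_compose[OF continuous_map_compose[OF this continuous_map_rsum_piece[OF y]]
        quotient_imp_continuous_map[OF quotient_map_rclass]]
    show "continuous_map (subtopology ?P (?T j)) (realization L) (\<lambda>(s, t). pv j (n, x, t) s)"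
      by (simp add: comp_def pv_def case_prod_unfold)
  next
    fix i j p assume ij: "i \<in> {..n}" "j \<in> {..n}" "p \<in> topspace ?P \<inter> ?T i \<inter> ?T j"
    obtain s t where p: "p = (s, t)" by (cases p)
    then have "(s, t) \<in> ?T i" "(s, t) \<in> ?T j" using ij(3) by blast+
    then have "t \<in> standard_simplex n" "(t, s) \<in> region i" "(t, s) \<in> region j"
      unfolding T by blast+
    then show "(\<lambda>(s, t). pv i (n, x, t) s) p = (\<lambda>(s, t). pv j (n, x, t) s) p"
      using ij(1,2) p pv_eq[OF x, of t i j s] by simp
  next
    fix p assume "p \<in> topspace ?P"
    then obtain s t where p: "p = (s, t)" "s \<in> {0..1}" "t \<in> standard_simplex n"
      by (auto simp: topspace_standard_simplex)
    obtain j where j: "j \<le> n" "(t, s) \<in> region j"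
      using region_exists[OF p(3), of s] p(2) by auto
    have "p \<in> ?T j" unfolding p(1) T using p j by blast
    moreover have "hpt (s, n, x, t) = pv j (n, x, t) s" by (rule hpt_eq[OF x p(3) j])
    ultimately show "\<exists>j. j \<in> {..n} \<and> p \<in> ?T j \<and> (\<lambda>(s, t). hpt (s, n, x, t)) p = (\<lambda>(s, t). pv j (n, x, t) s) p"
      using j(1) p(1) by (intro exI[of _ j]) simp
  qed simp
qed

lemma hpt_glue:
  assumes s: "s \<in> {0..1}" and "rglue K p q"
  shows "hpt (s, p) = hpt (s, q)"
proof -
  obtain m n x t \<theta> where *: "\<theta> \<in> dhom m n" "x \<in> spx K n" "t \<in> standard_simplex m"
    "p = (n, x, pushpt m \<theta> t)" "q = (m, act K m n \<theta> x, t)"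
    using assms(2) unfolding rglue_def by blast
  obtain j where j: "j \<le> m" "(t, s) \<in> region j"
    using region_exists[OF *(3), of s] s by auto
  have "hpt (s, p) = pv (\<theta> j) p s"
    unfolding *(4) by (rule hpt_eq) (use * j in \<open>auto intro: pushpt_simplex region_pushpt dhomD\<close>)
  also have "\<dots> = pv j q s" using * j by (simp add: pv_glue)
  also have "\<dots> = hpt (s, q)" using * j by (simp add: hpt_eq act_K)
  finally show ?thesis .
qed

text \<open>The map \<open>hpt\<close> respects the gluing relation in the second variable.  It descends to a continuous map on
  \<open>[0,1] \<times> |K|\<close> because \<open>[0,1]\<close> is locally compact Hausdorff, so that the product of
  its identity with the quotient map is again a quotient map.\<close>

theorem homotopic_realization:
  assumes u: "u \<in> smaps K L" and v: "v \<in> smaps K L"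
  shows "homotopic_with (\<lambda>_. True) (realization K) (realization L) (realization_map L u) (realization_map L v)"
proof -
  let ?J = "top_of_set {0..1::real}"
  have "locally_compact_space ?J"
    by (metis compact_space_subtopology compact_Icc compact_imp_locally_compact_space compactin_euclidean_iff)
  moreover have "Hausdorff_space ?J" by (simp add: Hausdorff_space_subtopology)
  ultimately have qm: "quotient_map (prod_topology ?J (rsum K)) (prod_topology ?J (realization K)) (\<lambda>(x, y). (x, rclass K y))"
    by (intro quotient_map_prod_right quotient_map_rclass) auto
  obtain h where h: "continuous_map (prod_topology ?J (realization K)) (realization L) h"
    "\<And>p. p \<in> topspace (prod_topology ?J (rsum K)) \<Longrightarrow> h ((\<lambda>(x, y). (x, rclass K y)) p) = hpt p"
  proof (rule quotient_map_lift_exists[OF qm continuous_map_hpt])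
    fix p q assume p: "p \<in> topspace (prod_topology ?J (rsum K))" "q \<in> topspace (prod_topology ?J (rsum K))"
      and eq: "(\<lambda>(x, y). (x, rclass K y)) p = (\<lambda>(x, y). (x, rclass K y)) q"
    obtain s a b where *: "p = (s, a)" "q = (s, b)" "rclass K a = rclass K b"
      using eq by (cases p; cases q) auto
    have "s \<in> {0..1}" using p *(1) by simp
    then show "hpt p = hpt q"
      unfolding * by (intro rclass_lift[OF _ *(3), of "\<lambda>a. hpt (s, a)"] hpt_glue)
  qed blast
  have ends: "h (0, c) = realization_map L u c" "h (1, c) = realization_map L v c"
    if "c \<in> topspace (realization K)" for c
  proof -
    obtain n x t where c: "c = rclass K (n, x, t)" "x \<in> spx K n" "t \<in> standard_simplex n"
      using \<open>c \<in> topspace (realization K)\<close> unfolding topspace_realization topspace_rsum by blast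
    have t: "psum t (Suc n) = 1" "0 \<le> t n" "0 \<le> t 0" using c(3) by (simp_all add: standard_simplex_psum)
    have "h (0, c) = hpt (0, n, x, t)" using h(2)[of "(0, n, x, t)"] c by (simp add: topspace_rsum)
    also have "\<dots> = pv n (n, x, t) 0" using c t by (intro hpt_eq) (auto simp: region_def)
    also have "\<dots> = rclass L (n, H n (x, compose {..n} (cut (Suc n) (Suc n)) (face n (Suc n))), t)"
      using c t by (intro pv_face) auto
    also have "compose {..n} (cut (Suc n) (Suc n)) (face n (Suc n)) = (\<lambda>_\<in>{..n}. 0)"
      by (auto simp: fun_eq_iff compose_def cut_def face_def)
    finally show "h (0, c) = realization_map L u c"
      unfolding H0[OF c(2)] unfolding c(1) realization_map_rclass[OF u] .
    have "h (1, c) = hpt (1, n, x, t)" using h(2)[of "(1, n, x, t)"] c by (simp add: topspace_rsum)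
    also have "\<dots> = pv 0 (n, x, t) 1" using c t by (intro hpt_eq) (auto simp: region_def)
    also have "\<dots> = rclass L (n, H n (x, compose {..n} (cut (Suc n) (Suc 0)) (face n 0)), t)"
      using c t by (intro pv_face) auto
    also have "compose {..n} (cut (Suc n) (Suc 0)) (face n 0) = (\<lambda>_\<in>{..n}. 1)"
      by (auto simp: fun_eq_iff compose_def cut_def face_def)
    finally show "h (1, c) = realization_map L v c"
      unfolding H1[OF c(2)] unfolding c(1) realization_map_rclass[OF v] .
  qed
  show ?thesis
    by (subst homotopic_with) (use h(1) ends in auto)
qed

end

lemma is_ssetD:
  "is_sset X \<Longrightarrow> \<theta> \<in> dhom m n \<Longrightarrow> x \<in> spx X n \<Longrightarrow> act X m n \<theta> x \<in> spx X m"
  "is_sset X \<Longrightarrow> x \<in> spx X n \<Longrightarrow> act X n n (\<lambda>i\<in>{..n}. i) x = x"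
  "is_sset X \<Longrightarrow> \<phi> \<in> dhom k m \<Longrightarrow> \<theta> \<in> dhom m n \<Longrightarrow> x \<in> spx X n \<Longrightarrow>
     act X k n (compose {..k} \<theta> \<phi>) x = act X k m \<phi> (act X m n \<theta> x)"
  unfolding is_sset_def by blast+

lemma smap_comp_in:
  assumes "is_sset X" "f \<in> smaps X Y" "g \<in> smaps Y Z"
  shows "smap_comp X g f \<in> smaps X Z"
  by (rule smapsI)
    (use smapsD[OF assms(2)] smapsD[OF assms(3)] is_ssetD(1)[OF assms(1)]
      in \<open>auto simp: smap_comp_def compose_def\<close>)

lemma sid_in: "is_sset X \<Longrightarrow> sid X \<in> smaps X X"
  by (rule smapsI) (auto simp: sid_def is_ssetD(1))

lemma realization_map_comp:
  assumes "is_sset X" "f \<in> smaps X Y" "g \<in> smaps Y Z" "c \<in> topspace (realization X)"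
  shows "realization_map Z g (realization_map Y f c) = realization_map Z (smap_comp X g f) c"
proof -
  obtain n x t where c: "c = rclass X (n, x, t)" "x \<in> spx X n"
    using assms(4) unfolding topspace_realization topspace_rsum by blast
  then show ?thesis
    by (simp add: realization_map_rclass[OF assms(2)] realization_map_rclass[OF assms(3)]
        realization_map_rclass[OF smap_comp_in[OF assms(1-3)]]) (simp add: smap_comp_def compose_def)
qed

lemma realization_map_id:
  assumes "is_sset X" "c \<in> topspace (realization X)"
  shows "realization_map X (sid X) c = c"
proof -
  obtain n x t where c: "c = rclass X (n, x, t)" "x \<in> spx X n"
    using assms(2) unfolding topspace_realization topspace_rsum by blast
  then show ?thesis
    by (simp add: realization_map_rclass[OF sid_in[OF assms(1)]]) (simp add: sid_def)
qed

theorem weak_equivalence_of_homotopy_inverse: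
  assumes K: "is_sset K" and L: "is_sset L" and f: "f \<in> smaps K L" and g: "g \<in> smaps L K"
    and 1: "homotopic_with (\<lambda>_. True) (realization K) (realization K)
      (realization_map K (smap_comp K g f)) (realization_map K (sid K))"
    and 2: "homotopic_with (\<lambda>_. True) (realization L) (realization L)
      (realization_map L (smap_comp L f g)) (realization_map L (sid L))"
  shows "weak_equivalence K L f"
proof -
  have "homotopic_with (\<lambda>_. True) (realization K) (realization K)
      (realization_map K g \<circ> realization_map L f) id"
    by (rule homotopic_with_eq[OF 1]) (simp_all add: realization_map_comp[OF K f g] realization_map_id[OF K])
  moreover have "homotopic_with (\<lambda>_. True) (realization L) (realization L)
      (realization_map L f \<circ> realization_map K g) id"
    by (rule homotopic_with_eq[OF 2])
      (simp_all add: realization_map_comp[OF L g f] realization_map_id[OF L])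
  ultimately show ?thesis
    unfolding weak_equivalence_def homotopy_equivalence_map_def
    using f continuous_map_realization_map[OF f] continuous_map_realization_map[OF g] by blast
qed

section \<open>Bisimplicial homotopies and mapping spaces\<close>

lemma is_bssetD:
  "is_bsset X \<Longrightarrow> is_sset (lev X n)"
  "is_bsset X \<Longrightarrow> \<theta> \<in> dhom m n \<Longrightarrow> hact X m n \<theta> \<in> smaps (lev X n) (lev X m)"
  unfolding is_bsset_def by blast+

lemma bmapsD:
  "f \<in> bmaps X Y \<Longrightarrow> x \<in> spx (lev X n) k \<Longrightarrow> f n k x \<in> spx (lev Y n) k"
  "f \<in> bmaps X Y \<Longrightarrow> x \<notin> spx (lev X n) k \<Longrightarrow> f n k x = undefined"
  "f \<in> bmaps X Y \<Longrightarrow> \<theta> \<in> dhom j k \<Longrightarrow> x \<in> spx (lev X n) k \<Longrightarrow>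
     f n j (act (lev X n) j k \<theta> x) = act (lev Y n) j k \<theta> (f n k x)"
  "f \<in> bmaps X Y \<Longrightarrow> \<theta> \<in> dhom m n \<Longrightarrow> x \<in> spx (lev X n) k \<Longrightarrow>
     f m k (hact X m n \<theta> k x) = hact Y m n \<theta> k (f n k x)"
proof -
  assume f: "f \<in> bmaps X Y"
  then have sm: "f n \<in> smaps (lev X n) (lev Y n)" by (simp add: bmaps_def)
  show "x \<in> spx (lev X n) k \<Longrightarrow> f n k x \<in> spx (lev Y n) k" by (rule smapsD(1)[OF sm])
  show "x \<notin> spx (lev X n) k \<Longrightarrow> f n k x = undefined" by (rule smapsD(3)[OF sm])
  show "\<theta> \<in> dhom j k \<Longrightarrow> x \<in> spx (lev X n) k \<Longrightarrow>
     f n j (act (lev X n) j k \<theta> x) = act (lev Y n) j k \<theta> (f n k x)" by (rule smapsD(2)[OF sm])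
  show "\<theta> \<in> dhom m n \<Longrightarrow> x \<in> spx (lev X n) k \<Longrightarrow>
     f m k (hact X m n \<theta> k x) = hact Y m n \<theta> k (f n k x)"
    using f by (simp add: bmaps_def)
qed

lemma bmapsI:
  assumes "\<And>n k x. x \<in> spx (lev X n) k \<Longrightarrow> f n k x \<in> spx (lev Y n) k"
    "\<And>n k x. x \<notin> spx (lev X n) k \<Longrightarrow> f n k x = undefined"
    "\<And>n j k \<theta> x. \<theta> \<in> dhom j k \<Longrightarrow> x \<in> spx (lev X n) k \<Longrightarrow>
       f n j (act (lev X n) j k \<theta> x) = act (lev Y n) j k \<theta> (f n k x)"
    "\<And>m n \<theta> k x. \<theta> \<in> dhom m n \<Longrightarrow> x \<in> spx (lev X n) k \<Longrightarrow>
       f m k (hact X m n \<theta> k x) = hact Y m n \<theta> k (f n k x)"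
  shows "f \<in> bmaps X Y"
  unfolding bmaps_def using assms by (auto intro!: smapsI)

lemma cylinder_simps:
  "spx (lev (btimes X (Delta k)) n) j = spx (lev X n) j \<times> dhom j k"
  "act (lev (btimes X (Delta k)) n) i j \<theta> (x, \<sigma>) = (act (lev X n) i j \<theta> x, compose {..i} \<sigma> \<theta>)"
  "x \<in> spx (lev X n) j \<Longrightarrow> \<sigma> \<in> dhom j k \<Longrightarrow> hact (btimes X (Delta k)) m n \<theta> j (x, \<sigma>) = (hact X m n \<theta> j x, \<sigma>)"
  by (simp_all add: btimes_def sprod_def Delta_def)

lemma cylinder_mapsD:
  assumes h: "h \<in> bmaps (btimes X (Delta k)) W"
  shows "x \<in> spx (lev X n) j \<Longrightarrow> \<sigma> \<in> dhom j k \<Longrightarrow> h n j (x, \<sigma>) \<in> spx (lev W n) j"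
    "\<not> (x \<in> spx (lev X n) j \<and> \<sigma> \<in> dhom j k) \<Longrightarrow> h n j (x, \<sigma>) = undefined"
    "\<theta> \<in> dhom i j \<Longrightarrow> x \<in> spx (lev X n) j \<Longrightarrow> \<sigma> \<in> dhom j k \<Longrightarrow>
       h n i (act (lev X n) i j \<theta> x, compose {..i} \<sigma> \<theta>) = act (lev W n) i j \<theta> (h n j (x, \<sigma>))"
    "\<theta> \<in> dhom m n \<Longrightarrow> x \<in> spx (lev X n) j \<Longrightarrow> \<sigma> \<in> dhom j k \<Longrightarrow>
       h m j (hact X m n \<theta> j x, \<sigma>) = hact W m n \<theta> j (h n j (x, \<sigma>))"
proof -
  show "x \<in> spx (lev X n) j \<Longrightarrow> \<sigma> \<in> dhom j k \<Longrightarrow> h n j (x, \<sigma>) \<in> spx (lev W n) j"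
    by (rule bmapsD(1)[OF h]) (simp add: cylinder_simps)
  show "\<not> (x \<in> spx (lev X n) j \<and> \<sigma> \<in> dhom j k) \<Longrightarrow> h n j (x, \<sigma>) = undefined"
    by (rule bmapsD(2)[OF h]) (simp add: cylinder_simps)
  show "\<theta> \<in> dhom i j \<Longrightarrow> x \<in> spx (lev X n) j \<Longrightarrow> \<sigma> \<in> dhom j k \<Longrightarrow>
       h n i (act (lev X n) i j \<theta> x, compose {..i} \<sigma> \<theta>) = act (lev W n) i j \<theta> (h n j (x, \<sigma>))"
    using bmapsD(3)[OF h, of \<theta> i j "(x, \<sigma>)" n] by (simp add: cylinder_simps)
  show "\<theta> \<in> dhom m n \<Longrightarrow> x \<in> spx (lev X n) j \<Longrightarrow> \<sigma> \<in> dhom j k \<Longrightarrow>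
       h m j (hact X m n \<theta> j x, \<sigma>) = hact W m n \<theta> j (h n j (x, \<sigma>))"
    using bmapsD(4)[OF h, of \<theta> m n "(x, \<sigma>)" j] by (simp add: cylinder_simps)
qed

lemma cylinder_mapsI:
  assumes 1: "\<And>n j x \<sigma>. x \<in> spx (lev X n) j \<Longrightarrow> \<sigma> \<in> dhom j k \<Longrightarrow> h n j (x, \<sigma>) \<in> spx (lev W n) j"
    and 2: "\<And>n j x \<sigma>. \<not> (x \<in> spx (lev X n) j \<and> \<sigma> \<in> dhom j k) \<Longrightarrow> h n j (x, \<sigma>) = undefined"
    and 3: "\<And>n i j \<theta> x \<sigma>. \<theta> \<in> dhom i j \<Longrightarrow> x \<in> spx (lev X n) j \<Longrightarrow> \<sigma> \<in> dhom j k \<Longrightarrow>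
       h n i (act (lev X n) i j \<theta> x, compose {..i} \<sigma> \<theta>) = act (lev W n) i j \<theta> (h n j (x, \<sigma>))"
    and 4: "\<And>m n \<theta> j x \<sigma>. \<theta> \<in> dhom m n \<Longrightarrow> x \<in> spx (lev X n) j \<Longrightarrow> \<sigma> \<in> dhom j k \<Longrightarrow>
       h m j (hact X m n \<theta> j x, \<sigma>) = hact W m n \<theta> j (h n j (x, \<sigma>))"
  shows "h \<in> bmaps (btimes X (Delta k)) W"
proof (rule bmapsI)
  fix n j p assume "p \<in> spx (lev (btimes X (Delta k)) n) j"
  then show "h n j p \<in> spx (lev W n) j" using 1 by (auto simp: cylinder_simps)
next
  fix n j p assume "p \<notin> spx (lev (btimes X (Delta k)) n) j"
  then show "h n j p = undefined" using 2[of "fst p" n j "snd p"] by (cases p) (auto simp: cylinder_simps)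
next
  fix n i j \<theta> p assume "\<theta> \<in> dhom i j" "p \<in> spx (lev (btimes X (Delta k)) n) j"
  then show "h n i (act (lev (btimes X (Delta k)) n) i j \<theta> p) = act (lev W n) i j \<theta> (h n j p)"
    using 3[of \<theta> i j "fst p" n "snd p"] by (cases p) (simp add: cylinder_simps)
next
  fix m n \<theta> j p assume "\<theta> \<in> dhom m n" "p \<in> spx (lev (btimes X (Delta k)) n) j"
  then show "h m j (hact (btimes X (Delta k)) m n \<theta> j p) = hact W m n \<theta> j (h n j p)"
    using 4[of \<theta> m n "fst p" j "snd p"] by (cases p) (simp add: cylinder_simps)
qed

lemma bmap_space_simps:
  "spx (bmap_space X W) k = bmaps (btimes X (Delta k)) W"
  "x \<in> spx (lev X n) j \<Longrightarrow> \<sigma> \<in> dhom j k \<Longrightarrow>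
     act (bmap_space X W) k q \<alpha> h n j (x, \<sigma>) = h n j (x, compose {..j} \<alpha> \<sigma>)"
  "\<not> (x \<in> spx (lev X n) j \<and> \<sigma> \<in> dhom j k) \<Longrightarrow> act (bmap_space X W) k q \<alpha> h n j (x, \<sigma>) = undefined"
  by (auto simp: bmap_space_def)

lemma bmap_precomp_simps:
  "h \<in> bmaps (btimes Y (Delta k)) W \<Longrightarrow> x \<in> spx (lev X n) j \<Longrightarrow> \<sigma> \<in> dhom j k \<Longrightarrow>
     bmap_precomp X Y W f k h n j (x, \<sigma>) = h n j (f n j x, \<sigma>)"
  "h \<in> bmaps (btimes Y (Delta k)) W \<Longrightarrow> \<not> (x \<in> spx (lev X n) j \<and> \<sigma> \<in> dhom j k) \<Longrightarrow>
     bmap_precomp X Y W f k h n j (x, \<sigma>) = undefined"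
  "h \<notin> bmaps (btimes Y (Delta k)) W \<Longrightarrow> bmap_precomp X Y W f k h = undefined"
  by (auto simp: bmap_precomp_def bmap_space_simps)

lemma compose_dhom_assoc:
  "\<sigma> \<in> dhom j k \<Longrightarrow> compose {..j} (compose {..k} \<alpha> \<beta>) \<sigma> = compose {..j} \<alpha> (compose {..j} \<beta> \<sigma>)"
  by (auto simp: fun_eq_iff compose_def dhomD)

lemma compose_dhom_id: "\<sigma> \<in> dhom j k \<Longrightarrow> compose {..j} (\<lambda>i\<in>{..k}. i) \<sigma> = \<sigma>"
  by (auto simp: fun_eq_iff compose_def dhomD)

lemma bmap_space_act_in:
  assumes X: "is_bsset X" and h: "h \<in> bmaps (btimes X (Delta q)) W" and \<alpha>: "\<alpha> \<in> dhom k q"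
  shows "act (bmap_space X W) k q \<alpha> h \<in> bmaps (btimes X (Delta k)) W"
proof (rule cylinder_mapsI)
  fix n j x \<sigma> assume x: "x \<in> spx (lev X n) j" and \<sigma>: "\<sigma> \<in> dhom j k"
  then show "act (bmap_space X W) k q \<alpha> h n j (x, \<sigma>) \<in> spx (lev W n) j"
    using \<alpha> by (simp add: bmap_space_simps dhom_compose cylinder_mapsD(1)[OF h])
  {
    fix i \<theta> assume \<theta>: "\<theta> \<in> dhom i j"
    have "act (lev X n) i j \<theta> x \<in> spx (lev X n) i" using is_ssetD(1)[OF is_bssetD(1)[OF X] \<theta> x] .
    then show "act (bmap_space X W) k q \<alpha> h n i (act (lev X n) i j \<theta> x, compose {..i} \<sigma> \<theta>) =
        act (lev W n) i j \<theta> (act (bmap_space X W) k q \<alpha> h n j (x, \<sigma>))"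
      using x \<sigma> \<alpha> \<theta> cylinder_mapsD(3)[OF h \<theta> x dhom_compose[OF \<sigma> \<alpha>]]
      by (simp add: bmap_space_simps dhom_compose compose_dhom_assoc[symmetric])
  next
    fix m \<theta> assume \<theta>: "\<theta> \<in> dhom m n"
    have "hact X m n \<theta> j x \<in> spx (lev X m) j" using smapsD(1)[OF is_bssetD(2)[OF X \<theta>] x] .
    then show "act (bmap_space X W) k q \<alpha> h m j (hact X m n \<theta> j x, \<sigma>) =
        hact W m n \<theta> j (act (bmap_space X W) k q \<alpha> h n j (x, \<sigma>))"
      using x \<sigma> \<alpha> \<theta> cylinder_mapsD(4)[OF h \<theta> x dhom_compose[OF \<sigma> \<alpha>]]
      by (simp add: bmap_space_simps)
  }
qed (simp add: bmap_space_simps)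

lemma is_sset_bmap_space:
  assumes X: "is_bsset X"
  shows "is_sset (bmap_space X W)"
  unfolding is_sset_def
proof (intro conjI allI ballI)
  fix m n \<theta> assume "\<theta> \<in> dhom m n"
  then show "act (bmap_space X W) m n \<theta> \<in> spx (bmap_space X W) n \<rightarrow> spx (bmap_space X W) m"
    using bmap_space_act_in[OF X] by (auto simp: bmap_space_simps)
next
  fix n h assume "h \<in> spx (bmap_space X W) n"
  then have h: "h \<in> bmaps (btimes X (Delta n)) W" by (simp add: bmap_space_simps)
  show "act (bmap_space X W) n n (\<lambda>i\<in>{..n}. i) h = h"
  proof (intro ext, safe)
    fix i j x \<sigma>
    show "act (bmap_space X W) n n (\<lambda>i\<in>{..n}. i) h i j (x, \<sigma>) = h i j (x, \<sigma>)"
      by (cases "x \<in> spx (lev X i) j \<and> \<sigma> \<in> dhom j n")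
        (simp_all only: bmap_space_simps compose_dhom_id cylinder_mapsD(2)[OF h] not_False_eq_True)
  qed
next
  fix k m n \<phi> \<theta> h assume \<phi>: "\<phi> \<in> dhom k m" and \<theta>: "\<theta> \<in> dhom m n" and "h \<in> spx (bmap_space X W) n"
  then have h: "h \<in> bmaps (btimes X (Delta n)) W" by (simp add: bmap_space_simps)
  show "act (bmap_space X W) k n (compose {..k} \<theta> \<phi>) h = act (bmap_space X W) k m \<phi> (act (bmap_space X W) m n \<theta> h)"
  proof (intro ext, safe)
    fix i j x \<sigma>
    show "act (bmap_space X W) k n (compose {..k} \<theta> \<phi>) h i j (x, \<sigma>) =
        act (bmap_space X W) k m \<phi> (act (bmap_space X W) m n \<theta> h) i j (x, \<sigma>)"
      using \<phi> by (cases "x \<in> spx (lev X i) j \<and> \<sigma> \<in> dhom j k")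
        (auto simp: bmap_space_simps dhom_compose compose_dhom_assoc[of _ j k \<theta> \<phi>])
  qed
qed

lemma bmap_precomp_in:
  assumes X: "is_bsset X" and Y: "is_bsset Y" and f: "f \<in> bmaps X Y"
  shows "bmap_precomp X Y W f \<in> smaps (bmap_space Y W) (bmap_space X W)"
proof (rule smapsI)
  fix k h assume "h \<in> spx (bmap_space Y W) k"
  then have h: "h \<in> bmaps (btimes Y (Delta k)) W" by (simp add: bmap_space_simps)
  show "bmap_precomp X Y W f k h \<in> spx (bmap_space X W) k"
    unfolding bmap_space_simps
  proof (rule cylinder_mapsI)
    fix n j x \<sigma> assume x: "x \<in> spx (lev X n) j" and \<sigma>: "\<sigma> \<in> dhom j k"
    then show "bmap_precomp X Y W f k h n j (x, \<sigma>) \<in> spx (lev W n) j"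
      by (simp add: bmap_precomp_simps(1,2)[OF h] cylinder_mapsD(1)[OF h] bmapsD(1)[OF f])
    {
      fix i \<theta> assume \<theta>: "\<theta> \<in> dhom i j"
      have "act (lev X n) i j \<theta> x \<in> spx (lev X n) i" using is_ssetD(1)[OF is_bssetD(1)[OF X] \<theta> x] .
      then show "bmap_precomp X Y W f k h n i (act (lev X n) i j \<theta> x, compose {..i} \<sigma> \<theta>) =
          act (lev W n) i j \<theta> (bmap_precomp X Y W f k h n j (x, \<sigma>))"
        using x \<sigma> \<theta> cylinder_mapsD(3)[OF h \<theta> bmapsD(1)[OF f x] \<sigma>]
        by (simp add: bmap_precomp_simps(1,2)[OF h] dhom_compose bmapsD(3)[OF f])
    next
      fix m \<theta> assume \<theta>: "\<theta> \<in> dhom m n"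
      have "hact X m n \<theta> j x \<in> spx (lev X m) j" using smapsD(1)[OF is_bssetD(2)[OF X \<theta>] x] .
      then show "bmap_precomp X Y W f k h m j (hact X m n \<theta> j x, \<sigma>) =
          hact W m n \<theta> j (bmap_precomp X Y W f k h n j (x, \<sigma>))"
        using x \<sigma> \<theta> cylinder_mapsD(4)[OF h \<theta> bmapsD(1)[OF f x] \<sigma>]
        by (simp add: bmap_precomp_simps(1,2)[OF h] bmapsD(4)[OF f])
    }
  qed (simp add: bmap_precomp_simps(1,2)[OF h])
next
  fix q k \<alpha> h assume \<alpha>: "\<alpha> \<in> dhom q k" and "h \<in> spx (bmap_space Y W) k"
  then have h: "h \<in> bmaps (btimes Y (Delta k)) W" by (simp add: bmap_space_simps)
  have ah: "act (bmap_space Y W) q k \<alpha> h \<in> bmaps (btimes Y (Delta q)) W"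
    using \<alpha> h by (simp add: bmap_space_act_in[OF Y])
  show "bmap_precomp X Y W f q (act (bmap_space Y W) q k \<alpha> h) =
      act (bmap_space X W) q k \<alpha> (bmap_precomp X Y W f k h)"
  proof (intro ext, safe)
    fix n j x \<sigma>
    show "bmap_precomp X Y W f q (act (bmap_space Y W) q k \<alpha> h) n j (x, \<sigma>) =
      act (bmap_space X W) q k \<alpha> (bmap_precomp X Y W f k h) n j (x, \<sigma>)"
    proof (cases "x \<in> spx (lev X n) j \<and> \<sigma> \<in> dhom j q")
      case True
      then have "compose {..j} \<alpha> \<sigma> \<in> dhom j k" using \<alpha> dhom_compose by blast
      with True show ?thesis
        by (simp add: bmap_precomp_simps(1,2)[OF h] bmap_precomp_simps(1,2)[OF ah] bmap_space_simps bmapsD(1)[OF f] dhom_compose)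
    next
      case False
      then show ?thesis by (simp only: bmap_precomp_simps(2)[OF ah False] bmap_space_simps(3)[OF False])
    qed
  qed
qed (simp add: bmap_precomp_simps bmap_space_simps)

text \<open>The interval of the homotopy \<open>B\<close> from \<open>u\<close> to \<open>v\<close> is constant in the horizontal direction, as are the
  simplices \<open>Delta k\<close> that define the mapping spaces.\<close>

definition bihomotopy ::
  "'a bsset \<Rightarrow> 'b bsset \<Rightarrow> (nat \<Rightarrow> nat \<Rightarrow> 'a \<times> (nat \<Rightarrow> nat) \<Rightarrow> 'b) \<Rightarrow>
   (nat \<Rightarrow> nat \<Rightarrow> 'a \<Rightarrow> 'b) \<Rightarrow> (nat \<Rightarrow> nat \<Rightarrow> 'a \<Rightarrow> 'b) \<Rightarrow> bool" where
  "bihomotopy X Y B u v \<longleftrightarrow> B \<in> bmaps (btimes X (Delta 1)) Y \<and>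
     (\<forall>n j. \<forall>x\<in>spx (lev X n) j. B n j (x, \<lambda>_\<in>{..j}. 0) = u n j x \<and> B n j (x, \<lambda>_\<in>{..j}. 1) = v n j x)"

text \<open>The homotopy of mapping spaces induced by \<open>B\<close> takes \<open>h\<close> and \<open>\<tau> : \<Delta>[k] \<rightarrow> \<Delta>[1]\<close> to the composite of \<open>h\<close>
  with the map \<open>X \<times> \<Delta>[k] \<rightarrow> Y \<times> \<Delta>[k]\<close> over \<open>\<Delta>[k]\<close> given by \<open>B\<close> and \<open>\<tau>\<close>.\<close>

definition precomp_homotopy ::
  "'a bsset \<Rightarrow> (nat \<Rightarrow> nat \<Rightarrow> 'a \<times> (nat \<Rightarrow> nat) \<Rightarrow> 'b) \<Rightarrow> 'w bsset \<Rightarrow> 'b bsset \<Rightarrow> nat \<Rightarrow>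
    (nat \<Rightarrow> nat \<Rightarrow> 'b \<times> (nat \<Rightarrow> nat) \<Rightarrow> 'w) \<times> (nat \<Rightarrow> nat) \<Rightarrow> (nat \<Rightarrow> nat \<Rightarrow> 'a \<times> (nat \<Rightarrow> nat) \<Rightarrow> 'w)" where
  "precomp_homotopy X B W Y k = (\<lambda>(h, \<tau>)\<in>spx (bmap_space Y W) k \<times> dhom k 1.
     \<lambda>n j. \<lambda>(x, \<sigma>)\<in>spx (lev X n) j \<times> dhom j k. h n j (B n j (x, compose {..j} \<tau> \<sigma>), \<sigma>))"

lemma precomp_homotopy_simps:
  assumes "h \<in> bmaps (btimes Y (Delta k)) W" "\<tau> \<in> dhom k (Suc 0)"
  shows "x \<in> spx (lev X n) j \<Longrightarrow> \<sigma> \<in> dhom j k \<Longrightarrow>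
     precomp_homotopy X B W Y k (h, \<tau>) n j (x, \<sigma>) = h n j (B n j (x, compose {..j} \<tau> \<sigma>), \<sigma>)"
  "\<not> (x \<in> spx (lev X n) j \<and> \<sigma> \<in> dhom j k) \<Longrightarrow> precomp_homotopy X B W Y k (h, \<tau>) n j (x, \<sigma>) = undefined"
  using assms by (auto simp: precomp_homotopy_def bmap_space_simps)

text \<open>The maps \<open>u'\<close> and \<open>v'\<close> are described by their values, so that they may also be identity maps or
  composites of two precompositions.\<close>

lemma simplicial_homotopy_precomp:
  assumes X: "is_bsset X" and Y: "is_bsset Y" and bh: "bihomotopy X Y B u v"
    and u: "\<And>k h n j x \<sigma>. h \<in> bmaps (btimes Y (Delta k)) W \<Longrightarrow> x \<in> spx (lev X n) j \<Longrightarrow> \<sigma> \<in> dhom j k \<Longrightarrow>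
      u' k h n j (x, \<sigma>) = h n j (u n j x, \<sigma>)"
    and u2: "\<And>k h n j x \<sigma>. h \<in> bmaps (btimes Y (Delta k)) W \<Longrightarrow> \<not> (x \<in> spx (lev X n) j \<and> \<sigma> \<in> dhom j k) \<Longrightarrow>
      u' k h n j (x, \<sigma>) = undefined"
    and v: "\<And>k h n j x \<sigma>. h \<in> bmaps (btimes Y (Delta k)) W \<Longrightarrow> x \<in> spx (lev X n) j \<Longrightarrow> \<sigma> \<in> dhom j k \<Longrightarrow>
      v' k h n j (x, \<sigma>) = h n j (v n j x, \<sigma>)"
    and v2: "\<And>k h n j x \<sigma>. h \<in> bmaps (btimes Y (Delta k)) W \<Longrightarrow> \<not> (x \<in> spx (lev X n) j \<and> \<sigma> \<in> dhom j k) \<Longrightarrow>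
      v' k h n j (x, \<sigma>) = undefined"
  shows "simplicial_homotopy (bmap_space Y W) (bmap_space X W) (precomp_homotopy X B W Y) u' v'"
proof
  have B: "B \<in> bmaps (btimes X (Delta (Suc 0))) Y" using bh by (simp add: bihomotopy_def)
  show "is_sset (bmap_space Y W)" by (rule is_sset_bmap_space[OF Y])
  show "precomp_homotopy X B W Y \<in> smaps (sprod (bmap_space Y W) (Delta 1)) (bmap_space X W)"
  proof (rule smapsI)
    fix k p assume "p \<in> spx (sprod (bmap_space Y W) (Delta 1)) k"
    then obtain h \<tau> where p: "p = (h, \<tau>)" and h: "h \<in> bmaps (btimes Y (Delta k)) W" and \<tau>: "\<tau> \<in> dhom k (Suc 0)"
      by (auto simp: sprod_def Delta_def bmap_space_simps)
    note ph = precomp_homotopy_simps[OF h \<tau>, of _ X]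
    show "precomp_homotopy X B W Y k p \<in> spx (bmap_space X W) k"
      unfolding bmap_space_simps p
    proof (rule cylinder_mapsI)
      fix n j x \<sigma> assume x: "x \<in> spx (lev X n) j" and \<sigma>: "\<sigma> \<in> dhom j k"
      have \<tau>\<sigma>: "compose {..j} \<tau> \<sigma> \<in> dhom j (Suc 0)" by (rule dhom_compose[OF \<sigma> \<tau>])
      then have Bx: "B n j (x, compose {..j} \<tau> \<sigma>) \<in> spx (lev Y n) j"
        by (rule cylinder_mapsD(1)[OF B x])
      then show "precomp_homotopy X B W Y k (h, \<tau>) n j (x, \<sigma>) \<in> spx (lev W n) j"
        using x \<sigma> by (simp add: ph cylinder_mapsD(1)[OF h])
      {
        fix i \<theta> assume \<theta>: "\<theta> \<in> dhom i j"
        have "act (lev X n) i j \<theta> x \<in> spx (lev X n) i" using is_ssetD(1)[OF is_bssetD(1)[OF X] \<theta> x] .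
        then show "precomp_homotopy X B W Y k (h, \<tau>) n i (act (lev X n) i j \<theta> x, compose {..i} \<sigma> \<theta>) =
            act (lev W n) i j \<theta> (precomp_homotopy X B W Y k (h, \<tau>) n j (x, \<sigma>))"
          using x \<sigma> \<theta> cylinder_mapsD(3)[OF h \<theta> Bx \<sigma>] cylinder_mapsD(3)[OF B \<theta> x \<tau>\<sigma>]
          by (simp add: ph dhom_compose compose_dhom_assoc[OF \<theta>, symmetric])
      next
        fix m \<theta> assume \<theta>: "\<theta> \<in> dhom m n"
        have "hact X m n \<theta> j x \<in> spx (lev X m) j" using smapsD(1)[OF is_bssetD(2)[OF X \<theta>] x] .
        then show "precomp_homotopy X B W Y k (h, \<tau>) m j (hact X m n \<theta> j x, \<sigma>) =
            hact W m n \<theta> j (precomp_homotopy X B W Y k (h, \<tau>) n j (x, \<sigma>))"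
          using x \<sigma> \<theta> cylinder_mapsD(4)[OF h \<theta> Bx \<sigma>] cylinder_mapsD(4)[OF B \<theta> x \<tau>\<sigma>]
          by (simp add: ph)
      }
    qed (simp add: ph)
  next
    fix k p assume "p \<notin> spx (sprod (bmap_space Y W) (Delta 1)) k"
    then show "precomp_homotopy X B W Y k p = undefined"
      by (auto simp: precomp_homotopy_def sprod_def Delta_def)
  next
    fix q k \<alpha> p assume \<alpha>: "\<alpha> \<in> dhom q k" and "p \<in> spx (sprod (bmap_space Y W) (Delta 1)) k"
    then obtain h \<tau> where p: "p = (h, \<tau>)" and h: "h \<in> bmaps (btimes Y (Delta k)) W" and \<tau>: "\<tau> \<in> dhom k (Suc 0)"
      by (auto simp: sprod_def Delta_def bmap_space_simps)
    have p': "act (sprod (bmap_space Y W) (Delta 1)) q k \<alpha> p = (act (bmap_space Y W) q k \<alpha> h, compose {..q} \<tau> \<alpha>)"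
      unfolding p by (simp add: sprod_def Delta_def)
    note ph = precomp_homotopy_simps[OF h \<tau>, of _ X]
    note ph' = precomp_homotopy_simps[OF bmap_space_act_in[OF Y h \<alpha>] dhom_compose[OF \<alpha> \<tau>], of _ X]
    show "precomp_homotopy X B W Y q (act (sprod (bmap_space Y W) (Delta 1)) q k \<alpha> p) =
        act (bmap_space X W) q k \<alpha> (precomp_homotopy X B W Y k p)"
      unfolding p' unfolding p
    proof (intro ext, safe)
      fix n j x \<sigma>
      show "precomp_homotopy X B W Y q (act (bmap_space Y W) q k \<alpha> h, compose {..q} \<tau> \<alpha>) n j (x, \<sigma>) =
        act (bmap_space X W) q k \<alpha> (precomp_homotopy X B W Y k (h, \<tau>)) n j (x, \<sigma>)"
      proof (cases "x \<in> spx (lev X n) j \<and> \<sigma> \<in> dhom j q")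
        case True
        then have "compose {..j} (compose {..q} \<tau> \<alpha>) \<sigma> = compose {..j} \<tau> (compose {..j} \<alpha> \<sigma>)"
          and d: "compose {..j} \<alpha> \<sigma> \<in> dhom j k"
          using compose_dhom_assoc dhom_compose \<alpha> by blast+
        moreover have "B n j (x, compose {..j} \<tau> (compose {..j} \<alpha> \<sigma>)) \<in> spx (lev Y n) j"
          using True dhom_compose[OF d \<tau>] by (simp add: cylinder_mapsD(1)[OF B])
        ultimately show ?thesis using True by (simp add: ph ph' bmap_space_simps)
      next
        case False
        then show ?thesis by (simp only: ph'(2)[OF False] bmap_space_simps(3)[OF False])
      qed
    qed
  qed
next
  fix k h assume "h \<in> spx (bmap_space Y W) k"
  then have h: "h \<in> bmaps (btimes Y (Delta k)) W" by (simp add: bmap_space_simps)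
  have c: "(\<lambda>_\<in>{..k}. 0) \<in> dhom k (Suc 0)" "(\<lambda>_\<in>{..k}. 1) \<in> dhom k (Suc 0)"
    by (rule dhomI; simp)+
  have cc: "compose {..j} (\<lambda>_\<in>{..k}. a) \<sigma> = (\<lambda>_\<in>{..j}. a)" if "\<sigma> \<in> dhom j k" for \<sigma> j and a :: nat
    using that by (auto simp: compose_def fun_eq_iff dhomD)
  have ends: "B n j (x, \<lambda>_\<in>{..j}. 0) = u n j x" "B n j (x, \<lambda>_\<in>{..j}. 1) = v n j x" if "x \<in> spx (lev X n) j" for n j x
    using bh that unfolding bihomotopy_def by blast+
  show "precomp_homotopy X B W Y k (h, \<lambda>_\<in>{..k}. 0) = u' k h"
  proof (intro ext, safe)
    fix n j x \<sigma>
    show "precomp_homotopy X B W Y k (h, \<lambda>_\<in>{..k}. 0) n j (x, \<sigma>) = u' k h n j (x, \<sigma>)"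
      by (cases "x \<in> spx (lev X n) j \<and> \<sigma> \<in> dhom j k")
        (simp_all only: u[OF h] u2[OF h] precomp_homotopy_simps[OF h c(1)] cc ends not_False_eq_True)
  qed
  show "precomp_homotopy X B W Y k (h, \<lambda>_\<in>{..k}. 1) = v' k h"
  proof (intro ext, safe)
    fix n j x \<sigma>
    show "precomp_homotopy X B W Y k (h, \<lambda>_\<in>{..k}. 1) n j (x, \<sigma>) = v' k h n j (x, \<sigma>)"
      by (cases "x \<in> spx (lev X n) j \<and> \<sigma> \<in> dhom j k")
        (simp_all only: v[OF h] v2[OF h] precomp_homotopy_simps[OF h c(2)] cc ends not_False_eq_True)
  qed
qed

text \<open>Precomposition with \<open>f\<close> and \<open>g\<close> gives mutually inverse homotopy equivalences of mapping spaces into an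
  arbitrary bisimplicial set.\<close>

theorem css_weak_equivalence_of_bihomotopy_inverse:
  fixes X :: "'a bsset" and Y :: "'b bsset"
  assumes X: "is_bsset X" and Y: "is_bsset Y" and f: "f \<in> bmaps X Y" and g: "g \<in> bmaps Y X"
    and B: "bihomotopy X X B (\<lambda>n j x. x) (\<lambda>n j x. g n j (f n j x))"
    and B': "bihomotopy Y Y B' (\<lambda>n j x. f n j (g n j x)) (\<lambda>n j x. x)"
  shows "css_weak_equivalence TYPE('w) X Y f" "css_weak_equivalence TYPE('w) Y X g"
proof -
  {
    fix W :: "'w bsset"
    let ?f = "bmap_precomp X Y W f" and ?g = "bmap_precomp Y X W g"
    have f': "?f \<in> smaps (bmap_space Y W) (bmap_space X W)" by (rule bmap_precomp_in[OF X Y f])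
    have g': "?g \<in> smaps (bmap_space X W) (bmap_space Y W)" by (rule bmap_precomp_in[OF Y X g])
    have gin: "?g k h \<in> bmaps (btimes Y (Delta k)) W" if "h \<in> bmaps (btimes X (Delta k)) W" for k h
      using smapsD(1)[OF g', of h k] that by (simp add: bmap_space_simps)
    have fin: "?f k h \<in> bmaps (btimes X (Delta k)) W" if "h \<in> bmaps (btimes Y (Delta k)) W" for k h
      using smapsD(1)[OF f', of h k] that by (simp add: bmap_space_simps)
    have H: "simplicial_homotopy (bmap_space X W) (bmap_space X W) (precomp_homotopy X B W X)
        (sid (bmap_space X W)) (smap_comp (bmap_space X W) ?f ?g)"
      by (rule simplicial_homotopy_precomp[OF X X B])
        (simp_all add: sid_def smap_comp_def compose_def bmap_space_simps bmap_precomp_simps gin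
          cylinder_mapsD(2) bmapsD(1)[OF f])
    have H': "simplicial_homotopy (bmap_space Y W) (bmap_space Y W) (precomp_homotopy Y B' W Y)
        (smap_comp (bmap_space Y W) ?g ?f) (sid (bmap_space Y W))"
      by (rule simplicial_homotopy_precomp[OF Y Y B'])
        (simp_all add: sid_def smap_comp_def compose_def bmap_space_simps bmap_precomp_simps fin
          cylinder_mapsD(2) bmapsD(1)[OF g])
    note K = is_sset_bmap_space[OF X, of W] and L = is_sset_bmap_space[OF Y, of W]
    note h = homotopic_with_symD[OF simplicial_homotopy.homotopic_realization[OF H sid_in[OF K] smap_comp_in[OF K g' f']]]
    note h' = simplicial_homotopy.homotopic_realization[OF H' smap_comp_in[OF L f' g'] sid_in[OF L]]
    have "weak_equivalence (bmap_space Y W) (bmap_space X W) ?f" "weak_equivalence (bmap_space X W) (bmap_space Y W) ?g"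
      using weak_equivalence_of_homotopy_inverse[OF L K f' g' h' h]
        weak_equivalence_of_homotopy_inverse[OF K L g' f' h h'] by blast+
  }
  then show "css_weak_equivalence TYPE('w) X Y f" "css_weak_equivalence TYPE('w) Y X g"
    unfolding css_weak_equivalence_def using f g by blast+
qed

section \<open>Categories, functors and diagrams\<close>

lemma HomD: "f \<in> Hom C a b \<Longrightarrow> f \<in> Ar C" "f \<in> Hom C a b \<Longrightarrow> Dom C f = a" "f \<in> Hom C a b \<Longrightarrow> Cod C f = b"
  by (simp_all add: Hom_def)

lemma categoryI:
  assumes "\<And>f. f \<in> Ar C \<Longrightarrow> Dom C f \<in> Ob C \<and> Cod C f \<in> Ob C"
    "\<And>a. a \<in> Ob C \<Longrightarrow> Id C a \<in> Hom C a a"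
    "\<And>f g a b c. f \<in> Hom C a b \<Longrightarrow> g \<in> Hom C b c \<Longrightarrow> Comp C g f \<in> Hom C a c"
    "\<And>f a b. f \<in> Hom C a b \<Longrightarrow> Comp C f (Id C a) = f"
    "\<And>f a b. f \<in> Hom C a b \<Longrightarrow> Comp C (Id C b) f = f"
    "\<And>f g h a b c d. f \<in> Hom C a b \<Longrightarrow> g \<in> Hom C b c \<Longrightarrow> h \<in> Hom C c d \<Longrightarrow>
       Comp C h (Comp C g f) = Comp C (Comp C h g) f"
  shows "category C"
  unfolding category_def using assms by (simp add: Hom_def)

context
  fixes C :: "('o, 'm) cat"
  assumes C: "category C"
begin

lemma cat_Ob: "f \<in> Hom C a b \<Longrightarrow> a \<in> Ob C" "f \<in> Hom C a b \<Longrightarrow> b \<in> Ob C"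
  using C by (auto simp: category_def Hom_def)

lemma cat_id: "a \<in> Ob C \<Longrightarrow> Id C a \<in> Hom C a a"
  using C by (simp add: category_def)

lemma cat_comp: "f \<in> Hom C a b \<Longrightarrow> g \<in> Hom C b c \<Longrightarrow> Comp C g f \<in> Hom C a c"
  using C unfolding category_def Hom_def by blast

lemma cat_idr: "f \<in> Hom C a b \<Longrightarrow> Comp C f (Id C a) = f"
  using C unfolding category_def Hom_def by blast

lemma cat_idl: "f \<in> Hom C a b \<Longrightarrow> Comp C (Id C b) f = f"
  using C unfolding category_def Hom_def by blast

lemma cat_assoc: "f \<in> Hom C a b \<Longrightarrow> g \<in> Hom C b c \<Longrightarrow> h \<in> Hom C c d \<Longrightarrow>
    Comp C h (Comp C g f) = Comp C (Comp C h g) f"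
  using C unfolding category_def Hom_def by blast

lemma cat_Ar: "f \<in> Ar C \<Longrightarrow> f \<in> Hom C (Dom C f) (Cod C f)"
  by (simp add: Hom_def)

end

lemma ftorD:
  assumes "is_ftor C D F"
  shows "a \<in> Ob C \<Longrightarrow> OMap F a \<in> Ob D"
    "f \<in> Hom C a b \<Longrightarrow> AMap F f \<in> Hom D (OMap F a) (OMap F b)"
    "a \<in> Ob C \<Longrightarrow> AMap F (Id C a) = Id D (OMap F a)"
    "f \<in> Hom C a b \<Longrightarrow> g \<in> Hom C b c \<Longrightarrow> AMap F (Comp C g f) = Comp D (AMap F g) (AMap F f)"
    "a \<notin> Ob C \<Longrightarrow> OMap F a = undefined" "f \<notin> Ar C \<Longrightarrow> AMap F f = undefined"
    "f \<in> Ar C \<Longrightarrow> AMap F f \<in> Ar D"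
    "f \<in> Ar C \<Longrightarrow> Dom D (AMap F f) = OMap F (Dom C f)" "f \<in> Ar C \<Longrightarrow> Cod D (AMap F f) = OMap F (Cod C f)"
  using assms unfolding is_ftor_def Hom_def PiE_iff extensional_def by auto

lemma is_ftorI:
  assumes "\<And>a. a \<in> Ob C \<Longrightarrow> OMap F a \<in> Ob D" "\<And>a. a \<notin> Ob C \<Longrightarrow> OMap F a = undefined"
    "\<And>f. f \<notin> Ar C \<Longrightarrow> AMap F f = undefined"
    "\<And>f. f \<in> Ar C \<Longrightarrow> AMap F f \<in> Hom D (OMap F (Dom C f)) (OMap F (Cod C f))"
    "\<And>a. a \<in> Ob C \<Longrightarrow> AMap F (Id C a) = Id D (OMap F a)"
    "\<And>f g a b c. f \<in> Hom C a b \<Longrightarrow> g \<in> Hom C b c \<Longrightarrow> AMap F (Comp C g f) = Comp D (AMap F g) (AMap F f)"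
  shows "is_ftor C D F"
  unfolding is_ftor_def PiE_iff extensional_def using assms by (auto simp: Hom_def)

lemma ftor_eqI:
  fixes F G :: "('o, 'm, 'p, 'n) ftor"
  assumes "is_ftor C D F" "is_ftor C D' G" "\<And>a. a \<in> Ob C \<Longrightarrow> OMap F a = OMap G a"
    "\<And>f. f \<in> Ar C \<Longrightarrow> AMap F f = AMap G f"
  shows "F = G"
proof (rule ftor.equality)
  show "OMap F = OMap G"
    using assms(3) ftorD(5)[OF assms(1)] ftorD(5)[OF assms(2)] by (metis ext)
  show "AMap F = AMap G"
    using assms(4) ftorD(6)[OF assms(1)] ftorD(6)[OF assms(2)] by (metis ext)
qed simp

lemma fid_simps: "a \<in> Ob C \<Longrightarrow> OMap (fid C) a = a" "f \<in> Ar C \<Longrightarrow> AMap (fid C) f = f"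
  by (simp_all add: fid_def)

lemma ftor_comp_simps:
  "a \<in> Ob C \<Longrightarrow> OMap (ftor_comp C G F) a = OMap G (OMap F a)"
  "f \<in> Ar C \<Longrightarrow> AMap (ftor_comp C G F) f = AMap G (AMap F f)"
  "a \<notin> Ob C \<Longrightarrow> OMap (ftor_comp C G F) a = undefined"
  "f \<notin> Ar C \<Longrightarrow> AMap (ftor_comp C G F) f = undefined"
  by (simp_all add: ftor_comp_def)

lemma is_ftor_fid:
  assumes C: "category C"
  shows "is_ftor C C (fid C)"
proof (rule is_ftorI)
  fix f assume f: "f \<in> Ar C"
  show "AMap (fid C) f \<in> Hom C (OMap (fid C) (Dom C f)) (OMap (fid C) (Cod C f))"
    using cat_Ar[OF C f] cat_Ob[OF C cat_Ar[OF C f]] f by (simp add: fid_simps)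
next
  fix a assume a: "a \<in> Ob C"
  then show "AMap (fid C) (Id C a) = Id C (OMap (fid C) a)"
    using HomD(1)[OF cat_id[OF C a]] by (simp add: fid_simps)
next
  fix f g a b c assume f: "f \<in> Hom C a b" and g: "g \<in> Hom C b c"
  then show "AMap (fid C) (Comp C g f) = Comp C (AMap (fid C) g) (AMap (fid C) f)"
    using HomD(1)[OF f] HomD(1)[OF g] HomD(1)[OF cat_comp[OF C f g]] by (simp add: fid_simps)
qed (simp_all add: fid_def)

lemma is_ftor_comp:
  assumes C: "category C" and F: "is_ftor C D F" and G: "is_ftor D E G"
  shows "is_ftor C E (ftor_comp C G F)"
proof (rule is_ftorI)
  fix f assume f: "f \<in> Ar C"
  then have "Dom C f \<in> Ob C" "Cod C f \<in> Ob C" using C by (auto simp: category_def)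
  with f show "AMap (ftor_comp C G F) f \<in> Hom E (OMap (ftor_comp C G F) (Dom C f)) (OMap (ftor_comp C G F) (Cod C f))"
    using ftorD(2)[OF G ftorD(2)[OF F cat_Ar[OF C f]]] by (simp add: ftor_comp_simps)
next
  fix a assume a: "a \<in> Ob C"
  then show "AMap (ftor_comp C G F) (Id C a) = Id E (OMap (ftor_comp C G F) a)"
    using HomD(1)[OF cat_id[OF C a]] by (simp add: ftor_comp_simps ftorD(3)[OF F a] ftorD(3)[OF G ftorD(1)[OF F a]])
next
  fix f g a b c assume f: "f \<in> Hom C a b" and g: "g \<in> Hom C b c"
  then show "AMap (ftor_comp C G F) (Comp C g f) = Comp E (AMap (ftor_comp C G F) g) (AMap (ftor_comp C G F) f)"
    using HomD(1)[OF f] HomD(1)[OF g] HomD(1)[OF cat_comp[OF C f g]]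
    by (simp add: ftor_comp_simps ftorD(4)[OF F f g] ftorD(4)[OF G ftorD(2)[OF F f] ftorD(2)[OF F g]])
qed (simp_all add: ftor_comp_simps ftorD(1)[OF F] ftorD(1)[OF G])

lemma ftor_comp_assoc:
  assumes C: "category C" and F: "is_ftor C D F"
  shows "ftor_comp C (ftor_comp D H G) F = ftor_comp C H (ftor_comp C G F)"
  unfolding ftor_comp_def using ftorD(1,7)[OF F] by (auto simp: restrict_def)

lemma ftor_comp_fid: "is_ftor C D F \<Longrightarrow> ftor_comp C (fid D) F = F" "category C \<Longrightarrow> is_ftor C D F \<Longrightarrow> ftor_comp C F (fid C) = F"
proof -
  assume F: "is_ftor C D F"
  show "ftor_comp C (fid D) F = F"
    by (rule ftor.equality) (auto simp: ftor_comp_def fid_def fun_eq_iff ftorD[OF F])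
  show "ftor_comp C F (fid C) = F"
    by (rule ftor.equality) (auto simp: ftor_comp_def fid_def fun_eq_iff ftorD[OF F])
qed

lemma nat_transD:
  assumes "nat_trans C D F G \<alpha>"
  shows "a \<in> Ob C \<Longrightarrow> \<alpha> a \<in> Hom D (OMap F a) (OMap G a)"
    "f \<in> Hom C a b \<Longrightarrow> Comp D (AMap G f) (\<alpha> a) = Comp D (\<alpha> b) (AMap F f)"
    "a \<notin> Ob C \<Longrightarrow> \<alpha> a = undefined"
  using assms unfolding nat_trans_def extensional_def Hom_def by auto

lemma nat_transI:
  assumes "\<And>a. a \<in> Ob C \<Longrightarrow> \<alpha> a \<in> Hom D (OMap F a) (OMap G a)"
    "\<And>f a b. f \<in> Hom C a b \<Longrightarrow> Comp D (AMap G f) (\<alpha> a) = Comp D (\<alpha> b) (AMap F f)"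
    "\<And>a. a \<notin> Ob C \<Longrightarrow> \<alpha> a = undefined"
  shows "nat_trans C D F G \<alpha>"
  using assms unfolding nat_trans_def extensional_def Hom_def by auto

lemma nat_trans_id:
  assumes J: "category J" and C: "category C" and X: "is_ftor J C X"
  shows "nat_trans J C X X (\<lambda>j\<in>Ob J. Id C (OMap X j))"
proof (rule nat_transI)
  fix f a b assume f: "f \<in> Hom J a b"
  then show "Comp C (AMap X f) ((\<lambda>j\<in>Ob J. Id C (OMap X j)) a) = Comp C ((\<lambda>j\<in>Ob J. Id C (OMap X j)) b) (AMap X f)"
    using cat_Ob[OF J f] cat_idl[OF C ftorD(2)[OF X f]] cat_idr[OF C ftorD(2)[OF X f]] by simp
qed (simp_all add: cat_id[OF C] ftorD(1)[OF X])

lemma nat_trans_comp: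
  assumes J: "category J" and C: "category C" and X: "is_ftor J C X" and Y: "is_ftor J C Y" and Z: "is_ftor J C Z"
    and a: "nat_trans J C X Y a" and b: "nat_trans J C Y Z b"
  shows "nat_trans J C X Z (\<lambda>j\<in>Ob J. Comp C (b j) (a j))"
proof (rule nat_transI)
  fix j assume "j \<in> Ob J"
  then show "(\<lambda>j\<in>Ob J. Comp C (b j) (a j)) j \<in> Hom C (OMap X j) (OMap Z j)"
    using cat_comp[OF C nat_transD(1)[OF a] nat_transD(1)[OF b]] by simp
next
  fix f i j assume f: "f \<in> Hom J i j"
  note ij = cat_Ob[OF J f]
  have "Comp C (AMap Z f) (Comp C (b i) (a i)) = Comp C (Comp C (AMap Z f) (b i)) (a i)"
    by (rule cat_assoc[OF C nat_transD(1)[OF a ij(1)] nat_transD(1)[OF b ij(1)] ftorD(2)[OF Z f]])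
  also have "\<dots> = Comp C (Comp C (b j) (AMap Y f)) (a i)" by (simp add: nat_transD(2)[OF b f])
  also have "\<dots> = Comp C (b j) (Comp C (AMap Y f) (a i))"
    by (rule cat_assoc[OF C nat_transD(1)[OF a ij(1)] ftorD(2)[OF Y f] nat_transD(1)[OF b ij(2)], symmetric])
  also have "\<dots> = Comp C (b j) (Comp C (a j) (AMap X f))" by (simp add: nat_transD(2)[OF a f])
  also have "\<dots> = Comp C (Comp C (b j) (a j)) (AMap X f)"
    by (rule cat_assoc[OF C ftorD(2)[OF X f] nat_transD(1)[OF a ij(2)] nat_transD(1)[OF b ij(2)]])
  finally show "Comp C (AMap Z f) ((\<lambda>j\<in>Ob J. Comp C (b j) (a j)) i) =
      Comp C ((\<lambda>j\<in>Ob J. Comp C (b j) (a j)) j) (AMap X f)"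
    using ij by simp
qed simp

lemma ftor_cat_simps:
  "Ob (ftor_cat J C W) = {X. is_ftor J C X}"
  "a \<in> Ar (ftor_cat J C W) \<longleftrightarrow> is_ftor J C (src a) \<and> is_ftor J C (tgt a) \<and>
     nat_trans J C (src a) (tgt a) (mor a) \<and> (\<forall>j\<in>Ob J. mor a j \<in> W)"
  "Dom (ftor_cat J C W) = src" "Cod (ftor_cat J C W) = tgt"
  "Id (ftor_cat J C W) X = Arr X X (\<lambda>j\<in>Ob J. Id C (OMap X j))"
  "Comp (ftor_cat J C W) b a = Arr (src a) (tgt b) (\<lambda>j\<in>Ob J. Comp C (mor b j) (mor a j))"
  by (cases a; auto simp: ftor_cat_def)+

lemma category_ftor_cat:
  assumes J: "category J" and W: "relative_category C W"
  shows "category (ftor_cat J C W)"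
proof (rule categoryI)
  have C: "category C" using W by (simp add: relative_category_def)
  have Wid: "Id C a \<in> W" if "a \<in> Ob C" for a using W that by (simp add: relative_category_def)
  have Wcomp: "Comp C g f \<in> W" if "f \<in> W" "g \<in> W" "f \<in> Hom C a b" "g \<in> Hom C b c" for f g a b c
    using W that unfolding relative_category_def Hom_def by auto
  {
    fix f assume "f \<in> Ar (ftor_cat J C W)"
    then show "Dom (ftor_cat J C W) f \<in> Ob (ftor_cat J C W) \<and> Cod (ftor_cat J C W) f \<in> Ob (ftor_cat J C W)"
      by (simp add: ftor_cat_simps)
  next
    fix X assume "X \<in> Ob (ftor_cat J C W)"
    then show "Id (ftor_cat J C W) X \<in> Hom (ftor_cat J C W) X X"
      by (simp add: ftor_cat_simps Hom_def nat_trans_id[OF J C] Wid ftorD)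
  next
    fix f g X Y Z assume "f \<in> Hom (ftor_cat J C W) X Y" "g \<in> Hom (ftor_cat J C W) Y Z"
    then have f: "is_ftor J C X" "is_ftor J C Y" "nat_trans J C X Y (mor f)" "src f = X" "tgt f = Y" "\<forall>j\<in>Ob J. mor f j \<in> W"
      and g: "is_ftor J C Z" "nat_trans J C Y Z (mor g)" "src g = Y" "tgt g = Z" "\<forall>j\<in>Ob J. mor g j \<in> W"
      by (auto simp: ftor_cat_simps Hom_def)
    have "\<forall>j\<in>Ob J. Comp C (mor g j) (mor f j) \<in> W"
      using f g nat_transD(1)[OF f(3)] nat_transD(1)[OF g(2)] by (auto intro!: Wcomp)
    then show "Comp (ftor_cat J C W) g f \<in> Hom (ftor_cat J C W) X Z"
      using f g nat_trans_comp[OF J C f(1,2) g(1) f(3) g(2)] by (simp add: ftor_cat_simps Hom_def)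
  next
    fix f X Y assume "f \<in> Hom (ftor_cat J C W) X Y"
    then have f: "is_ftor J C X" "is_ftor J C Y" "nat_trans J C X Y (mor f)" "src f = X" "tgt f = Y"
      by (auto simp: ftor_cat_simps Hom_def)
    have "(\<lambda>j\<in>Ob J. Comp C (mor f j) ((\<lambda>j\<in>Ob J. Id C (OMap X j)) j)) = mor f"
      "(\<lambda>j\<in>Ob J. Comp C ((\<lambda>j\<in>Ob J. Id C (OMap Y j)) j) (mor f j)) = mor f"
      using cat_idr[OF C nat_transD(1)[OF f(3)]] cat_idl[OF C nat_transD(1)[OF f(3)]] nat_transD(3)[OF f(3)]
      by (auto simp: fun_eq_iff)
    then show "Comp (ftor_cat J C W) f (Id (ftor_cat J C W) X) = f" "Comp (ftor_cat J C W) (Id (ftor_cat J C W) Y) f = f"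
      using f(4,5) by (cases f; simp add: ftor_cat_simps)+
  next
    fix f g h X Y Z V assume "f \<in> Hom (ftor_cat J C W) X Y" "g \<in> Hom (ftor_cat J C W) Y Z" "h \<in> Hom (ftor_cat J C W) Z V"
    then have f: "nat_trans J C X Y (mor f)" and g: "nat_trans J C Y Z (mor g)" and h: "nat_trans J C Z V (mor h)"
      by (auto simp: ftor_cat_simps Hom_def)
    then show "Comp (ftor_cat J C W) h (Comp (ftor_cat J C W) g f) = Comp (ftor_cat J C W) (Comp (ftor_cat J C W) h g) f"
      using cat_assoc[OF C nat_transD(1)[OF f] nat_transD(1)[OF g] nat_transD(1)[OF h]]
      by (auto simp: ftor_cat_simps fun_eq_iff)
  }
qed

lemma relative_category_Ar: "category C \<Longrightarrow> relative_category C (Ar C)"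
  unfolding relative_category_def category_def Hom_def by simp

lemma pdiag_simps:
  "Ob (pdiag J z C T) = {X. is_ftor J C X \<and> OMap X z = T}"
  "a \<in> Ar (pdiag J z C T) \<longleftrightarrow> is_ftor J C (src a) \<and> is_ftor J C (tgt a) \<and>
     nat_trans J C (src a) (tgt a) (mor a) \<and> OMap (src a) z = T \<and> OMap (tgt a) z = T"
  "Dom (pdiag J z C T) = src" "Cod (pdiag J z C T) = tgt"
  "Id (pdiag J z C T) X = Arr X X (\<lambda>j\<in>Ob J. Id C (OMap X j))"
  "Comp (pdiag J z C T) b a = Arr (src a) (tgt b) (\<lambda>j\<in>Ob J. Comp C (mor b j) (mor a j))"
proof -
  have "\<forall>j\<in>Ob J. mor a j \<in> Ar C" if "nat_trans J C (src a) (tgt a) (mor a)"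
    using nat_transD(1)[OF that, THEN HomD(1)] by (rule ballI)
  then show "a \<in> Ar (pdiag J z C T) \<longleftrightarrow> is_ftor J C (src a) \<and> is_ftor J C (tgt a) \<and>
     nat_trans J C (src a) (tgt a) (mor a) \<and> OMap (src a) z = T \<and> OMap (tgt a) z = T"
    unfolding pdiag_def by (simp add: ftor_cat_simps) blast
qed (simp_all add: pdiag_def ftor_cat_simps)

lemma category_pdiag:
  assumes J: "category J" and C: "category C"
  shows "category (pdiag J z C T)"
proof -
  note F = category_ftor_cat[OF J relative_category_Ar[OF C]]
  have *: "Hom (pdiag J z C T) X Y = {f \<in> Hom (ftor_cat J C (Ar C)) X Y. OMap X z = T \<and> OMap Y z = T}" for X Y
    unfolding Hom_def by (auto simp: pdiag_def ftor_cat_simps(3,4))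
  have **: "Id (pdiag J z C T) = Id (ftor_cat J C (Ar C))" "Comp (pdiag J z C T) = Comp (ftor_cat J C (Ar C))"
    by (auto simp: pdiag_def)
  show ?thesis
  proof (rule categoryI)
    fix f assume "f \<in> Ar (pdiag J z C T)"
    then show "Dom (pdiag J z C T) f \<in> Ob (pdiag J z C T) \<and> Cod (pdiag J z C T) f \<in> Ob (pdiag J z C T)"
      by (simp add: pdiag_simps)
  next
    fix X assume "X \<in> Ob (pdiag J z C T)"
    then show "Id (pdiag J z C T) X \<in> Hom (pdiag J z C T) X X"
      unfolding * ** using cat_id[OF F] by (simp add: pdiag_simps ftor_cat_simps)
  qed (use cat_comp[OF F] cat_idl[OF F] cat_idr[OF F] cat_assoc[OF F] in \<open>auto simp: * **\<close>)
qed

subsection \<open>Small categories and small simplicial sets\<close>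

lemma CAT_simps:
  "Ob (CAT \<U>) = {C. small_category \<U> C}"
  "f \<in> Hom (CAT \<U>) A B \<longleftrightarrow> small_category \<U> A \<and> small_category \<U> B \<and> (\<exists>F. f = Arr A B F \<and> is_ftor A B F)"
  "Dom (CAT \<U>) = src" "Cod (CAT \<U>) = tgt" "Id (CAT \<U>) A = Arr A A (fid A)"
  "Comp (CAT \<U>) g f = Arr (src f) (tgt g) (ftor_comp (src f) (mor g) (mor f))"
  by (auto simp: CAT_def Hom_def)

lemma category_CAT: "category (CAT \<U>)"
proof (rule categoryI)
  have cat: "category A" if "small_category \<U> A" for A using that by (simp add: small_category_def)
  {
    fix f assume "f \<in> Ar (CAT \<U>)"
    then show "Dom (CAT \<U>) f \<in> Ob (CAT \<U>) \<and> Cod (CAT \<U>) f \<in> Ob (CAT \<U>)" by (auto simp: CAT_def)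
  next
    fix A assume "A \<in> Ob (CAT \<U>)"
    then show "Id (CAT \<U>) A \<in> Hom (CAT \<U>) A A" by (simp add: CAT_simps is_ftor_fid cat)
  next
    fix f g A B C assume "f \<in> Hom (CAT \<U>) A B" "g \<in> Hom (CAT \<U>) B C"
    then show "Comp (CAT \<U>) g f \<in> Hom (CAT \<U>) A C" using is_ftor_comp[OF cat] by (auto simp: CAT_simps)
  next
    fix f A B assume "f \<in> Hom (CAT \<U>) A B"
    then show "Comp (CAT \<U>) f (Id (CAT \<U>) A) = f" "Comp (CAT \<U>) (Id (CAT \<U>) B) f = f"
      by (auto simp: CAT_simps ftor_comp_fid cat)
  next
    fix f g h A B C D assume "f \<in> Hom (CAT \<U>) A B" "g \<in> Hom (CAT \<U>) B C" "h \<in> Hom (CAT \<U>) C D"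
    then show "Comp (CAT \<U>) h (Comp (CAT \<U>) g f) = Comp (CAT \<U>) (Comp (CAT \<U>) h g) f"
      by (auto simp: CAT_simps intro!: ftor_comp_assoc[OF cat, symmetric])
  }
qed

lemma smap_comp_apply: "x \<in> spx X k \<Longrightarrow> smap_comp X g f k x = g k (f k x)" "x \<notin> spx X k \<Longrightarrow> smap_comp X g f k x = undefined"
  by (simp_all add: smap_comp_def compose_def)

lemma SSET_simps:
  "Ob (SSET \<U>) = {X. small_sset \<U> X}"
  "f \<in> Hom (SSET \<U>) A B \<longleftrightarrow> small_sset \<U> A \<and> small_sset \<U> B \<and> (\<exists>F. f = Arr A B F \<and> F \<in> smaps A B)"
  "Dom (SSET \<U>) = src" "Cod (SSET \<U>) = tgt" "Id (SSET \<U>) A = Arr A A (sid A)"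
  "Comp (SSET \<U>) g f = Arr (src f) (tgt g) (smap_comp (src f) (mor g) (mor f))"
  by (auto simp: SSET_def Hom_def)

lemma category_SSET: "category (SSET \<U>)"
proof (rule categoryI)
  have sset: "is_sset A" if "small_sset \<U> A" for A using that by (simp add: small_sset_def)
  {
    fix f assume "f \<in> Ar (SSET \<U>)"
    then show "Dom (SSET \<U>) f \<in> Ob (SSET \<U>) \<and> Cod (SSET \<U>) f \<in> Ob (SSET \<U>)" by (auto simp: SSET_def)
  next
    fix A assume "A \<in> Ob (SSET \<U>)"
    then show "Id (SSET \<U>) A \<in> Hom (SSET \<U>) A A" by (simp add: SSET_simps sid_in sset)
  next
    fix f g A B C assume "f \<in> Hom (SSET \<U>) A B" "g \<in> Hom (SSET \<U>) B C"
    then show "Comp (SSET \<U>) g f \<in> Hom (SSET \<U>) A C" using smap_comp_in[OF sset] by (auto simp: SSET_simps)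
  next
    fix f A B assume "f \<in> Hom (SSET \<U>) A B"
    then obtain F where F: "f = Arr A B F" "F \<in> smaps A B" by (auto simp: SSET_simps)
    then have "smap_comp A F (sid A) = F" "smap_comp A (sid B) F = F"
      by (auto simp: fun_eq_iff smap_comp_def compose_def sid_def smapsD)
    then show "Comp (SSET \<U>) f (Id (SSET \<U>) A) = f" "Comp (SSET \<U>) (Id (SSET \<U>) B) f = f"
      by (auto simp: SSET_simps F)
  next
    fix f g h A B C D assume "f \<in> Hom (SSET \<U>) A B" "g \<in> Hom (SSET \<U>) B C" "h \<in> Hom (SSET \<U>) C D"
    then obtain F G H where F: "f = Arr A B F" "F \<in> smaps A B" and G: "g = Arr B C G" and H: "h = Arr C D H"
      by (auto simp: SSET_simps)
    have "smap_comp A H (smap_comp A G F) = smap_comp A (smap_comp B H G) F"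
      using smapsD(1)[OF F(2)] by (auto simp: fun_eq_iff smap_comp_def compose_def)
    then show "Comp (SSET \<U>) h (Comp (SSET \<U>) g f) = Comp (SSET \<U>) (Comp (SSET \<U>) h g) f"
      by (simp add: SSET_simps F G H)
  }
qed

section \<open>The indexing categories\<close>

lemma pmapsD: "\<phi> \<in> pmaps m n \<Longrightarrow> x \<le> m \<Longrightarrow> \<phi> x \<le> n" "\<phi> \<in> pmaps m n \<Longrightarrow> \<phi> 0 = 0"
  "\<phi> \<in> pmaps m n \<Longrightarrow> \<not> x \<le> m \<Longrightarrow> \<phi> x = undefined"
  by (auto simp: pmaps_def PiE_iff extensional_def)

lemma pmapsI: "(\<And>x. x \<le> m \<Longrightarrow> \<phi> x \<le> n) \<Longrightarrow> \<phi> 0 = 0 \<Longrightarrow> (\<And>x. \<not> x \<le> m \<Longrightarrow> \<phi> x = undefined) \<Longrightarrow> \<phi> \<in> pmaps m n"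
  by (auto simp: pmaps_def PiE_iff extensional_def)

lemma pmaps_compose: "\<phi> \<in> pmaps l m \<Longrightarrow> \<psi> \<in> pmaps m n \<Longrightarrow> compose {..l} \<psi> \<phi> \<in> pmaps l n"
  by (rule pmapsI) (auto simp: compose_def pmapsD)

lemma pmaps_ident: "(\<lambda>x\<in>{..n}. x) \<in> pmaps n n"
  by (rule pmapsI) auto

lemma pzero_in: "pzero m \<in> pmaps m n"
  by (rule pmapsI) (auto simp: pzero_def)

lemma pmaps_to_0: "\<phi> \<in> pmaps m 0 \<Longrightarrow> \<phi> = pzero m"
  using pmapsD[of \<phi> m 0] by (auto simp: fun_eq_iff pzero_def)

lemma pmaps_from_0: "\<phi> \<in> pmaps 0 n \<Longrightarrow> \<phi> = pzero 0"
  using pmapsD[of \<phi> 0 n] by (auto simp: fun_eq_iff pzero_def)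

lemma compose_pzero:
  "\<psi> \<in> pmaps m n \<Longrightarrow> compose {..l} \<psi> (pzero l) = pzero l"
  "\<phi> \<in> pmaps l m \<Longrightarrow> compose {..l} (pzero m) \<phi> = pzero l"
  by (auto simp: fun_eq_iff compose_def pzero_def pmapsD)

lemma compose_pmaps_ident:
  "\<phi> \<in> pmaps m n \<Longrightarrow> compose {..m} (\<lambda>x\<in>{..n}. x) \<phi> = \<phi>"
  "\<phi> \<in> pmaps m n \<Longrightarrow> compose {..m} \<phi> (\<lambda>x\<in>{..m}. x) = \<phi>"
  by (auto simp: fun_eq_iff compose_def pmapsD)

lemma compose_pmaps_assoc:
  "\<phi> \<in> pmaps k l \<Longrightarrow> compose {..k} \<upsilon> (compose {..k} \<psi> \<phi>) = compose {..k} (compose {..l} \<upsilon> \<psi>) \<phi>"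
  by (auto simp: fun_eq_iff compose_def pmapsD)

lemma FF_simps:
  "Ob FF = UNIV" "a \<in> Hom FF m n \<longleftrightarrow> (\<exists>\<phi>. a = Arr m n \<phi> \<and> \<phi> \<in> pmaps m n)"
  "a \<in> Ar FF \<longleftrightarrow> mor a \<in> pmaps (src a) (tgt a)"
  "Dom FF = src" "Cod FF = tgt" "Id FF n = Arr n n (\<lambda>x\<in>{..n}. x)"
  "Comp FF b a = Arr (src a) (tgt b) (compose {..src a} (mor b) (mor a))"
  by (auto simp: FF_def Hom_def) (metis arr.exhaust_sel)

lemma category_FF: "category FF"
proof (rule categoryI)
  fix f g h a b c d assume "f \<in> Hom FF a b" "g \<in> Hom FF b c" "h \<in> Hom FF c d"
  then show "Comp FF h (Comp FF g f) = Comp FF (Comp FF h g) f"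
    using compose_pmaps_assoc by (auto simp: FF_simps)
qed (auto simp: FF_simps pmaps_ident compose_pmaps_ident pmaps_compose)

lemma finite_pmaps: "finite (pmaps m n)"
  by (rule finite_subset[OF _ finite_PiE[of "{..m}" "\<lambda>_. {..n}"]]) (auto simp: pmaps_def)

subsection \<open>Composition of tuples of pointed maps\<close>

text \<open>Pairs in which components may be zero compose associatively, and the pairs with a zero
  component form an ideal.\<close>

definition gpre :: "nat list \<Rightarrow> nat list \<Rightarrow> ((nat \<Rightarrow> nat) \<times> (nat \<Rightarrow> nat \<Rightarrow> nat)) set" where
  "gpre ns ms = {(f, \<psi>). f \<in> {..<length ns} \<rightarrow>\<^sub>E {..<length ms} \<and> inj_on f {..<length ns} \<and>
     \<psi> \<in> extensional {..<length ms} \<and> (\<forall>j<length ms. \<psi> j \<in> pmaps (gsrc ns f j) (ms ! j))}"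

definition gzero :: "nat list \<Rightarrow> nat list \<Rightarrow> (nat \<Rightarrow> nat) \<times> (nat \<Rightarrow> nat \<Rightarrow> nat) \<Rightarrow> bool" where
  "gzero ns ms = (\<lambda>(f, \<psi>). \<exists>j<length ms. \<psi> j = pzero (gsrc ns f j))"

definition graw :: "nat list \<Rightarrow> nat list \<Rightarrow> nat list \<Rightarrow> (nat \<Rightarrow> nat) \<times> (nat \<Rightarrow> nat \<Rightarrow> nat) \<Rightarrow>
    (nat \<Rightarrow> nat) \<times> (nat \<Rightarrow> nat \<Rightarrow> nat) \<Rightarrow> (nat \<Rightarrow> nat) \<times> (nat \<Rightarrow> nat \<Rightarrow> nat)" where
  "graw ns ms ls = (\<lambda>(g, \<phi>) (f, \<psi>). (compose {..<length ns} g f,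
     \<lambda>k\<in>{..<length ls}. compose {..gsrc ns (compose {..<length ns} g f) k} (\<phi> k)
       (if k \<in> g ` {..<length ms} then \<psi> (inv_into {..<length ms} g k) else (\<lambda>x\<in>{..1}. x))))"

lemma gpairs_gpre: "p \<in> gpairs ns ms \<longleftrightarrow> p \<in> gpre ns ms \<and> \<not> gzero ns ms p"
  by (auto simp: gpairs_def gpre_def gzero_def)

lemma gcomp_graw:
  "gcomp (Arr (Tup ms) (Tup ls) (Some q)) (Arr (Tup ns) t (Some p)) =
     (if gzero ns ls (graw ns ms ls q p) then None else Some (graw ns ms ls q p))"
  by (cases p; cases q) (auto simp: graw_def gzero_def Let_def restrict_def)

lemma gpreD:
  assumes "(f, \<psi>) \<in> gpre ns ms"
  shows "i < length ns \<Longrightarrow> f i < length ms" "inj_on f {..<length ns}"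
    "j < length ms \<Longrightarrow> \<psi> j \<in> pmaps (gsrc ns f j) (ms ! j)"
    "\<not> i < length ns \<Longrightarrow> f i = undefined" "\<not> j < length ms \<Longrightarrow> \<psi> j = undefined"
  using assms by (auto simp: gpre_def PiE_iff extensional_def)

lemma gsrc_image: "inj_on f {..<length ns} \<Longrightarrow> i < length ns \<Longrightarrow> gsrc ns f (f i) = ns ! i"
  by (simp add: gsrc_def inv_into_f_f)

lemma gsrc_off: "j \<notin> f ` {..<length ns} \<Longrightarrow> gsrc ns f j = 1"
  by (simp add: gsrc_def)

context
  fixes ns ms ls g \<phi> f \<psi>
  assumes g: "(g, \<phi>) \<in> gpre ms ls" and f: "(f, \<psi>) \<in> gpre ns ms"
begin

lemma inj_gf: "inj_on (compose {..<length ns} g f) {..<length ns}"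
  using gpreD(1,2)[OF f] gpreD(2)[OF g] by (auto simp: inj_on_def compose_def)

lemma gsrc_comp_image: "j < length ms \<Longrightarrow> gsrc ns (compose {..<length ns} g f) (g j) = gsrc ns f j"
proof (cases "j \<in> f ` {..<length ns}")
  case True
  then obtain i where i: "i < length ns" "j = f i" by auto
  then have "g j = compose {..<length ns} g f i" by (simp add: compose_def)
  then show ?thesis using i gsrc_image[OF inj_gf i(1)] gsrc_image[OF gpreD(2)[OF f] i(1)] by simp
next
  case False
  assume j: "j < length ms"
  have "g j \<notin> compose {..<length ns} g f ` {..<length ns}"
  proof
    assume "g j \<in> compose {..<length ns} g f ` {..<length ns}"
    then obtain i where i: "i < length ns" "g j = g (f i)" by (auto simp: compose_def)
    then have "j = f i" using inj_onD[OF gpreD(2)[OF g] i(2)] j gpreD(1)[OF f i(1)] by simp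
    then show False using False i by auto
  qed
  then show ?thesis using False by (simp add: gsrc_off)
qed

lemma gsrc_comp_off: "k \<notin> g ` {..<length ms} \<Longrightarrow> gsrc ns (compose {..<length ns} g f) k = 1"
  by (rule gsrc_off) (use gpreD(1)[OF f] in \<open>auto simp: compose_def\<close>)

lemma graw_image: "j < length ms \<Longrightarrow> snd (graw ns ms ls (g, \<phi>) (f, \<psi>)) (g j) = compose {..gsrc ns f j} (\<phi> (g j)) (\<psi> j)"
  using gpreD(1)[OF g, of j] inv_into_f_f[OF gpreD(2)[OF g], of j] gsrc_comp_image[of j]
  by (simp add: graw_def)

lemma graw_off: "k < length ls \<Longrightarrow> k \<notin> g ` {..<length ms} \<Longrightarrow> snd (graw ns ms ls (g, \<phi>) (f, \<psi>)) k = \<phi> k"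
  using gsrc_comp_off[of k] compose_pmaps_ident(2)[of "\<phi> k" "Suc 0" "ls ! k"] gpreD(3)[OF g, of k] gsrc_off[of k g ms]
  by (simp add: graw_def)

lemma graw_fst: "fst (graw ns ms ls (g, \<phi>) (f, \<psi>)) = compose {..<length ns} g f"
  by (simp add: graw_def)

lemma graw_undefined: "\<not> k < length ls \<Longrightarrow> snd (graw ns ms ls (g, \<phi>) (f, \<psi>)) k = undefined"
  by (simp add: graw_def)

lemma graw_in: "graw ns ms ls (g, \<phi>) (f, \<psi>) \<in> gpre ns ls"
proof -
  obtain \<omega> where w: "graw ns ms ls (g, \<phi>) (f, \<psi>) = (compose {..<length ns} g f, \<omega>)"
    by (simp add: graw_def)
  have "\<omega> k \<in> pmaps (gsrc ns (compose {..<length ns} g f) k) (ls ! k)" if k: "k < length ls" for k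
  proof (cases "k \<in> g ` {..<length ms}")
    case True
    then obtain j where j: "j < length ms" "k = g j" by auto
    have "\<phi> k \<in> pmaps (ms ! j) (ls ! k)"
      using gpreD(3)[OF g k] gsrc_image[OF gpreD(2)[OF g] j(1)] j by simp
    then show ?thesis
      using graw_image[OF j(1)] pmaps_compose[OF gpreD(3)[OF f j(1)]] gsrc_comp_image[OF j(1)] j by (simp add: w)
  next
    case False
    then show ?thesis using graw_off[OF k False] gpreD(3)[OF g k] by (simp add: w gsrc_off gsrc_comp_off)
  qed
  moreover have "\<omega> k = undefined" if "\<not> k < length ls" for k using graw_undefined[OF that] by (simp add: w)
  moreover have "compose {..<length ns} g f \<in> {..<length ns} \<rightarrow>\<^sub>E {..<length ls}"
    using gpreD(1)[OF f] gpreD(1)[OF g] by (auto simp: compose_def)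
  ultimately show ?thesis using inj_gf by (simp add: w gpre_def extensional_def)
qed

text \<open>Therefore composition is compatible with the identification of all pairs that have a zero
  component.\<close>

lemma gzero_graw: "gzero ms ls (g, \<phi>) \<or> gzero ns ms (f, \<psi>) \<Longrightarrow> gzero ns ls (graw ns ms ls (g, \<phi>) (f, \<psi>))"
proof -
  obtain \<omega> where w: "graw ns ms ls (g, \<phi>) (f, \<psi>) = (compose {..<length ns} g f, \<omega>)"
    by (simp add: graw_def)
  assume "gzero ms ls (g, \<phi>) \<or> gzero ns ms (f, \<psi>)"
  then consider k where "k < length ls" "\<phi> k = pzero (gsrc ms g k)" | j where "j < length ms" "\<psi> j = pzero (gsrc ns f j)"
    by (auto simp: gzero_def)
  then have "\<exists>k<length ls. \<omega> k = pzero (gsrc ns (compose {..<length ns} g f) k)"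
  proof cases
    case 1
    show ?thesis
    proof (cases "k \<in> g ` {..<length ms}")
      case True
      then obtain j where j: "j < length ms" "k = g j" by auto
      then have "\<omega> k = pzero (gsrc ns f j)"
        using graw_image[OF j(1)] 1 gsrc_image[OF gpreD(2)[OF g] j(1)] compose_pzero(2)[OF gpreD(3)[OF f j(1)]]
        by (simp add: w)
      then show ?thesis using 1(1) gsrc_comp_image[OF j(1)] j by auto
    next
      case False
      then show ?thesis using graw_off[OF 1(1) False] 1 by (auto simp: w gsrc_off gsrc_comp_off)
    qed
  next
    case 2
    then have "\<omega> (g j) = pzero (gsrc ns f j)"
      using graw_image[OF 2(1)] compose_pzero(1)[OF gpreD(3)[OF g gpreD(1)[OF g 2(1)]]]
        by (simp add: w)
    then show ?thesis using gpreD(1)[OF g 2(1)] gsrc_comp_image[OF 2(1)] by auto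
  qed
  then show ?thesis by (simp add: w gzero_def)
qed

end

lemma graw_assoc:
  assumes r: "r \<in> gpre ls ks" and q: "q \<in> gpre ms ls" and p: "p \<in> gpre ns ms"
  shows "graw ns ls ks r (graw ns ms ls q p) = graw ns ms ks (graw ms ls ks r q) p"
proof -
  obtain u \<upsilon> where r': "r = (u, \<upsilon>)" by (cases r)
  obtain g \<phi> where q': "q = (g, \<phi>)" by (cases q)
  obtain f \<psi> where p': "p = (f, \<psi>)" by (cases p)
  note rr = r[unfolded r'] and qq = q[unfolded q'] and pp = p[unfolded p']
  obtain \<omega> where w: "graw ns ms ls q p = (compose {..<length ns} g f, \<omega>)"
    unfolding p' q' by (simp add: graw_def)
  obtain \<rho> where v: "graw ms ls ks r q = (compose {..<length ms} u g, \<rho>)"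
    unfolding r' q' by (simp add: graw_def)
  have w_in: "(compose {..<length ns} g f, \<omega>) \<in> gpre ns ls" using graw_in[OF qq pp] w p' q' by simp
  have v_in: "(compose {..<length ms} u g, \<rho>) \<in> gpre ms ks" using graw_in[OF rr qq] v r' q' by simp
  note wi = graw_image[OF qq pp, folded p' q', unfolded w snd_conv]
    and wo = graw_off[OF qq pp, folded p' q', unfolded w snd_conv]
  note vi = graw_image[OF rr qq, folded r' q', unfolded v snd_conv]
    and vo = graw_off[OF rr qq, folded r' q', unfolded v snd_conv]
  show ?thesis
  proof (rule prod_eqI)
    show "fst (graw ns ls ks r (graw ns ms ls q p)) = fst (graw ns ms ks (graw ms ls ks r q) p)"
      unfolding w v unfolding r' p' graw_fst[OF rr w_in] graw_fst[OF v_in pp]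
      using gpreD(1)[OF pp] by (auto simp: fun_eq_iff compose_def)
    show "snd (graw ns ls ks r (graw ns ms ls q p)) = snd (graw ns ms ks (graw ms ls ks r q) p)"
      unfolding w v unfolding r' p'
    proof
      fix l
      consider "\<not> l < length ks" | "l < length ks" "l \<notin> u ` {..<length ls}"
        | k where "l = u k" "k < length ls" "k \<notin> g ` {..<length ms}"
        | j where "l = u (g j)" "j < length ms" by auto
      then show "snd (graw ns ls ks (u, \<upsilon>) (compose {..<length ns} g f, \<omega>)) l =
          snd (graw ns ms ks (compose {..<length ms} u g, \<rho>) (f, \<psi>)) l"
      proof cases
        case 1
        then show ?thesis using graw_undefined[OF rr w_in] graw_undefined[OF v_in pp] by simp
      next
        case 2
        then have "l \<notin> compose {..<length ms} u g ` {..<length ms}"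
          using gpreD(1)[OF qq] by (auto simp: compose_def)
        then show ?thesis using 2 graw_off[OF rr w_in] graw_off[OF v_in pp] vo by simp
      next
        case 3
        have l: "l < length ks" using gpreD(1)[OF rr 3(2)] 3 by simp
        have "l \<notin> compose {..<length ms} u g ` {..<length ms}"
        proof
          assume "l \<in> compose {..<length ms} u g ` {..<length ms}"
          then obtain j where j: "j < length ms" "u k = u (g j)" using 3 by (auto simp: compose_def)
          then have "k = g j" using inj_onD[OF gpreD(2)[OF rr] j(2)] 3 gpreD(1)[OF qq j(1)] by simp
          then show False using 3 j by auto
        qed
        then have "snd (graw ns ms ks (compose {..<length ms} u g, \<rho>) (f, \<psi>)) l = \<rho> l"
          using graw_off[OF v_in pp l] by simp
        then show ?thesis
          using 3 graw_image[OF rr w_in 3(2)] vi[OF 3(2)] wo[OF 3(2,3)]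
          by (simp add: gsrc_off gsrc_comp_off[OF qq pp])
      next
        case 4
        have k: "g j < length ls" using gpreD(1)[OF qq 4(2)] .
        have "snd (graw ns ls ks (u, \<upsilon>) (compose {..<length ns} g f, \<omega>)) l =
            compose {..gsrc ns f j} (\<upsilon> l) (compose {..gsrc ns f j} (\<phi> (g j)) (\<psi> j))"
          using graw_image[OF rr w_in k] wi[OF 4(2)] 4 gsrc_comp_image[OF qq pp 4(2)] by simp
        also have "\<dots> = compose {..gsrc ns f j} (compose {..ms ! j} (\<upsilon> l) (\<phi> (g j))) (\<psi> j)"
          by (rule compose_pmaps_assoc[OF gpreD(3)[OF pp 4(2)]])
        also have "compose {..ms ! j} (\<upsilon> l) (\<phi> (g j)) = \<rho> l"
          using vi[OF k] 4 gsrc_image[OF gpreD(2)[OF qq] 4(2)] by simp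
        also have "compose {..gsrc ns f j} (\<rho> l) (\<psi> j) = snd (graw ns ms ks (compose {..<length ms} u g, \<rho>) (f, \<psi>)) l"
          using graw_image[OF v_in pp 4(2)] 4 by (simp add: compose_def)
        finally show ?thesis .
      qed
    qed
  qed
qed

subsection \<open>The categories of tuples\<close>

lemma GG_simps:
  "s \<in> Ob GG \<longleftrightarrow> (\<forall>ns. s = Tup ns \<longrightarrow> (\<forall>n\<in>set ns. 0 < n))"
  "f \<in> Hom GG s t \<longleftrightarrow> s \<in> Ob GG \<and> t \<in> Ob GG \<and> (\<exists>x. f = Arr s t x \<and> x \<in> ghom s t)"
  "Dom GG = src" "Cod GG = tgt" "Id GG s = Arr s s (gid s)"
  "Comp GG g f = Arr (src f) (tgt g) (gcomp g f)"
proof -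
  show "s \<in> Ob GG \<longleftrightarrow> (\<forall>ns. s = Tup ns \<longrightarrow> (\<forall>n\<in>set ns. 0 < n))"
    by (cases s) (auto simp: GG_def Let_def)
  show "f \<in> Hom GG s t \<longleftrightarrow> s \<in> Ob GG \<and> t \<in> Ob GG \<and> (\<exists>x. f = Arr s t x \<and> x \<in> ghom s t)"
    by (cases f) (auto simp: GG_def Let_def Hom_def)
qed (simp_all add: GG_def Let_def)

lemma ghom_cases:
  assumes "x \<in> ghom s t"
  obtains "x = None" | ns ms p where "s = Tup ns" "t = Tup ms" "x = Some p" "p \<in> gpairs ns ms"
  using assms by (cases "(s, t)" rule: ghom.cases) auto

lemma None_in_ghom: "None \<in> ghom s t"
  by (cases "(s, t)" rule: ghom.cases) auto

lemma gcomp_None: "gcomp (Arr s t None) f = None" "gcomp g (Arr s t None) = None"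
  by (cases f; cases s; cases t; cases "src f"; simp) (cases g; cases s; cases t; cases "src g"; cases "tgt g"; simp)

lemma gcomp_in:
  assumes "x \<in> ghom s t" "y \<in> ghom t u"
  shows "gcomp (Arr t u y) (Arr s t x) \<in> ghom s u"
proof -
  consider "x = None \<or> y = None" | ns ms ls p q where "s = Tup ns" "t = Tup ms" "u = Tup ls" "x = Some p" "y = Some q"
      "p \<in> gpairs ns ms" "q \<in> gpairs ms ls"
    using assms by (auto elim!: ghom_cases)
  then show ?thesis
  proof cases
    case 1
    then show ?thesis by (auto simp: gcomp_None None_in_ghom)
  next
    case 2
    then show ?thesis using graw_in[of "fst q" "snd q" ms ls "fst p" "snd p" ns]
      by (auto simp: gcomp_graw gpairs_gpre)
  qed
qed

lemma gcomp_assoc: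
  assumes "x \<in> ghom s t" "y \<in> ghom t u" "z \<in> ghom u v"
  shows "gcomp (Arr u v z) (Arr s u (gcomp (Arr t u y) (Arr s t x))) = gcomp (Arr t v (gcomp (Arr u v z) (Arr t u y))) (Arr s t x)"
proof -
  consider "x = None \<or> y = None \<or> z = None" | ns ms ls ks p q r where "s = Tup ns" "t = Tup ms" "u = Tup ls" "v = Tup ks"
      "x = Some p" "y = Some q" "z = Some r" "p \<in> gpairs ns ms" "q \<in> gpairs ms ls" "r \<in> gpairs ls ks"
    using assms by (auto elim!: ghom_cases)
  then show ?thesis
  proof cases
    case 1
    then show ?thesis by (auto simp: gcomp_None)
  next
    case 2
    then have g: "p \<in> gpre ns ms" "q \<in> gpre ms ls" "r \<in> gpre ls ks" by (auto simp: gpairs_gpre)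
    have qp: "graw ns ms ls q p \<in> gpre ns ls" and rq: "graw ms ls ks r q \<in> gpre ms ks"
      using graw_in[of "fst q" "snd q" ms ls "fst p" "snd p" ns] graw_in[of "fst r" "snd r" ls ks "fst q" "snd q" ms] g by auto
    have z1: "gzero ns ls (graw ns ms ls q p) \<Longrightarrow> gzero ns ks (graw ns ls ks r (graw ns ms ls q p))"
      using gzero_graw[of "fst r" "snd r" ls ks "fst (graw ns ms ls q p)" "snd (graw ns ms ls q p)" ns] g qp by simp
    have z2: "gzero ms ks (graw ms ls ks r q) \<Longrightarrow> gzero ns ks (graw ns ms ks (graw ms ls ks r q) p)"
      using gzero_graw[of "fst (graw ms ls ks r q)" "snd (graw ms ls ks r q)" ms ks "fst p" "snd p" ns] g rq by simp
    show ?thesis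
      using z1 z2 2 graw_assoc[OF g(3,2,1)]
      by (cases "gzero ns ks (graw ns ms ks (graw ms ls ks r q) p)") (auto simp: gcomp_graw gcomp_None)
  qed
qed

lemma ident_neq_pzero: "0 < n \<Longrightarrow> (\<lambda>x\<in>{..n}. x) \<noteq> pzero n"
proof
  assume "0 < n" "(\<lambda>x\<in>{..n}. x) = pzero n"
  then have "(\<lambda>x\<in>{..n}. x) n = pzero n n" by simp
  then show False using \<open>0 < n\<close> by (simp add: pzero_def)
qed

lemma gid_gpairs:
  assumes "\<forall>n\<in>set ns. 0 < n"
  shows "(\<lambda>i\<in>{..<length ns}. i, \<lambda>j\<in>{..<length ns}. \<lambda>x\<in>{..ns ! j}. x) \<in> gpairs ns ns"
proof -
  let ?i = "\<lambda>i\<in>{..<length ns}. i"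
  have inj: "inj_on ?i {..<length ns}" by (simp add: inj_on_def)
  have "gsrc ns ?i j = ns ! j" if "j < length ns" for j
    using gsrc_image[OF inj that] that by simp
  moreover have "(\<lambda>x\<in>{..ns ! j}. x) \<noteq> pzero (ns ! j)" if "j < length ns" for j
    using assms that by (intro ident_neq_pzero) simp
  ultimately show ?thesis using inj by (simp add: gpairs_def pmaps_ident PiE_iff)
qed

lemma gcomp_gid:
  assumes "x \<in> ghom s t" "s \<in> Ob GG" "t \<in> Ob GG"
  shows "gcomp (Arr s t x) (Arr s s (gid s)) = x" "gcomp (Arr t t (gid t)) (Arr s t x) = x"
proof -
  consider "x = None" | ns ms p where "s = Tup ns" "t = Tup ms" "x = Some p" "p \<in> gpairs ns ms"
    using assms by (auto elim!: ghom_cases)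
  then have "gcomp (Arr s t x) (Arr s s (gid s)) = x \<and> gcomp (Arr t t (gid t)) (Arr s t x) = x"
  proof cases
    case 2
    obtain f \<psi> where p: "p = (f, \<psi>)" by (cases p)
    have pp: "(f, \<psi>) \<in> gpre ns ms" using 2 p by (simp add: gpairs_gpre)
    have pos: "\<forall>n\<in>set ns. 0 < n" "\<forall>n\<in>set ms. 0 < n" using assms 2 by (simp_all add: GG_simps)
    let ?i = "\<lambda>ns :: nat list. \<lambda>i\<in>{..<length ns}. i" and ?\<iota> = "\<lambda>ns. \<lambda>j\<in>{..<length ns}. \<lambda>x\<in>{..ns ! j}. x"
    have in1: "(?i ns, ?\<iota> ns) \<in> gpre ns ns" and im: "(?i ms, ?\<iota> ms) \<in> gpre ms ms"
      using gid_gpairs pos by (simp_all add: gpairs_gpre)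
    have src: "gsrc ns (?i ns) j = ns ! j" if "j < length ns" for ns j
      using gsrc_image[of "?i ns" ns j] that by (simp add: inj_on_def)
    have 1: "graw ns ns ms (f, \<psi>) (?i ns, ?\<iota> ns) = (f, \<psi>)"
    proof (rule prod_eqI)
      show "fst (graw ns ns ms (f, \<psi>) (?i ns, ?\<iota> ns)) = fst (f, \<psi>)"
        unfolding graw_fst[OF pp in1] using gpreD(4)[OF pp] by (auto simp: fun_eq_iff compose_def)
      show "snd (graw ns ns ms (f, \<psi>) (?i ns, ?\<iota> ns)) = snd (f, \<psi>)"
      proof
        fix k
        consider "\<not> k < length ms" | "k < length ms" "k \<notin> f ` {..<length ns}" | j where "k = f j" "j < length ns" by auto
        then show "snd (graw ns ns ms (f, \<psi>) (?i ns, ?\<iota> ns)) k = snd (f, \<psi>) k"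
        proof cases
          case 1 then show ?thesis using graw_undefined[OF pp in1] gpreD(5)[OF pp] by simp
        next
          case 2 then show ?thesis using graw_off[OF pp in1] by simp
        next
          case 3
          have "\<psi> k \<in> pmaps (ns ! j) (ms ! k)"
            using gpreD(3)[OF pp gpreD(1)[OF pp 3(2)]] gsrc_image[OF gpreD(2)[OF pp] 3(2)] 3 by simp
          then show ?thesis using graw_image[OF pp in1 3(2)] 3 src[OF 3(2)] by (simp add: compose_pmaps_ident)
        qed
      qed
    qed
    have 2: "graw ns ms ms (?i ms, ?\<iota> ms) (f, \<psi>) = (f, \<psi>)"
    proof (rule prod_eqI)
      show "fst (graw ns ms ms (?i ms, ?\<iota> ms) (f, \<psi>)) = fst (f, \<psi>)"
        unfolding graw_fst[OF im pp] using gpreD(1,4)[OF pp] by (auto simp: fun_eq_iff compose_def)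
      show "snd (graw ns ms ms (?i ms, ?\<iota> ms) (f, \<psi>)) = snd (f, \<psi>)"
      proof
        fix k
        show "snd (graw ns ms ms (?i ms, ?\<iota> ms) (f, \<psi>)) k = snd (f, \<psi>) k"
        proof (cases "k < length ms")
          case True
          then show ?thesis using graw_image[OF im pp True] compose_pmaps_ident(1)[OF gpreD(3)[OF pp True]] by simp
        next
          case False
          then show ?thesis using graw_undefined[OF im pp] gpreD(5)[OF pp] by simp
        qed
      qed
    qed
    have "\<not> gzero ns ms (f, \<psi>)" using \<open>p \<in> gpairs ns ms\<close> p by (simp add: gpairs_gpre)
    then show ?thesis
      using \<open>s = Tup ns\<close> \<open>t = Tup ms\<close> \<open>x = Some p\<close> p 1 2 by (simp add: gcomp_graw)
  qed (simp add: gcomp_None)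
  then show "gcomp (Arr s t x) (Arr s s (gid s)) = x" "gcomp (Arr t t (gid t)) (Arr s t x) = x" by simp_all
qed

lemma category_GG: "category GG"
proof (rule categoryI)
  fix f assume "f \<in> Ar GG"
  then show "Dom GG f \<in> Ob GG \<and> Cod GG f \<in> Ob GG" by (auto simp: GG_def Let_def)
next
  fix s assume s: "s \<in> Ob GG"
  have "gid s \<in> ghom s s" using s gid_gpairs by (cases s) (auto simp: GG_simps)
  then show "Id GG s \<in> Hom GG s s" using s by (simp add: GG_simps(2,5))
next
  fix f g s t u assume "f \<in> Hom GG s t" "g \<in> Hom GG t u"
  then show "Comp GG g f \<in> Hom GG s u" using gcomp_in by (auto simp: GG_simps(2,6))
next
  fix f s t assume "f \<in> Hom GG s t"
  then show "Comp GG f (Id GG s) = f" "Comp GG (Id GG t) f = f"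
    using gcomp_gid by (auto simp: GG_simps(2,5,6))
next
  fix f g h s t u v assume "f \<in> Hom GG s t" "g \<in> Hom GG t u" "h \<in> Hom GG u v"
  then show "Comp GG h (Comp GG g f) = Comp GG (Comp GG h g) f"
    using gcomp_assoc by (auto simp: GG_simps(2,6))
qed

lemma Gflat_cases: "h \<in> Hom GG s t \<Longrightarrow> h \<in> Gflat s t \<or> h = Arr s t None"
  by (cases "mor h") (auto simp: Gflat_def GG_simps(2))

lemma Gflat_Hom: "h \<in> Gflat s t \<Longrightarrow> h \<in> Hom GG s t"
  by (simp add: Gflat_def)

lemma zero_notin_Gflat: "Arr s t None \<notin> Gflat u v"
  by (simp add: Gflat_def)

lemma zero_in_Hom: "s \<in> Ob GG \<Longrightarrow> t \<in> Ob GG \<Longrightarrow> Arr s t None \<in> Hom GG s t"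
  by (simp add: GG_simps(2) None_in_ghom)

lemma Comp_zero:
  "Comp GG (Arr s t None) f = Arr (src f) t None" "Comp GG g (Arr s t None) = Arr s (tgt g) None"
  by (simp_all add: GG_simps(6) gcomp_None)

lemma Gflat_Star: "Gflat Star t = {}" "Gflat s Star = {}"
  by (cases s; auto simp: Gflat_def GG_simps(2) elim!: ghom_cases)+

lemma finite_Gflat: "finite (Gflat s t)"
proof -
  have "finite (ghom s t)"
  proof (cases "(s, t)" rule: ghom.cases)
    case (1 ns ms)
    let ?B = "Max (insert 1 (set ns \<union> set ms))"
    have "gpairs ns ms \<subseteq> ({..<length ns} \<rightarrow>\<^sub>E {..<length ms}) \<times> ({..<length ms} \<rightarrow>\<^sub>E (\<Union>a\<le>?B. \<Union>b\<le>?B. pmaps a b))"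
    proof
      fix p assume "p \<in> gpairs ns ms"
      then obtain f \<psi> where p: "p = (f, \<psi>)" "(f, \<psi>) \<in> gpre ns ms" "f \<in> {..<length ns} \<rightarrow>\<^sub>E {..<length ms}"
        by (cases p) (auto simp: gpairs_gpre gpre_def)
      have "\<psi> j \<in> (\<Union>a\<le>?B. \<Union>b\<le>?B. pmaps a b)" if j: "j < length ms" for j
      proof -
        have "gsrc ns f j \<le> ?B"
        proof (cases "j \<in> f ` {..<length ns}")
          case True
          then obtain i where "i < length ns" "j = f i" by auto
          then show ?thesis using gsrc_image[OF gpreD(2)[OF p(2)]] by simp
        qed (simp add: gsrc_off)
        moreover have "ms ! j \<le> ?B" using j by simp
        ultimately show ?thesis using gpreD(3)[OF p(2) j] by blast
      qed
      then show "p \<in> ({..<length ns} \<rightarrow>\<^sub>E {..<length ms}) \<times> ({..<length ms} \<rightarrow>\<^sub>E (\<Union>a\<le>?B. \<Union>b\<le>?B. pmaps a b))"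
        using p gpreD(5)[OF p(2)] by (auto simp: PiE_iff extensional_def)
    qed
    then have "finite (gpairs ns ms)"
      by (rule finite_subset) (intro finite_cartesian_product finite_PiE finite_UN_I finite_pmaps; simp)
    then show ?thesis using 1 by simp
  qed simp_all
  then have "finite (Arr s t ` ghom s t)" by simp
  then show ?thesis by (rule finite_subset[rotated]) (auto simp: Gflat_def GG_simps(2))
qed

subsection \<open>The embedding of pointed sets into tuples\<close>

lemma i_ob_Ob: "i_ob n \<in> Ob GG"
  by (simp add: i_ob_def GG_simps(1))

lemma gsrc_single: "gsrc [m] (\<lambda>k\<in>{..<1}. k) 0 = m"
  using gsrc_image[of "\<lambda>k\<in>{..<1}. k" "[m]" 0] by simp

lemma single_gpairs:
  "(\<lambda>k\<in>{..<1}. k, \<lambda>k\<in>{..<1}. \<phi>) \<in> gpairs [m] [n] \<longleftrightarrow> \<phi> \<in> pmaps m n \<and> \<phi> \<noteq> pzero m"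
  using gsrc_single[of m] by (auto simp: gpairs_def extensional_def)

lemma gpairs_single:
  assumes "p \<in> gpairs [m] [n]"
  obtains \<phi> where "p = (\<lambda>k\<in>{..<1}. k, \<lambda>k\<in>{..<1}. \<phi>)" "\<phi> \<in> pmaps m n" "\<phi> \<noteq> pzero m"
proof -
  obtain f \<psi> where p: "p = (f, \<psi>)" by (cases p)
  then have "f \<in> {..<1} \<rightarrow>\<^sub>E {..<1}" "\<psi> \<in> extensional {..<1}" using assms by (auto simp: gpairs_def)
  then have "f = (\<lambda>k\<in>{..<1}. k)" "\<psi> = (\<lambda>k\<in>{..<1}. \<psi> 0)" by (auto simp: fun_eq_iff PiE_iff extensional_def)
  then show ?thesis using that[of "\<psi> 0"] assms single_gpairs[of "\<psi> 0" m n] p by metis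
qed

lemma i_ar_zero: "i_ar (Arr m n (pzero m)) = Arr (i_ob m) (i_ob n) None"
  by (simp add: i_ar_def)

lemma i_ar_Hom:
  assumes "a \<in> Hom FF m n"
  shows "i_ar a \<in> Hom GG (i_ob m) (i_ob n)"
proof -
  obtain \<phi> where a: "a = Arr m n \<phi>" "\<phi> \<in> pmaps m n" using assms by (auto simp: FF_simps)
  show ?thesis
  proof (cases "\<phi> = pzero m")
    case True
    then show ?thesis using a by (simp add: i_ar_zero zero_in_Hom i_ob_Ob)
  next
    case False
    then have "m \<noteq> 0" "n \<noteq> 0" using a pmaps_from_0 pmaps_to_0 by auto
    then show ?thesis using a False single_gpairs[of \<phi> m n]
      by (auto simp: i_ar_def GG_simps(2) i_ob_Ob) (auto simp: i_ob_def)
  qed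
qed

lemma i_ar_id: "i_ar (Id FF n) = Id GG (i_ob n)"
proof (cases "n = 0")
  case True
  have "(\<lambda>x\<in>{..0}. x) = pzero 0" by (simp add: pzero_def fun_eq_iff)
  then show ?thesis using True by (simp add: FF_simps GG_simps(5) i_ar_def i_ob_def)
next
  case False
  have "(\<lambda>x\<in>{..n}. x) \<noteq> pzero n"
    using False by (intro ident_neq_pzero) simp
  then show ?thesis using False by (auto simp: FF_simps GG_simps(5) i_ar_def i_ob_def fun_eq_iff)
qed

lemma i_ar_comp:
  assumes "a \<in> Hom FF l m" "b \<in> Hom FF m n"
  shows "i_ar (Comp FF b a) = Comp GG (i_ar b) (i_ar a)"
proof -
  obtain \<phi> where a: "a = Arr l m \<phi>" "\<phi> \<in> pmaps l m" using assms by (auto simp: FF_simps)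
  obtain \<psi> where b: "b = Arr m n \<psi>" "\<psi> \<in> pmaps m n" using assms by (auto simp: FF_simps)
  show ?thesis
  proof (cases "\<phi> = pzero l \<or> \<psi> = pzero m")
    case True
    then have "compose {..l} \<psi> \<phi> = pzero l" using a b compose_pzero by auto
    then show ?thesis using a b True by (auto simp: FF_simps i_ar_def Comp_zero)
  next
    case False
    then have pos: "l \<noteq> 0" "m \<noteq> 0" "n \<noteq> 0" using a b pmaps_from_0 pmaps_to_0 by auto
    let ?i = "\<lambda>k\<in>{..<1::nat}. k"
    have p: "(?i, \<lambda>k\<in>{..<1}. \<phi>) \<in> gpre [l] [m]" and q: "(?i, \<lambda>k\<in>{..<1}. \<psi>) \<in> gpre [m] [n]"
      using single_gpairs a b False by (auto simp: gpairs_gpre)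
    have 1: "fst (graw [l] [m] [n] (?i, \<lambda>k\<in>{..<1}. \<psi>) (?i, \<lambda>k\<in>{..<1}. \<phi>)) = ?i"
      unfolding graw_fst[OF q p] by (auto simp: compose_def fun_eq_iff)
    have "snd (graw [l] [m] [n] (?i, \<lambda>k\<in>{..<1}. \<psi>) (?i, \<lambda>k\<in>{..<1}. \<phi>)) 0 = compose {..l} \<psi> \<phi>"
      using graw_image[OF q p, of 0] gsrc_single by simp
    then have 2: "snd (graw [l] [m] [n] (?i, \<lambda>k\<in>{..<1}. \<psi>) (?i, \<lambda>k\<in>{..<1}. \<phi>)) = (\<lambda>k\<in>{..<1}. compose {..l} \<psi> \<phi>)"
      using graw_undefined[OF q p] by (auto simp: fun_eq_iff)
    have 3: "graw [l] [m] [n] (?i, \<lambda>k\<in>{..<1}. \<psi>) (?i, \<lambda>k\<in>{..<1}. \<phi>) = (?i, \<lambda>k\<in>{..<1}. compose {..l} \<psi> \<phi>)"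
      using 1 2 by (metis prod.collapse)
    have "gzero [l] [n] (?i, \<lambda>k\<in>{..<1}. compose {..l} \<psi> \<phi>) \<longleftrightarrow> compose {..l} \<psi> \<phi> = pzero l"
      using gsrc_single[of l] by (simp add: gzero_def)
    then have "gcomp (i_ar b) (i_ar a) = mor (i_ar (Comp FF b a))"
      using False pos a b unfolding i_ar_def de_Morgan_disj
      by (simp only: arr.sel FF_simps i_ob_def if_False gcomp_graw 3)
    then show ?thesis by (simp add: GG_simps(6) i_ar_def FF_simps a b)
  qed
qed

text \<open>An injection between sets with one element is the identity, so that a morphism between tuples of length
  one is a single pointed map.\<close>

lemma i_ar_full:
  assumes "h \<in> Gflat (i_ob m) (i_ob n)"
  obtains a where "a \<in> Hom FF m n" "h = i_ar a"
proof -
  have pos: "m \<noteq> 0" "n \<noteq> 0" using assms Gflat_Star by (auto simp: i_ob_def split: if_splits)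
  then obtain p where p: "h = Arr (Tup [m]) (Tup [n]) (Some p)" "p \<in> gpairs [m] [n]"
    using assms by (auto simp: Gflat_def GG_simps(2) i_ob_def)
  obtain \<phi> where \<phi>: "p = (\<lambda>k\<in>{..<1}. k, \<lambda>k\<in>{..<1}. \<phi>)" "\<phi> \<in> pmaps m n" "\<phi> \<noteq> pzero m"
    using gpairs_single[OF p(2)] .
  show ?thesis
    by (rule that[of "Arr m n \<phi>"]) (use \<phi> p pos in \<open>auto simp: FF_simps i_ar_def i_ob_def\<close>)
qed

lemma ifun_simps: "OMap ifun n = i_ob n" "a \<in> Hom FF m n \<Longrightarrow> AMap ifun a = i_ar a"
  by (auto simp: ifun_def FF_simps)

lemma is_ftor_ifun: "is_ftor FF GG ifun"
proof (rule is_ftorI)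
  fix f assume f: "f \<in> Ar FF"
  then show "AMap ifun f \<in> Hom GG (OMap ifun (Dom FF f)) (OMap ifun (Cod FF f))"
    using cat_Ar[OF category_FF f] by (simp add: ifun_simps(1) ifun_simps(2)[OF cat_Ar[OF category_FF f]] i_ar_Hom)
next
  fix n :: nat
  show "AMap ifun (Id FF n) = Id GG (OMap ifun n)"
    using cat_id[OF category_FF, of n] by (simp add: ifun_simps(1) ifun_simps(2)[of _ n n] i_ar_id FF_simps(1))
next
  fix f g a b c assume f: "f \<in> Hom FF a b" and g: "g \<in> Hom FF b c"
  then show "AMap ifun (Comp FF g f) = Comp GG (AMap ifun g) (AMap ifun f)"
    by (simp add: ifun_simps(2)[OF f] ifun_simps(2)[OF g] ifun_simps(2)[OF cat_comp[OF category_FF f g]] i_ar_comp)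
qed (auto simp: ifun_def FF_simps i_ob_Ob)

section \<open>The left adjoint as a universal cocone\<close>

locale pointed_category =
  fixes C :: "('o, 'm) cat" and T :: 'o
  assumes C: "category C" and T: "terminal_object C T"
begin

abbreviation cmp (infixr "\<cdot>" 70) where "g \<cdot> f \<equiv> Comp C g f"

lemmas comp_in = cat_comp[OF C]
lemmas assoc = cat_assoc[OF C]
lemmas idl = cat_idl[OF C]
lemmas idr = cat_idr[OF C]

lemma T_Ob: "T \<in> Ob C"
  using T by (simp add: terminal_object_def)

lemma idT: "Id C T \<in> Hom C T T"
  by (rule cat_id[OF C T_Ob])

lemma to_T_unique: "f \<in> Hom C A T \<Longrightarrow> g \<in> Hom C A T \<Longrightarrow> f = g"
  using T cat_Ob(1)[OF C] unfolding terminal_object_def by blast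

definition pointed_diagram :: "('o, 'm) gamma_ob \<Rightarrow> bool" where
  "pointed_diagram X \<longleftrightarrow> is_ftor FF C X \<and> OMap X 0 = T"

context
  fixes X assumes X: "pointed_diagram X"
begin

lemma X_ftor: "is_ftor FF C X" and X_0: "OMap X 0 = T"
  using X by (simp_all add: pointed_diagram_def)

lemma X_Ob: "OMap X n \<in> Ob C"
  using ftorD(1)[OF X_ftor] by (simp add: FF_simps)

lemma X_in: "a \<in> Hom FF m n \<Longrightarrow> AMap X a \<in> Hom C (OMap X m) (OMap X n)"
  by (rule ftorD(2)[OF X_ftor])

lemma zero_FF: "Arr m n (pzero m) \<in> Hom FF m n"
  by (simp add: FF_simps pzero_in)

lemma basepoint_in: "basepoint X n \<in> Hom C T (OMap X n)"
  using X_in[OF zero_FF[of 0 n]] by (simp add: basepoint_def X_0)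

lemma collapse_in: "collapse X n \<in> Hom C (OMap X n) T"
  using X_in[OF zero_FF[of n 0]] by (simp add: collapse_def X_0)

lemma collapse_X: "a \<in> Hom FF m n \<Longrightarrow> collapse X n \<cdot> AMap X a = collapse X m"
  by (rule to_T_unique[OF comp_in[OF X_in collapse_in] collapse_in])

lemma X_basepoint: "a \<in> Hom FF m n \<Longrightarrow> AMap X a \<cdot> basepoint X m = basepoint X n"
proof -
  assume a: "a \<in> Hom FF m n"
  have "Comp FF a (Arr 0 m (pzero 0)) = Arr 0 n (pzero 0)"
    using a compose_pzero(1)[of _ m n 0] by (auto simp: FF_simps)
  then show ?thesis
    using ftorD(4)[OF X_ftor zero_FF a, of 0] by (simp add: basepoint_def)
qed

lemma X_id: "AMap X (Id FF n) = Id C (OMap X n)"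
  using ftorD(3)[OF X_ftor] by (simp add: FF_simps(1))

lemma X_comp: "a \<in> Hom FF l m \<Longrightarrow> b \<in> Hom FF m n \<Longrightarrow> AMap X (Comp FF b a) = AMap X b \<cdot> AMap X a"
  by (rule ftorD(4)[OF X_ftor])

end

text \<open>A family \<open>j\<close> indexed by the nonzero morphisms \<open>i n \<rightarrow> t\<close>, extended to the zero morphism by
  the constant map at \<open>q\<close>.\<close>

definition leg :: "('o, 'm) gamma_ob \<Rightarrow> gobj \<Rightarrow> 'm \<Rightarrow> (nat \<Rightarrow> gar \<Rightarrow> 'm) \<Rightarrow> nat \<Rightarrow> gar \<Rightarrow> 'm" where
  "leg X t q j n h = (if h \<in> Gflat (i_ob n) t then j n h else q \<cdot> collapse X n)"

text \<open>The compatible families from which the coend of wedges is glued: precomposition of the leg at \<open>h\<close> with the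
  map induced by \<open>a\<close> is the leg at \<open>h \<circ> i a\<close>, which is constant at \<open>q\<close> if this composite is zero.\<close>

definition cocone :: "('o, 'm) gamma_ob \<Rightarrow> gobj \<Rightarrow> 'o \<Rightarrow> 'm \<Rightarrow> (nat \<Rightarrow> gar \<Rightarrow> 'm) \<Rightarrow> bool" where
  "cocone X t Z q j \<longleftrightarrow> q \<in> Hom C T Z \<and> (\<forall>n. \<forall>h\<in>Gflat (i_ob n) t. j n h \<in> Hom C (OMap X n) Z) \<and>
     (\<forall>m n. \<forall>a\<in>Hom FF m n. \<forall>h\<in>Gflat (i_ob n) t.
        j n h \<cdot> AMap X a = leg X t q j m (Comp GG h (i_ar a)))"

definition ucocone :: "('o, 'm) gamma_ob \<Rightarrow> gobj \<Rightarrow> 'o \<Rightarrow> 'm \<Rightarrow> (nat \<Rightarrow> gar \<Rightarrow> 'm) \<Rightarrow> bool" where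
  "ucocone X t E q j \<longleftrightarrow> cocone X t E q j \<and>
     (\<forall>Z r k. cocone X t Z r k \<longrightarrow>
        (\<exists>!u. u \<in> Hom C E Z \<and> u \<cdot> q = r \<and> (\<forall>n. \<forall>h\<in>Gflat (i_ob n) t. u \<cdot> j n h = k n h)))"

context
  fixes X assumes X: "pointed_diagram X"
begin

lemma cocone_base:
  assumes "cocone X t Z q j" "h \<in> Gflat (i_ob n) t"
  shows "j n h \<cdot> basepoint X n = q"
proof -
  have "q \<in> Hom C T Z" using assms(1) by (simp add: cocone_def)
  then have "q \<cdot> collapse X 0 = q"
    using idr to_T_unique[OF _ idT, of "collapse X 0"] collapse_in[OF X, of 0] by (simp add: X_0[OF X])
  moreover have "Comp GG h (i_ar (Arr 0 n (pzero 0))) \<notin> Gflat (i_ob 0) t"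
    by (simp add: i_ob_def Gflat_Star)
  ultimately show ?thesis
    using assms zero_FF[OF X, of 0 n] unfolding cocone_def basepoint_def leg_def by auto
qed

lemma leg_in: "cocone X t Z q j \<Longrightarrow> leg X t q j n h \<in> Hom C (OMap X n) Z"
  using comp_in[OF collapse_in[OF X]] by (auto simp: cocone_def leg_def)

lemma leg_X:
  assumes j: "cocone X t Z q j" and h: "h \<in> Hom GG (i_ob n) t" and a: "a \<in> Hom FF m n"
  shows "leg X t q j n h \<cdot> AMap X a = leg X t q j m (Comp GG h (i_ar a))"
proof (cases "h \<in> Gflat (i_ob n) t")
  case True
  then show ?thesis using j a by (simp add: cocone_def leg_def)
next
  case False
  then have "h = Arr (i_ob n) t None" using Gflat_cases[OF h] by simp
  then have "Comp GG h (i_ar a) \<notin> Gflat (i_ob m) t" by (simp add: Comp_zero zero_notin_Gflat)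
  moreover have "q \<in> Hom C T Z" using j by (simp add: cocone_def)
  then have "(q \<cdot> collapse X n) \<cdot> AMap X a = q \<cdot> collapse X m"
    using assoc[OF X_in[OF X a] collapse_in[OF X]] collapse_X[OF X a] by metis
  ultimately show ?thesis using False by (simp add: leg_def)
qed

lemma comp_leg:
  assumes "cocone X t Z q j" "u \<in> Hom C Z Z'"
  shows "u \<cdot> leg X t q j n h = leg X t (u \<cdot> q) (\<lambda>n h. u \<cdot> j n h) n h"
  using assms assoc[OF collapse_in[OF X] _ assms(2)] by (simp add: leg_def cocone_def)

lemma cocone_comp:
  assumes j: "cocone X t Z q j" and u: "u \<in> Hom C Z Z'"
  shows "cocone X t Z' (u \<cdot> q) (\<lambda>n h. u \<cdot> j n h)"
  unfolding cocone_def
proof (intro conjI allI ballI)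
  fix m n a h assume a: "a \<in> Hom FF m n" and h: "h \<in> Gflat (i_ob n) t"
  have "j n h \<in> Hom C (OMap X n) Z" using j h by (simp add: cocone_def)
  then have "(u \<cdot> j n h) \<cdot> AMap X a = u \<cdot> (j n h \<cdot> AMap X a)"
    using assoc[OF X_in[OF X a] _ u] by simp
  also have "\<dots> = u \<cdot> leg X t q j m (Comp GG h (i_ar a))" using j a h by (simp add: cocone_def)
  finally show "(u \<cdot> j n h) \<cdot> AMap X a = leg X t (u \<cdot> q) (\<lambda>n h. u \<cdot> j n h) m (Comp GG h (i_ar a))"
    using comp_leg[OF j u] by simp
qed (use j comp_in[OF _ u] in \<open>auto simp: cocone_def\<close>)

lemma ucocone_ex:
  assumes "ucocone X t E q j" "cocone X t Z r k"
  obtains u where "u \<in> Hom C E Z" "u \<cdot> q = r" "\<And>n h. h \<in> Gflat (i_ob n) t \<Longrightarrow> u \<cdot> j n h = k n h"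
  using assms unfolding ucocone_def by blast

lemma ucocone_eq:
  assumes U: "ucocone X t E q j" and "u \<in> Hom C E Z" "v \<in> Hom C E Z" "u \<cdot> q = v \<cdot> q"
    "\<And>n h. h \<in> Gflat (i_ob n) t \<Longrightarrow> u \<cdot> j n h = v \<cdot> j n h"
  shows "u = v"
proof -
  have "cocone X t E q j" using U by (simp add: ucocone_def)
  then have "cocone X t Z (v \<cdot> q) (\<lambda>n h. v \<cdot> j n h)" using cocone_comp assms by blast
  then have "\<exists>!u. u \<in> Hom C E Z \<and> u \<cdot> q = v \<cdot> q \<and> (\<forall>n. \<forall>h\<in>Gflat (i_ob n) t. u \<cdot> j n h = v \<cdot> j n h)"
    using U unfolding ucocone_def by blast
  then show ?thesis using assms by blast
qed

end

subsection \<open>Wedges and coends\<close>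

lemma is_wedgeD:
  assumes "is_wedge C T H A b V inc pt"
  shows "V \<in> Ob C" "pt \<in> Hom C T V" "h \<in> H \<Longrightarrow> inc h \<in> Hom C A V" "h \<in> H \<Longrightarrow> inc h \<cdot> b = pt"
  using assms by (auto simp: is_wedge_def)

lemma wedge_ex1:
  assumes W: "is_wedge C T H A b V inc pt" and q: "q \<in> Hom C T Z"
    and j: "\<forall>h\<in>H. j h \<in> Hom C A Z \<and> j h \<cdot> b = q"
  shows "\<exists>!u. u \<in> Hom C V Z \<and> u \<cdot> pt = q \<and> (\<forall>h\<in>H. u \<cdot> inc h = j h)"
proof -
  have "\<forall>Z\<in>Ob C. \<forall>q\<in>Hom C T Z. \<forall>j. (\<forall>h\<in>H. j h \<in> Hom C A Z \<and> j h \<cdot> b = q) \<longrightarrow>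
        (\<exists>!u. u \<in> Hom C V Z \<and> u \<cdot> pt = q \<and> (\<forall>h\<in>H. u \<cdot> inc h = j h))"
    using W unfolding is_wedge_def by (elim conjE)
  from this[THEN bspec, OF cat_Ob(2)[OF C q], THEN bspec, OF q, THEN spec, THEN mp, OF j] show ?thesis .
qed

lemma wedge_ex:
  assumes "is_wedge C T H A b V inc pt" "q \<in> Hom C T Z" "\<And>h. h \<in> H \<Longrightarrow> j h \<in> Hom C A Z" "\<And>h. h \<in> H \<Longrightarrow> j h \<cdot> b = q"
  obtains u where "u \<in> Hom C V Z" "u \<cdot> pt = q" "\<And>h. h \<in> H \<Longrightarrow> u \<cdot> inc h = j h"
proof -
  have "\<exists>!u. u \<in> Hom C V Z \<and> u \<cdot> pt = q \<and> (\<forall>h\<in>H. u \<cdot> inc h = j h)"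
    by (rule wedge_ex1[OF assms(1,2)]) (use assms in auto)
  then show ?thesis using that by (elim ex1E conjE) blast
qed

lemma wedge_eq:
  assumes W: "is_wedge C T H A b V inc pt" and b: "b \<in> Hom C T A" and u: "u \<in> Hom C V Z" and v: "v \<in> Hom C V Z"
    and eq: "u \<cdot> pt = v \<cdot> pt" "\<And>h. h \<in> H \<Longrightarrow> u \<cdot> inc h = v \<cdot> inc h"
  shows "u = v"
proof -
  have 1: "v \<cdot> pt \<in> Hom C T Z" by (rule comp_in[OF is_wedgeD(2)[OF W] v])
  have 2: "\<forall>h\<in>H. v \<cdot> inc h \<in> Hom C A Z \<and> (v \<cdot> inc h) \<cdot> b = v \<cdot> pt"
    using comp_in[OF is_wedgeD(3)[OF W] v] assoc[OF b is_wedgeD(3)[OF W] v] is_wedgeD(4)[OF W] by simp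
  have "\<exists>!u. u \<in> Hom C V Z \<and> u \<cdot> pt = v \<cdot> pt \<and> (\<forall>h\<in>H. u \<cdot> inc h = v \<cdot> inc h)"
    by (rule wedge_ex1[OF W 1 2])
  then show ?thesis using u v eq by (elim ex1E) metis
qed

context
  fixes X t S inc pt assumes X: "pointed_diagram X" and I: "is_integrand C T X t S inc pt"
begin

lemma S_ftor: "is_ftor (prod_cat (opp FF) FF) C S"
  using I by (simp add: is_integrand_def)

lemma S_wedge: "is_wedge C T (Gflat (i_ob n) t) (OMap X m) (basepoint X m) (OMap S (n, m)) (inc (n, m)) (pt (n, m))"
  using I by (simp add: is_integrand_def)

lemma S_in:
  assumes "a \<in> Hom FF m n" "b \<in> Hom FF k l"
  shows "AMap S (a, b) \<in> Hom C (OMap S (n, k)) (OMap S (m, l))"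
proof (rule ftorD(2)[OF S_ftor])
  show "(a, b) \<in> Hom (prod_cat (opp FF) FF) (n, k) (m, l)"
    using assms by (auto simp: Hom_def prod_cat_def opp_def)
qed

lemma S_pt: "a \<in> Hom FF m n \<Longrightarrow> b \<in> Hom FF k l \<Longrightarrow> AMap S (a, b) \<cdot> pt (n, k) = pt (m, l)"
proof -
  assume "a \<in> Hom FF m n" "b \<in> Hom FF k l"
  then have "a \<in> Ar FF" "b \<in> Ar FF" "src a = m" "tgt a = n" "src b = k" "tgt b = l"
    by (auto simp: Hom_def FF_simps)
  then show ?thesis using I unfolding is_integrand_def by blast
qed

lemma S_inc:
  assumes a: "a \<in> Hom FF m n" and b: "b \<in> Hom FF k l" and h: "h \<in> Gflat (i_ob n) t"
  shows "AMap S (a, b) \<cdot> inc (n, k) h = (if Comp GG h (i_ar a) \<in> Gflat (i_ob m) t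
     then inc (m, l) (Comp GG h (i_ar a)) \<cdot> AMap X b else pt (m, l) \<cdot> collapse X k)"
proof -
  have "a \<in> Ar FF" "b \<in> Ar FF" "src a = m" "tgt a = n" "src b = k" "tgt b = l"
    using a b by (auto simp: Hom_def FF_simps)
  then show ?thesis using I h unfolding is_integrand_def Let_def by metis
qed

text \<open>A map out of a wedge is a family of maps that agree at the basepoints.  Hence the cowedges under the
  integrand are the cocones, and coends of the integrand are universal cocones.\<close>

lemma cowedge_pt:
  assumes W: "is_cowedge FF C S Z \<zeta>"
  shows "\<zeta> n \<cdot> pt (n, n) = \<zeta> m \<cdot> pt (m, m)"
proof -
  have a: "Arr n m (pzero n) \<in> Hom FF n m" by (rule zero_FF[OF X])
  have z: "\<zeta> k \<in> Hom C (OMap S (k, k)) Z" for k using W by (simp add: is_cowedge_def FF_simps(1))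
  have i: "Id FF k \<in> Hom FF k k" for k by (rule cat_id[OF category_FF]) (simp add: FF_simps)
  have p: "pt (m, n) \<in> Hom C T (OMap S (m, n))" by (rule is_wedgeD(2)[OF S_wedge])
  have eq: "\<zeta> n \<cdot> AMap S (Arr n m (pzero n), Id FF n) = \<zeta> m \<cdot> AMap S (Id FF m, Arr n m (pzero n))"
    using W HomD(1)[OF a] unfolding is_cowedge_def by (auto simp: FF_simps(4,5))
  have "\<zeta> n \<cdot> pt (n, n) = (\<zeta> n \<cdot> AMap S (Arr n m (pzero n), Id FF n)) \<cdot> pt (m, n)"
    using assoc[OF p S_in[OF a i] z] S_pt[OF a i] by simp
  also have "\<dots> = \<zeta> m \<cdot> pt (m, m)"
    unfolding eq using assoc[OF p S_in[OF i a] z] S_pt[OF i a] by simp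
  finally show ?thesis .
qed

lemma cocone_of_cowedge:
  assumes W: "is_cowedge FF C S Z \<zeta>"
  shows "cocone X t Z (\<zeta> 0 \<cdot> pt (0, 0)) (\<lambda>n h. \<zeta> n \<cdot> inc (n, n) h)"
  unfolding cocone_def
proof (intro conjI allI ballI)
  have z: "\<zeta> k \<in> Hom C (OMap S (k, k)) Z" for k using W by (simp add: is_cowedge_def FF_simps(1))
  have i: "Id FF k \<in> Hom FF k k" for k by (rule cat_id[OF category_FF]) (simp add: FF_simps)
  have inc_in: "inc (n, m) h \<in> Hom C (OMap X m) (OMap S (n, m))" if "h \<in> Gflat (i_ob n) t" for n m h
    by (rule is_wedgeD(3)[OF S_wedge that])
  have pt_in: "pt (n, m) \<in> Hom C T (OMap S (n, m))" for n m by (rule is_wedgeD(2)[OF S_wedge])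
  show "\<zeta> 0 \<cdot> pt (0, 0) \<in> Hom C T Z" by (rule comp_in[OF pt_in z])
  show "\<zeta> n \<cdot> inc (n, n) h \<in> Hom C (OMap X n) Z" if "h \<in> Gflat (i_ob n) t" for n h
    by (rule comp_in[OF inc_in[OF that] z])
  fix m n a h assume a: "a \<in> Hom FF m n" and h: "h \<in> Gflat (i_ob n) t"
  let ?h = "Comp GG h (i_ar a)"
  have eq: "\<zeta> m \<cdot> AMap S (a, Id FF m) = \<zeta> n \<cdot> AMap S (Id FF n, a)"
    using W HomD[OF a] unfolding is_cowedge_def by auto
  have hid: "Comp GG h (i_ar (Id FF n)) = h"
    unfolding i_ar_id by (rule cat_idr[OF category_GG Gflat_Hom[OF h]])
  have "(\<zeta> n \<cdot> inc (n, n) h) \<cdot> AMap X a = \<zeta> n \<cdot> (inc (n, n) h \<cdot> AMap X a)"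
    by (rule assoc[OF X_in[OF X a] inc_in[OF h] z, symmetric])
  also have "\<dots> = \<zeta> n \<cdot> (AMap S (Id FF n, a) \<cdot> inc (n, m) h)"
    using S_inc[OF i a h] hid h by simp
  also have "\<dots> = \<zeta> m \<cdot> (AMap S (a, Id FF m) \<cdot> inc (n, m) h)"
    using assoc[OF inc_in[OF h] S_in[OF i a] z] assoc[OF inc_in[OF h] S_in[OF a i] z] eq by simp
  also have "\<dots> = leg X t (\<zeta> 0 \<cdot> pt (0, 0)) (\<lambda>n h. \<zeta> n \<cdot> inc (n, n) h) m ?h"
  proof (cases "?h \<in> Gflat (i_ob m) t")
    case True
    then show ?thesis using S_inc[OF a i h, of m] idr[OF inc_in[OF True]] by (simp add: leg_def X_id[OF X])
  next
    case False
    then show ?thesis using S_inc[OF a i h, of m] cowedge_pt[OF W, of m 0] assoc[OF collapse_in[OF X] pt_in z]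
      by (simp add: leg_def)
  qed
  finally show "(\<zeta> n \<cdot> inc (n, n) h) \<cdot> AMap X a = leg X t (\<zeta> 0 \<cdot> pt (0, 0)) (\<lambda>n h. \<zeta> n \<cdot> inc (n, n) h) m ?h" .
qed

lemma cowedge_of_cocone:
  assumes J: "cocone X t Z q j"
    and z: "\<And>n. \<zeta> n \<in> Hom C (OMap S (n, n)) Z" and zp: "\<And>n. \<zeta> n \<cdot> pt (n, n) = q"
    and zi: "\<And>n h. h \<in> Gflat (i_ob n) t \<Longrightarrow> \<zeta> n \<cdot> inc (n, n) h = j n h"
  shows "is_cowedge FF C S Z \<zeta>"
  unfolding is_cowedge_def
proof (intro conjI ballI)
  show "Z \<in> Ob C" using cat_Ob(2)[OF C z] .
  show "\<zeta> n \<in> Hom C (OMap S (n, n)) Z" for n by (rule z)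
  have i: "Id FF k \<in> Hom FF k k" for k by (rule cat_id[OF category_FF]) (simp add: FF_simps)
  have inc_in: "inc (n, m) h \<in> Hom C (OMap X m) (OMap S (n, m))" if "h \<in> Gflat (i_ob n) t" for n m h
    by (rule is_wedgeD(3)[OF S_wedge that])
  have pt_in: "pt (n, m) \<in> Hom C T (OMap S (n, m))" for n m by (rule is_wedgeD(2)[OF S_wedge])
  fix a assume "a \<in> Ar FF"
  then obtain m n where a: "a \<in> Hom FF m n" and mn: "Dom FF a = m" "Cod FF a = n" by (simp add: Hom_def)
  show "\<zeta> (Dom FF a) \<cdot> AMap S (a, Id FF (Dom FF a)) = \<zeta> (Cod FF a) \<cdot> AMap S (Id FF (Cod FF a), a)"
    unfolding mn
  proof (rule wedge_eq[OF S_wedge[of n m] basepoint_in[OF X]])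
    show "\<zeta> m \<cdot> AMap S (a, Id FF m) \<in> Hom C (OMap S (n, m)) Z" "\<zeta> n \<cdot> AMap S (Id FF n, a) \<in> Hom C (OMap S (n, m)) Z"
      by (rule comp_in[OF S_in[OF a i] z], rule comp_in[OF S_in[OF i a] z])
    show "(\<zeta> m \<cdot> AMap S (a, Id FF m)) \<cdot> pt (n, m) = (\<zeta> n \<cdot> AMap S (Id FF n, a)) \<cdot> pt (n, m)"
      using assoc[OF pt_in S_in[OF a i] z] assoc[OF pt_in S_in[OF i a] z] S_pt[OF a i] S_pt[OF i a] zp by simp
    fix h assume h: "h \<in> Gflat (i_ob n) t"
    let ?h = "Comp GG h (i_ar a)"
    have hid: "Comp GG h (i_ar (Id FF n)) = h"
      unfolding i_ar_id by (rule cat_idr[OF category_GG Gflat_Hom[OF h]])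
    have "(\<zeta> m \<cdot> AMap S (a, Id FF m)) \<cdot> inc (n, m) h = \<zeta> m \<cdot> (AMap S (a, Id FF m) \<cdot> inc (n, m) h)"
      by (rule assoc[OF inc_in[OF h] S_in[OF a i] z, symmetric])
    also have "\<dots> = leg X t q j m ?h"
    proof (cases "?h \<in> Gflat (i_ob m) t")
      case True
      then show ?thesis using S_inc[OF a i h, of m] idr[OF inc_in[OF True]] zi[OF True] by (simp add: leg_def X_id[OF X])
    next
      case False
      then show ?thesis using S_inc[OF a i h, of m] zp assoc[OF collapse_in[OF X] pt_in z]
        by (simp add: leg_def)
    qed
    also have "\<dots> = j n h \<cdot> AMap X a" using J a h by (simp add: cocone_def)
    also have "\<dots> = \<zeta> n \<cdot> (inc (n, n) h \<cdot> AMap X a)"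
      unfolding zi[OF h, symmetric] by (rule assoc[OF X_in[OF X a] inc_in[OF h] z, symmetric])
    also have "inc (n, n) h \<cdot> AMap X a = AMap S (Id FF n, a) \<cdot> inc (n, m) h"
      using S_inc[OF i a h] hid h by simp
    also have "\<zeta> n \<cdot> (AMap S (Id FF n, a) \<cdot> inc (n, m) h) = (\<zeta> n \<cdot> AMap S (Id FF n, a)) \<cdot> inc (n, m) h"
      by (rule assoc[OF inc_in[OF h] S_in[OF i a] z])
    finally show "(\<zeta> m \<cdot> AMap S (a, Id FF m)) \<cdot> inc (n, m) h = (\<zeta> n \<cdot> AMap S (Id FF n, a)) \<cdot> inc (n, m) h" .
  qed
qed

lemma cowedge_legs_ex:
  assumes J: "cocone X t Z q j"
  obtains \<zeta> where "\<And>n. \<zeta> n \<in> Hom C (OMap S (n, n)) Z" "\<And>n. \<zeta> n \<cdot> pt (n, n) = q"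
    "\<And>n h. h \<in> Gflat (i_ob n) t \<Longrightarrow> \<zeta> n \<cdot> inc (n, n) h = j n h"
proof -
  have "\<exists>u. u \<in> Hom C (OMap S (n, n)) Z \<and> u \<cdot> pt (n, n) = q \<and> (\<forall>h\<in>Gflat (i_ob n) t. u \<cdot> inc (n, n) h = j n h)" for n
  proof -
    have "q \<in> Hom C T Z" "\<And>h. h \<in> Gflat (i_ob n) t \<Longrightarrow> j n h \<in> Hom C (OMap X n) Z" using J by (simp_all add: cocone_def)
    then show ?thesis
      by (intro ex1_implies_ex wedge_ex1[OF S_wedge] ballI conjI) (simp_all add: cocone_base[OF X J])
  qed
  then show ?thesis using that by metis
qed

lemma cowedge_eq:
  assumes u: "\<And>n. u n \<in> Hom C (OMap S (n, n)) Z" and v: "\<And>n. v n \<in> Hom C (OMap S (n, n)) Z"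
    and "\<And>n. u n \<cdot> pt (n, n) = v n \<cdot> pt (n, n)" "\<And>n h. h \<in> Gflat (i_ob n) t \<Longrightarrow> u n \<cdot> inc (n, n) h = v n \<cdot> inc (n, n) h"
  shows "u n = v n"
  by (rule wedge_eq[OF S_wedge basepoint_in[OF X] u v]) (use assms in auto)

lemma ucocone_of_coend:
  assumes co: "is_coend FF C S E \<omega>"
  shows "ucocone X t E (\<omega> 0 \<cdot> pt (0, 0)) (\<lambda>n h. \<omega> n \<cdot> inc (n, n) h)"
  unfolding ucocone_def
proof (intro conjI allI impI)
  have W: "is_cowedge FF C S E \<omega>" using co by (simp add: is_coend_def)
  have w: "\<omega> k \<in> Hom C (OMap S (k, k)) E" for k using W by (simp add: is_cowedge_def FF_simps(1))
  have inc_in: "inc (n, m) h \<in> Hom C (OMap X m) (OMap S (n, m))" if "h \<in> Gflat (i_ob n) t" for n m h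
    by (rule is_wedgeD(3)[OF S_wedge that])
  have pt_in: "pt (n, m) \<in> Hom C T (OMap S (n, m))" for n m by (rule is_wedgeD(2)[OF S_wedge])
  show "cocone X t E (\<omega> 0 \<cdot> pt (0, 0)) (\<lambda>n h. \<omega> n \<cdot> inc (n, n) h)" by (rule cocone_of_cowedge[OF W])
  fix Z r k assume K: "cocone X t Z r k"
  obtain \<zeta> where z: "\<And>n. \<zeta> n \<in> Hom C (OMap S (n, n)) Z" "\<And>n. \<zeta> n \<cdot> pt (n, n) = r"
    "\<And>n h. h \<in> Gflat (i_ob n) t \<Longrightarrow> \<zeta> n \<cdot> inc (n, n) h = k n h"
    using cowedge_legs_ex[OF K] by blast
  have "is_cowedge FF C S Z \<zeta>" by (rule cowedge_of_cocone[OF K z])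
  then have ex1: "\<exists>!u. u \<in> Hom C E Z \<and> (\<forall>n. u \<cdot> \<omega> n = \<zeta> n)"
    using co by (simp add: is_coend_def FF_simps(1))
  then obtain u where u: "u \<in> Hom C E Z" "\<And>n. u \<cdot> \<omega> n = \<zeta> n" by blast
  show "\<exists>!u. u \<in> Hom C E Z \<and> u \<cdot> (\<omega> 0 \<cdot> pt (0, 0)) = r \<and> (\<forall>n. \<forall>h\<in>Gflat (i_ob n) t. u \<cdot> (\<omega> n \<cdot> inc (n, n) h) = k n h)"
  proof (rule ex1I[of _ u])
    show "u \<in> Hom C E Z \<and> u \<cdot> (\<omega> 0 \<cdot> pt (0, 0)) = r \<and> (\<forall>n. \<forall>h\<in>Gflat (i_ob n) t. u \<cdot> (\<omega> n \<cdot> inc (n, n) h) = k n h)"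
      using u z assoc[OF pt_in w u(1)] assoc[OF inc_in w u(1)] by simp
    fix v assume v: "v \<in> Hom C E Z \<and> v \<cdot> (\<omega> 0 \<cdot> pt (0, 0)) = r \<and> (\<forall>n. \<forall>h\<in>Gflat (i_ob n) t. v \<cdot> (\<omega> n \<cdot> inc (n, n) h) = k n h)"
    then have v1: "v \<in> Hom C E Z" by simp
    have "v \<cdot> \<omega> n = \<zeta> n" for n
    proof (rule cowedge_eq[of "\<lambda>n. v \<cdot> \<omega> n" Z \<zeta>])
      show "v \<cdot> \<omega> n \<in> Hom C (OMap S (n, n)) Z" for n by (rule comp_in[OF w v1])
      show "(v \<cdot> \<omega> n) \<cdot> pt (n, n) = \<zeta> n \<cdot> pt (n, n)" for n
        using assoc[OF pt_in w v1] cowedge_pt[OF W, of n 0] v z(2) by metis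
      show "(v \<cdot> \<omega> n) \<cdot> inc (n, n) h = \<zeta> n \<cdot> inc (n, n) h" if "h \<in> Gflat (i_ob n) t" for n h
        using assoc[OF inc_in[OF that] w v1, symmetric] v z(3) that by simp
    qed (rule z)
    then show "v = u" using ex1 u v1 by blast
  qed
qed

lemma coend_of_ucocone:
  assumes U: "ucocone X t E q j"
  obtains \<omega> where "is_coend FF C S E \<omega>" "\<And>n. \<omega> n \<cdot> pt (n, n) = q"
    "\<And>n h. h \<in> Gflat (i_ob n) t \<Longrightarrow> \<omega> n \<cdot> inc (n, n) h = j n h"
proof -
  have J: "cocone X t E q j" using U by (simp add: ucocone_def)
  have inc_in: "inc (n, m) h \<in> Hom C (OMap X m) (OMap S (n, m))" if "h \<in> Gflat (i_ob n) t" for n m h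
    by (rule is_wedgeD(3)[OF S_wedge that])
  have pt_in: "pt (n, m) \<in> Hom C T (OMap S (n, m))" for n m by (rule is_wedgeD(2)[OF S_wedge])
  obtain \<omega> where w: "\<And>n. \<omega> n \<in> Hom C (OMap S (n, n)) E" "\<And>n. \<omega> n \<cdot> pt (n, n) = q"
    "\<And>n h. h \<in> Gflat (i_ob n) t \<Longrightarrow> \<omega> n \<cdot> inc (n, n) h = j n h"
    using cowedge_legs_ex[OF J] by blast
  have "is_coend FF C S E \<omega>"
    unfolding is_coend_def
  proof (intro conjI allI impI)
    show "is_cowedge FF C S E \<omega>" by (rule cowedge_of_cocone[OF J w])
    fix Z \<zeta> assume W: "is_cowedge FF C S Z \<zeta>"
    then have z: "\<zeta> k \<in> Hom C (OMap S (k, k)) Z" for k by (simp add: is_cowedge_def FF_simps(1))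
    obtain u where u: "u \<in> Hom C E Z" "u \<cdot> q = \<zeta> 0 \<cdot> pt (0, 0)"
      "\<And>n h. h \<in> Gflat (i_ob n) t \<Longrightarrow> u \<cdot> j n h = \<zeta> n \<cdot> inc (n, n) h"
      using ucocone_ex[OF X U cocone_of_cowedge[OF W]] by blast
    show "\<exists>!u. u \<in> Hom C E Z \<and> (\<forall>n\<in>Ob FF. u \<cdot> \<omega> n = \<zeta> n)"
    proof (rule ex1I[of _ u])
      have "u \<cdot> \<omega> n = \<zeta> n" for n
      proof (rule cowedge_eq[of "\<lambda>n. u \<cdot> \<omega> n" Z \<zeta>])
        show "u \<cdot> \<omega> n \<in> Hom C (OMap S (n, n)) Z" for n by (rule comp_in[OF w(1) u(1)])
        show "(u \<cdot> \<omega> n) \<cdot> pt (n, n) = \<zeta> n \<cdot> pt (n, n)" for n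
          using assoc[OF pt_in w(1) u(1), symmetric] cowedge_pt[OF W, of n 0] u(2) w(2) by simp
        show "(u \<cdot> \<omega> n) \<cdot> inc (n, n) h = \<zeta> n \<cdot> inc (n, n) h" if "h \<in> Gflat (i_ob n) t" for n h
          using assoc[OF inc_in[OF that] w(1) u(1), symmetric] u(3)[OF that] w(3)[OF that] by simp
      qed (rule z)
      then show "u \<in> Hom C E Z \<and> (\<forall>n\<in>Ob FF. u \<cdot> \<omega> n = \<zeta> n)" using u by simp
      fix v assume v: "v \<in> Hom C E Z \<and> (\<forall>n\<in>Ob FF. v \<cdot> \<omega> n = \<zeta> n)"
      then have v1: "v \<in> Hom C E Z" and v2: "\<And>n. v \<cdot> \<omega> n = \<zeta> n" by (simp_all add: FF_simps(1))
      show "v = u"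
      proof (rule ucocone_eq[OF X U v1 u(1)])
        show "v \<cdot> q = u \<cdot> q" using assoc[OF pt_in w(1) v1, of 0] v2[of 0] u(2) w(2) by simp
        show "v \<cdot> j n h = u \<cdot> j n h" if "h \<in> Gflat (i_ob n) t" for n h
          using assoc[OF inc_in[OF that] w(1) v1] v2[of n] u(3)[OF that] w(3)[OF that] by simp
      qed
    qed
  qed
  then show ?thesis using that w(2,3) by blast
qed

end

end

context pointed_category
begin

abbreviation "Gam \<equiv> Gamma_diag C T"
abbreviation "Gst \<equiv> Gstar_diag C T"

definition star_diagram :: "('o, 'm) gstar_ob \<Rightarrow> bool" where
  "star_diagram Y \<longleftrightarrow> is_ftor GG C Y \<and> OMap Y Star = T"

lemma category_Gam: "category Gam" and category_Gst: "category Gst"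
  unfolding Gamma_diag_def Gstar_diag_def
  by (rule category_pdiag[OF category_FF C] category_pdiag[OF category_GG C])+

lemma Gam_simps:
  "X \<in> Ob Gam \<longleftrightarrow> pointed_diagram X"
  "x \<in> Ar Gam \<longleftrightarrow> pointed_diagram (src x) \<and> pointed_diagram (tgt x) \<and> nat_trans FF C (src x) (tgt x) (mor x)"
  "Dom Gam = src" "Cod Gam = tgt" "Id Gam X = Arr X X (\<lambda>n\<in>Ob FF. Id C (OMap X n))"
  "Comp Gam y x = Arr (src x) (tgt y) (\<lambda>n\<in>Ob FF. mor y n \<cdot> mor x n)"
  unfolding Gamma_diag_def pdiag_simps pointed_diagram_def by auto

lemma Gst_simps:
  "Y \<in> Ob Gst \<longleftrightarrow> star_diagram Y"
  "y \<in> Ar Gst \<longleftrightarrow> star_diagram (src y) \<and> star_diagram (tgt y) \<and> nat_trans GG C (src y) (tgt y) (mor y)"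
  "Dom Gst = src" "Cod Gst = tgt" "Id Gst Y = Arr Y Y (\<lambda>t\<in>Ob GG. Id C (OMap Y t))"
  "Comp Gst y x = Arr (src x) (tgt y) (\<lambda>t\<in>Ob GG. mor y t \<cdot> mor x t)"
  unfolding Gstar_diag_def pdiag_simps star_diagram_def by auto

lemma Gam_HomD:
  assumes "x \<in> Hom Gam X Y"
  shows "pointed_diagram X" "pointed_diagram Y" "nat_trans FF C X Y (mor x)" "src x = X" "tgt x = Y"
    "mor x n \<in> Hom C (OMap X n) (OMap Y n)"
    "a \<in> Hom FF m n \<Longrightarrow> AMap Y a \<cdot> mor x m = mor x n \<cdot> AMap X a"
proof -
  show n: "pointed_diagram X" "pointed_diagram Y" "nat_trans FF C X Y (mor x)" "src x = X" "tgt x = Y"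
    using assms unfolding Hom_def Gam_simps by auto
  show "mor x n \<in> Hom C (OMap X n) (OMap Y n)" using nat_transD(1)[OF n(3)] by (simp add: FF_simps(1))
  show "a \<in> Hom FF m n \<Longrightarrow> AMap Y a \<cdot> mor x m = mor x n \<cdot> AMap X a" by (rule nat_transD(2)[OF n(3)])
qed

lemma Gst_HomD:
  assumes "y \<in> Hom Gst X Y"
  shows "star_diagram X" "star_diagram Y" "nat_trans GG C X Y (mor y)" "src y = X" "tgt y = Y"
    "t \<in> Ob GG \<Longrightarrow> mor y t \<in> Hom C (OMap X t) (OMap Y t)"
    "g \<in> Hom GG s t \<Longrightarrow> AMap Y g \<cdot> mor y s = mor y t \<cdot> AMap X g"
proof -
  show n: "star_diagram X" "star_diagram Y" "nat_trans GG C X Y (mor y)" "src y = X" "tgt y = Y"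
    using assms unfolding Hom_def Gst_simps by auto
  show "t \<in> Ob GG \<Longrightarrow> mor y t \<in> Hom C (OMap X t) (OMap Y t)" by (rule nat_transD(1)[OF n(3)])
  show "g \<in> Hom GG s t \<Longrightarrow> AMap Y g \<cdot> mor y s = mor y t \<cdot> AMap X g" by (rule nat_transD(2)[OF n(3)])
qed

lemma Gam_HomI:
  assumes "pointed_diagram X" "pointed_diagram Y" "\<And>n. \<xi> n \<in> Hom C (OMap X n) (OMap Y n)"
    "\<And>a m n. a \<in> Hom FF m n \<Longrightarrow> AMap Y a \<cdot> \<xi> m = \<xi> n \<cdot> AMap X a"
  shows "Arr X Y \<xi> \<in> Hom Gam X Y"
proof -
  have "nat_trans FF C X Y \<xi>" by (rule nat_transI) (use assms in \<open>auto simp: FF_simps(1)\<close>)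
  then show ?thesis unfolding Hom_def Gam_simps using assms by simp
qed

lemma Gst_HomI:
  assumes "star_diagram X" "star_diagram Y" "\<And>t. t \<in> Ob GG \<Longrightarrow> \<xi> t \<in> Hom C (OMap X t) (OMap Y t)"
    "\<And>g s t. g \<in> Hom GG s t \<Longrightarrow> AMap Y g \<cdot> \<xi> s = \<xi> t \<cdot> AMap X g" "\<And>t. t \<notin> Ob GG \<Longrightarrow> \<xi> t = undefined"
  shows "Arr X Y \<xi> \<in> Hom Gst X Y"
proof -
  have "nat_trans GG C X Y \<xi>" by (rule nat_transI) (use assms in auto)
  then show ?thesis unfolding Hom_def Gst_simps using assms by simp
qed

lemma Gam_eqI: "x \<in> Hom Gam X Y \<Longrightarrow> y \<in> Hom Gam X Y \<Longrightarrow> (\<And>n. mor x n = mor y n) \<Longrightarrow> x = y"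
  by (rule arr.expand) (auto simp: Gam_HomD(4,5))

lemma Gst_eqI:
  assumes "x \<in> Hom Gst X Y" "y \<in> Hom Gst X Y" "\<And>t. t \<in> Ob GG \<Longrightarrow> mor x t = mor y t"
  shows "x = y"
proof (rule arr.expand, intro conjI)
  show "mor x = mor y"
  proof
    fix t show "mor x t = mor y t"
      using assms(3) nat_transD(3)[OF Gst_HomD(3)[OF assms(1)], of t] nat_transD(3)[OF Gst_HomD(3)[OF assms(2)], of t]
      by (cases "t \<in> Ob GG") auto
  qed
qed (use assms in \<open>auto simp: Gst_HomD(4,5)\<close>)

text \<open>The values of \<open>L\<close> are universal cocones with basepoints \<open>q\<close> and legs \<open>\<iota>\<close>, and on these \<open>L\<close> acts by
  composition in the index and by the components of a morphism of diagrams.\<close>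

definition lan ::
  "(('o, 'm) gamma_ob, ('o, 'm) gamma_ar, ('o, 'm) gstar_ob, ('o, 'm) gstar_ar) ftor \<Rightarrow>
   (('o, 'm) gamma_ob \<Rightarrow> gobj \<Rightarrow> 'm) \<Rightarrow> (('o, 'm) gamma_ob \<Rightarrow> gobj \<Rightarrow> nat \<Rightarrow> gar \<Rightarrow> 'm) \<Rightarrow> bool" where
  "lan L q \<iota> \<longleftrightarrow> is_ftor Gam Gst L \<and>
     (\<forall>X t. pointed_diagram X \<longrightarrow> t \<in> Ob GG \<longrightarrow> ucocone X t (OMap (OMap L X) t) (q X t) (\<iota> X t)) \<and>
     (\<forall>X s t g. pointed_diagram X \<longrightarrow> g \<in> Hom GG s t \<longrightarrow> AMap (OMap L X) g \<cdot> q X s = q X t \<and>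
        (\<forall>n. \<forall>h\<in>Gflat (i_ob n) s. AMap (OMap L X) g \<cdot> \<iota> X s n h = leg X t (q X t) (\<iota> X t) n (Comp GG g h))) \<and>
     (\<forall>X Y x t. x \<in> Hom Gam X Y \<longrightarrow> t \<in> Ob GG \<longrightarrow> mor (AMap L x) t \<cdot> q X t = q Y t \<and>
        (\<forall>n. \<forall>h\<in>Gflat (i_ob n) t. mor (AMap L x) t \<cdot> \<iota> X t n h = \<iota> Y t n h \<cdot> mor x n))"

lemma lan_of_is_L:
  assumes "is_L C T L"
  obtains q \<iota> where "lan L q \<iota>"
proof -
  have Lf: "is_ftor Gam Gst L" using assms by (simp add: is_L_def)
  obtain S inc pt \<omega> where
    int: "\<forall>X\<in>Ob Gam. \<forall>t\<in>Ob GG. is_integrand C T X t (S X t) (inc X t) (pt X t) \<and>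
          is_coend FF C (S X t) (OMap (OMap L X) t) (\<omega> X t)" and
    ing: "\<forall>X\<in>Ob Gam. \<forall>g\<in>Ar GG. \<forall>n. let s = src g; t = tgt g; Lg = AMap (OMap L X) g in
          Lg \<cdot> (\<omega> X s n \<cdot> pt X s (n, n)) = \<omega> X t n \<cdot> pt X t (n, n) \<and>
          (\<forall>h\<in>Gflat (i_ob n) s. let h' = Comp GG g h in
             Lg \<cdot> (\<omega> X s n \<cdot> inc X s (n, n) h) =
             \<omega> X t n \<cdot> (if h' \<in> Gflat (i_ob n) t then inc X t (n, n) h' else pt X t (n, n) \<cdot> collapse X n))" and
    inx: "\<forall>x\<in>Ar Gam. \<forall>t\<in>Ob GG. \<forall>n. let X = src x; Y = tgt x; Lx = mor (AMap L x) t in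
          Lx \<cdot> (\<omega> X t n \<cdot> pt X t (n, n)) = \<omega> Y t n \<cdot> pt Y t (n, n) \<and>
          (\<forall>h\<in>Gflat (i_ob n) t. Lx \<cdot> (\<omega> X t n \<cdot> inc X t (n, n) h) = \<omega> Y t n \<cdot> (inc Y t (n, n) h \<cdot> mor x n))"
    using assms unfolding is_L_def by (elim conjE exE) blast
  have I: "is_integrand C T X t (S X t) (inc X t) (pt X t)"
    and E: "is_coend FF C (S X t) (OMap (OMap L X) t) (\<omega> X t)" if "pointed_diagram X" "t \<in> Ob GG" for X t
    using int that by (auto simp: Gam_simps)
  have W: "is_cowedge FF C (S X t) (OMap (OMap L X) t) (\<omega> X t)" if "pointed_diagram X" "t \<in> Ob GG" for X t
    using E[OF that] by (simp add: is_coend_def)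
  have w: "\<omega> X t n \<in> Hom C (OMap (S X t) (n, n)) (OMap (OMap L X) t)" if "pointed_diagram X" "t \<in> Ob GG" for X t n
    using W[OF that] by (simp add: is_cowedge_def FF_simps(1))
  let ?q = "\<lambda>X t. \<omega> X t 0 \<cdot> pt X t (0, 0)" and ?\<iota> = "\<lambda>X t n h. \<omega> X t n \<cdot> inc X t (n, n) h"
  have "lan L ?q ?\<iota>"
    unfolding lan_def
  proof (intro conjI allI impI ballI)
    show "is_ftor Gam Gst L" by (rule Lf)
    show "ucocone X t (OMap (OMap L X) t) (?q X t) (?\<iota> X t)" if X: "pointed_diagram X" and t: "t \<in> Ob GG" for X t
      by (rule ucocone_of_coend[OF X I[OF X t] E[OF X t]])
    fix X s t g assume X: "pointed_diagram X" and g: "g \<in> Hom GG s t"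
    then have ga: "g \<in> Ar GG" "src g = s" "tgt g = t" by (auto simp: Hom_def GG_simps(3,4))
    have st: "s \<in> Ob GG" "t \<in> Ob GG" using cat_Ob[OF category_GG g] .
    show "AMap (OMap L X) g \<cdot> ?q X s = ?q X t"
      using ing[rule_format, of X g 0] X ga by (simp add: Gam_simps Let_def)
    fix n h assume h: "h \<in> Gflat (i_ob n) s"
    have "AMap (OMap L X) g \<cdot> ?\<iota> X s n h = \<omega> X t n \<cdot> (if Comp GG g h \<in> Gflat (i_ob n) t then inc X t (n, n) (Comp GG g h)
        else pt X t (n, n) \<cdot> collapse X n)"
      using ing[rule_format, of X g n] X ga h by (simp add: Gam_simps Let_def)
    also have "\<dots> = leg X t (?q X t) (?\<iota> X t) n (Comp GG g h)"
      using assoc[OF collapse_in[OF X] is_wedgeD(2)[OF S_wedge[OF X I[OF X st(2)]]] w[OF X st(2)], of n n]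
        cowedge_pt[OF X I[OF X st(2)] W[OF X st(2)], of n 0]
      by (simp add: leg_def)
    finally show "AMap (OMap L X) g \<cdot> ?\<iota> X s n h = leg X t (?q X t) (?\<iota> X t) n (Comp GG g h)" .
  next
    fix X Y x t assume x: "x \<in> Hom Gam X Y" and t: "t \<in> Ob GG"
    note xx = Gam_HomD[OF x] and xa = HomD(1)[OF x]
    show "mor (AMap L x) t \<cdot> ?q X t = ?q Y t"
      using inx[rule_format, of x t 0] xa xx(4,5) t by (simp add: Let_def)
    fix n h assume h: "h \<in> Gflat (i_ob n) t"
    have "mor (AMap L x) t \<cdot> ?\<iota> X t n h = \<omega> Y t n \<cdot> (inc Y t (n, n) h \<cdot> mor x n)"
      using inx[rule_format, of x t n] xa xx(4,5) t h by (simp add: Let_def)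
    also have "\<dots> = ?\<iota> Y t n h \<cdot> mor x n"
      by (rule assoc[OF xx(6) is_wedgeD(3)[OF S_wedge[OF xx(2) I[OF xx(2) t]] h] w[OF xx(2) t]])
    finally show "mor (AMap L x) t \<cdot> ?\<iota> X t n h = ?\<iota> Y t n h \<cdot> mor x n" .
  qed
  then show ?thesis by (rule that)
qed

lemma is_L_of_lan:
  assumes lan: "lan L q \<iota>"
    and int: "\<And>X t. pointed_diagram X \<Longrightarrow> t \<in> Ob GG \<Longrightarrow> \<exists>S inc pt. is_integrand C T X t S inc pt"
  shows "is_L C T L"
proof -
  have U: "ucocone X t (OMap (OMap L X) t) (q X t) (\<iota> X t)" if "pointed_diagram X" "t \<in> Ob GG" for X t
    using lan that unfolding lan_def by blast
  have "\<exists>S inc pt \<omega>. is_integrand C T X t S inc pt \<and> is_coend FF C S (OMap (OMap L X) t) \<omega> \<and>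
      (\<forall>n. \<omega> n \<cdot> pt (n, n) = q X t \<and> (\<forall>h\<in>Gflat (i_ob n) t. \<omega> n \<cdot> inc (n, n) h = \<iota> X t n h))"
    if X: "pointed_diagram X" and t: "t \<in> Ob GG" for X t
  proof -
    obtain S inc pt where I: "is_integrand C T X t S inc pt" using int[OF X t] by blast
    obtain \<omega> where "is_coend FF C S (OMap (OMap L X) t) \<omega>" "\<And>n. \<omega> n \<cdot> pt (n, n) = q X t"
      "\<And>n h. h \<in> Gflat (i_ob n) t \<Longrightarrow> \<omega> n \<cdot> inc (n, n) h = \<iota> X t n h"
      using coend_of_ucocone[OF X I U[OF X t]] by blast
    then show ?thesis using I by blast
  qed
  then obtain S inc pt \<omega> where *: "\<And>X t. pointed_diagram X \<Longrightarrow> t \<in> Ob GG \<Longrightarrow> is_integrand C T X t (S X t) (inc X t) (pt X t) \<and>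
      is_coend FF C (S X t) (OMap (OMap L X) t) (\<omega> X t) \<and>
      (\<forall>n. \<omega> X t n \<cdot> pt X t (n, n) = q X t \<and> (\<forall>h\<in>Gflat (i_ob n) t. \<omega> X t n \<cdot> inc X t (n, n) h = \<iota> X t n h))"
    by metis
  have I: "is_integrand C T X t (S X t) (inc X t) (pt X t)" if "pointed_diagram X" "t \<in> Ob GG" for X t
    using * that by blast
  have E: "is_coend FF C (S X t) (OMap (OMap L X) t) (\<omega> X t)" if "pointed_diagram X" "t \<in> Ob GG" for X t
    using * that by blast
  have qq: "\<omega> X t n \<cdot> pt X t (n, n) = q X t" if "pointed_diagram X" "t \<in> Ob GG" for X t n
    using * that by blast
  have ii: "\<omega> X t n \<cdot> inc X t (n, n) h = \<iota> X t n h" if "pointed_diagram X" "t \<in> Ob GG" "h \<in> Gflat (i_ob n) t" for X t n h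
    using * that by blast
  have w: "\<omega> X t n \<in> Hom C (OMap (S X t) (n, n)) (OMap (OMap L X) t)" if "pointed_diagram X" "t \<in> Ob GG" for X t n
    using E[OF that] by (simp add: is_cowedge_def is_coend_def FF_simps(1))
  show ?thesis
    unfolding is_L_def
  proof (intro conjI exI[of _ S] exI[of _ inc] exI[of _ pt] exI[of _ \<omega>] ballI allI)
    show "is_ftor Gam Gst L" using lan by (simp add: lan_def)
    show "is_integrand C T X t (S X t) (inc X t) (pt X t)" "is_coend FF C (S X t) (OMap (OMap L X) t) (\<omega> X t)"
      if "X \<in> Ob Gam" "t \<in> Ob GG" for X t
      using that I E by (simp_all add: Gam_simps)
    fix X g n assume "X \<in> Ob Gam" and "g \<in> Ar GG"
    then have X: "pointed_diagram X" and g: "g \<in> Hom GG (src g) (tgt g)" by (auto simp: Gam_simps Hom_def GG_simps(3,4))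
    note st = cat_Ob[OF category_GG g]
    have a: "AMap (OMap L X) g \<cdot> q X (src g) = q X (tgt g)"
      "\<And>n h. h \<in> Gflat (i_ob n) (src g) \<Longrightarrow> AMap (OMap L X) g \<cdot> \<iota> X (src g) n h =
          leg X (tgt g) (q X (tgt g)) (\<iota> X (tgt g)) n (Comp GG g h)"
      using lan X g unfolding lan_def by blast+
    have b: "\<omega> X (tgt g) n \<cdot> (pt X (tgt g) (n, n) \<cdot> collapse X n) = q X (tgt g) \<cdot> collapse X n"
      using assoc[OF collapse_in[OF X] is_wedgeD(2)[OF S_wedge[OF X I[OF X st(2)]]] w[OF X st(2)], of n n]
        qq[OF X st(2)] by simp
    show "let s = src g; t = tgt g; Lg = AMap (OMap L X) g in
          Lg \<cdot> (\<omega> X s n \<cdot> pt X s (n, n)) = \<omega> X t n \<cdot> pt X t (n, n) \<and>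
          (\<forall>h\<in>Gflat (i_ob n) s. let h' = Comp GG g h in
             Lg \<cdot> (\<omega> X s n \<cdot> inc X s (n, n) h) =
             \<omega> X t n \<cdot> (if h' \<in> Gflat (i_ob n) t then inc X t (n, n) h' else pt X t (n, n) \<cdot> collapse X n))"
      unfolding Let_def using a b qq[OF X st(1)] qq[OF X st(2)] ii[OF X st(1)] ii[OF X st(2)]
      by (auto simp: leg_def)
  next
    fix x t n assume "x \<in> Ar Gam" and t: "t \<in> Ob GG"
    then have x: "x \<in> Hom Gam (src x) (tgt x)" by (auto simp: Hom_def Gam_simps(3,4))
    note X = Gam_HomD(1)[OF x] and Y = Gam_HomD(2)[OF x]
    have a: "mor (AMap L x) t \<cdot> q (src x) t = q (tgt x) t"
      "\<And>n h. h \<in> Gflat (i_ob n) t \<Longrightarrow> mor (AMap L x) t \<cdot> \<iota> (src x) t n h = \<iota> (tgt x) t n h \<cdot> mor x n"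
      using lan x t unfolding lan_def by blast+
    have b: "\<omega> (tgt x) t n \<cdot> (inc (tgt x) t (n, n) h \<cdot> mor x n) = \<iota> (tgt x) t n h \<cdot> mor x n" if "h \<in> Gflat (i_ob n) t" for h
      using assoc[OF Gam_HomD(6)[OF x] is_wedgeD(3)[OF S_wedge[OF Y I[OF Y t]] that] w[OF Y t]] ii[OF Y t that]
      by simp
    show "let X = src x; Y = tgt x; Lx = mor (AMap L x) t in
          Lx \<cdot> (\<omega> X t n \<cdot> pt X t (n, n)) = \<omega> Y t n \<cdot> pt Y t (n, n) \<and>
          (\<forall>h\<in>Gflat (i_ob n) t. Lx \<cdot> (\<omega> X t n \<cdot> inc X t (n, n) h) = \<omega> Y t n \<cdot> (inc Y t (n, n) h \<cdot> mor x n))"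
      unfolding Let_def using a b qq[OF X t] qq[OF Y t] ii[OF X t] by simp
  qed
qed

subsection \<open>The adjunction\<close>

context
  fixes L q \<iota> assumes lan: "lan L q \<iota>"
begin

lemma L_ftor: "is_ftor Gam Gst L"
  using lan by (simp add: lan_def)

lemma L_ucocone: "pointed_diagram X \<Longrightarrow> t \<in> Ob GG \<Longrightarrow> ucocone X t (OMap (OMap L X) t) (q X t) (\<iota> X t)"
  using lan unfolding lan_def by blast

lemma L_cocone: "pointed_diagram X \<Longrightarrow> t \<in> Ob GG \<Longrightarrow> cocone X t (OMap (OMap L X) t) (q X t) (\<iota> X t)"
  using L_ucocone by (simp add: ucocone_def)

lemma L_star: "pointed_diagram X \<Longrightarrow> star_diagram (OMap L X)"
  using ftorD(1)[OF L_ftor] by (simp add: Gam_simps Gst_simps)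

lemma q_in: "pointed_diagram X \<Longrightarrow> t \<in> Ob GG \<Longrightarrow> q X t \<in> Hom C T (OMap (OMap L X) t)"
  using L_cocone by (simp add: cocone_def)


lemma L_g_q: "pointed_diagram X \<Longrightarrow> g \<in> Hom GG s t \<Longrightarrow> AMap (OMap L X) g \<cdot> q X s = q X t"
  using lan unfolding lan_def by blast

lemma star_in: "star_diagram Y \<Longrightarrow> g \<in> Hom GG s t \<Longrightarrow> AMap Y g \<in> Hom C (OMap Y s) (OMap Y t)"
  unfolding star_diagram_def by (elim conjE) (rule ftorD(2))

lemma star_Ob: "star_diagram Y \<Longrightarrow> t \<in> Ob GG \<Longrightarrow> OMap Y t \<in> Ob C"
  unfolding star_diagram_def by (elim conjE) (rule ftorD(1))

lemma star_comp: "star_diagram Y \<Longrightarrow> f \<in> Hom GG s t \<Longrightarrow> g \<in> Hom GG t u \<Longrightarrow> AMap Y (Comp GG g f) = AMap Y g \<cdot> AMap Y f"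
  unfolding star_diagram_def by (elim conjE) (rule ftorD(4))

lemma star_id: "star_diagram Y \<Longrightarrow> t \<in> Ob GG \<Longrightarrow> AMap Y (Id GG t) = Id C (OMap Y t)"
  unfolding star_diagram_def by (elim conjE) (rule ftorD(3))

lemma L_g_in: "pointed_diagram X \<Longrightarrow> g \<in> Hom GG s t \<Longrightarrow>
    AMap (OMap L X) g \<in> Hom C (OMap (OMap L X) s) (OMap (OMap L X) t)"
  by (rule star_in[OF L_star])

lemma L_g_leg:
  assumes X: "pointed_diagram X" and g: "g \<in> Hom GG s t" and h: "h \<in> Hom GG (i_ob n) s"
  shows "AMap (OMap L X) g \<cdot> leg X s (q X s) (\<iota> X s) n h = leg X t (q X t) (\<iota> X t) n (Comp GG g h)"
proof (cases "h \<in> Gflat (i_ob n) s")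
  case True
  then show ?thesis using lan X g unfolding lan_def by (simp add: leg_def[of X s])
next
  case False
  then have "h = Arr (i_ob n) s None" using Gflat_cases[OF h] by simp
  then have "Comp GG g h \<notin> Gflat (i_ob n) t" by (simp add: Comp_zero zero_notin_Gflat)
  then show ?thesis
    using False L_g_q[OF X g] assoc[OF collapse_in[OF X, of n] q_in[OF X cat_Ob(1)[OF category_GG g]] L_g_in[OF X g]]
    by (simp add: leg_def)
qed

lemma L_x_in: "x \<in> Hom Gam X Y \<Longrightarrow> AMap L x \<in> Hom Gst (OMap L X) (OMap L Y)"
  by (rule ftorD(2)[OF L_ftor])

lemma L_x_q: "x \<in> Hom Gam X Y \<Longrightarrow> t \<in> Ob GG \<Longrightarrow> mor (AMap L x) t \<cdot> q X t = q Y t"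
  using lan unfolding lan_def by blast

lemma L_x_leg:
  assumes x: "x \<in> Hom Gam X Y" and t: "t \<in> Ob GG"
  shows "mor (AMap L x) t \<cdot> leg X t (q X t) (\<iota> X t) n h = leg Y t (q Y t) (\<iota> Y t) n h \<cdot> mor x n"
proof (cases "h \<in> Gflat (i_ob n) t")
  case True
  then show ?thesis using lan x t unfolding lan_def by (simp add: leg_def)
next
  case False
  note X = Gam_HomD(1)[OF x] and Y = Gam_HomD(2)[OF x]
  have "collapse Y n \<cdot> mor x n = collapse X n"
    by (rule to_T_unique[OF comp_in[OF Gam_HomD(6)[OF x] collapse_in[OF Y]] collapse_in[OF X]])
  then have "(q Y t \<cdot> collapse Y n) \<cdot> mor x n = q Y t \<cdot> collapse X n"
    using assoc[OF Gam_HomD(6)[OF x] collapse_in[OF Y] q_in[OF Y t]] by metis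
  moreover have "mor (AMap L x) t \<cdot> (q X t \<cdot> collapse X n) = q Y t \<cdot> collapse X n"
    using assoc[OF collapse_in[OF X] q_in[OF X t] Gst_HomD(6)[OF L_x_in[OF x] t]] L_x_q[OF x t] by simp
  ultimately show ?thesis using False by (simp add: leg_def)
qed

lemma q_Star: "pointed_diagram X \<Longrightarrow> q X Star = Id C T"
  using q_in[of X Star] L_star[of X] to_T_unique[OF _ idT] by (simp add: star_diagram_def GG_simps(1))

abbreviation "G \<equiv> i_pull C T"

lemma pull_simps:
  assumes Y: "star_diagram Y"
  shows "OMap (OMap G Y) n = OMap Y (i_ob n)" "a \<in> Hom FF m n \<Longrightarrow> AMap (OMap G Y) a = AMap Y (i_ar a)"
    "pointed_diagram (OMap G Y)"
proof -
  have "OMap G Y = ftor_comp FF Y ifun" using Y by (simp add: i_pull_def Gst_simps)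
  moreover have Yf: "is_ftor GG C Y" using Y by (simp add: star_diagram_def)
  ultimately show 1: "OMap (OMap G Y) n = OMap Y (i_ob n)"
    "a \<in> Hom FF m n \<Longrightarrow> AMap (OMap G Y) a = AMap Y (i_ar a)"
    using HomD(1)[of a FF m n] by (simp_all add: ftor_comp_simps ifun_simps FF_simps(1))
  have "is_ftor FF C (OMap G Y)" unfolding \<open>OMap G Y = _\<close>
    by (rule is_ftor_comp[OF category_FF is_ftor_ifun Yf])
  moreover have "OMap (OMap G Y) 0 = T"
    using Y \<open>OMap G Y = _\<close> by (simp add: ftor_comp_simps ifun_simps FF_simps(1) i_ob_def star_diagram_def)
  ultimately show "pointed_diagram (OMap G Y)" by (simp add: pointed_diagram_def)
qed

lemma pull_ar:
  assumes y: "y \<in> Hom Gst Y Y'"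
  shows "AMap G y = Arr (OMap G Y) (OMap G Y') (\<lambda>n. mor y (i_ob n))"
    "AMap G y \<in> Hom Gam (OMap G Y) (OMap G Y')"
proof -
  note yy = Gst_HomD[OF y]
  show 1: "AMap G y = Arr (OMap G Y) (OMap G Y') (\<lambda>n. mor y (i_ob n))"
    using HomD(1)[OF y] yy(1,2,4,5) by (simp add: i_pull_def Gst_simps(1) FF_simps(1) restrict_def)
  show "AMap G y \<in> Hom Gam (OMap G Y) (OMap G Y')"
    unfolding 1
    by (rule Gam_HomI) (use yy pull_simps[OF yy(1)] pull_simps[OF yy(2)] i_ar_Hom i_ob_Ob in auto)
qed

lemma is_ftor_pull: "is_ftor Gst Gam G"
proof (rule is_ftorI)
  fix Y assume Y: "Y \<in> Ob Gst"
  then show "OMap G Y \<in> Ob Gam" using pull_simps(3) by (simp add: Gst_simps(1) Gam_simps(1))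
  have Y': "star_diagram Y" using Y by (simp add: Gst_simps(1))
  show "AMap G (Id Gst Y) = Id Gam (OMap G Y)"
    unfolding pull_ar(1)[OF cat_id[OF category_Gst Y]] Gam_simps(5)
    by (auto simp: Gst_simps(5) i_ob_Ob FF_simps(1) pull_simps[OF Y'])
next
  fix y assume "y \<in> Ar Gst"
  then show "AMap G y \<in> Hom Gam (OMap G (Dom Gst y)) (OMap G (Cod Gst y))"
    by (intro pull_ar(2) cat_Ar[OF category_Gst])
next
  fix y z X Y Z assume y: "y \<in> Hom Gst X Y" and z: "z \<in> Hom Gst Y Z"
  show "AMap G (Comp Gst z y) = Comp Gam (AMap G z) (AMap G y)"
    unfolding pull_ar(1)[OF y] pull_ar(1)[OF z] pull_ar(1)[OF cat_comp[OF category_Gst y z]]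
    unfolding Gam_simps(6) Gst_simps(6)
    by (auto simp: i_ob_Ob FF_simps(1))
qed (auto simp: i_pull_def Gst_simps(1))

text \<open>The unit is the leg at the identity of \<open>i n\<close>.\<close>

definition unit_at :: "('o, 'm) gamma_ob \<Rightarrow> nat \<Rightarrow> 'm" where
  "unit_at X n = leg X (i_ob n) (q X (i_ob n)) (\<iota> X (i_ob n)) n (Id GG (i_ob n))"

definition unit_ar :: "('o, 'm) gamma_ob \<Rightarrow> ('o, 'm) gamma_ar" where
  "unit_ar X = Arr X (OMap G (OMap L X)) (unit_at X)"

lemma unit_at_in: "pointed_diagram X \<Longrightarrow> unit_at X n \<in> Hom C (OMap X n) (OMap (OMap L X) (i_ob n))"
  unfolding unit_at_def by (rule leg_in[OF _ L_cocone[OF _ i_ob_Ob]])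

lemma id_i: "Id GG (i_ob n) \<in> Hom GG (i_ob n) (i_ob n)"
  by (rule cat_id[OF category_GG i_ob_Ob])

lemma L_unit_at:
  assumes X: "pointed_diagram X" and h: "h \<in> Hom GG (i_ob n) t"
  shows "AMap (OMap L X) h \<cdot> unit_at X n = leg X t (q X t) (\<iota> X t) n h"
  unfolding unit_at_def L_g_leg[OF X h id_i] cat_idr[OF category_GG h] ..

lemma unit_at_X:
  assumes X: "pointed_diagram X" and a: "a \<in> Hom FF m n"
  shows "unit_at X n \<cdot> AMap X a = leg X (i_ob n) (q X (i_ob n)) (\<iota> X (i_ob n)) m (i_ar a)"
  unfolding unit_at_def leg_X[OF X L_cocone[OF X i_ob_Ob] id_i a] cat_idl[OF category_GG i_ar_Hom[OF a]] ..

lemma unit_ar_in: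
  assumes X: "pointed_diagram X"
  shows "unit_ar X \<in> Hom Gam X (OMap G (OMap L X))"
  unfolding unit_ar_def
proof (rule Gam_HomI[OF X])
  note Ls = L_star[OF X]
  show "pointed_diagram (OMap G (OMap L X))" by (rule pull_simps(3)[OF Ls])
  show "unit_at X n \<in> Hom C (OMap X n) (OMap (OMap G (OMap L X)) n)" for n
    unfolding pull_simps(1)[OF Ls] by (rule unit_at_in[OF X])
  show "AMap (OMap G (OMap L X)) a \<cdot> unit_at X m = unit_at X n \<cdot> AMap X a" if a: "a \<in> Hom FF m n" for a m n
    unfolding pull_simps(2)[OF Ls a] L_unit_at[OF X i_ar_Hom[OF a]] unit_at_X[OF X a] ..
qed

lemma unit_natural:
  assumes x: "x \<in> Hom Gam X Y"
  shows "Comp Gam (AMap G (AMap L x)) (unit_ar X) = Comp Gam (unit_ar Y) x"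
proof (rule Gam_eqI)
  note X = Gam_HomD(1)[OF x] and Y = Gam_HomD(2)[OF x]
  show "Comp Gam (AMap G (AMap L x)) (unit_ar X) \<in> Hom Gam X (OMap G (OMap L Y))"
    by (rule cat_comp[OF category_Gam unit_ar_in[OF X] pull_ar(2)[OF L_x_in[OF x]]])
  show "Comp Gam (unit_ar Y) x \<in> Hom Gam X (OMap G (OMap L Y))"
    by (rule cat_comp[OF category_Gam x unit_ar_in[OF Y]])
  show "mor (Comp Gam (AMap G (AMap L x)) (unit_ar X)) n = mor (Comp Gam (unit_ar Y) x) n" for n
    unfolding Gam_simps(6) pull_ar(1)[OF L_x_in[OF x]] unit_ar_def
    using L_x_leg[OF x i_ob_Ob] by (simp add: FF_simps(1) unit_at_def)
qed

text \<open>The inverse of the unit sends the leg at \<open>i a\<close> to the map induced by \<open>a\<close>; this uses that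
  every nonzero morphism \<open>i m \<rightarrow> i n\<close> comes from exactly one pointed map \<open>a\<close>.\<close>

definition preimage_ar :: "nat \<Rightarrow> nat \<Rightarrow> gar \<Rightarrow> fin_ar" where
  "preimage_ar m n h = Arr m n (snd (the (mor h)) 0)"

lemma preimage_i_ar:
  assumes "a \<in> Hom FF m n" "i_ar a \<in> Gflat s t"
  shows "preimage_ar m n (i_ar a) = a"
  using assms by (auto simp: preimage_ar_def FF_simps Gflat_def i_ar_def split: if_splits)

lemma i_ar_notin_Gflat:
  assumes "a \<in> Hom FF m n" "i_ar a \<notin> Gflat (i_ob m) (i_ob n)"
  shows "a = Arr m n (pzero m)"
  using i_ar_Hom[OF assms(1)] assms by (auto simp: Gflat_def FF_simps i_ar_def split: if_splits)

lemma X_zero: "pointed_diagram X \<Longrightarrow> AMap X (Arr m n (pzero m)) = basepoint X n \<cdot> collapse X m"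
proof -
  assume X: "pointed_diagram X"
  have "Comp FF (Arr 0 n (pzero 0)) (Arr m 0 (pzero m)) = Arr m n (pzero m)"
    using compose_pzero(1)[OF pzero_in[of 0 n], of m] by (simp add: FF_simps)
  then show ?thesis
    using X_comp[OF X zero_FF[OF X, of m 0] zero_FF[OF X, of 0 n]] by (simp add: basepoint_def collapse_def)
qed

lemma unit_inverse_at:
  assumes X: "pointed_diagram X"
  shows "\<exists>\<rho>\<in>Hom C (OMap (OMap L X) (i_ob n)) (OMap X n).
    \<rho> \<cdot> unit_at X n = Id C (OMap X n) \<and> unit_at X n \<cdot> \<rho> = Id C (OMap (OMap L X) (i_ob n))"
proof -
  let ?j = "\<lambda>m h. AMap X (preimage_ar m n h)"
  have leg: "leg X (i_ob n) (basepoint X n) ?j m (i_ar a) = AMap X a" if a: "a \<in> Hom FF m n" for a m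
    using preimage_i_ar[OF a] i_ar_notin_Gflat[OF a] X_zero[OF X, of m n] by (auto simp: leg_def)
  have K: "cocone X (i_ob n) (OMap X n) (basepoint X n) ?j"
    unfolding cocone_def
  proof (intro conjI allI ballI)
    show "basepoint X n \<in> Hom C T (OMap X n)" by (rule basepoint_in[OF X])
    show "?j m h \<in> Hom C (OMap X m) (OMap X n)" if h: "h \<in> Gflat (i_ob m) (i_ob n)" for m h
    proof -
      obtain a where "a \<in> Hom FF m n" "h = i_ar a" using i_ar_full[OF h] .
      then show ?thesis using X_in[OF X] preimage_i_ar h by simp
    qed
    fix l m a h assume a: "a \<in> Hom FF l m" and h: "h \<in> Gflat (i_ob m) (i_ob n)"
    obtain b where b: "b \<in> Hom FF m n" "h = i_ar b" using i_ar_full[OF h] .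
    have "?j m h \<cdot> AMap X a = AMap X (Comp FF b a)"
      using preimage_i_ar[OF b(1)] h b X_comp[OF X a b(1)] by simp
    also have "\<dots> = leg X (i_ob n) (basepoint X n) ?j l (Comp GG h (i_ar a))"
      unfolding b(2) i_ar_comp[OF a b(1), symmetric] by (rule leg[OF cat_comp[OF category_FF a b(1)], symmetric])
    finally show "?j m h \<cdot> AMap X a = leg X (i_ob n) (basepoint X n) ?j l (Comp GG h (i_ar a))" .
  qed
  note U = L_ucocone[OF X i_ob_Ob[of n]] and J = L_cocone[OF X i_ob_Ob[of n]]
  obtain \<rho> where r: "\<rho> \<in> Hom C (OMap (OMap L X) (i_ob n)) (OMap X n)" "\<rho> \<cdot> q X (i_ob n) = basepoint X n"
    "\<And>m h. h \<in> Gflat (i_ob m) (i_ob n) \<Longrightarrow> \<rho> \<cdot> \<iota> X (i_ob n) m h = ?j m h"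
    using ucocone_ex[OF X U K] by blast
  have rl: "\<rho> \<cdot> leg X (i_ob n) (q X (i_ob n)) (\<iota> X (i_ob n)) m (i_ar a) = AMap X a" if a: "a \<in> Hom FF m n" for a m
    using comp_leg[OF X J r(1), of m "i_ar a"] leg[OF a] r(2,3) by (simp add: leg_def split: if_splits)
  have idF: "Id FF n \<in> Hom FF n n" by (rule cat_id[OF category_FF]) (simp add: FF_simps)
  have 1: "\<rho> \<cdot> unit_at X n = Id C (OMap X n)"
    unfolding unit_at_def using rl[OF idF] by (simp add: i_ar_id X_id[OF X])
  have 2: "unit_at X n \<cdot> \<rho> = Id C (OMap (OMap L X) (i_ob n))"
  proof (rule ucocone_eq[OF X U])
    have E: "OMap (OMap L X) (i_ob n) \<in> Ob C" by (rule star_Ob[OF L_star[OF X] i_ob_Ob])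
    show "unit_at X n \<cdot> \<rho> \<in> Hom C (OMap (OMap L X) (i_ob n)) (OMap (OMap L X) (i_ob n))"
      by (rule comp_in[OF r(1) unit_at_in[OF X]])
    show "Id C (OMap (OMap L X) (i_ob n)) \<in> Hom C (OMap (OMap L X) (i_ob n)) (OMap (OMap L X) (i_ob n))"
      by (rule cat_id[OF C E])
    have z: "i_ar (Arr 0 n (pzero 0)) \<notin> Gflat (i_ob 0) (i_ob n)" by (simp add: i_ar_zero zero_notin_Gflat)
    have "collapse X 0 = Id C T"
      using to_T_unique[OF _ idT, of "collapse X 0"] collapse_in[OF X, of 0] by (simp add: X_0[OF X])
    then have "unit_at X n \<cdot> basepoint X n = q X (i_ob n)"
      using unit_at_X[OF X zero_FF[OF X, of 0 n]] z idr[OF q_in[OF X i_ob_Ob]] by (simp add: basepoint_def leg_def)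
    then show "(unit_at X n \<cdot> \<rho>) \<cdot> q X (i_ob n) = Id C (OMap (OMap L X) (i_ob n)) \<cdot> q X (i_ob n)"
      using assoc[OF q_in[OF X i_ob_Ob] r(1) unit_at_in[OF X]] r(2) idl[OF q_in[OF X i_ob_Ob]] by simp
    fix m h assume h: "h \<in> Gflat (i_ob m) (i_ob n)"
    obtain a where a: "a \<in> Hom FF m n" "h = i_ar a" using i_ar_full[OF h] .
    have i: "\<iota> X (i_ob n) m h \<in> Hom C (OMap X m) (OMap (OMap L X) (i_ob n))" using J h by (simp add: cocone_def)
    have "unit_at X n \<cdot> (\<rho> \<cdot> \<iota> X (i_ob n) m h) = \<iota> X (i_ob n) m h"
      using rl[OF a(1)] unit_at_X[OF X a(1)] h a(2) by (simp add: leg_def)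
    then show "(unit_at X n \<cdot> \<rho>) \<cdot> \<iota> X (i_ob n) m h = Id C (OMap (OMap L X) (i_ob n)) \<cdot> \<iota> X (i_ob n) m h"
      using assoc[OF i r(1) unit_at_in[OF X]] idl[OF i] by simp
  qed
  show ?thesis using r(1) 1 2 by blast
qed

lemma unit_iso:
  assumes X: "pointed_diagram X"
  shows "\<exists>r\<in>Hom Gam (OMap G (OMap L X)) X. Comp Gam r (unit_ar X) = Id Gam X \<and>
    Comp Gam (unit_ar X) r = Id Gam (OMap G (OMap L X))"
proof -
  obtain \<rho> where r: "\<And>n. \<rho> n \<in> Hom C (OMap (OMap L X) (i_ob n)) (OMap X n)"
    "\<And>n. \<rho> n \<cdot> unit_at X n = Id C (OMap X n)" "\<And>n. unit_at X n \<cdot> \<rho> n = Id C (OMap (OMap L X) (i_ob n))"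
    using unit_inverse_at[OF X] by metis
  note Ls = L_star[OF X] and u = unit_at_in[OF X]
  have R: "Arr (OMap G (OMap L X)) X \<rho> \<in> Hom Gam (OMap G (OMap L X)) X"
  proof (rule Gam_HomI[OF pull_simps(3)[OF Ls] X])
    show "\<rho> n \<in> Hom C (OMap (OMap G (OMap L X)) n) (OMap X n)" for n unfolding pull_simps(1)[OF Ls] by (rule r(1))
    fix a m n assume a: "a \<in> Hom FF m n"
    note Xa = X_in[OF X a] and La = L_g_in[OF X i_ar_Hom[OF a]]
    have "AMap X a \<cdot> \<rho> m = (\<rho> n \<cdot> unit_at X n) \<cdot> (AMap X a \<cdot> \<rho> m)"
      unfolding r(2) by (rule idl[OF comp_in[OF r(1) Xa], symmetric])
    also have "\<dots> = \<rho> n \<cdot> ((unit_at X n \<cdot> AMap X a) \<cdot> \<rho> m)"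
      using assoc[OF comp_in[OF r(1) Xa] u r(1)] assoc[OF r(1) Xa u] by simp
    also have "unit_at X n \<cdot> AMap X a = AMap (OMap L X) (i_ar a) \<cdot> unit_at X m"
      unfolding L_unit_at[OF X i_ar_Hom[OF a]] unit_at_X[OF X a] ..
    also have "\<rho> n \<cdot> ((AMap (OMap L X) (i_ar a) \<cdot> unit_at X m) \<cdot> \<rho> m) = \<rho> n \<cdot> AMap (OMap L X) (i_ar a)"
      using assoc[OF r(1) u La] r(3) idr[OF La] by simp
    finally show "AMap X a \<cdot> \<rho> m = \<rho> n \<cdot> AMap (OMap G (OMap L X)) a" unfolding pull_simps(2)[OF Ls a] .
  qed
  have "Comp Gam (Arr (OMap G (OMap L X)) X \<rho>) (unit_ar X) = Id Gam X"
    "Comp Gam (unit_ar X) (Arr (OMap G (OMap L X)) X \<rho>) = Id Gam (OMap G (OMap L X))"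
    by (simp_all add: Gam_simps(5,6) unit_ar_def r FF_simps(1) pull_simps(1)[OF Ls])
  then show ?thesis using R by blast
qed

text \<open>The counit sends the leg at \<open>h\<close> to the map induced by \<open>h\<close>.\<close>

definition y0 :: "('o, 'm) gstar_ob \<Rightarrow> gobj \<Rightarrow> 'm" where
  "y0 Y t = AMap Y (Arr Star t None)"

definition is_counit :: "('o, 'm) gstar_ob \<Rightarrow> gobj \<Rightarrow> 'm \<Rightarrow> bool" where
  "is_counit Y t u \<longleftrightarrow> u \<in> Hom C (OMap (OMap L (OMap G Y)) t) (OMap Y t) \<and> u \<cdot> q (OMap G Y) t = y0 Y t \<and>
     (\<forall>n. \<forall>h\<in>Hom GG (i_ob n) t. u \<cdot> leg (OMap G Y) t (q (OMap G Y) t) (\<iota> (OMap G Y) t) n h = AMap Y h)"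

definition counit_at :: "('o, 'm) gstar_ob \<Rightarrow> gobj \<Rightarrow> 'm" where
  "counit_at Y = (\<lambda>t\<in>Ob GG. SOME u. is_counit Y t u)"

definition counit_ar :: "('o, 'm) gstar_ob \<Rightarrow> ('o, 'm) gstar_ar" where
  "counit_ar Y = Arr (OMap L (OMap G Y)) Y (counit_at Y)"

lemma zero_Star: "t \<in> Ob GG \<Longrightarrow> Arr Star t None \<in> Hom GG Star t"
  by (rule zero_in_Hom) (simp_all add: GG_simps(1))

lemma y0_in: "star_diagram Y \<Longrightarrow> t \<in> Ob GG \<Longrightarrow> y0 Y t \<in> Hom C T (OMap Y t)"
  using star_in[OF _ zero_Star] unfolding y0_def by (metis star_diagram_def)

lemma y0_g: "star_diagram Y \<Longrightarrow> g \<in> Hom GG s t \<Longrightarrow> AMap Y g \<cdot> y0 Y s = y0 Y t"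
  using star_comp[of Y "Arr Star s None" Star s g t] zero_Star[of s] cat_Ob(1)[OF category_GG, of g s t]
  by (auto simp: y0_def Comp_zero GG_simps(2))

lemma is_counit_counit_at:
  assumes Y: "star_diagram Y" and t: "t \<in> Ob GG"
  shows "is_counit Y t (counit_at Y t)"
proof -
  note P = pull_simps(3)[OF Y]
  have leg: "leg (OMap G Y) t (y0 Y t) (\<lambda>n h. AMap Y h) n h = AMap Y h" if h: "h \<in> Hom GG (i_ob n) t" for n h
  proof (cases "h \<in> Gflat (i_ob n) t")
    case False
    then have hz: "h = Arr (i_ob n) t None" using Gflat_cases[OF h] by simp
    have z: "Arr (i_ob n) Star None \<in> Hom GG (i_ob n) Star" by (rule zero_in_Hom[OF i_ob_Ob]) (simp add: GG_simps(1))
    have "collapse (OMap G Y) n = AMap Y (Arr (i_ob n) Star None)"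
      using pull_simps(2)[OF Y zero_FF[OF P, of n 0]] by (simp add: collapse_def i_ar_zero) (simp add: i_ob_def)
    then have "y0 Y t \<cdot> collapse (OMap G Y) n = AMap Y h"
      using star_comp[OF Y z zero_Star[OF t]] by (simp add: y0_def Comp_zero hz)
    then show ?thesis using False by (simp add: leg_def)
  qed (simp add: leg_def)
  have K: "cocone (OMap G Y) t (OMap Y t) (y0 Y t) (\<lambda>n h. AMap Y h)"
    unfolding cocone_def
  proof (intro conjI allI ballI)
    show "y0 Y t \<in> Hom C T (OMap Y t)" by (rule y0_in[OF Y t])
    show "AMap Y h \<in> Hom C (OMap (OMap G Y) n) (OMap Y t)" if "h \<in> Gflat (i_ob n) t" for n h
      unfolding pull_simps(1)[OF Y] by (rule star_in[OF Y Gflat_Hom[OF that]])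
    fix m n a h assume a: "a \<in> Hom FF m n" and "h \<in> Gflat (i_ob n) t"
    then have h: "h \<in> Hom GG (i_ob n) t" by (simp add: Gflat_Hom)
    show "AMap Y h \<cdot> AMap (OMap G Y) a = leg (OMap G Y) t (y0 Y t) (\<lambda>n h. AMap Y h) m (Comp GG h (i_ar a))"
      unfolding pull_simps(2)[OF Y a] leg[OF cat_comp[OF category_GG i_ar_Hom[OF a] h]]
      by (rule star_comp[OF Y i_ar_Hom[OF a] h, symmetric])
  qed
  obtain u where u: "u \<in> Hom C (OMap (OMap L (OMap G Y)) t) (OMap Y t)" "u \<cdot> q (OMap G Y) t = y0 Y t"
    "\<And>n h. h \<in> Gflat (i_ob n) t \<Longrightarrow> u \<cdot> \<iota> (OMap G Y) t n h = AMap Y h"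
    using ucocone_ex[OF P L_ucocone[OF P t] K] by blast
  have "u \<cdot> leg (OMap G Y) t (q (OMap G Y) t) (\<iota> (OMap G Y) t) n h = AMap Y h" if h: "h \<in> Hom GG (i_ob n) t" for n h
    using comp_leg[OF P L_cocone[OF P t] u(1), of n h] leg[OF h] u(2,3) by (simp add: leg_def split: if_splits)
  then have "is_counit Y t u" using u by (simp add: is_counit_def)
  then show ?thesis using t unfolding counit_at_def by (simp add: someI)
qed

lemma counit_at_in: "star_diagram Y \<Longrightarrow> t \<in> Ob GG \<Longrightarrow> counit_at Y t \<in> Hom C (OMap (OMap L (OMap G Y)) t) (OMap Y t)"
  and counit_at_q: "star_diagram Y \<Longrightarrow> t \<in> Ob GG \<Longrightarrow> counit_at Y t \<cdot> q (OMap G Y) t = y0 Y t"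
  and counit_at_leg: "star_diagram Y \<Longrightarrow> t \<in> Ob GG \<Longrightarrow> h \<in> Hom GG (i_ob n) t \<Longrightarrow>
    counit_at Y t \<cdot> leg (OMap G Y) t (q (OMap G Y) t) (\<iota> (OMap G Y) t) n h = AMap Y h"
  using is_counit_counit_at unfolding is_counit_def by blast+

text \<open>The legs, including the constant one at the zero morphism, are jointly epimorphic.\<close>

lemma leg_eqI:
  assumes X: "pointed_diagram X" and t: "t \<in> Ob GG" and u: "u \<in> Hom C (OMap (OMap L X) t) Z" and v: "v \<in> Hom C (OMap (OMap L X) t) Z"
    and "u \<cdot> q X t = v \<cdot> q X t"
    and leg: "\<And>n h. h \<in> Hom GG (i_ob n) t \<Longrightarrow> u \<cdot> leg X t (q X t) (\<iota> X t) n h = v \<cdot> leg X t (q X t) (\<iota> X t) n h"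
  shows "u = v"
proof (rule ucocone_eq[OF X L_ucocone[OF X t] u v])
  show "u \<cdot> \<iota> X t n h = v \<cdot> \<iota> X t n h" if "h \<in> Gflat (i_ob n) t" for n h
    using leg[OF Gflat_Hom[OF that]] that by (simp add: leg_def)
qed fact

lemma L_leg_in: "pointed_diagram X \<Longrightarrow> t \<in> Ob GG \<Longrightarrow> leg X t (q X t) (\<iota> X t) n h \<in> Hom C (OMap X n) (OMap (OMap L X) t)"
  by (rule leg_in[OF _ L_cocone])

lemma counit_ar_in:
  assumes Y: "star_diagram Y"
  shows "counit_ar Y \<in> Hom Gst (OMap L (OMap G Y)) Y"
  unfolding counit_ar_def
proof (rule Gst_HomI[OF L_star[OF pull_simps(3)[OF Y]] Y counit_at_in[OF Y]])
  note P = pull_simps(3)[OF Y]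
  show "counit_at Y t = undefined" if "t \<notin> Ob GG" for t using that by (simp add: counit_at_def)
  fix g s t assume g: "g \<in> Hom GG s t"
  note s = cat_Ob(1)[OF category_GG g] and t = cat_Ob(2)[OF category_GG g]
  show "AMap Y g \<cdot> counit_at Y s = counit_at Y t \<cdot> AMap (OMap L (OMap G Y)) g"
  proof (rule leg_eqI[OF P s])
    show "AMap Y g \<cdot> counit_at Y s \<in> Hom C (OMap (OMap L (OMap G Y)) s) (OMap Y t)"
      by (rule comp_in[OF counit_at_in[OF Y s] star_in[OF Y g]])
    show "counit_at Y t \<cdot> AMap (OMap L (OMap G Y)) g \<in> Hom C (OMap (OMap L (OMap G Y)) s) (OMap Y t)"
      by (rule comp_in[OF L_g_in[OF P g] counit_at_in[OF Y t]])
    show "(AMap Y g \<cdot> counit_at Y s) \<cdot> q (OMap G Y) s = (counit_at Y t \<cdot> AMap (OMap L (OMap G Y)) g) \<cdot> q (OMap G Y) s"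
      using assoc[OF q_in[OF P s] counit_at_in[OF Y s] star_in[OF Y g]]
        assoc[OF q_in[OF P s] L_g_in[OF P g] counit_at_in[OF Y t]]
      by (simp add: counit_at_q[OF Y s] counit_at_q[OF Y t] L_g_q[OF P g] y0_g[OF Y g])
    fix n h assume h: "h \<in> Hom GG (i_ob n) s"
    show "(AMap Y g \<cdot> counit_at Y s) \<cdot> leg (OMap G Y) s (q (OMap G Y) s) (\<iota> (OMap G Y) s) n h =
        (counit_at Y t \<cdot> AMap (OMap L (OMap G Y)) g) \<cdot> leg (OMap G Y) s (q (OMap G Y) s) (\<iota> (OMap G Y) s) n h"
      using assoc[OF L_leg_in[OF P s] counit_at_in[OF Y s] star_in[OF Y g], of n h]
        assoc[OF L_leg_in[OF P s] L_g_in[OF P g] counit_at_in[OF Y t], of n h]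
      by (simp add: counit_at_leg[OF Y s h] L_g_leg[OF P g h] counit_at_leg[OF Y t cat_comp[OF category_GG h g]] star_comp[OF Y h g])
  qed
qed

lemma counit_natural:
  assumes y: "y \<in> Hom Gst Y Z"
  shows "Comp Gst y (counit_ar Y) = Comp Gst (counit_ar Z) (AMap L (AMap G y))"
proof (rule Gst_eqI)
  note Y = Gst_HomD(1)[OF y] and Z = Gst_HomD(2)[OF y]
  note PY = pull_simps(3)[OF Y] and PZ = pull_simps(3)[OF Z] and Gy = pull_ar(2)[OF y]
  note LGy = L_x_in[OF Gy]
  show 1: "Comp Gst y (counit_ar Y) \<in> Hom Gst (OMap L (OMap G Y)) Z"
    by (rule cat_comp[OF category_Gst counit_ar_in[OF Y] y])
  show 2: "Comp Gst (counit_ar Z) (AMap L (AMap G y)) \<in> Hom Gst (OMap L (OMap G Y)) Z"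
    by (rule cat_comp[OF category_Gst LGy counit_ar_in[OF Z]])
  fix t assume t: "t \<in> Ob GG"
  note yt = Gst_HomD(6)[OF y t] and Lt = Gst_HomD(6)[OF LGy t] and cY = counit_at_in[OF Y t] and cZ = counit_at_in[OF Z t]
  have "mor y t \<cdot> counit_at Y t = counit_at Z t \<cdot> mor (AMap L (AMap G y)) t"
  proof (rule leg_eqI[OF PY t comp_in[OF cY yt] comp_in[OF Lt cZ]])
    have S: "Star \<in> Ob GG" by (simp add: GG_simps(1))
    have "mor y Star \<in> Hom C T T" using Gst_HomD(6)[OF y S] Y Z by (simp add: star_diagram_def)
    then have "mor y Star = Id C T" by (rule to_T_unique[OF _ idT])
    then have "mor y t \<cdot> y0 Y t = y0 Z t"
      using Gst_HomD(7)[OF y zero_Star[OF t]] idr[OF y0_in[OF Z t]] by (simp add: y0_def)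
    then show "(mor y t \<cdot> counit_at Y t) \<cdot> q (OMap G Y) t = (counit_at Z t \<cdot> mor (AMap L (AMap G y)) t) \<cdot> q (OMap G Y) t"
      using assoc[OF q_in[OF PY t] cY yt] assoc[OF q_in[OF PY t] Lt cZ]
      by (simp add: counit_at_q[OF Y t] counit_at_q[OF Z t] L_x_q[OF Gy t])
    fix n h assume h: "h \<in> Hom GG (i_ob n) t"
    let ?l = "leg (OMap G Y) t (q (OMap G Y) t) (\<iota> (OMap G Y) t) n h"
      and ?l' = "leg (OMap G Z) t (q (OMap G Z) t) (\<iota> (OMap G Z) t) n h"
    have "(mor y t \<cdot> counit_at Y t) \<cdot> ?l = mor y t \<cdot> AMap Y h"
      using assoc[OF L_leg_in[OF PY t] cY yt, of n h] by (simp add: counit_at_leg[OF Y t h])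
    also have "\<dots> = AMap Z h \<cdot> mor y (i_ob n)" by (rule Gst_HomD(7)[OF y h, symmetric])
    also have "\<dots> = (counit_at Z t \<cdot> ?l') \<cdot> mor y (i_ob n)" by (simp add: counit_at_leg[OF Z t h])
    also have "\<dots> = counit_at Z t \<cdot> (?l' \<cdot> mor (AMap G y) n)"
      using assoc[OF Gam_HomD(6)[OF Gy, of n] L_leg_in[OF PZ t] cZ, of h] by (simp add: pull_ar(1)[OF y])
    also have "\<dots> = (counit_at Z t \<cdot> mor (AMap L (AMap G y)) t) \<cdot> ?l"
      unfolding L_x_leg[OF Gy t, symmetric] by (rule assoc[OF L_leg_in[OF PY t] Lt cZ])
    finally show "(mor y t \<cdot> counit_at Y t) \<cdot> ?l = (counit_at Z t \<cdot> mor (AMap L (AMap G y)) t) \<cdot> ?l" .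
  qed
  then show "mor (Comp Gst y (counit_ar Y)) t = mor (Comp Gst (counit_ar Z) (AMap L (AMap G y))) t"
    using t by (simp add: Gst_simps(6) counit_ar_def)
qed

lemma triangle_L:
  assumes X: "pointed_diagram X"
  shows "Comp Gst (counit_ar (OMap L X)) (AMap L (unit_ar X)) = Id Gst (OMap L X)"
proof (rule Gst_eqI)
  note Ls = L_star[OF X] and u = unit_ar_in[OF X]
  note Lu = L_x_in[OF u] and P = pull_simps(3)[OF Ls]
  have ObL: "OMap L X \<in> Ob Gst" using Ls by (simp add: Gst_simps(1))
  show "Comp Gst (counit_ar (OMap L X)) (AMap L (unit_ar X)) \<in> Hom Gst (OMap L X) (OMap L X)"
    by (rule cat_comp[OF category_Gst Lu counit_ar_in[OF Ls]])
  show "Id Gst (OMap L X) \<in> Hom Gst (OMap L X) (OMap L X)" by (rule cat_id[OF category_Gst ObL])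
  fix t assume t: "t \<in> Ob GG"
  note c = counit_at_in[OF Ls t] and Lt = Gst_HomD(6)[OF Lu t]
  have "counit_at (OMap L X) t \<cdot> mor (AMap L (unit_ar X)) t = Id C (OMap (OMap L X) t)"
  proof (rule leg_eqI[OF X t comp_in[OF Lt c] cat_id[OF C star_Ob[OF Ls t]]])
    have "y0 (OMap L X) t = q X t"
      using L_g_q[OF X zero_Star[OF t]] idr[OF y0_in[OF Ls t]] by (simp add: y0_def q_Star[OF X])
    then show "(counit_at (OMap L X) t \<cdot> mor (AMap L (unit_ar X)) t) \<cdot> q X t = Id C (OMap (OMap L X) t) \<cdot> q X t"
      using assoc[OF q_in[OF X t] Lt c] by (simp add: L_x_q[OF u t] counit_at_q[OF Ls t] idl[OF q_in[OF X t]])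
    fix n h assume h: "h \<in> Hom GG (i_ob n) t"
    let ?l = "leg X t (q X t) (\<iota> X t) n h"
      and ?l' = "leg (OMap G (OMap L X)) t (q (OMap G (OMap L X)) t) (\<iota> (OMap G (OMap L X)) t) n h"
    have "(counit_at (OMap L X) t \<cdot> mor (AMap L (unit_ar X)) t) \<cdot> ?l = counit_at (OMap L X) t \<cdot> (?l' \<cdot> unit_at X n)"
      using assoc[OF L_leg_in[OF X t] Lt c, of n h] L_x_leg[OF u t, of n h] by (simp add: unit_ar_def)
    also have "\<dots> = AMap (OMap L X) h \<cdot> unit_at X n"
      using assoc[OF Gam_HomD(6)[OF u, of n] L_leg_in[OF P t] c, of h] by (simp add: counit_at_leg[OF Ls t h] unit_ar_def)
    also have "\<dots> = ?l" by (rule L_unit_at[OF X h])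
    finally show "(counit_at (OMap L X) t \<cdot> mor (AMap L (unit_ar X)) t) \<cdot> ?l = Id C (OMap (OMap L X) t) \<cdot> ?l"
      by (simp add: idl[OF L_leg_in[OF X t]])
  qed
  then show "mor (Comp Gst (counit_ar (OMap L X)) (AMap L (unit_ar X))) t = mor (Id Gst (OMap L X)) t"
    using t by (simp add: Gst_simps(5,6) counit_ar_def)
qed

lemma triangle_G:
  assumes Y: "star_diagram Y"
  shows "Comp Gam (AMap G (counit_ar Y)) (unit_ar (OMap G Y)) = Id Gam (OMap G Y)"
proof -
  have "counit_at Y (i_ob n) \<cdot> unit_at (OMap G Y) n = Id C (OMap (OMap G Y) n)" for n
    unfolding unit_at_def counit_at_leg[OF Y i_ob_Ob id_i] star_id[OF Y i_ob_Ob] pull_simps(1)[OF Y] ..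
  then show ?thesis
    unfolding pull_ar(1)[OF counit_ar_in[OF Y]] by (simp add: Gam_simps(5,6) unit_ar_def counit_ar_def FF_simps(1))
qed

theorem lan_adjunction:
  obtains \<eta> \<epsilon> where "is_ftor Gam Gst L" "is_ftor Gst Gam G"
    "nat_trans Gam Gam (fid Gam) (ftor_comp Gam G L) \<eta>" "nat_trans Gst Gst (ftor_comp Gst L G) (fid Gst) \<epsilon>"
    "\<And>X. X \<in> Ob Gam \<Longrightarrow> Comp Gst (\<epsilon> (OMap L X)) (AMap L (\<eta> X)) = Id Gst (OMap L X)"
    "\<And>Y. Y \<in> Ob Gst \<Longrightarrow> Comp Gam (AMap G (\<epsilon> Y)) (\<eta> (OMap G Y)) = Id Gam (OMap G Y)"
    "\<And>X. X \<in> Ob Gam \<Longrightarrow> \<exists>r\<in>Hom Gam (OMap G (OMap L X)) X. Comp Gam r (\<eta> X) = Id Gam X \<and>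
       Comp Gam (\<eta> X) r = Id Gam (OMap G (OMap L X))"
proof
  let ?\<eta> = "\<lambda>X\<in>Ob Gam. unit_ar X" and ?\<epsilon> = "\<lambda>Y\<in>Ob Gst. counit_ar Y"
  show "is_ftor Gam Gst L" "is_ftor Gst Gam G" by (rule L_ftor, rule is_ftor_pull)
  show "nat_trans Gam Gam (fid Gam) (ftor_comp Gam G L) ?\<eta>"
  proof (rule nat_transI)
    show "?\<eta> X \<in> Hom Gam (OMap (fid Gam) X) (OMap (ftor_comp Gam G L) X)" if X: "X \<in> Ob Gam" for X
      using X unit_ar_in[of X] by (simp add: fid_simps ftor_comp_simps) (simp add: Gam_simps(1))
    fix x X Y assume x: "x \<in> Hom Gam X Y"
    show "Comp Gam (AMap (ftor_comp Gam G L) x) (?\<eta> X) = Comp Gam (?\<eta> Y) (AMap (fid Gam) x)"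
      using unit_natural[OF x] cat_Ob[OF category_Gam x] HomD(1)[OF x] by (simp add: fid_simps ftor_comp_simps)
  qed simp
  show "nat_trans Gst Gst (ftor_comp Gst L G) (fid Gst) ?\<epsilon>"
  proof (rule nat_transI)
    show "?\<epsilon> Y \<in> Hom Gst (OMap (ftor_comp Gst L G) Y) (OMap (fid Gst) Y)" if Y: "Y \<in> Ob Gst" for Y
      using Y counit_ar_in[of Y] by (simp add: fid_simps ftor_comp_simps) (simp add: Gst_simps(1))
    fix y X Y assume y: "y \<in> Hom Gst X Y"
    show "Comp Gst (AMap (fid Gst) y) (?\<epsilon> X) = Comp Gst (?\<epsilon> Y) (AMap (ftor_comp Gst L G) y)"
      using counit_natural[OF y] cat_Ob[OF category_Gst y] HomD(1)[OF y] by (simp add: fid_simps ftor_comp_simps)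
  qed simp
  {
    fix X assume X: "X \<in> Ob Gam"
    then have "OMap L X \<in> Ob Gst" "pointed_diagram X" using L_star by (simp_all add: Gam_simps(1) Gst_simps(1))
    then show "Comp Gst (?\<epsilon> (OMap L X)) (AMap L (?\<eta> X)) = Id Gst (OMap L X)"
      "\<exists>r\<in>Hom Gam (OMap G (OMap L X)) X. Comp Gam r (?\<eta> X) = Id Gam X \<and>
       Comp Gam (?\<eta> X) r = Id Gam (OMap G (OMap L X))"
      using triangle_L[of X] unit_iso[of X] X by simp_all
  }
  fix Y assume Y: "Y \<in> Ob Gst"
  then have "OMap G Y \<in> Ob Gam" "star_diagram Y" using pull_simps(3) by (simp_all add: Gam_simps(1) Gst_simps(1))
  then show "Comp Gam (AMap G (?\<epsilon> Y)) (?\<eta> (OMap G Y)) = Id Gam (OMap G Y)"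
    using triangle_G[of Y] Y by simp
qed

end

end

subsection \<open>Existence of the left adjoint\<close>

text \<open>Colimits are presented by objects \<open>A i\<close> and equations \<open>j i \<circ> f = j k \<circ> g\<close> between the legs.  In this form
  wedges and universal cocones are instances without a detour through an indexing category.\<close>

definition compatible ::
  "('o, 'm) cat \<Rightarrow> 'i set \<Rightarrow> ('i \<Rightarrow> 'o) \<Rightarrow> ('i \<times> 'm \<times> 'i \<times> 'm) set \<Rightarrow> 'o \<Rightarrow> ('i \<Rightarrow> 'm) \<Rightarrow> bool" where
  "compatible C I A R Z j \<longleftrightarrow> Z \<in> Ob C \<and> (\<forall>i\<in>I. j i \<in> Hom C (A i) Z) \<and>
     (\<forall>(i, f, k, g)\<in>R. Comp C (j i) f = Comp C (j k) g)"

definition is_colimit ::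
  "('o, 'm) cat \<Rightarrow> 'i set \<Rightarrow> ('i \<Rightarrow> 'o) \<Rightarrow> ('i \<times> 'm \<times> 'i \<times> 'm) set \<Rightarrow> 'o \<Rightarrow> ('i \<Rightarrow> 'm) \<Rightarrow> bool" where
  "is_colimit C I A R E \<iota> \<longleftrightarrow> compatible C I A R E \<iota> \<and>
     (\<forall>Z j. compatible C I A R Z j \<longrightarrow> (\<exists>!u. u \<in> Hom C E Z \<and> (\<forall>i\<in>I. Comp C u (\<iota> i) = j i)))"

definition relations ::
  "('o, 'm) cat \<Rightarrow> 'i set \<Rightarrow> ('i \<Rightarrow> 'o) \<Rightarrow> ('i \<times> 'm \<times> 'i \<times> 'm) set \<Rightarrow> bool" where
  "relations C I A R \<longleftrightarrow> (\<forall>(i, f, k, g)\<in>R. i \<in> I \<and> k \<in> I \<and> (\<exists>B. f \<in> Hom C B (A i) \<and> g \<in> Hom C B (A k)))"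

definition has_countable_colimits :: "'i itself \<Rightarrow> ('o, 'm) cat \<Rightarrow> bool" where
  "has_countable_colimits _ C \<longleftrightarrow> (\<forall>(I :: 'i set) A R. countable I \<longrightarrow> (\<forall>i\<in>I. A i \<in> Ob C) \<longrightarrow> relations C I A R \<longrightarrow>
     (\<exists>E \<iota>. is_colimit C I A R E \<iota>))"

context pointed_category
begin

context
  assumes colims: "has_countable_colimits TYPE((nat \<times> gar) option) C"
begin

lemma colimit_ex:
  fixes I :: "(nat \<times> gar) option set"
  assumes "countable I" "\<And>i. i \<in> I \<Longrightarrow> A i \<in> Ob C" "relations C I A R"
  obtains E \<iota> where "is_colimit C I A R E \<iota>"
  using colims assms unfolding has_countable_colimits_def by blast

lemma wedge_exists:
  fixes H :: "gar set"
  assumes H: "finite H" and b: "b \<in> Hom C T A"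
  shows "\<exists>V inc pt. is_wedge C T H A b V inc pt"
proof (cases "H = {}")
  case True
  have "is_wedge C T H A b T inc (Id C T)" for inc
    unfolding is_wedge_def True
  proof (intro conjI ballI allI impI)
    fix Z r j assume "r \<in> Hom C T Z"
    then show "\<exists>!u. u \<in> Hom C T Z \<and> u \<cdot> Id C T = r \<and> (\<forall>h\<in>{}. u \<cdot> inc h = j h)"
      by (intro ex1I[of _ r]) (auto simp: idr)
  qed (simp_all add: T_Ob idT)
  then show ?thesis by blast
next
  case False
  let ?I = "insert None ((\<lambda>h. Some (0::nat, h)) ` H)" and ?A = "\<lambda>i. if i = None then T else A"
    and ?R = "(\<lambda>h. (Some (0::nat, h), b, None, Id C T)) ` H"
  have "countable ?I" using H by (simp add: countable_finite)
  moreover have "?A i \<in> Ob C" for i :: "(nat \<times> gar) option" using T_Ob cat_Ob(2)[OF C b] by simp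
  moreover have "relations C ?I ?A ?R" using b idT unfolding relations_def by auto
  ultimately obtain E \<iota> where E: "is_colimit C ?I ?A ?R E \<iota>" using colimit_ex[of ?I ?A ?R] by metis
  have compat: "compatible C ?I ?A ?R Z j \<longleftrightarrow> Z \<in> Ob C \<and> j None \<in> Hom C T Z \<and>
      (\<forall>h\<in>H. j (Some (0::nat, h)) \<in> Hom C A Z \<and> j (Some (0::nat, h)) \<cdot> b = j None)" for Z j
    unfolding compatible_def using idr by auto
  have Ec: "compatible C ?I ?A ?R E \<iota>" using E by (simp add: is_colimit_def)
  have "is_wedge C T H A b E (\<lambda>h. \<iota> (Some (0::nat, h))) (\<iota> None)"
    unfolding is_wedge_def
  proof (intro conjI ballI allI impI)
    fix Z r j assume Z: "Z \<in> Ob C" and r: "r \<in> Hom C T Z" and j: "\<forall>h\<in>H. j h \<in> Hom C A Z \<and> j h \<cdot> b = r"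
    let ?j = "\<lambda>i. case i of None \<Rightarrow> r | Some (_, h) \<Rightarrow> j h"
    have "compatible C ?I ?A ?R Z ?j" unfolding compat using Z r j by simp
    then have "\<exists>!u. u \<in> Hom C E Z \<and> (\<forall>i\<in>?I. u \<cdot> \<iota> i = ?j i)" using E unfolding is_colimit_def by blast
    then show "\<exists>!u. u \<in> Hom C E Z \<and> u \<cdot> \<iota> None = r \<and> (\<forall>h\<in>H. u \<cdot> \<iota> (Some (0::nat, h)) = j h)" by simp
  qed (use Ec False in \<open>auto simp: compat\<close>)
  then show ?thesis by blast
qed

text \<open>The index \<open>None\<close> stands for the basepoint.  The index set is countable because there are finitely many
  nonzero morphisms \<open>i n \<rightarrow> t\<close> for every \<open>n\<close>.\<close>

lemma ucocone_exists:
  assumes X: "pointed_diagram X"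
  shows "\<exists>E q j. ucocone X t E q j"
proof -
  let ?N = "{(n, h). h \<in> Gflat (i_ob n) t}"
  let ?I = "insert None (Some ` ?N)" and ?A = "\<lambda>i. case i of None \<Rightarrow> T | Some (n, h) \<Rightarrow> OMap X n"
  let ?R = "{(Some (n, h), AMap X a, if Comp GG h (i_ar a) \<in> Gflat (i_ob m) t then (Some (m, Comp GG h (i_ar a)), Id C (OMap X m))
      else (None, collapse X m)) | m n a h. a \<in> Hom FF m n \<and> h \<in> Gflat (i_ob n) t}"
  have "?N = Sigma UNIV (\<lambda>n. Gflat (i_ob n) t)" by auto
  then have "countable ?N" by (simp add: countable_SIGMA countable_finite finite_Gflat)
  then have 1: "countable ?I" by simp
  have 2: "?A i \<in> Ob C" for i using T_Ob X_Ob[OF X] by (simp split: option.split)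
  have 3: "relations C ?I ?A ?R"
    unfolding relations_def
  proof
    fix p assume "p \<in> ?R"
    then obtain m n a h k g where p: "p = (Some (n, h), AMap X a, k, g)" and a: "a \<in> Hom FF m n" and h: "h \<in> Gflat (i_ob n) t"
      and eq: "(k, g) = (if Comp GG h (i_ar a) \<in> Gflat (i_ob m) t then (Some (m, Comp GG h (i_ar a)), Id C (OMap X m))
      else (None, collapse X m))"
      by (cases p) (force split: if_splits)
    have "g \<in> Hom C (OMap X m) (?A k)" "k \<in> ?I"
      using eq cat_id[OF C X_Ob[OF X]] collapse_in[OF X] by (auto split: if_splits)
    then show "case p of (i, f, k, g) \<Rightarrow> i \<in> ?I \<and> k \<in> ?I \<and> (\<exists>B. f \<in> Hom C B (?A i) \<and> g \<in> Hom C B (?A k))"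
      using X_in[OF X a] h unfolding p by auto
  qed
  have compat: "compatible C ?I ?A ?R Z j \<longleftrightarrow> cocone X t Z (j None) (\<lambda>n h. j (Some (n, h)))" for Z j
  proof
    assume c: "compatible C ?I ?A ?R Z j"
    then have j: "j (Some (n, h)) \<in> Hom C (OMap X n) Z" if "h \<in> Gflat (i_ob n) t" for n h
      using that unfolding compatible_def by auto
    show "cocone X t Z (j None) (\<lambda>n h. j (Some (n, h)))"
      unfolding cocone_def
    proof (intro conjI allI ballI)
      show "j None \<in> Hom C T Z" using c unfolding compatible_def by auto
      fix m n a h assume a: "a \<in> Hom FF m n" and h: "h \<in> Gflat (i_ob n) t"
      let ?h = "Comp GG h (i_ar a)"
      obtain k g where kg: "(k, g) = (if ?h \<in> Gflat (i_ob m) t then (Some (m, ?h), Id C (OMap X m)) else (None, collapse X m))"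
        by (metis surj_pair)
      then have "(Some (n, h), AMap X a, k, g) \<in> ?R" using a h by blast
      then have "j (Some (n, h)) \<cdot> AMap X a = j k \<cdot> g" using c unfolding compatible_def by blast
      then show "j (Some (n, h)) \<cdot> AMap X a = leg X t (j None) (\<lambda>n h. j (Some (n, h))) m ?h"
        using kg idr[OF j] by (auto simp: leg_def split: if_splits)
    qed (rule j)
  next
    assume c: "cocone X t Z (j None) (\<lambda>n h. j (Some (n, h)))"
    then have j: "j None \<in> Hom C T Z" "j (Some (n, h)) \<in> Hom C (OMap X n) Z" if "h \<in> Gflat (i_ob n) t" for n h
      using that unfolding cocone_def by auto
    show "compatible C ?I ?A ?R Z j"
      unfolding compatible_def
    proof (intro conjI)
      have jN: "j None \<in> Hom C T Z" using c unfolding cocone_def by auto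
      then show "Z \<in> Ob C" by (rule cat_Ob(2)[OF C])
      show "\<forall>i\<in>?I. j i \<in> Hom C (?A i) Z" using jN j by auto
      show "\<forall>(i, f, k, g)\<in>?R. j i \<cdot> f = j k \<cdot> g"
      proof
        fix p assume "p \<in> ?R"
        then obtain m n a h k g where p: "p = (Some (n, h), AMap X a, k, g)" and a: "a \<in> Hom FF m n" and h: "h \<in> Gflat (i_ob n) t"
          and eq: "(k, g) = (if Comp GG h (i_ar a) \<in> Gflat (i_ob m) t then (Some (m, Comp GG h (i_ar a)), Id C (OMap X m))
          else (None, collapse X m))"
          by (cases p) (force split: if_splits)
        have "j (Some (n, h)) \<cdot> AMap X a = leg X t (j None) (\<lambda>n h. j (Some (n, h))) m (Comp GG h (i_ar a))"
          using c a h unfolding cocone_def by blast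
        also have "\<dots> = j k \<cdot> g" using eq idr[OF j(2)] by (auto simp: leg_def split: if_splits)
        finally show "case p of (i, f, k, g) \<Rightarrow> j i \<cdot> f = j k \<cdot> g" unfolding p by simp
      qed
    qed
  qed
  obtain E \<iota> where E: "is_colimit C ?I ?A ?R E \<iota>" using colimit_ex[OF 1 2 3] .
  have "ucocone X t E (\<iota> None) (\<lambda>n h. \<iota> (Some (n, h)))"
    unfolding ucocone_def
  proof (intro conjI allI impI)
    show "cocone X t E (\<iota> None) (\<lambda>n h. \<iota> (Some (n, h)))" using E unfolding is_colimit_def compat by blast
    fix Z r k assume k: "cocone X t Z r k"
    let ?j = "\<lambda>i. case i of None \<Rightarrow> r | Some (n, h) \<Rightarrow> k n h"
    have "compatible C ?I ?A ?R Z ?j" unfolding compat using k by simp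
    then have "\<exists>!u. u \<in> Hom C E Z \<and> (\<forall>i\<in>?I. u \<cdot> \<iota> i = ?j i)" using E unfolding is_colimit_def by blast
    moreover have "(\<forall>i\<in>?I. u \<cdot> \<iota> i = ?j i) \<longleftrightarrow> u \<cdot> \<iota> None = r \<and> (\<forall>n. \<forall>h\<in>Gflat (i_ob n) t. u \<cdot> \<iota> (Some (n, h)) = k n h)" for u
      by auto
    ultimately show "\<exists>!u. u \<in> Hom C E Z \<and> u \<cdot> \<iota> None = r \<and> (\<forall>n. \<forall>h\<in>Gflat (i_ob n) t. u \<cdot> \<iota> (Some (n, h)) = k n h)" by simp
  qed
  then show ?thesis by blast
qed

lemma integrand_exists:
  assumes X: "pointed_diagram X"
  shows "\<exists>S inc pt. is_integrand C T X t S inc pt"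
proof -
  have "\<exists>V inc pt. is_wedge C T (Gflat (i_ob n) t) (OMap X m) (basepoint X m) V inc pt" for n m
    by (rule wedge_exists[OF finite_Gflat basepoint_in[OF X]])
  then obtain V inc pt where W: "\<And>n m. is_wedge C T (Gflat (i_ob n) t) (OMap X m) (basepoint X m) (V n m) (inc n m) (pt n m)"
    by metis
  note VO = is_wedgeD(1)[OF W] and pt_in = is_wedgeD(2)[OF W] and inc_in = is_wedgeD(3)[OF W] and inc_b = is_wedgeD(4)[OF W]
  define wl where "wl n m h = (if h \<in> Gflat (i_ob n) t then inc n m h else pt n m \<cdot> collapse X m)" for n m h
  have wl_in: "wl n m h \<in> Hom C (OMap X m) (V n m)" for n m h
    using inc_in comp_in[OF collapse_in[OF X] pt_in] by (simp add: wl_def)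
  have cb: "collapse X m \<cdot> basepoint X m = Id C T" for m
    by (rule to_T_unique[OF comp_in[OF basepoint_in[OF X] collapse_in[OF X]] idT])
  have wl_b: "wl n m h \<cdot> basepoint X m = pt n m" for n m h
  proof -
    have "(pt n m \<cdot> collapse X m) \<cdot> basepoint X m = pt n m \<cdot> (collapse X m \<cdot> basepoint X m)"
      by (rule assoc[OF basepoint_in[OF X] collapse_in[OF X] pt_in, symmetric])
    then show ?thesis using inc_b cb idr[OF pt_in] by (simp add: wl_def)
  qed
  define P where "P m n k l a b u \<longleftrightarrow> u \<in> Hom C (V n k) (V m l) \<and> u \<cdot> pt n k = pt m l \<and>
      (\<forall>h\<in>Hom GG (i_ob n) t. u \<cdot> wl n k h = wl m l (Comp GG h (i_ar a)) \<cdot> AMap X b)" for m n k l a b u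
  have ex: "\<exists>u. P m n k l a b u" if a: "a \<in> Hom FF m n" and b: "b \<in> Hom FF k l" for m n k l a b
  proof -
    let ?j = "\<lambda>h. wl m l (Comp GG h (i_ar a)) \<cdot> AMap X b"
    obtain u where u: "u \<in> Hom C (V n k) (V m l)" "u \<cdot> pt n k = pt m l" "\<And>h. h \<in> Gflat (i_ob n) t \<Longrightarrow> u \<cdot> inc n k h = ?j h"
    proof (rule wedge_ex[OF W pt_in, where j = ?j])
      show "?j h \<in> Hom C (OMap X k) (V m l)" for h by (rule comp_in[OF X_in[OF X b] wl_in])
      show "?j h \<cdot> basepoint X k = pt m l" for h
        using assoc[OF basepoint_in[OF X] X_in[OF X b] wl_in] X_basepoint[OF X b] wl_b by metis
    qed blast
    have "u \<cdot> wl n k h = ?j h" if h: "h \<in> Hom GG (i_ob n) t" for h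
    proof (cases "h \<in> Gflat (i_ob n) t")
      case True
      then show ?thesis using u(3) by (simp add: wl_def)
    next
      case False
      then have "h = Arr (i_ob n) t None" using Gflat_cases[OF h] by simp
      then have "Comp GG h (i_ar a) \<notin> Gflat (i_ob m) t" by (simp add: Comp_zero zero_notin_Gflat)
      then show ?thesis
        using False assoc[OF collapse_in[OF X] pt_in u(1)] u(2) assoc[OF X_in[OF X b] collapse_in[OF X] pt_in, symmetric] collapse_X[OF X b]
        by (simp add: wl_def)
    qed
    then show ?thesis using u by (auto simp: P_def)
  qed
  have uniq: "u = v" if u: "P m n k l a b u" and v: "P m n k l a b v" for m n k l a b u v
  proof (rule wedge_eq[OF W basepoint_in[OF X]])
    show "u \<in> Hom C (V n k) (V m l)" "v \<in> Hom C (V n k) (V m l)" "u \<cdot> pt n k = v \<cdot> pt n k" using u v by (auto simp: P_def)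
    fix h assume h: "h \<in> Gflat (i_ob n) t"
    then have "u \<cdot> wl n k h = v \<cdot> wl n k h" using u v Gflat_Hom[OF h] unfolding P_def by metis
    then show "u \<cdot> inc n k h = v \<cdot> inc n k h" using h by (simp add: wl_def)
  qed
  define M where "M a b = (SOME u. P (src a) (tgt a) (src b) (tgt b) a b u)" for a b
  have M: "P m n k l a b (M a b)" if "a \<in> Hom FF m n" "b \<in> Hom FF k l" for m n k l a b
  proof -
    have "src a = m" "tgt a = n" "src b = k" "tgt b = l" using that by (auto simp: FF_simps)
    then show ?thesis unfolding M_def using someI_ex[OF ex[OF that]] by simp
  qed
  have M_id: "M (Id FF n) (Id FF m) = Id C (V n m)" for n m
  proof (rule uniq[OF M])
    show "Id FF n \<in> Hom FF n n" "Id FF m \<in> Hom FF m m" by (rule cat_id[OF category_FF]; simp add: FF_simps)+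
    have V: "Id C (V n m) \<in> Hom C (V n m) (V n m)" by (rule cat_id[OF C VO])
    have "Comp GG h (i_ar (Id FF n)) = h" if "h \<in> Hom GG (i_ob n) t" for h
      unfolding i_ar_id by (rule cat_idr[OF category_GG that])
    then show "P n n m m (Id FF n) (Id FF m) (Id C (V n m))"
      unfolding P_def using V idl[OF pt_in] idl[OF wl_in] idr[OF wl_in] by (simp add: X_id[OF X])
  qed
  have M_comp: "M (Comp FF a a') (Comp FF b' b) = M a' b' \<cdot> M a b"
    if a: "a \<in> Hom FF m n" and a': "a' \<in> Hom FF m' m" and b: "b \<in> Hom FF k l" and b': "b' \<in> Hom FF l l'" for a a' b b' m n k l m' l'
  proof (rule uniq[OF M])
    show "Comp FF a a' \<in> Hom FF m' n" by (rule cat_comp[OF category_FF a' a])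
    show "Comp FF b' b \<in> Hom FF k l'" by (rule cat_comp[OF category_FF b b'])
    note p = M[OF a b, unfolded P_def] and p' = M[OF a' b', unfolded P_def]
    have p1: "M a b \<in> Hom C (V n k) (V m l)" and p1': "M a' b' \<in> Hom C (V m l) (V m' l')" using p p' by blast+
    show "P m' n k l' (Comp FF a a') (Comp FF b' b) (M a' b' \<cdot> M a b)"
      unfolding P_def
    proof (intro conjI ballI)
      show "M a' b' \<cdot> M a b \<in> Hom C (V n k) (V m' l')" by (rule comp_in[OF p1 p1'])
      show "(M a' b' \<cdot> M a b) \<cdot> pt n k = pt m' l'" using assoc[OF pt_in p1 p1'] p p' by simp
      fix h assume h: "h \<in> Hom GG (i_ob n) t"
      have h': "Comp GG h (i_ar a) \<in> Hom GG (i_ob m) t" by (rule cat_comp[OF category_GG i_ar_Hom[OF a] h])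
      have "(M a' b' \<cdot> M a b) \<cdot> wl n k h = M a' b' \<cdot> (wl m l (Comp GG h (i_ar a)) \<cdot> AMap X b)"
        using assoc[OF wl_in p1 p1', symmetric] p h by simp
      also have "\<dots> = (wl m' l' (Comp GG (Comp GG h (i_ar a)) (i_ar a')) \<cdot> AMap X b') \<cdot> AMap X b"
        using assoc[OF X_in[OF X b] wl_in p1'] p' h' by simp
      also have "Comp GG (Comp GG h (i_ar a)) (i_ar a') = Comp GG h (i_ar (Comp FF a a'))"
        unfolding i_ar_comp[OF a' a] by (rule cat_assoc[OF category_GG i_ar_Hom[OF a'] i_ar_Hom[OF a] h, symmetric])
      also have "(wl m' l' (Comp GG h (i_ar (Comp FF a a'))) \<cdot> AMap X b') \<cdot> AMap X b =
          wl m' l' (Comp GG h (i_ar (Comp FF a a'))) \<cdot> AMap X (Comp FF b' b)"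
        unfolding X_comp[OF X b b'] by (rule assoc[OF X_in[OF X b] X_in[OF X b'] wl_in, symmetric])
      finally show "(M a' b' \<cdot> M a b) \<cdot> wl n k h = wl m' l' (Comp GG h (i_ar (Comp FF a a'))) \<cdot> AMap X (Comp FF b' b)" .
    qed
  qed
  define S where "S = (\<lparr>OMap = \<lambda>(n, m). V n m, AMap = \<lambda>(a, b)\<in>Ar FF \<times> Ar FF. M a b\<rparr> :: (nat \<times> nat, fin_ar \<times> fin_ar, 'o, 'm) ftor)"
  have S: "OMap S (n, m) = V n m" "a \<in> Ar FF \<Longrightarrow> b \<in> Ar FF \<Longrightarrow> AMap S (a, b) = M a b" for n m a b
    by (simp_all add: S_def)
  have Hm: "(a, b) \<in> Hom (prod_cat (opp FF) FF) (n, k) (m, l) \<longleftrightarrow> a \<in> Hom FF m n \<and> b \<in> Hom FF k l" for a b n k m l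
    by (auto simp: Hom_def prod_cat_def opp_def)
  have Hm1: "M a b \<in> Hom C (V n k) (V m l)" if "a \<in> Hom FF m n" "b \<in> Hom FF k l" for a b n k m l
    using M[OF that] by (simp add: P_def)
  have "is_ftor (prod_cat (opp FF) FF) C S"
  proof (rule is_ftorI)
    fix p :: "nat \<times> nat"
    obtain n m where p: "p = (n, m)" by (cases p)
    show "OMap S p \<in> Ob C" using VO p by (simp add: S)
    have "Id FF n \<in> Ar FF" "Id FF m \<in> Ar FF" by (rule HomD(1)[OF cat_id[OF category_FF]]; simp add: FF_simps)+
    then show "AMap S (Id (prod_cat (opp FF) FF) p) = Id C (OMap S p)"
      using M_id p by (simp add: prod_cat_def opp_def S)
    show "OMap S p = undefined" if "p \<notin> Ob (prod_cat (opp FF) FF)" using that p by (simp add: prod_cat_def opp_def FF_simps(1))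
  next
    fix f assume "f \<notin> Ar (prod_cat (opp FF) FF)"
    then show "AMap S f = undefined" by (cases f) (auto simp: S_def prod_cat_def opp_def)
  next
    fix f assume f: "f \<in> Ar (prod_cat (opp FF) FF)"
    obtain a b where ab: "f = (a, b)" by (cases f)
    then have "a \<in> Ar FF" "b \<in> Ar FF" using f by (auto simp: prod_cat_def opp_def)
    then show "AMap S f \<in> Hom C (OMap S (Dom (prod_cat (opp FF) FF) f)) (OMap S (Cod (prod_cat (opp FF) FF) f))"
      using Hm1[OF cat_Ar[OF category_FF, of a] cat_Ar[OF category_FF, of b]] ab
      by (simp add: S prod_cat_def opp_def)
  next
    fix f g p q r assume f: "f \<in> Hom (prod_cat (opp FF) FF) p q" and g: "g \<in> Hom (prod_cat (opp FF) FF) q r"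
    obtain a b a' b' n k m l m' l' where *: "f = (a, b)" "g = (a', b')" "p = (n, k)" "q = (m, l)" "r = (m', l')"
      by (metis surj_pair)
    have h: "a \<in> Hom FF m n" "b \<in> Hom FF k l" "a' \<in> Hom FF m' m" "b' \<in> Hom FF l l'"
      using f g unfolding * Hm by auto
    then have "AMap S (Comp (prod_cat (opp FF) FF) g f) = M (Comp FF a a') (Comp FF b' b)"
      using HomD(1)[OF cat_comp[OF category_FF h(3,1)]] HomD(1)[OF cat_comp[OF category_FF h(2,4)]]
      by (simp add: * prod_cat_def opp_def S)
    then show "AMap S (Comp (prod_cat (opp FF) FF) g f) = AMap S g \<cdot> AMap S f"
      using M_comp[OF h(1,3,2,4)] h[THEN HomD(1)] by (simp add: * S)
  qed
  moreover have "is_wedge C T (Gflat (i_ob n) t) (OMap X m) (basepoint X m) (OMap S (n, m)) (inc n m) (pt n m)" for n m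
    using W by (simp add: S)
  moreover have "AMap S (a, b) \<cdot> pt (tgt a) (src b) = pt (src a) (tgt b) \<and>
        (\<forall>h\<in>Gflat (i_ob (tgt a)) t. let h' = Comp GG h (i_ar a) in
          AMap S (a, b) \<cdot> inc (tgt a) (src b) h =
            (if h' \<in> Gflat (i_ob (src a)) t then inc (src a) (tgt b) h' \<cdot> AMap X b
             else pt (src a) (tgt b) \<cdot> collapse X (src b)))" if ab: "a \<in> Ar FF" "b \<in> Ar FF" for a b
  proof -
    have a: "a \<in> Hom FF (src a) (tgt a)" and b: "b \<in> Hom FF (src b) (tgt b)" using ab by (auto simp: Hom_def FF_simps(4,5))
    note p = M[OF a b, unfolded P_def]
    have "M a b \<cdot> inc (tgt a) (src b) h = (if Comp GG h (i_ar a) \<in> Gflat (i_ob (src a)) t then inc (src a) (tgt b) (Comp GG h (i_ar a)) \<cdot> AMap X b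
             else pt (src a) (tgt b) \<cdot> collapse X (src b))" if h: "h \<in> Gflat (i_ob (tgt a)) t" for h
    proof -
      have "M a b \<cdot> inc (tgt a) (src b) h = wl (src a) (tgt b) (Comp GG h (i_ar a)) \<cdot> AMap X b"
        using p Gflat_Hom[OF h] h unfolding wl_def[of "tgt a"] by (elim conjE) (drule bspec[of _ _ h], auto)
      then show ?thesis
        using assoc[OF X_in[OF X b] collapse_in[OF X] pt_in, symmetric] collapse_X[OF X b] by (simp add: wl_def)
    qed
    then show ?thesis using p ab by (simp add: S Let_def)
  qed
  ultimately have "is_integrand C T X t S (\<lambda>(n, m). inc n m) (\<lambda>(n, m). pt n m)"
    unfolding is_integrand_def prod.case by blast
  then show ?thesis by blast
qed

lemma lan_exists: "\<exists>L q \<iota>. lan L q \<iota>"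
proof -
  \<comment> \<open>A universal cocone over \<open>Star\<close> is only isomorphic to \<open>T\<close>, but \<open>L X\<close> has to take the value \<open>T\<close> there.\<close>
  have "\<exists>E q \<iota>. ucocone X t E q \<iota> \<and> (t = Star \<longrightarrow> E = T)" if X: "pointed_diagram X" for X t
  proof (cases "t = Star")
    case True
    have "ucocone X Star T (Id C T) \<iota>" for \<iota>
      unfolding ucocone_def
    proof (intro conjI allI impI)
      show "cocone X Star T (Id C T) \<iota>" using idT by (simp add: cocone_def Gflat_Star)
      fix Z r k assume "cocone X Star Z r k"
      then have r: "r \<in> Hom C T Z" by (simp add: cocone_def)
      show "\<exists>!u. u \<in> Hom C T Z \<and> u \<cdot> Id C T = r \<and> (\<forall>n. \<forall>h\<in>Gflat (i_ob n) Star. u \<cdot> \<iota> n h = k n h)"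
        by (rule ex1I[of _ r]) (use r idr in \<open>auto simp: Gflat_Star\<close>)
    qed
    then show ?thesis using True by blast
  next
    case False
    then show ?thesis using ucocone_exists[OF X] by blast
  qed
  then obtain E q \<iota> where U: "\<And>X t. pointed_diagram X \<Longrightarrow> ucocone X t (E X t) (q X t) (\<iota> X t)"
    and EStar: "\<And>X. pointed_diagram X \<Longrightarrow> E X Star = T" by metis
  have J: "cocone X t (E X t) (q X t) (\<iota> X t)" if "pointed_diagram X" for X t using U[OF that] by (simp add: ucocone_def)
  have q_in: "q X t \<in> Hom C T (E X t)" if "pointed_diagram X" for X t using J[OF that] by (simp add: cocone_def)
  let ?l = "\<lambda>X t. leg X t (q X t) (\<iota> X t)"
  have l_in: "?l X t n h \<in> Hom C (OMap X n) (E X t)" if "pointed_diagram X" for X t n h by (rule leg_in[OF that J[OF that]])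
  have eqI: "u = v" if "pointed_diagram X" "u \<in> Hom C (E X t) Z" "v \<in> Hom C (E X t) Z" "u \<cdot> q X t = v \<cdot> q X t"
    "\<And>n h. h \<in> Hom GG (i_ob n) t \<Longrightarrow> u \<cdot> ?l X t n h = v \<cdot> ?l X t n h" for X t Z u v
  proof (rule ucocone_eq[OF that(1) U[OF that(1)] that(2-4)])
    show "u \<cdot> \<iota> X t n h = v \<cdot> \<iota> X t n h" if "h \<in> Gflat (i_ob n) t" for n h
      using \<open>\<And>n h. h \<in> Hom GG (i_ob n) t \<Longrightarrow> u \<cdot> ?l X t n h = v \<cdot> ?l X t n h\<close>[OF Gflat_Hom[OF that]] that by (simp add: leg_def)
  qed
  have ex: "\<exists>u. u \<in> Hom C (E X t) Z \<and> u \<cdot> q X t = r \<and> (\<forall>n. \<forall>h\<in>Hom GG (i_ob n) t. u \<cdot> ?l X t n h = k n h)"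
    if X: "pointed_diagram X" and r: "r \<in> Hom C T Z" and k: "\<And>n h. h \<in> Hom GG (i_ob n) t \<Longrightarrow> k n h \<in> Hom C (OMap X n) Z"
      and kX: "\<And>m n a h. a \<in> Hom FF m n \<Longrightarrow> h \<in> Hom GG (i_ob n) t \<Longrightarrow> k n h \<cdot> AMap X a = k m (Comp GG h (i_ar a))"
      and kz: "\<And>n. k n (Arr (i_ob n) t None) = r \<cdot> collapse X n" for X t Z r k
  proof -
    have lk: "leg X t r k n h = k n h" if "h \<in> Hom GG (i_ob n) t" for n h
      using Gflat_cases[OF that] kz by (auto simp: leg_def)
    have "cocone X t Z r k"
      unfolding cocone_def using r k kX lk cat_comp[OF category_GG i_ar_Hom] by (simp add: Gflat_Hom)
    then obtain u where u: "u \<in> Hom C (E X t) Z" "u \<cdot> q X t = r" "\<And>n h. h \<in> Gflat (i_ob n) t \<Longrightarrow> u \<cdot> \<iota> X t n h = k n h"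
      using ucocone_ex[OF X U[OF X]] by metis
    have "u \<cdot> ?l X t n h = k n h" if "h \<in> Hom GG (i_ob n) t" for n h
      using comp_leg[OF X J[OF X] u(1), of n h] lk[OF that] u(2,3) by (simp add: leg_def split: if_splits)
    then show ?thesis using u by blast
  qed
  \<comment> \<open>\<open>P X s t g\<close> determines the value of the diagram \<open>L X\<close> at \<open>g : s \<rightarrow> t\<close>, by joint epimorphy of the legs.\<close>
  define P where "P X s t g u \<longleftrightarrow> u \<in> Hom C (E X s) (E X t) \<and> u \<cdot> q X s = q X t \<and>
      (\<forall>n. \<forall>h\<in>Hom GG (i_ob n) s. u \<cdot> ?l X s n h = ?l X t n (Comp GG g h))" for X s t g u
  have P_ex: "\<exists>u. P X s t g u" if X: "pointed_diagram X" and g: "g \<in> Hom GG s t" for X s t g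
    unfolding P_def
  proof (rule ex[OF X q_in[OF X] l_in[OF X]])
    fix m n a h assume a: "a \<in> Hom FF m n" and h: "h \<in> Hom GG (i_ob n) s"
    show "?l X t n (Comp GG g h) \<cdot> AMap X a = ?l X t m (Comp GG g (Comp GG h (i_ar a)))"
      unfolding cat_assoc[OF category_GG i_ar_Hom[OF a] h g]
      by (rule leg_X[OF X J[OF X] cat_comp[OF category_GG h g] a])
  next
    fix n
    have "tgt g = t" using g by (auto simp: GG_simps(2))
    then show "?l X t n (Comp GG g (Arr (i_ob n) s None)) = q X t \<cdot> collapse X n"
      by (simp add: Comp_zero leg_def zero_notin_Gflat)
  qed
  define M where "M X g = (SOME u. P X (src g) (tgt g) g u)" for X g
  have M: "P X s t g (M X g)" if X: "pointed_diagram X" and g: "g \<in> Hom GG s t" for X s t g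
  proof -
    have "src g = s" "tgt g = t" using g by (auto simp: GG_simps(2))
    then show ?thesis unfolding M_def using someI_ex[OF P_ex[OF X g]] by simp
  qed
  have P_uniq: "u = v" if "pointed_diagram X" "P X s t g u" "P X s t g v" for X s t g u v
    by (rule eqI[OF that(1)]) (use that(2,3) in \<open>auto simp: P_def\<close>)
  define LO where "LO X = (\<lparr>OMap = \<lambda>t\<in>Ob GG. E X t, AMap = \<lambda>g\<in>Ar GG. M X g\<rparr> :: ('o, 'm) gstar_ob)" for X
  have LO: "t \<in> Ob GG \<Longrightarrow> OMap (LO X) t = E X t" "g \<in> Hom GG s t \<Longrightarrow> AMap (LO X) g = M X g" for X t g s
    by (simp_all add: LO_def Hom_def)
  have EO: "E X t \<in> Ob C" if "pointed_diagram X" for X t using cat_Ob(2)[OF C q_in[OF that]] .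
  have LO_star: "star_diagram (LO X)" if X: "pointed_diagram X" for X
    unfolding star_diagram_def
  proof
    show "OMap (LO X) Star = T" using EStar[OF X] by (simp add: LO GG_simps(1))
    show "is_ftor GG C (LO X)"
    proof (rule is_ftorI)
      fix t assume t: "t \<in> Ob GG"
      then show "OMap (LO X) t \<in> Ob C" using EO[OF X] by (simp add: LO)
      have i: "Id GG t \<in> Hom GG t t" by (rule cat_id[OF category_GG t])
      have V: "Id C (E X t) \<in> Hom C (E X t) (E X t)" by (rule cat_id[OF C EO[OF X]])
      have "P X t t (Id GG t) (Id C (E X t))"
        unfolding P_def using V idl[OF q_in[OF X]] idl[OF l_in[OF X]] cat_idl[OF category_GG] by simp
      then show "AMap (LO X) (Id GG t) = Id C (OMap (LO X) t)"
        using P_uniq[OF X M[OF X i]] by (simp add: LO(2)[OF i] LO(1)[OF t])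
    next
      fix g assume g: "g \<in> Ar GG"
      note g' = cat_Ar[OF category_GG g]
      show "AMap (LO X) g \<in> Hom C (OMap (LO X) (Dom GG g)) (OMap (LO X) (Cod GG g))"
        using M[OF X g'] cat_Ob[OF category_GG g'] by (simp add: LO(1) LO(2)[OF g'] P_def)
    next
      fix f g s t v assume f: "f \<in> Hom GG s t" and g: "g \<in> Hom GG t v"
      note gf = cat_comp[OF category_GG f g]
      note p = M[OF X f, unfolded P_def] and p' = M[OF X g, unfolded P_def]
      have p1: "M X f \<in> Hom C (E X s) (E X t)" and p1': "M X g \<in> Hom C (E X t) (E X v)" using p p' by blast+
      have "P X s v (Comp GG g f) (M X g \<cdot> M X f)"
        unfolding P_def
      proof (intro conjI allI ballI)
        show "M X g \<cdot> M X f \<in> Hom C (E X s) (E X v)" by (rule comp_in[OF p1 p1'])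
        show "(M X g \<cdot> M X f) \<cdot> q X s = q X v" using assoc[OF q_in[OF X] p1 p1'] p p' by simp
        fix n h assume h: "h \<in> Hom GG (i_ob n) s"
        have "(M X g \<cdot> M X f) \<cdot> ?l X s n h = M X g \<cdot> ?l X t n (Comp GG f h)" using assoc[OF l_in[OF X] p1 p1', symmetric] p h by simp
        also have "\<dots> = ?l X v n (Comp GG g (Comp GG f h))" using p' cat_comp[OF category_GG h f] by blast
        finally show "(M X g \<cdot> M X f) \<cdot> ?l X s n h = ?l X v n (Comp GG (Comp GG g f) h)"
          using cat_assoc[OF category_GG h f g] by simp
      qed
      then show "AMap (LO X) (Comp GG g f) = AMap (LO X) g \<cdot> AMap (LO X) f"
        using P_uniq[OF X M[OF X gf]] by (simp add: LO(2)[OF f] LO(2)[OF g] LO(2)[OF gf])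
    qed (simp_all add: LO_def)
  qed
  \<comment> \<open>\<open>N X Y x t\<close> determines the component of \<open>L x\<close> at \<open>t\<close>.\<close>
  define N where "N X Y x t u \<longleftrightarrow> u \<in> Hom C (E X t) (E Y t) \<and> u \<cdot> q X t = q Y t \<and>
      (\<forall>n. \<forall>h\<in>Hom GG (i_ob n) t. u \<cdot> ?l X t n h = ?l Y t n h \<cdot> mor x n)"
    for X Y t u and x :: "('o, 'm) gamma_ar"
  have N_ex: "\<exists>u. N X Y x t u" if x: "x \<in> Hom Gam X Y" for X Y x t
    unfolding N_def
  proof (rule ex[OF Gam_HomD(1)[OF x] q_in[OF Gam_HomD(2)[OF x]]])
    note X = Gam_HomD(1)[OF x] and Y = Gam_HomD(2)[OF x] and xn = Gam_HomD(6)[OF x]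
    show "?l Y t n h \<cdot> mor x n \<in> Hom C (OMap X n) (E Y t)" for n h by (rule comp_in[OF xn l_in[OF Y]])
    fix m n a h assume a: "a \<in> Hom FF m n" and h: "h \<in> Hom GG (i_ob n) t"
    have "(?l Y t n h \<cdot> mor x n) \<cdot> AMap X a = ?l Y t n h \<cdot> (AMap Y a \<cdot> mor x m)"
      unfolding Gam_HomD(7)[OF x a] by (rule assoc[OF X_in[OF X a] xn l_in[OF Y], symmetric])
    also have "\<dots> = (?l Y t n h \<cdot> AMap Y a) \<cdot> mor x m" by (rule assoc[OF xn X_in[OF Y a] l_in[OF Y]])
    also have "?l Y t n h \<cdot> AMap Y a = ?l Y t m (Comp GG h (i_ar a))" by (rule leg_X[OF Y J[OF Y] h a])
    finally show "(?l Y t n h \<cdot> mor x n) \<cdot> AMap X a = ?l Y t m (Comp GG h (i_ar a)) \<cdot> mor x m" .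
  next
    fix n
    note X = Gam_HomD(1)[OF x] and Y = Gam_HomD(2)[OF x] and xn = Gam_HomD(6)[OF x]
    have "collapse Y n \<cdot> mor x n = collapse X n"
      by (rule to_T_unique[OF comp_in[OF xn collapse_in[OF Y]] collapse_in[OF X]])
    then show "?l Y t n (Arr (i_ob n) t None) \<cdot> mor x n = q Y t \<cdot> collapse X n"
      using assoc[OF xn collapse_in[OF Y] q_in[OF Y], symmetric] by (simp add: leg_def zero_notin_Gflat)
  qed
  define NN where "NN x t = (SOME u. N (src x) (tgt x) x t u)" for x t
  have NN: "N X Y x t (NN x t)" if x: "x \<in> Hom Gam X Y" for X Y x t
    unfolding NN_def Gam_HomD(4,5)[OF x] using someI_ex[OF N_ex[OF x]] .
  have N_uniq: "u = v" if "pointed_diagram X" "N X Y x t u" "N X Y x t v" for X Y x t u v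
    by (rule eqI[OF that(1)]) (use that(2,3) in \<open>auto simp: N_def\<close>)
  define L where "L = \<lparr>OMap = \<lambda>X\<in>Ob Gam. LO X, AMap = \<lambda>x\<in>Ar Gam. Arr (LO (src x)) (LO (tgt x)) (\<lambda>t\<in>Ob GG. NN x t)\<rparr>"
  have L: "pointed_diagram X \<Longrightarrow> OMap L X = LO X"
    "x \<in> Hom Gam X Y \<Longrightarrow> AMap L x = Arr (LO X) (LO Y) (\<lambda>t\<in>Ob GG. NN x t)" for X Y x
    using Gam_HomD(4,5)[of x X Y] by (auto simp: L_def Gam_simps(1) HomD(1))
  have L_ar: "AMap L x \<in> Hom Gst (LO X) (LO Y)" if x: "x \<in> Hom Gam X Y" for X Y x
    unfolding L(2)[OF x]
  proof (rule Gst_HomI)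
    note X = Gam_HomD(1)[OF x] and Y = Gam_HomD(2)[OF x] and xn = Gam_HomD(6)[OF x]
    show "star_diagram (LO X)" "star_diagram (LO Y)" by (rule LO_star[OF X], rule LO_star[OF Y])
    show "(\<lambda>t\<in>Ob GG. NN x t) t \<in> Hom C (OMap (LO X) t) (OMap (LO Y) t)" if "t \<in> Ob GG" for t
      using NN[OF x, of t] that by (simp add: LO N_def)
    fix g s t assume g: "g \<in> Hom GG s t"
    note st = cat_Ob[OF category_GG g]
    note n1 = NN[OF x, of s, unfolded N_def] and n2 = NN[OF x, of t, unfolded N_def]
      and m1 = M[OF X g, unfolded P_def] and m2 = M[OF Y g, unfolded P_def]
    have i: "NN x s \<in> Hom C (E X s) (E Y s)" "NN x t \<in> Hom C (E X t) (E Y t)" "M X g \<in> Hom C (E X s) (E X t)"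
      "M Y g \<in> Hom C (E Y s) (E Y t)" using n1 n2 m1 m2 by blast+
    have "M Y g \<cdot> NN x s = NN x t \<cdot> M X g"
    proof (rule eqI[OF X comp_in[OF i(1,4)] comp_in[OF i(3,2)]])
      show "(M Y g \<cdot> NN x s) \<cdot> q X s = (NN x t \<cdot> M X g) \<cdot> q X s"
        using assoc[OF q_in[OF X] i(1,4)] assoc[OF q_in[OF X] i(3,2)] n1 n2 m1 m2 by simp
      fix n h assume h: "h \<in> Hom GG (i_ob n) s"
      have "(M Y g \<cdot> NN x s) \<cdot> ?l X s n h = M Y g \<cdot> (?l Y s n h \<cdot> mor x n)"
        using assoc[OF l_in[OF X] i(1,4), symmetric] n1 h by simp
      also have "\<dots> = ?l Y t n (Comp GG g h) \<cdot> mor x n" using assoc[OF xn l_in[OF Y] i(4)] m2 h by simp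
      also have "\<dots> = NN x t \<cdot> ?l X t n (Comp GG g h)" using n2 cat_comp[OF category_GG h g] by simp
      also have "\<dots> = (NN x t \<cdot> M X g) \<cdot> ?l X s n h" using assoc[OF l_in[OF X] i(3,2), symmetric] m1 h by simp
      finally show "(M Y g \<cdot> NN x s) \<cdot> ?l X s n h = (NN x t \<cdot> M X g) \<cdot> ?l X s n h" .
    qed
    then show "AMap (LO Y) g \<cdot> (\<lambda>t\<in>Ob GG. NN x t) s = (\<lambda>t\<in>Ob GG. NN x t) t \<cdot> AMap (LO X) g"
      using st by (simp add: LO(2)[OF g])
  qed simp
  have "lan L q \<iota>"
    unfolding lan_def
  proof (intro conjI allI impI ballI)
    show "is_ftor Gam Gst L"
    proof (rule is_ftorI)
      fix X assume "X \<in> Ob Gam"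
      then have X: "pointed_diagram X" by (simp add: Gam_simps(1))
      then show "OMap L X \<in> Ob Gst" using LO_star by (simp add: L Gst_simps(1))
      have iX: "Id Gam X \<in> Hom Gam X X" by (rule cat_id[OF category_Gam]) (simp add: Gam_simps(1) X)
      have "NN (Id Gam X) t = Id C (E X t)" for t
      proof (rule N_uniq[OF X NN[OF iX]])
        show "N X X (Id Gam X) t (Id C (E X t))"
          unfolding N_def using cat_id[OF C EO[OF X]] idl[OF q_in[OF X]] idl[OF l_in[OF X]] idr[OF l_in[OF X]]
          by (simp add: Gam_simps(5) FF_simps(1))
      qed
      then show "AMap L (Id Gam X) = Id Gst (OMap L X)"
        unfolding L(1)[OF X] L(2)[OF iX] Gst_simps(5) by (auto simp: LO)
    next
      fix x assume x: "x \<in> Ar Gam"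
      note x' = cat_Ar[OF category_Gam x]
      show "AMap L x \<in> Hom Gst (OMap L (Dom Gam x)) (OMap L (Cod Gam x))"
        using L_ar[OF x'] L(1)[OF Gam_HomD(1)[OF x']] L(1)[OF Gam_HomD(2)[OF x']] by simp
    next
      fix x y X Y Z assume x: "x \<in> Hom Gam X Y" and y: "y \<in> Hom Gam Y Z"
      note X = Gam_HomD(1)[OF x] and Y = Gam_HomD(2)[OF x] and Z = Gam_HomD(2)[OF y] and yx = cat_comp[OF category_Gam x y]
      have "NN (Comp Gam y x) t = NN y t \<cdot> NN x t" for t
      proof (rule N_uniq[OF X NN[OF yx]])
        note n1 = NN[OF x, of t, unfolded N_def] and n2 = NN[OF y, of t, unfolded N_def]
        have i: "NN x t \<in> Hom C (E X t) (E Y t)" "NN y t \<in> Hom C (E Y t) (E Z t)" using n1 n2 by blast+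
        show "N X Z (Comp Gam y x) t (NN y t \<cdot> NN x t)"
          unfolding N_def
        proof (intro conjI allI ballI)
          show "NN y t \<cdot> NN x t \<in> Hom C (E X t) (E Z t)" by (rule comp_in[OF i])
          show "(NN y t \<cdot> NN x t) \<cdot> q X t = q Z t" using assoc[OF q_in[OF X] i] n1 n2 by simp
          fix n h assume h: "h \<in> Hom GG (i_ob n) t"
          have "(NN y t \<cdot> NN x t) \<cdot> ?l X t n h = NN y t \<cdot> (?l Y t n h \<cdot> mor x n)" using assoc[OF l_in[OF X] i, symmetric] n1 h by simp
          also have "\<dots> = (?l Z t n h \<cdot> mor y n) \<cdot> mor x n" using assoc[OF Gam_HomD(6)[OF x] l_in[OF Y] i(2)] n2 h by simp
          also have "\<dots> = ?l Z t n h \<cdot> (mor y n \<cdot> mor x n)"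
            by (rule assoc[OF Gam_HomD(6)[OF x] Gam_HomD(6)[OF y] l_in[OF Z], symmetric])
          finally show "(NN y t \<cdot> NN x t) \<cdot> ?l X t n h = ?l Z t n h \<cdot> mor (Comp Gam y x) n"
            by (simp add: Gam_simps(6) FF_simps(1))
        qed
      qed
      then show "AMap L (Comp Gam y x) = Comp Gst (AMap L y) (AMap L x)"
        unfolding L(2)[OF x] L(2)[OF y] L(2)[OF yx] Gst_simps(6) by auto
    qed (simp_all add: L_def)
    fix X assume X: "pointed_diagram X"
    show "ucocone X t (OMap (OMap L X) t) (q X t) (\<iota> X t)" if t: "t \<in> Ob GG" for t
      using U[OF X, of t] by (simp add: L(1)[OF X] LO(1)[OF t])
    fix s t g assume g: "g \<in> Hom GG s t"
    note m = M[OF X g, unfolded P_def]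
    show "AMap (OMap L X) g \<cdot> q X s = q X t" using m by (simp add: L(1)[OF X] LO(2)[OF g])
    show "AMap (OMap L X) g \<cdot> \<iota> X s n h = ?l X t n (Comp GG g h)" if h: "h \<in> Gflat (i_ob n) s" for n h
    proof -
      have "M X g \<cdot> ?l X s n h = ?l X t n (Comp GG g h)" using m Gflat_Hom[OF h] by blast
      then show ?thesis using h by (simp add: L(1)[OF X] LO(2)[OF g] leg_def[of X s])
    qed
  next
    fix X Y x t assume x: "x \<in> Hom Gam X Y" and t: "t \<in> Ob GG"
    note n1 = NN[OF x, of t, unfolded N_def]
    show "mor (AMap L x) t \<cdot> q X t = q Y t" using n1 t by (simp add: L(2)[OF x])
    show "mor (AMap L x) t \<cdot> \<iota> X t n h = \<iota> Y t n h \<cdot> mor x n" if h: "h \<in> Gflat (i_ob n) t" for n h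
    proof -
      have "NN x t \<cdot> ?l X t n h = ?l Y t n h \<cdot> mor x n" using n1 Gflat_Hom[OF h] by blast
      then show ?thesis using h t by (simp add: L(2)[OF x] leg_def)
    qed
  qed
  then show ?thesis by blast
qed

theorem is_L_LL: "is_L C T (LL C T)"
proof -
  obtain L q \<iota> where "lan L q \<iota>" using lan_exists by blast
  then have "is_L C T L" by (rule is_L_of_lan) (rule integrand_exists)
  then show ?thesis unfolding LL_def by (rule someI)
qed

end

end

section \<open>Countable colimits of small categories and small simplicial sets\<close>

lemma universe_subset: "universe \<U> \<Longrightarrow> B \<in> \<U> \<Longrightarrow> A \<subseteq> B \<Longrightarrow> A \<in> \<U>"
  unfolding universe_def by blast

lemma universe_image: "universe \<U> \<Longrightarrow> A \<in> \<U> \<Longrightarrow> (f :: 'u \<Rightarrow> 'u) ` A \<in> \<U>"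
  unfolding universe_def by blast

lemma universe_UN: "universe \<U> \<Longrightarrow> (A :: 'u set) \<in> \<U> \<Longrightarrow> (\<And>a. a \<in> A \<Longrightarrow> (B a :: 'u set) \<in> \<U>) \<Longrightarrow> (\<Union>a\<in>A. B a) \<in> \<U>"
  unfolding universe_def by blast

lemma universe_countable:
  assumes U: "universe \<U>" and S: "countable (S :: 'u set)"
  shows "S \<in> \<U>"
proof -
  obtain A where A: "A \<in> \<U>" "infinite A" using U unfolding universe_def by blast
  obtain g :: "nat \<Rightarrow> 'u" where g: "inj g" "range g \<subseteq> A" using infinite_countable_subset[OF A(2)] by blast
  have "S \<subseteq> (\<lambda>a. from_nat_into S (inv_into UNIV g a)) ` A"
  proof
    fix s assume s: "s \<in> S"
    obtain n where "from_nat_into S n = s" using from_nat_into_surj[OF S s] by blast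
    then have "s = (\<lambda>a. from_nat_into S (inv_into UNIV g a)) (g n)" using g by simp
    then show "s \<in> (\<lambda>a. from_nat_into S (inv_into UNIV g a)) ` A" using g by blast
  qed
  then show ?thesis using universe_subset[OF U universe_image[OF U A(1)]] by blast
qed

text \<open>A pairing function on the type of the universe codes disjoint unions and lists by elements of this type,
  so that colimits can be formed inside of it.\<close>

locale coding =
  fixes \<U> :: "'u set set" and pr :: "'u \<Rightarrow> 'u \<Rightarrow> 'u" and \<nu> :: "nat \<Rightarrow> 'u"
  assumes U: "universe \<U>" and pr: "\<And>a b c d. pr a b = pr c d \<longleftrightarrow> a = c \<and> b = d" and \<nu>: "inj \<nu>"
begin

lemma pr_product: "A \<in> \<U> \<Longrightarrow> B \<in> \<U> \<Longrightarrow> (\<Union>a\<in>A. pr a ` B) \<in> \<U>"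
  by (intro universe_UN[OF U] universe_image[OF U])

fun lc :: "'u list \<Rightarrow> 'u" where
  "lc [] = \<nu> 0"
| "lc (x # l) = pr x (lc l)"

lemma lc_inj: "length l = length l' \<Longrightarrow> lc l = lc l' \<Longrightarrow> l = l'"
  by (induction l l' rule: list_induct2) (auto simp: pr)

text \<open>The map \<open>lc\<close> is injective only on lists of a fixed length, so that the length has to be recorded.\<close>

definition lcode :: "'u list \<Rightarrow> 'u" where
  "lcode l = pr (\<nu> (length l)) (lc l)"

lemma lcode_inj: "lcode l = lcode l' \<Longrightarrow> l = l'"
  using \<nu> lc_inj by (auto simp: lcode_def pr inj_def)

lemma lists_in_universe:
  assumes B: "B \<in> \<U>"
  shows "lcode ` lists B \<in> \<U>"
proof -
  have len: "lc ` {l \<in> lists B. length l = n} \<in> \<U>" for n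
  proof (induction n)
    case 0
    have "lc ` {l \<in> lists B. length l = 0} \<subseteq> {\<nu> 0}" by auto
    then show ?case using universe_subset[OF U] universe_countable[OF U, of "{\<nu> 0}"] by blast
  next
    case (Suc n)
    have "lc ` {l \<in> lists B. length l = Suc n} \<subseteq> (\<Union>b\<in>B. pr b ` lc ` {l \<in> lists B. length l = n})"
    proof
      fix y assume "y \<in> lc ` {l \<in> lists B. length l = Suc n}"
      then obtain l0 where l0: "y = lc l0" "l0 \<in> lists B" "length l0 = Suc n" by blast
      then obtain b l where "l0 = b # l" by (cases l0) auto
      with l0 have "y = pr b (lc l)" "b \<in> B" "l \<in> lists B" "length l = n" by auto
      then show "y \<in> (\<Union>b\<in>B. pr b ` lc ` {l \<in> lists B. length l = n})" by blast
    qed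
    then show ?case using universe_subset[OF U pr_product[OF B Suc]] by blast
  qed
  have "(\<Union>a\<in>range \<nu>. pr a ` lc ` {l \<in> lists B. length l = inv_into UNIV \<nu> a}) \<in> \<U>"
    by (intro universe_UN[OF U] universe_image[OF U] len universe_countable[OF U]) simp
  moreover have "lcode ` lists B \<subseteq> (\<Union>a\<in>range \<nu>. pr a ` lc ` {l \<in> lists B. length l = inv_into UNIV \<nu> a})"
    using \<nu> by (auto simp: lcode_def)
  ultimately show ?thesis using universe_subset[OF U] by blast
qed

end

lemma coding_exists:
  assumes U: "universe (\<U> :: 'u set set)"
  obtains pr \<nu> where "coding \<U> pr \<nu>"
proof -
  have inf: "infinite (UNIV :: 'u set)" using U unfolding universe_def by (meson finite_subset subset_UNIV)
  have "|(UNIV :: 'u set) \<times> (UNIV :: 'u set)| \<le>o |UNIV :: 'u set|"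
    using card_of_Times_same_infinite[OF inf] ordIso_imp_ordLeq by blast
  then obtain f :: "'u \<times> 'u \<Rightarrow> 'u" where f: "inj f"
    using card_of_ordLeq[of "(UNIV :: 'u set) \<times> (UNIV :: 'u set)" "UNIV :: 'u set"] by auto
  obtain \<nu> :: "nat \<Rightarrow> 'u" where "inj \<nu>" using infinite_countable_subset[OF inf] by blast
  then have "coding \<U> (\<lambda>a b. f (a, b)) \<nu>"
    unfolding coding_def using U inj_eq[OF f] by simp
  then show ?thesis by (rule that)
qed

text \<open>The quotient of \<open>S\<close> by the kernel of \<open>F\<close>, with its elements coded by \<open>code\<close>.\<close>

definition quot :: "'x set \<Rightarrow> ('x \<Rightarrow> 'y) \<Rightarrow> ('x \<Rightarrow> 'u) \<Rightarrow> 'x \<Rightarrow> 'u" where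
  "quot S F code x = code (inv_into S F (F x))"

lemma quot_in: "x \<in> S \<Longrightarrow> quot S F code x \<in> code ` S"
  unfolding quot_def by (intro imageI inv_into_into) simp

lemma quot_eq:
  assumes "inj_on code S" "x \<in> S" "y \<in> S"
  shows "quot S F code x = quot S F code y \<longleftrightarrow> F x = F y"
proof
  assume "quot S F code x = quot S F code y"
  then have "inv_into S F (F x) = inv_into S F (F y)"
    unfolding quot_def using assms by (meson inj_onD inv_into_into imageI)
  then show "F x = F y" using assms by (metis f_inv_into_f imageI)
qed (simp add: quot_def)

lemma quot_lift:
  assumes "inj_on code S" "x \<in> S" "\<And>y. y \<in> S \<Longrightarrow> F y = F x \<Longrightarrow> G y = G x"
  shows "G (inv_into S (quot S F code) (quot S F code x)) = G x"
proof -
  let ?Q = "quot S F code"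
  have *: "?Q x \<in> ?Q ` S" using assms by simp
  have "inv_into S ?Q (?Q x) \<in> S" by (rule inv_into_into[OF *])
  moreover have "?Q (inv_into S ?Q (?Q x)) = ?Q x" by (rule f_inv_into_f[OF *])
  ultimately show ?thesis using assms quot_eq[OF assms(1)] by metis
qed

locale colimit_data = coding \<U> pr \<nu> for \<U> :: "'u set set" and pr \<nu> +
  fixes e :: "'i \<Rightarrow> 'u" and I :: "'i set"
  assumes e: "inj_on e I" and I: "countable I"
begin

definition code :: "'i \<times> 'u \<Rightarrow> 'u" where
  "code = (\<lambda>(i, x). pr (e i) x)"

lemma inj_code: "inj_on code (I \<times> UNIV)"
  using e by (auto simp: code_def inj_on_def pr)

lemma code_in_universe:
  assumes "\<And>i. i \<in> I \<Longrightarrow> B i \<in> \<U>"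
  shows "code ` (SIGMA i:I. B i) \<in> \<U>"
proof -
  have "(\<Union>a\<in>e ` I. pr a ` B (inv_into I e a)) \<in> \<U>"
    using e assms by (intro universe_UN[OF U universe_countable[OF U]] universe_image[OF U]) (auto simp: I)
  moreover have "code ` (SIGMA i:I. B i) \<subseteq> (\<Union>a\<in>e ` I. pr a ` B (inv_into I e a))"
    using e by (auto simp: code_def)
  ultimately show ?thesis using universe_subset[OF U] by blast
qed

end

lemma colimit_data_exists:
  assumes U: "universe (\<U> :: 'u set set)" and I: "countable (I :: 'i set)"
  obtains pr \<nu> e where "colimit_data \<U> pr \<nu> e I"
proof -
  obtain pr \<nu> where c: "coding \<U> pr \<nu>" using coding_exists[OF U] .
  have "inj_on (\<nu> \<circ> to_nat_on I) I"
    using c inj_on_to_nat_on[OF I] by (intro comp_inj_on) (auto simp: coding_def intro: inj_on_subset)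
  then have "colimit_data \<U> pr \<nu> (\<nu> \<circ> to_nat_on I) I" using c I by (simp add: colimit_data_def colimit_data_axioms_def)
  then show ?thesis by (rule that)
qed

subsection \<open>Simplicial sets\<close>

text \<open>Two elements of the disjoint union of the given objects are identified when they have the same
  image under every compatible family of morphisms.  The factorization through the quotient is then
  immediate, and the inclusions are compatible because all compatible families are.\<close>

locale sset_colimit = colimit_data \<U> pr \<nu> e I for \<U> :: "'u set set" and pr \<nu> and e :: "'i \<Rightarrow> 'u" and I +
  fixes A :: "'i \<Rightarrow> 'u sset" and R :: "('i \<times> 'u sset_map \<times> 'i \<times> 'u sset_map) set"
  assumes A: "\<And>i. i \<in> I \<Longrightarrow> small_sset \<U> (A i)" and R: "relations (SSET \<U>) I A R"
begin

abbreviation "cpt Z j \<equiv> compatible (SSET \<U>) I A R Z j"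

definition elems :: "nat \<Rightarrow> ('i \<times> 'u) set" where
  "elems n = (SIGMA i:I. spx (A i) n)"

definition vals :: "nat \<Rightarrow> 'i \<times> 'u \<Rightarrow> 'u sset \<times> ('i \<Rightarrow> 'u sset_map) \<Rightarrow> 'u" where
  "vals n = (\<lambda>(i, x) (Z, j). if cpt Z j then mor (j i) n x else undefined)"

definition Q :: "nat \<Rightarrow> 'i \<times> 'u \<Rightarrow> 'u" where
  "Q n = quot (elems n) (vals n) code"

lemma inj_code_elems: "inj_on code (elems n)"
  by (rule inj_on_subset[OF inj_code]) (auto simp: elems_def)

lemma Q_eq: "p \<in> elems n \<Longrightarrow> q \<in> elems n \<Longrightarrow> Q n p = Q n q \<longleftrightarrow> vals n p = vals n q"
  unfolding Q_def by (rule quot_eq[OF inj_code_elems])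

lemma vals_eqD: "vals n (i, x) = vals n (k, y) \<Longrightarrow> cpt Z j \<Longrightarrow> mor (j i) n x = mor (j k) n y"
  by (drule fun_cong[of _ _ "(Z, j)"]) (simp add: vals_def)

lemma vals_eqI: "(\<And>Z j. cpt Z j \<Longrightarrow> mor (j i) n x = mor (j k) n y) \<Longrightarrow> vals n (i, x) = vals n (k, y)"
  by (auto simp: vals_def)

lemma compat_map: "cpt Z j \<Longrightarrow> i \<in> I \<Longrightarrow> mor (j i) \<in> smaps (A i) Z \<and> j i = Arr (A i) Z (mor (j i))"
  unfolding compatible_def SSET_simps by (metis arr.sel(3))

definition colim :: "'u sset" where
  "colim = \<lparr>spx = \<lambda>n. Q n ` elems n, act = \<lambda>m n \<theta> y. if \<theta> \<in> dhom m n \<and> y \<in> Q n ` elems n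
     then (\<lambda>(i, x). Q m (i, act (A i) m n \<theta> x)) (inv_into (elems n) (Q n) y) else undefined\<rparr>"

lemma elems_act: "(i, x) \<in> elems n \<Longrightarrow> \<theta> \<in> dhom m n \<Longrightarrow> (i, act (A i) m n \<theta> x) \<in> elems m"
  using A by (auto simp: elems_def small_sset_def is_ssetD(1))

lemma act_colim:
  assumes p: "(i, x) \<in> elems n" and \<theta>: "\<theta> \<in> dhom m n"
  shows "act colim m n \<theta> (Q n (i, x)) = Q m (i, act (A i) m n \<theta> x)"
proof -
  have "(\<lambda>(i, x). Q m (i, act (A i) m n \<theta> x)) (inv_into (elems n) (Q n) (Q n (i, x))) = (\<lambda>(i, x). Q m (i, act (A i) m n \<theta> x)) (i, x)"
    unfolding Q_def[of n]
  proof (rule quot_lift[OF inj_code_elems p])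
    fix q assume q: "q \<in> elems n" and eq: "vals n q = vals n (i, x)"
    obtain k y where q': "q = (k, y)" by (cases q)
    have "vals m (k, act (A k) m n \<theta> y) = vals m (i, act (A i) m n \<theta> x)"
    proof (rule vals_eqI)
      fix Z j assume c: "cpt Z j"
      have "k \<in> I" "y \<in> spx (A k) n" "i \<in> I" "x \<in> spx (A i) n" using p q by (auto simp: elems_def q')
      then show "mor (j k) m (act (A k) m n \<theta> y) = mor (j i) m (act (A i) m n \<theta> x)"
        using vals_eqD[OF eq[unfolded q'] c] compat_map[OF c] smapsD(2)[OF _ \<theta>] by metis
    qed
    then show "(\<lambda>(i, x). Q m (i, act (A i) m n \<theta> x)) q = (\<lambda>(i, x). Q m (i, act (A i) m n \<theta> x)) (i, x)"
      using Q_eq[of "(k, act (A k) m n \<theta> y)" m "(i, act (A i) m n \<theta> x)"] elems_act p q \<theta> by (simp add: q')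
  qed
  then show ?thesis using p \<theta> by (simp add: colim_def)
qed

lemma spx_colim: "spx colim n = Q n ` elems n"
  by (simp add: colim_def)

lemma small_colim: "small_sset \<U> colim"
proof -
  have "is_sset colim"
    unfolding is_sset_def
  proof (intro conjI allI ballI)
    fix m n \<theta> assume \<theta>: "\<theta> \<in> dhom m n"
    show "act colim m n \<theta> \<in> spx colim n \<rightarrow> spx colim m"
      using act_colim[OF _ \<theta>] elems_act[OF _ \<theta>] by (auto simp: spx_colim)
  next
    fix n y assume "y \<in> spx colim n"
    then obtain i x where y: "y = Q n (i, x)" "(i, x) \<in> elems n" by (auto simp: spx_colim)
    then have "act (A i) n n (\<lambda>i\<in>{..n}. i) x = x" using A by (auto simp: elems_def small_sset_def intro!: is_ssetD(2))
    then show "act colim n n (\<lambda>i\<in>{..n}. i) y = y" using act_colim[OF y(2) dhom_ident] y(1) by simp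
  next
    fix k m n \<phi> \<theta> y assume \<phi>: "\<phi> \<in> dhom k m" and \<theta>: "\<theta> \<in> dhom m n" and "y \<in> spx colim n"
    then obtain i x where y: "y = Q n (i, x)" "(i, x) \<in> elems n" by (auto simp: spx_colim)
    then have "act (A i) k n (compose {..k} \<theta> \<phi>) x = act (A i) k m \<phi> (act (A i) m n \<theta> x)"
      using A \<phi> \<theta> by (auto simp: elems_def small_sset_def intro!: is_ssetD(3))
    then show "act colim k n (compose {..k} \<theta> \<phi>) y = act colim k m \<phi> (act colim m n \<theta> y)"
      using act_colim[OF y(2) dhom_compose[OF \<phi> \<theta>]] act_colim[OF y(2) \<theta>] act_colim[OF elems_act[OF y(2) \<theta>] \<phi>] y(1) by simp
  qed
  moreover have "spx colim n \<in> \<U>" for n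
  proof (rule universe_subset[OF U])
    show "code ` elems n \<in> \<U>" unfolding elems_def by (rule code_in_universe) (use A in \<open>auto simp: small_sset_def\<close>)
    show "spx colim n \<subseteq> code ` elems n" unfolding spx_colim Q_def by (rule image_subsetI) (rule quot_in)
  qed
  ultimately show ?thesis unfolding small_sset_def by (auto simp: colim_def)
qed

definition inj_at :: "'i \<Rightarrow> 'u sset_map" where
  "inj_at i = Arr (A i) colim (\<lambda>n. \<lambda>x\<in>spx (A i) n. Q n (i, x))"

lemma inj_at_map: "i \<in> I \<Longrightarrow> (\<lambda>n. \<lambda>x\<in>spx (A i) n. Q n (i, x)) \<in> smaps (A i) colim"
  by (rule smapsI) (use elems_act act_colim in \<open>auto simp: elems_def spx_colim\<close>)

lemma compat_colim: "cpt colim inj_at"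
  unfolding compatible_def
proof (intro conjI ballI)
  show "colim \<in> Ob (SSET \<U>)" by (simp add: SSET_simps small_colim)
  show "inj_at i \<in> Hom (SSET \<U>) (A i) colim" if "i \<in> I" for i
    using that A small_colim inj_at_map by (simp add: SSET_simps inj_at_def)
  fix r assume r: "r \<in> R"
  obtain i f k g where r': "r = (i, f, k, g)" by (cases r)
  obtain B where ik: "i \<in> I" "k \<in> I" and fg: "f \<in> Hom (SSET \<U>) B (A i)" "g \<in> Hom (SSET \<U>) B (A k)"
    using R r unfolding relations_def r' by blast
  obtain F G where F: "f = Arr B (A i) F" "F \<in> smaps B (A i)" and G: "g = Arr B (A k) G" "G \<in> smaps B (A k)"
    using fg by (auto simp: SSET_simps)
  have "Q n (i, F n b) = Q n (k, G n b)" if b: "b \<in> spx B n" for n b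
  proof -
    have "vals n (i, F n b) = vals n (k, G n b)"
    proof (rule vals_eqI)
      fix Z j assume c: "cpt Z j"
      then have "Comp (SSET \<U>) (j i) f = Comp (SSET \<U>) (j k) g" using r unfolding compatible_def r' by blast
      then have "smap_comp B (mor (j i)) F = smap_comp B (mor (j k)) G" by (simp add: SSET_simps F G)
      then have "smap_comp B (mor (j i)) F n b = smap_comp B (mor (j k)) G n b" by simp
      then show "mor (j i) n (F n b) = mor (j k) n (G n b)" using b by (simp add: smap_comp_apply)
    qed
    then show ?thesis using Q_eq[of "(i, F n b)" n "(k, G n b)"] ik smapsD(1)[OF F(2) b] smapsD(1)[OF G(2) b]
      by (simp add: elems_def)
  qed
  then have "smap_comp B (mor (inj_at i)) F = smap_comp B (mor (inj_at k)) G"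
    using smapsD(1)[OF F(2)] smapsD(1)[OF G(2)] by (auto simp: fun_eq_iff smap_comp_def compose_def inj_at_def)
  then show "case r of (i, f, k, g) \<Rightarrow> Comp (SSET \<U>) (inj_at i) f = Comp (SSET \<U>) (inj_at k) g"
    unfolding r' by (simp add: SSET_simps F G) (simp add: inj_at_def)
qed

lemma colim_universal:
  assumes c: "cpt Z j"
  shows "\<exists>!u. u \<in> Hom (SSET \<U>) colim Z \<and> (\<forall>i\<in>I. Comp (SSET \<U>) u (inj_at i) = j i)"
proof -
  define u where "u n = (\<lambda>y\<in>Q n ` elems n. (\<lambda>(i, x). mor (j i) n x) (inv_into (elems n) (Q n) y))" for n
  have uQ: "u n (Q n (i, x)) = mor (j i) n x" if p: "(i, x) \<in> elems n" for n i x
  proof -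
    have "(\<lambda>(i, x). mor (j i) n x) (inv_into (elems n) (Q n) (Q n (i, x))) = (\<lambda>(i, x). mor (j i) n x) (i, x)"
      unfolding Q_def
    proof (rule quot_lift[OF inj_code_elems p])
      fix q assume eq: "vals n q = vals n (i, x)"
      obtain k y where q: "q = (k, y)" by (cases q)
      show "(\<lambda>(i, x). mor (j i) n x) q = (\<lambda>(i, x). mor (j i) n x) (i, x)"
        unfolding q prod.case by (rule vals_eqD[OF eq[unfolded q] c])
    qed
    then show ?thesis using p by (simp add: u_def)
  qed
  have Z: "small_sset \<U> Z" using c by (simp add: compatible_def SSET_simps)
  have um: "u \<in> smaps colim Z"
  proof (rule smapsI)
    fix n y assume "y \<in> spx colim n"
    then obtain i x where y: "y = Q n (i, x)" "(i, x) \<in> elems n" by (auto simp: spx_colim)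
    then have ix: "i \<in> I" "x \<in> spx (A i) n" by (auto simp: elems_def)
    show "u n y \<in> spx Z n" using uQ[OF y(2)] compat_map[OF c ix(1)] smapsD(1)[OF _ ix(2)] y(1) by metis
    fix m \<theta> assume \<theta>: "\<theta> \<in> dhom m n"
    show "u m (act colim m n \<theta> y) = act Z m n \<theta> (u n y)"
      unfolding y(1) act_colim[OF y(2) \<theta>] uQ[OF y(2)] uQ[OF elems_act[OF y(2) \<theta>]]
      using compat_map[OF c ix(1)] smapsD(2)[OF _ \<theta> ix(2)] by blast
  qed (simp add: u_def spx_colim)
  show ?thesis
  proof (rule ex1I[of _ "Arr colim Z u"])
    have "smap_comp (A i) u (\<lambda>n. \<lambda>x\<in>spx (A i) n. Q n (i, x)) = mor (j i)" if "i \<in> I" for i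
      using uQ compat_map[OF c that] smapsD(3)[of "mor (j i)" "A i" Z] that
      by (auto simp: fun_eq_iff smap_comp_def compose_def elems_def)
    then show "Arr colim Z u \<in> Hom (SSET \<U>) colim Z \<and> (\<forall>i\<in>I. Comp (SSET \<U>) (Arr colim Z u) (inj_at i) = j i)"
      using compat_map[OF c] um Z small_colim by (simp add: SSET_simps inj_at_def)
    fix v assume v: "v \<in> Hom (SSET \<U>) colim Z \<and> (\<forall>i\<in>I. Comp (SSET \<U>) v (inj_at i) = j i)"
    then obtain w where w: "v = Arr colim Z w" "w \<in> smaps colim Z" by (auto simp: SSET_simps)
    have "w n y = u n y" for n y
    proof (cases "y \<in> spx colim n")
      case True
      then obtain i x where y: "y = Q n (i, x)" "(i, x) \<in> elems n" by (auto simp: spx_colim)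
      then have ix: "i \<in> I" "x \<in> spx (A i) n" by (auto simp: elems_def)
      have "mor (Comp (SSET \<U>) v (inj_at i)) n x = mor (j i) n x" using v ix by simp
      then show ?thesis using ix uQ[OF y(2)] by (simp add: SSET_simps inj_at_def w smap_comp_apply y(1))
    next
      case False
      then show ?thesis using smapsD(3)[OF w(2) False] smapsD(3)[OF um False] by simp
    qed
    then show "v = Arr colim Z u" using w by auto
  qed
qed

end

theorem has_countable_colimits_SSET:
  assumes U: "universe \<U>"
  shows "has_countable_colimits TYPE('i) (SSET \<U>)"
  unfolding has_countable_colimits_def
proof (intro allI impI)
  fix I :: "'i set" and A R assume I: "countable I" and A: "\<forall>i\<in>I. A i \<in> Ob (SSET \<U>)" and R: "relations (SSET \<U>) I A R"
  obtain pr \<nu> e where d: "colimit_data \<U> pr \<nu> e I" using colimit_data_exists[OF U I] .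
  interpret sset_colimit \<U> pr \<nu> e I A R
    using d A R by (simp add: sset_colimit_def sset_colimit_axioms_def SSET_simps)
  show "\<exists>E \<iota>. is_colimit (SSET \<U>) I A R E \<iota>"
    using compat_colim colim_universal unfolding is_colimit_def by blast
qed

subsection \<open>Categories\<close>

locale cat_colimit = colimit_data \<U> pr \<nu> e I for \<U> :: "'u set set" and pr \<nu> and e :: "'i \<Rightarrow> 'u" and I +
  fixes A :: "'i \<Rightarrow> 'u small_cat" and R :: "('i \<times> 'u small_ftor \<times> 'i \<times> 'u small_ftor) set"
  assumes A: "\<And>i. i \<in> I \<Longrightarrow> small_category \<U> (A i)" and R: "relations (CAT \<U>) I A R"
begin

abbreviation "cpt Z j \<equiv> compatible (CAT \<U>) I A R Z j"

lemma cat_A: "i \<in> I \<Longrightarrow> category (A i)"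
  using A by (simp add: small_category_def)

lemma cpt_map: "cpt Z j \<Longrightarrow> i \<in> I \<Longrightarrow> j i = Arr (A i) Z (mor (j i))"
  "cpt Z j \<Longrightarrow> i \<in> I \<Longrightarrow> is_ftor (A i) Z (mor (j i))"
  unfolding compatible_def CAT_simps by (metis arr.sel(3))+

lemma cpt_cat: "cpt Z j \<Longrightarrow> category Z"
  unfolding compatible_def CAT_simps by (auto simp: small_category_def)

definition nodes :: "('i \<times> 'u) set" where
  "nodes = (SIGMA i:I. Ob (A i))"

definition obj :: "('i \<Rightarrow> 'u small_ftor) \<Rightarrow> 'i \<times> 'u \<Rightarrow> 'u" where
  "obj j = (\<lambda>(i, a). OMap (mor (j i)) a)"

definition obj_vals :: "'i \<times> 'u \<Rightarrow> 'u small_cat \<times> ('i \<Rightarrow> 'u small_ftor) \<Rightarrow> 'u" where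
  "obj_vals p = (\<lambda>(Z, j). if cpt Z j then obj j p else undefined)"

definition Qo :: "'i \<times> 'u \<Rightarrow> 'u" where
  "Qo = quot nodes obj_vals code"

lemma inj_code_nodes: "inj_on code nodes"
  by (rule inj_on_subset[OF inj_code]) (auto simp: nodes_def)

lemma Qo_eq: "p \<in> nodes \<Longrightarrow> p' \<in> nodes \<Longrightarrow> Qo p = Qo p' \<longleftrightarrow> obj_vals p = obj_vals p'"
  unfolding Qo_def by (rule quot_eq[OF inj_code_nodes])

lemma obj_valsD: "obj_vals p = obj_vals p' \<Longrightarrow> cpt Z j \<Longrightarrow> obj j p = obj j p'"
  by (drule fun_cong[of _ _ "(Z, j)"]) (simp add: obj_vals_def)

lemma obj_valsI: "(\<And>Z j. cpt Z j \<Longrightarrow> obj j p = obj j p') \<Longrightarrow> obj_vals p = obj_vals p'"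
  by (auto simp: obj_vals_def)

lemma obj_in: "cpt Z j \<Longrightarrow> p \<in> nodes \<Longrightarrow> obj j p \<in> Ob Z"
  using ftorD(1)[OF cpt_map(2)] by (auto simp: nodes_def obj_def)

text \<open>The arrows of the colimit are represented by paths of arrows of the given categories.  Consecutive
  arrows are composable after the identification of objects: their ends need only have the same image
  under every compatible family.  Two paths are identified when all compatible families give
  them the same composite.\<close>

fun valid :: "'i \<times> 'u \<Rightarrow> ('i \<times> 'u) list \<Rightarrow> bool" where
  "valid p [] \<longleftrightarrow> True"
| "valid p ((i, f) # l) \<longleftrightarrow> i \<in> I \<and> f \<in> Ar (A i) \<and> obj_vals p = obj_vals (i, Dom (A i) f) \<and> valid (i, Cod (A i) f) l"

fun endp :: "'i \<times> 'u \<Rightarrow> ('i \<times> 'u) list \<Rightarrow> 'i \<times> 'u" where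
  "endp p [] = p"
| "endp p ((i, f) # l) = endp (i, Cod (A i) f) l"

fun ev :: "'u small_cat \<Rightarrow> ('i \<Rightarrow> 'u small_ftor) \<Rightarrow> 'i \<times> 'u \<Rightarrow> ('i \<times> 'u) list \<Rightarrow> 'u" where
  "ev Z j p [] = Id Z (obj j p)"
| "ev Z j p ((i, f) # l) = Comp Z (ev Z j (i, Cod (A i) f) l) (AMap (mor (j i)) f)"

definition paths :: "(('i \<times> 'u) \<times> ('i \<times> 'u) list) set" where
  "paths = {(p, l). p \<in> nodes \<and> valid p l}"

lemma Cod_node: "i \<in> I \<Longrightarrow> f \<in> Ar (A i) \<Longrightarrow> (i, Cod (A i) f) \<in> nodes"
  and Dom_node: "i \<in> I \<Longrightarrow> f \<in> Ar (A i) \<Longrightarrow> (i, Dom (A i) f) \<in> nodes"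
  using cat_A by (auto simp: nodes_def category_def)

lemma endp_node: "p \<in> nodes \<Longrightarrow> valid p l \<Longrightarrow> endp p l \<in> nodes"
  by (induction p l rule: endp.induct) (auto simp: Cod_node)

lemma AMap_in: "cpt Z j \<Longrightarrow> i \<in> I \<Longrightarrow> f \<in> Ar (A i) \<Longrightarrow>
    AMap (mor (j i)) f \<in> Hom Z (obj j (i, Dom (A i) f)) (obj j (i, Cod (A i) f))"
  unfolding obj_def prod.case by (rule ftorD(2)[OF cpt_map(2) cat_Ar[OF cat_A]])

lemma ev_in: "cpt Z j \<Longrightarrow> p \<in> nodes \<Longrightarrow> valid p l \<Longrightarrow> ev Z j p l \<in> Hom Z (obj j p) (obj j (endp p l))"
proof (induction p l rule: endp.induct)
  case (1 p)
  then show ?case using cat_id[OF cpt_cat obj_in] by simp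
next
  case (2 p i f l)
  then have "ev Z j (i, Cod (A i) f) l \<in> Hom Z (obj j (i, Cod (A i) f)) (obj j (endp (i, Cod (A i) f) l))"
    by (simp add: Cod_node)
  then show ?case
    using cat_comp[OF cpt_cat[OF 2(2)] AMap_in[OF 2(2)]] 2 obj_valsD[OF _ 2(2), of p] by auto
qed

lemma valid_append: "valid p (l @ l') \<longleftrightarrow> valid p l \<and> valid (endp p l) l'"
  by (induction p l rule: endp.induct) auto

lemma endp_append: "endp p (l @ l') = endp (endp p l) l'"
  by (induction p l rule: endp.induct) auto

lemma ev_append:
  "cpt Z j \<Longrightarrow> p \<in> nodes \<Longrightarrow> valid p l \<Longrightarrow> valid (endp p l) l' \<Longrightarrow>
     ev Z j p (l @ l') = Comp Z (ev Z j (endp p l) l') (ev Z j p l)"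
proof (induction p l rule: endp.induct)
  case (1 p)
  then show ?case using cat_idr[OF cpt_cat[OF 1(1)] ev_in[OF 1(1,2), of l']] by simp
next
  case (2 p i f l)
  note c = 2(2)
  have n: "(i, Cod (A i) f) \<in> nodes" using 2 by (simp add: Cod_node)
  have v: "valid (i, Cod (A i) f) l" "valid (endp (i, Cod (A i) f) l) l'" "i \<in> I" "f \<in> Ar (A i)" using 2 by auto
  show ?case
    using 2(1)[OF c n v(1,2)] cat_assoc[OF cpt_cat[OF c] AMap_in[OF c v(3,4)] ev_in[OF c n v(1)] ev_in[OF c endp_node[OF n v(1)] v(2)]]
    by simp
qed

lemma start_irrelevant:
  "obj_vals p = obj_vals p' \<Longrightarrow> valid p l \<longleftrightarrow> valid p' l"
  "obj_vals p = obj_vals p' \<Longrightarrow> cpt Z j \<Longrightarrow> ev Z j p l = ev Z j p' l"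
  "obj_vals p = obj_vals p' \<Longrightarrow> obj_vals (endp p l) = obj_vals (endp p' l)"
  using obj_valsD[of p p' Z j] by (cases l; auto)+

definition path_vals :: "('i \<times> 'u) \<times> ('i \<times> 'u) list \<Rightarrow> 'u small_cat \<times> ('i \<Rightarrow> 'u small_ftor) \<Rightarrow> 'u" where
  "path_vals = (\<lambda>(p, l) (Z, j). if cpt Z j then ev Z j p l else undefined)"

lemma path_valsD: "path_vals (p, l) = path_vals (p', l') \<Longrightarrow> cpt Z j \<Longrightarrow> ev Z j p l = ev Z j p' l'"
  by (drule fun_cong[of _ _ "(Z, j)"]) (simp add: path_vals_def)

lemma path_valsI: "(\<And>Z j. cpt Z j \<Longrightarrow> ev Z j p l = ev Z j p' l') \<Longrightarrow> path_vals (p, l) = path_vals (p', l')"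
  by (auto simp: path_vals_def)

lemma path_vals_ends:
  assumes eq: "path_vals (p, l) = path_vals (p', l')" and "(p, l) \<in> paths" "(p', l') \<in> paths"
  shows "obj_vals p = obj_vals p'" "obj_vals (endp p l) = obj_vals (endp p' l')"
proof -
  have "obj j p = obj j p' \<and> obj j (endp p l) = obj j (endp p' l')" if c: "cpt Z j" for Z j
    using HomD(2,3)[OF ev_in[OF c, of p l]] HomD(2,3)[OF ev_in[OF c, of p' l']] path_valsD[OF eq c] assms(2,3)
    by (auto simp: paths_def)
  then show "obj_vals p = obj_vals p'" "obj_vals (endp p l) = obj_vals (endp p' l')" by (auto intro: obj_valsI)
qed

definition path_code :: "('i \<times> 'u) \<times> ('i \<times> 'u) list \<Rightarrow> 'u" where
  "path_code = (\<lambda>(p, l). pr (code p) (lcode (map code l)))"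

definition Qa :: "('i \<times> 'u) \<times> ('i \<times> 'u) list \<Rightarrow> 'u" where
  "Qa = quot paths path_vals path_code"

definition arrs :: "('i \<times> 'u) set" where
  "arrs = (SIGMA i:I. Ar (A i))"

lemma valid_arrs: "valid p l \<Longrightarrow> set l \<subseteq> arrs"
  by (induction p l rule: valid.induct) (auto simp: arrs_def)

lemma inj_path_code: "inj_on path_code paths"
proof (rule inj_onI)
  fix x y assume x: "x \<in> paths" and y: "y \<in> paths" and eq: "path_code x = path_code y"
  obtain p l where x': "x = (p, l)" by (cases x)
  obtain p' l' where y': "y = (p', l')" by (cases y)
  have arrs: "set l \<union> set l' \<subseteq> arrs" using x y valid_arrs[of p l] valid_arrs[of p' l'] by (auto simp: paths_def x' y')
  have inj: "inj_on code arrs" by (rule inj_on_subset[OF inj_code]) (auto simp: arrs_def)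
  have "code p = code p'" and "map code l = map code l'"
    using eq lcode_inj by (auto simp: path_code_def pr x' y')
  then have "p = p'" and "l = l'"
    using inj_onD[OF inj_code_nodes] x y map_inj_on[OF _ inj_on_subset[OF inj arrs]] by (auto simp: paths_def x' y')
  then show "x = y" by (simp add: x' y')
qed

lemma Qa_eq: "x \<in> paths \<Longrightarrow> y \<in> paths \<Longrightarrow> Qa x = Qa y \<longleftrightarrow> path_vals x = path_vals y"
  unfolding Qa_def by (rule quot_eq[OF inj_path_code])

definition rep :: "'u \<Rightarrow> ('i \<times> 'u) \<times> ('i \<times> 'u) list" where
  "rep = inv_into paths Qa"

definition colim :: "'u small_cat" where
  "colim = \<lparr>Ob = Qo ` nodes, Ar = Qa ` paths,
     Dom = \<lambda>x\<in>Qa ` paths. (\<lambda>(p, l). Qo p) (rep x),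
     Cod = \<lambda>x\<in>Qa ` paths. (\<lambda>(p, l). Qo (endp p l)) (rep x),
     Id = \<lambda>y\<in>Qo ` nodes. Qa (inv_into nodes Qo y, []),
     Comp = \<lambda>y x. if y \<in> Qa ` paths \<and> x \<in> Qa ` paths \<and> (\<lambda>(p, l). Qo p) (rep y) = (\<lambda>(p, l). Qo (endp p l)) (rep x)
       then Qa (fst (rep x), snd (rep x) @ snd (rep y)) else undefined\<rparr>"

lemma rep_in: "x \<in> Qa ` paths \<Longrightarrow> rep x \<in> paths" and Qa_rep: "x \<in> Qa ` paths \<Longrightarrow> Qa (rep x) = x"
  unfolding rep_def by (rule inv_into_into, assumption) (rule f_inv_into_f, assumption)

lemma rep_Qa:
  assumes "(p, l) \<in> paths"
  obtains p' l' where "rep (Qa (p, l)) = (p', l')" "(p', l') \<in> paths" "path_vals (p', l') = path_vals (p, l)"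
    "obj_vals p' = obj_vals p" "obj_vals (endp p' l') = obj_vals (endp p l)"
proof -
  obtain p' l' where r: "rep (Qa (p, l)) = (p', l')" by (cases "rep (Qa (p, l))")
  have in': "(p', l') \<in> paths" using rep_in[of "Qa (p, l)"] assms r by simp
  have "path_vals (p', l') = path_vals (p, l)"
    using Qa_rep[of "Qa (p, l)"] assms r Qa_eq[OF in' assms] by simp
  then show ?thesis using that[OF r in'] path_vals_ends[OF _ in' assms] by blast
qed

lemma Ob_colim: "Ob colim = Qo ` nodes" and Ar_colim: "Ar colim = Qa ` paths"
  by (simp_all add: colim_def)

lemma Dom_Cod_colim:
  assumes "(p, l) \<in> paths"
  shows "Dom colim (Qa (p, l)) = Qo p" "Cod colim (Qa (p, l)) = Qo (endp p l)"
proof -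
  obtain p' l' where r: "rep (Qa (p, l)) = (p', l')" "(p', l') \<in> paths"
    "obj_vals p' = obj_vals p" "obj_vals (endp p' l') = obj_vals (endp p l)"
    using rep_Qa[OF assms] by metis
  have n: "p \<in> nodes" "p' \<in> nodes" "endp p l \<in> nodes" "endp p' l' \<in> nodes"
    using assms r(2) endp_node by (auto simp: paths_def)
  show "Dom colim (Qa (p, l)) = Qo p" "Cod colim (Qa (p, l)) = Qo (endp p l)"
    using assms r n Qo_eq[OF n(2,1)] Qo_eq[OF n(4,3)] by (simp_all add: colim_def)
qed

lemma Id_colim:
  assumes p: "p \<in> nodes"
  shows "Id colim (Qo p) = Qa (p, [])"
proof -
  let ?p = "inv_into nodes Qo (Qo p)"
  have n: "?p \<in> nodes" using p by (intro inv_into_into) simp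
  have "Qo ?p = Qo p" using p by (intro f_inv_into_f) simp
  then have h: "obj_vals ?p = obj_vals p" using Qo_eq n p by simp
  have "path_vals (?p, []) = path_vals (p, [])"
  proof (rule path_valsI)
    fix Z j assume "cpt Z j"
    then show "ev Z j ?p [] = ev Z j p []" using obj_valsD[OF h] by simp
  qed
  then have "Qa (?p, []) = Qa (p, [])" using Qa_eq[of "(?p, [])" "(p, [])"] n p by (simp add: paths_def)
  then show ?thesis using p by (simp add: colim_def)
qed

lemma path_append:
  assumes x: "(p, l) \<in> paths" and y: "(p', l') \<in> paths" and eq: "obj_vals p' = obj_vals (endp p l)"
  shows "(p, l @ l') \<in> paths" "cpt Z j \<Longrightarrow> ev Z j p (l @ l') = Comp Z (ev Z j p' l') (ev Z j p l)"
    "obj_vals (endp p (l @ l')) = obj_vals (endp p' l')"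
proof -
  have v: "p \<in> nodes" "valid p l" "valid (endp p l) l'"
    using x y start_irrelevant(1)[OF eq, of l'] by (auto simp: paths_def)
  then show "(p, l @ l') \<in> paths" by (simp add: paths_def valid_append)
  show "cpt Z j \<Longrightarrow> ev Z j p (l @ l') = Comp Z (ev Z j p' l') (ev Z j p l)"
    using ev_append[OF _ v] start_irrelevant(2)[OF eq] by simp
  show "obj_vals (endp p (l @ l')) = obj_vals (endp p' l')"
    unfolding endp_append by (rule start_irrelevant(3)[OF eq, symmetric])
qed

lemma Comp_colim:
  assumes x: "(p, l) \<in> paths" and y: "(p', l') \<in> paths" and eq: "Qo p' = Qo (endp p l)"
  shows "Comp colim (Qa (p', l')) (Qa (p, l)) = Qa (p, l @ l')"
proof -
  have n: "p \<in> nodes" "p' \<in> nodes" "endp p l \<in> nodes" using x y endp_node by (auto simp: paths_def)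
  then have e: "obj_vals p' = obj_vals (endp p l)" using eq Qo_eq by simp
  obtain p1 l1 where r: "rep (Qa (p, l)) = (p1, l1)" "(p1, l1) \<in> paths" "path_vals (p1, l1) = path_vals (p, l)"
    "obj_vals (endp p1 l1) = obj_vals (endp p l)" using rep_Qa[OF x] by metis
  obtain p2 l2 where s: "rep (Qa (p', l')) = (p2, l2)" "(p2, l2) \<in> paths" "path_vals (p2, l2) = path_vals (p', l')"
    "obj_vals p2 = obj_vals p'" using rep_Qa[OF y] by metis
  have e': "obj_vals p2 = obj_vals (endp p1 l1)" using r s e by simp
  have n': "p2 \<in> nodes" "endp p1 l1 \<in> nodes" using r(2) s(2) endp_node by (auto simp: paths_def)
  have "path_vals (p1, l1 @ l2) = path_vals (p, l @ l')"
  proof (rule path_valsI)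
    fix Z j assume c: "cpt Z j"
    show "ev Z j p1 (l1 @ l2) = ev Z j p (l @ l')"
      unfolding path_append(2)[OF x y e c] path_append(2)[OF r(2) s(2) e' c]
      using path_valsD[OF r(3) c] path_valsD[OF s(3) c] by simp
  qed
  then have "Qa (p1, l1 @ l2) = Qa (p, l @ l')"
    using Qa_eq path_append(1)[OF x y e] path_append(1)[OF r(2) s(2) e'] by simp
  then show ?thesis using x y r(1) s(1) e' Qo_eq[OF n'] by (simp add: colim_def)
qed

lemma Ar_colim_cases:
  assumes "x \<in> Hom colim a b"
  obtains p l where "x = Qa (p, l)" "(p, l) \<in> paths" "a = Qo p" "b = Qo (endp p l)"
  using assms Dom_Cod_colim by (auto simp: Hom_def Ar_colim)

lemma Qa_in: "(p, l) \<in> paths \<Longrightarrow> Qa (p, l) \<in> Hom colim (Qo p) (Qo (endp p l))"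
  using Dom_Cod_colim by (simp add: Hom_def Ar_colim)

lemma category_colim: "category colim"
proof (rule categoryI)
  fix x assume "x \<in> Ar colim"
  then obtain p l where x: "x = Qa (p, l)" "(p, l) \<in> paths" by (auto simp: Ar_colim)
  then show "Dom colim x \<in> Ob colim \<and> Cod colim x \<in> Ob colim"
    using endp_node by (auto simp: Dom_Cod_colim Ob_colim paths_def)
next
  fix a assume "a \<in> Ob colim"
  then obtain p where p: "a = Qo p" "p \<in> nodes" by (auto simp: Ob_colim)
  then show "Id colim a \<in> Hom colim a a"
    using Qa_in[of p "[]"] by (simp add: Id_colim paths_def)
next
  fix x y a b c assume "x \<in> Hom colim a b" "y \<in> Hom colim b c"
  then obtain p l p' l' where *: "x = Qa (p, l)" "(p, l) \<in> paths" "a = Qo p" "b = Qo (endp p l)"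
    "y = Qa (p', l')" "(p', l') \<in> paths" "b = Qo p'" "c = Qo (endp p' l')"
    by (metis Ar_colim_cases)
  have n: "p' \<in> nodes" "endp p l \<in> nodes" using * endp_node by (auto simp: paths_def)
  then have eq: "obj_vals p' = obj_vals (endp p l)" using * Qo_eq by simp
  note ap = path_append[OF *(2,6) eq]
  have "endp p (l @ l') \<in> nodes" "endp p' l' \<in> nodes" using ap(1) *(6) endp_node by (auto simp: paths_def)
  then have "Qo (endp p (l @ l')) = Qo (endp p' l')" using Qo_eq ap(3) by simp
  then show "Comp colim y x \<in> Hom colim a c"
    using Qa_in[OF ap(1)] Comp_colim[OF *(2,6)] * by simp
next
  fix x a b assume "x \<in> Hom colim a b"
  then obtain p l where *: "x = Qa (p, l)" "(p, l) \<in> paths" "a = Qo p" "b = Qo (endp p l)"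
    by (metis Ar_colim_cases)
  then have n: "p \<in> nodes" "endp p l \<in> nodes" using endp_node by (auto simp: paths_def)
  then have "(p, []) \<in> paths" "(endp p l, []) \<in> paths" by (auto simp: paths_def)
  then show "Comp colim x (Id colim a) = x" "Comp colim (Id colim b) x = x"
    using Comp_colim[of p "[]" p l] Comp_colim[of p l "endp p l" "[]"] n * by (simp_all add: Id_colim)
next
  fix x y z a b c d assume "x \<in> Hom colim a b" "y \<in> Hom colim b c" "z \<in> Hom colim c d"
  then obtain p l p' l' p'' l'' where *: "x = Qa (p, l)" "(p, l) \<in> paths" "a = Qo p" "b = Qo (endp p l)"
    "y = Qa (p', l')" "(p', l') \<in> paths" "b = Qo p'" "c = Qo (endp p' l')"
    "z = Qa (p'', l'')" "(p'', l'') \<in> paths" "c = Qo p''" "d = Qo (endp p'' l'')"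
    by (metis Ar_colim_cases)
  have n: "p' \<in> nodes" "endp p l \<in> nodes" "p'' \<in> nodes" "endp p' l' \<in> nodes" using * endp_node by (auto simp: paths_def)
  then have eq: "obj_vals p' = obj_vals (endp p l)" and eq': "obj_vals p'' = obj_vals (endp p' l')" using * Qo_eq by simp_all
  note ap = path_append[OF *(2,6) eq] and ap' = path_append[OF *(6,10) eq']
  have "endp p (l @ l') \<in> nodes" using ap(1) endp_node by (auto simp: paths_def)
  then have "Qo p'' = Qo (endp p (l @ l'))" using Qo_eq n ap(3) eq' by simp
  then show "Comp colim z (Comp colim y x) = Comp colim (Comp colim z y) x"
    using Comp_colim[OF *(2,6)] Comp_colim[OF *(6,10)] Comp_colim[OF ap(1) *(10)] Comp_colim[OF *(2) ap'(1)] * by simp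
qed

lemma small_colim: "small_category \<U> colim"
proof -
  have n: "code ` nodes \<in> \<U>" unfolding nodes_def by (rule code_in_universe) (use A in \<open>auto simp: small_category_def\<close>)
  have a: "code ` arrs \<in> \<U>" unfolding arrs_def by (rule code_in_universe) (use A in \<open>auto simp: small_category_def\<close>)
  have "Ob colim \<in> \<U>"
    by (rule universe_subset[OF U n]) (unfold Ob_colim Qo_def, rule image_subsetI, rule quot_in)
  moreover have "path_code ` paths \<subseteq> (\<Union>b\<in>code ` nodes. pr b ` lcode ` lists (code ` arrs))"
  proof
    fix y assume "y \<in> path_code ` paths"
    then obtain p l where y: "y = pr (code p) (lcode (map code l))" "p \<in> nodes" "valid p l"
      by (auto simp: path_code_def paths_def)
    have "map code l \<in> lists (code ` arrs)" using valid_arrs[OF y(3)] by (auto simp: in_lists_conv_set)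
    then show "y \<in> (\<Union>b\<in>code ` nodes. pr b ` lcode ` lists (code ` arrs))" using y by blast
  qed
  then have "path_code ` paths \<in> \<U>" by (rule universe_subset[OF U pr_product[OF n lists_in_universe[OF a]]])
  then have "Ar colim \<in> \<U>"
    by (rule universe_subset[OF U]) (unfold Ar_colim Qa_def, rule image_subsetI, rule quot_in)
  moreover have "Dom colim \<in> extensional (Ar colim)" "Cod colim \<in> extensional (Ar colim)" "Id colim \<in> extensional (Ob colim)"
    by (simp_all add: colim_def)
  moreover have "Comp colim g f = undefined" if "\<not> (g \<in> Ar colim \<and> f \<in> Ar colim \<and> Dom colim g = Cod colim f)" for g f
    using that by (auto simp: colim_def)
  ultimately show ?thesis using category_colim unfolding small_category_def by blast
qed

definition inj_ftor :: "'i \<Rightarrow> ('u, 'u, 'u, 'u) ftor" where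
  "inj_ftor i = \<lparr>OMap = \<lambda>a\<in>Ob (A i). Qo (i, a), AMap = \<lambda>f\<in>Ar (A i). Qa ((i, Dom (A i) f), [(i, f)])\<rparr>"

definition inj_at :: "'i \<Rightarrow> 'u small_ftor" where
  "inj_at i = Arr (A i) colim (inj_ftor i)"

lemma single_path: "i \<in> I \<Longrightarrow> f \<in> Ar (A i) \<Longrightarrow> ((i, Dom (A i) f), [(i, f)]) \<in> paths"
  by (simp add: paths_def Dom_node)

lemma ev_single: "cpt Z j \<Longrightarrow> i \<in> I \<Longrightarrow> f \<in> Ar (A i) \<Longrightarrow> ev Z j p [(i, f)] = AMap (mor (j i)) f"
  using cat_idl[OF cpt_cat AMap_in] by simp

lemma inj_ftor_is_ftor: "i \<in> I \<Longrightarrow> is_ftor (A i) colim (inj_ftor i)"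
proof (rule is_ftorI)
  assume i: "i \<in> I"
  note C = cat_A[OF i]
  {
    fix f assume f: "f \<in> Ar (A i)"
    have "Dom (A i) f \<in> Ob (A i)" "Cod (A i) f \<in> Ob (A i)" using Dom_node[OF i f] Cod_node[OF i f] by (auto simp: nodes_def)
    then show "AMap (inj_ftor i) f \<in> Hom colim (OMap (inj_ftor i) (Dom (A i) f)) (OMap (inj_ftor i) (Cod (A i) f))"
      using Qa_in[OF single_path[OF i f]] f by (simp add: inj_ftor_def)
  next
    fix a assume a: "a \<in> Ob (A i)"
    then have p: "(i, a) \<in> nodes" using i by (simp add: nodes_def)
    have d: "Id (A i) a \<in> Ar (A i)" "Dom (A i) (Id (A i) a) = a" using HomD(1,2)[OF cat_id[OF C a]] .
    have "path_vals ((i, a), [(i, Id (A i) a)]) = path_vals ((i, a), [])"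
    proof (rule path_valsI)
      fix Z j assume c: "cpt Z j"
      show "ev Z j (i, a) [(i, Id (A i) a)] = ev Z j (i, a) []"
        unfolding ev_single[OF c i d(1)] using ftorD(3)[OF cpt_map(2)[OF c i] a] by (simp add: obj_def)
    qed
    then have "Qa ((i, a), [(i, Id (A i) a)]) = Qa ((i, a), [])"
      using Qa_eq[of "((i, a), [(i, Id (A i) a)])" "((i, a), [])"] single_path[OF i d(1)] p d(2) by (simp add: paths_def)
    then show "AMap (inj_ftor i) (Id (A i) a) = Id colim (OMap (inj_ftor i) a)"
      using a d p by (simp add: inj_ftor_def Id_colim)
  next
    fix f g a b c assume f: "f \<in> Hom (A i) a b" and g: "g \<in> Hom (A i) b c"
    note ff = HomD[OF f] and gg = HomD[OF g] and gf = cat_comp[OF C f g]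
    note pf = single_path[OF i ff(1)] and pg = single_path[OF i gg(1)] and pgf = single_path[OF i HomD(1)[OF gf]]
    have e: "obj_vals (i, Dom (A i) g) = obj_vals (endp (i, Dom (A i) f) [(i, f)])" using ff gg by simp
    have "path_vals ((i, a), [(i, Comp (A i) g f)]) = path_vals ((i, a), [(i, f), (i, g)])"
    proof (rule path_valsI)
      fix Z j assume c: "cpt Z j"
      have "ev Z j (i, a) [(i, f), (i, g)] = Comp Z (AMap (mor (j i)) g) (AMap (mor (j i)) f)"
        using path_append(2)[OF pf pg e c] ev_single[OF c i ff(1)] ev_single[OF c i gg(1)] ff(2) by simp
      then show "ev Z j (i, a) [(i, Comp (A i) g f)] = ev Z j (i, a) [(i, f), (i, g)]"
        unfolding ev_single[OF c i HomD(1)[OF gf]] using ftorD(4)[OF cpt_map(2)[OF c i] f g] by simp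
    qed
    then have "Qa ((i, a), [(i, Comp (A i) g f)]) = Qa ((i, a), [(i, f), (i, g)])"
      using Qa_eq[of "((i, a), [(i, Comp (A i) g f)])" "((i, a), [(i, f), (i, g)])"] pgf path_append(1)[OF pf pg e]
        ff(2) HomD(2)[OF gf] by simp
    then show "AMap (inj_ftor i) (Comp (A i) g f) = Comp colim (AMap (inj_ftor i) g) (AMap (inj_ftor i) f)"
      using Comp_colim[OF pf pg] ff gg HomD(1,2)[OF gf] by (simp add: inj_ftor_def)
  }
qed (auto simp: inj_ftor_def Ob_colim nodes_def)

lemma cpt_colim: "cpt colim inj_at"
  unfolding compatible_def
proof (intro conjI ballI)
  show "colim \<in> Ob (CAT \<U>)" by (simp add: CAT_simps small_colim)
  show "inj_at i \<in> Hom (CAT \<U>) (A i) colim" if "i \<in> I" for i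
    using that A small_colim inj_ftor_is_ftor by (simp add: CAT_simps inj_at_def)
  fix r assume r: "r \<in> R"
  obtain i f k g where r': "r = (i, f, k, g)" by (cases r)
  obtain B where ik: "i \<in> I" "k \<in> I" and fg: "f \<in> Hom (CAT \<U>) B (A i)" "g \<in> Hom (CAT \<U>) B (A k)"
    using R r unfolding relations_def r' by blast
  obtain F G where F: "f = Arr B (A i) F" "is_ftor B (A i) F" and G: "g = Arr B (A k) G" "is_ftor B (A k) G"
    and B: "category B" using fg by (auto simp: CAT_simps small_category_def)
  have eq: "ftor_comp B (mor (j i)) F = ftor_comp B (mor (j k)) G" if c: "cpt Z j" for Z j
  proof -
    have "Comp (CAT \<U>) (j i) f = Comp (CAT \<U>) (j k) g" using c r unfolding compatible_def r' by blast
    then show ?thesis by (simp add: CAT_simps F G)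
  qed
  have "ftor_comp B (inj_ftor i) F = ftor_comp B (inj_ftor k) G"
  proof (rule ftor_eqI[OF is_ftor_comp[OF B F(2) inj_ftor_is_ftor[OF ik(1)]] is_ftor_comp[OF B G(2) inj_ftor_is_ftor[OF ik(2)]]])
    fix b assume b: "b \<in> Ob B"
    have n: "(i, OMap F b) \<in> nodes" "(k, OMap G b) \<in> nodes" using ik b ftorD(1)[OF F(2)] ftorD(1)[OF G(2)] by (simp_all add: nodes_def)
    have "obj_vals (i, OMap F b) = obj_vals (k, OMap G b)"
    proof (rule obj_valsI)
      fix Z j assume c: "cpt Z j"
      have "OMap (ftor_comp B (mor (j i)) F) b = OMap (ftor_comp B (mor (j k)) G) b" by (simp add: eq[OF c])
      then show "obj j (i, OMap F b) = obj j (k, OMap G b)" using b by (simp add: obj_def ftor_comp_simps)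
    qed
    then show "OMap (ftor_comp B (inj_ftor i) F) b = OMap (ftor_comp B (inj_ftor k) G) b"
      using b n Qo_eq[OF n] by (simp add: ftor_comp_simps inj_ftor_def nodes_def)
  next
    fix x assume x: "x \<in> Ar B"
    have a: "AMap F x \<in> Ar (A i)" "AMap G x \<in> Ar (A k)" using ftorD(7)[OF F(2) x] ftorD(7)[OF G(2) x] .
    note p = single_path[OF ik(1) a(1)] and p' = single_path[OF ik(2) a(2)]
    have "path_vals ((i, Dom (A i) (AMap F x)), [(i, AMap F x)]) = path_vals ((k, Dom (A k) (AMap G x)), [(k, AMap G x)])"
    proof (rule path_valsI)
      fix Z j assume c: "cpt Z j"
      have "AMap (ftor_comp B (mor (j i)) F) x = AMap (ftor_comp B (mor (j k)) G) x" by (simp add: eq[OF c])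
      then show "ev Z j (i, Dom (A i) (AMap F x)) [(i, AMap F x)] = ev Z j (k, Dom (A k) (AMap G x)) [(k, AMap G x)]"
        unfolding ev_single[OF c ik(1) a(1)] ev_single[OF c ik(2) a(2)] using x by (simp add: ftor_comp_simps)
    qed
    then show "AMap (ftor_comp B (inj_ftor i) F) x = AMap (ftor_comp B (inj_ftor k) G) x"
      using x a Qa_eq[OF p p'] by (simp add: ftor_comp_simps inj_ftor_def)
  qed
  then show "case r of (i, f, k, g) \<Rightarrow> Comp (CAT \<U>) (inj_at i) f = Comp (CAT \<U>) (inj_at k) g"
    unfolding r' by (simp add: CAT_simps F G inj_at_def)
qed

lemma colim_universal:
  assumes c: "cpt Z j"
  shows "\<exists>!u. u \<in> Hom (CAT \<U>) colim Z \<and> (\<forall>i\<in>I. Comp (CAT \<U>) u (inj_at i) = j i)"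
proof -
  define u where "u = \<lparr>OMap = \<lambda>y\<in>Qo ` nodes. obj j (inv_into nodes Qo y), AMap = \<lambda>x\<in>Qa ` paths. (\<lambda>(p, l). ev Z j p l) (rep x)\<rparr>"
  have uo: "OMap u (Qo p) = obj j p" if p: "p \<in> nodes" for p
  proof -
    have "obj j (inv_into nodes Qo (Qo p)) = obj j p"
      unfolding Qo_def by (rule quot_lift[OF inj_code_nodes p]) (rule obj_valsD[OF _ c])
    then show ?thesis using p by (simp add: u_def)
  qed
  have ua: "AMap u (Qa (p, l)) = ev Z j p l" if x: "(p, l) \<in> paths" for p l
  proof -
    obtain p' l' where r: "rep (Qa (p, l)) = (p', l')" "path_vals (p', l') = path_vals (p, l)" using rep_Qa[OF x] by metis
    then show ?thesis using x path_valsD[OF r(2) c] by (simp add: u_def)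
  qed
  have Z: "small_category \<U> Z" using c by (simp add: compatible_def CAT_simps)
  have um: "is_ftor colim Z u"
  proof (rule is_ftorI)
    fix x assume "x \<in> Ar colim"
    then obtain p l where x: "x = Qa (p, l)" "(p, l) \<in> paths" by (auto simp: Ar_colim)
    then have "p \<in> nodes" "valid p l" "endp p l \<in> nodes" using endp_node by (auto simp: paths_def)
    then show "AMap u x \<in> Hom Z (OMap u (Dom colim x)) (OMap u (Cod colim x))"
      using ev_in[OF c, of p l] x by (simp add: Dom_Cod_colim ua uo)
  next
    fix y assume "y \<in> Ob colim"
    then obtain p where p: "y = Qo p" "p \<in> nodes" by (auto simp: Ob_colim)
    then show "OMap u y \<in> Ob Z" using obj_in[OF c] uo by simp
    show "AMap u (Id colim y) = Id Z (OMap u y)"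
      using p ua[of p "[]"] by (simp add: Id_colim uo paths_def)
  next
    fix x y a b d assume "x \<in> Hom colim a b" "y \<in> Hom colim b d"
    then obtain p l p' l' where *: "x = Qa (p, l)" "(p, l) \<in> paths" "b = Qo (endp p l)"
      "y = Qa (p', l')" "(p', l') \<in> paths" "b = Qo p'" by (metis Ar_colim_cases)
    have "p' \<in> nodes" "endp p l \<in> nodes" using * endp_node by (auto simp: paths_def)
    then have eq: "obj_vals p' = obj_vals (endp p l)" using * Qo_eq by simp
    show "AMap u (Comp colim y x) = Comp Z (AMap u y) (AMap u x)"
      using Comp_colim[OF *(2,5)] * path_append[OF *(2,5) eq] ua c by simp
  qed (simp_all add: u_def Ob_colim Ar_colim)
  show ?thesis
  proof (rule ex1I[of _ "Arr colim Z u"])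
    have "ftor_comp (A i) u (inj_ftor i) = mor (j i)" if i: "i \<in> I" for i
    proof (rule ftor_eqI[OF is_ftor_comp[OF cat_A[OF i] inj_ftor_is_ftor[OF i] um] cpt_map(2)[OF c i]])
      show "OMap (ftor_comp (A i) u (inj_ftor i)) a = OMap (mor (j i)) a" if "a \<in> Ob (A i)" for a
        using that uo[of "(i, a)"] i by (simp add: ftor_comp_simps inj_ftor_def nodes_def obj_def)
      show "AMap (ftor_comp (A i) u (inj_ftor i)) f = AMap (mor (j i)) f" if f: "f \<in> Ar (A i)" for f
        using f ua[OF single_path[OF i f]] ev_single[OF c i f] by (simp add: ftor_comp_simps inj_ftor_def del: ev.simps)
    qed
    then show "Arr colim Z u \<in> Hom (CAT \<U>) colim Z \<and> (\<forall>i\<in>I. Comp (CAT \<U>) (Arr colim Z u) (inj_at i) = j i)"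
      using cpt_map(1)[OF c] um Z small_colim by (simp add: CAT_simps inj_at_def)
    fix v assume v: "v \<in> Hom (CAT \<U>) colim Z \<and> (\<forall>i\<in>I. Comp (CAT \<U>) v (inj_at i) = j i)"
    then obtain w where w: "v = Arr colim Z w" "is_ftor colim Z w" by (auto simp: CAT_simps)
    have wi: "ftor_comp (A i) w (inj_ftor i) = mor (j i)" if i: "i \<in> I" for i
    proof -
      have "mor (Comp (CAT \<U>) v (inj_at i)) = mor (j i)" using v i by simp
      then show ?thesis by (simp add: CAT_simps w inj_at_def)
    qed
    have wo: "OMap w (Qo p) = obj j p" if p: "p \<in> nodes" for p
    proof -
      obtain i a where ia: "p = (i, a)" "i \<in> I" "a \<in> Ob (A i)" using p by (auto simp: nodes_def)
      have "OMap (ftor_comp (A i) w (inj_ftor i)) a = OMap (mor (j i)) a" by (simp add: wi[OF ia(2)])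
      then show ?thesis using ia by (simp add: ftor_comp_simps inj_ftor_def obj_def)
    qed
    have wa: "AMap w (Qa (p, l)) = ev Z j p l" if "(p, l) \<in> paths" for p l
      using that
    proof (induction p l rule: endp.induct)
      case (1 p)
      then have p: "p \<in> nodes" by (simp add: paths_def)
      then have "Qo p \<in> Ob colim" by (simp add: Ob_colim)
      then show ?case using ftorD(3)[OF w(2)] p wo[OF p] by (simp add: Id_colim[symmetric])
    next
      case (2 p i f l)
      then have *: "p \<in> nodes" "i \<in> I" "f \<in> Ar (A i)" "obj_vals p = obj_vals (i, Dom (A i) f)" "valid (i, Cod (A i) f) l"
        by (simp_all add: paths_def)
      have y: "((i, Cod (A i) f), l) \<in> paths" using * by (simp add: paths_def Cod_node)
      note s = single_path[OF *(2,3)]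
      have n: "(i, Dom (A i) f) \<in> nodes" "(i, Cod (A i) f) \<in> nodes" using * by (simp_all add: Dom_node Cod_node)
      have s': "((i, Dom (A i) f), (i, f) # l) \<in> paths" using * n by (simp add: paths_def)
      have "path_vals (p, (i, f) # l) = path_vals ((i, Dom (A i) f), (i, f) # l)" by (rule path_valsI) simp
      then have "Qa (p, (i, f) # l) = Qa ((i, Dom (A i) f), (i, f) # l)" using Qa_eq[OF 2(2) s'] by simp
      also have "\<dots> = Comp colim (Qa ((i, Cod (A i) f), l)) (Qa ((i, Dom (A i) f), [(i, f)]))"
        using Comp_colim[OF s y] by simp
      finally have eq: "Qa (p, (i, f) # l) = Comp colim (Qa ((i, Cod (A i) f), l)) (Qa ((i, Dom (A i) f), [(i, f)]))" .
      have "Qa ((i, Dom (A i) f), [(i, f)]) \<in> Hom colim (Qo (i, Dom (A i) f)) (Qo (i, Cod (A i) f))" using Qa_in[OF s] by simp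
      then have "AMap w (Qa (p, (i, f) # l)) = Comp Z (AMap w (Qa ((i, Cod (A i) f), l))) (AMap w (Qa ((i, Dom (A i) f), [(i, f)])))"
        unfolding eq using ftorD(4)[OF w(2) _ Qa_in[OF y]] by blast
      moreover have "AMap w (Qa ((i, Dom (A i) f), [(i, f)])) = AMap (mor (j i)) f"
      proof -
        have "AMap (ftor_comp (A i) w (inj_ftor i)) f = AMap (mor (j i)) f" by (simp add: wi[OF *(2)])
        then show ?thesis using * by (simp add: ftor_comp_simps inj_ftor_def)
      qed
      ultimately show ?case using 2(1)[OF y] by simp
    qed
    have "w = u"
    proof (rule ftor_eqI[OF w(2) um])
      show "OMap w y = OMap u y" if "y \<in> Ob colim" for y using that wo uo by (auto simp: Ob_colim)
      show "AMap w x = AMap u x" if "x \<in> Ar colim" for x using that wa ua by (auto simp: Ar_colim)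
    qed
    then show "v = Arr colim Z u" using w by simp
  qed
qed

end

theorem has_countable_colimits_CAT:
  assumes U: "universe \<U>"
  shows "has_countable_colimits TYPE('i) (CAT \<U>)"
  unfolding has_countable_colimits_def
proof (intro allI impI)
  fix I :: "'i set" and A R assume I: "countable I" and A: "\<forall>i\<in>I. A i \<in> Ob (CAT \<U>)" and R: "relations (CAT \<U>) I A R"
  obtain pr \<nu> e where d: "colimit_data \<U> pr \<nu> e I" using colimit_data_exists[OF U I] .
  interpret cat_colimit \<U> pr \<nu> e I A R
    using d A R by (simp add: cat_colimit_def cat_colimit_axioms_def CAT_simps)
  show "\<exists>E \<iota>. is_colimit (CAT \<U>) I A R E \<iota>"
    using cpt_colim colim_universal unfolding is_colimit_def by blast
qed

section \<open>Natural transformations and classification diagrams\<close>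

lemma ordcat_simps:
  "Ob (ordcat n) = {..n}" "x \<in> Ar (ordcat n) \<longleftrightarrow> fst x \<le> snd x \<and> snd x \<le> n" "x \<in> Hom (ordcat n) i j \<longleftrightarrow> x = (i, j) \<and> i \<le> j \<and> j \<le> n"
  "Dom (ordcat n) = fst" "Cod (ordcat n) = snd" "Id (ordcat n) i = (i, i)" "Comp (ordcat n) y x = (fst x, snd y)"
  by (auto simp: ordcat_def Hom_def split: prod.splits)

lemma category_ordcat: "category (ordcat n)"
  by (rule categoryI) (auto simp: ordcat_simps)

lemma ordftor_simps: "i \<le> m \<Longrightarrow> OMap (ordftor m \<theta>) i = \<theta> i" "i \<le> j \<Longrightarrow> j \<le> m \<Longrightarrow> AMap (ordftor m \<theta>) (i, j) = (\<theta> i, \<theta> j)"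
  by (simp_all add: ordftor_def ordcat_simps)

lemma is_ftor_ordftor: "\<theta> \<in> dhom m n \<Longrightarrow> is_ftor (ordcat m) (ordcat n) (ordftor m \<theta>)"
  by (rule is_ftorI) (auto simp: ordcat_simps ordftor_def dhomD)

text \<open>Functors that need not be \<open>undefined\<close> outside of their source, as is the case for \<open>chain_pull\<close> and
  \<open>chain_push\<close>.\<close>

definition preftor :: "('o, 'm) cat \<Rightarrow> ('p, 'n) cat \<Rightarrow> ('o, 'm, 'p, 'n) ftor \<Rightarrow> bool" where
  "preftor A B F \<longleftrightarrow> (\<forall>a\<in>Ob A. OMap F a \<in> Ob B \<and> AMap F (Id A a) = Id B (OMap F a)) \<and>
     (\<forall>a b. \<forall>f\<in>Hom A a b. AMap F f \<in> Hom B (OMap F a) (OMap F b)) \<and>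
     (\<forall>a b c. \<forall>f\<in>Hom A a b. \<forall>g\<in>Hom A b c. AMap F (Comp A g f) = Comp B (AMap F g) (AMap F f))"

lemma preftorD:
  assumes "preftor A B F"
  shows "a \<in> Ob A \<Longrightarrow> OMap F a \<in> Ob B" "a \<in> Ob A \<Longrightarrow> AMap F (Id A a) = Id B (OMap F a)"
    "f \<in> Hom A a b \<Longrightarrow> AMap F f \<in> Hom B (OMap F a) (OMap F b)"
    "f \<in> Hom A a b \<Longrightarrow> g \<in> Hom A b c \<Longrightarrow> AMap F (Comp A g f) = Comp B (AMap F g) (AMap F f)"
  using assms unfolding preftor_def by blast+

lemma is_ftor_comp_pre:
  assumes J: "category J" and S: "is_ftor J A \<sigma>" and F: "preftor A B F"
  shows "is_ftor J B (ftor_comp J F \<sigma>)"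
proof (rule is_ftorI)
  fix f assume f: "f \<in> Ar J"
  show "AMap (ftor_comp J F \<sigma>) f \<in> Hom B (OMap (ftor_comp J F \<sigma>) (Dom J f)) (OMap (ftor_comp J F \<sigma>) (Cod J f))"
    using preftorD(3)[OF F ftorD(2)[OF S cat_Ar[OF J f]]] cat_Ob[OF J cat_Ar[OF J f]] f by (simp add: ftor_comp_simps)
next
  fix a assume a: "a \<in> Ob J"
  then show "AMap (ftor_comp J F \<sigma>) (Id J a) = Id B (OMap (ftor_comp J F \<sigma>) a)"
    using HomD(1)[OF cat_id[OF J a]] by (simp add: ftor_comp_simps ftorD(3)[OF S a] preftorD(2)[OF F ftorD(1)[OF S a]])
next
  fix f g a b c assume f: "f \<in> Hom J a b" and g: "g \<in> Hom J b c"
  then show "AMap (ftor_comp J F \<sigma>) (Comp J g f) = Comp B (AMap (ftor_comp J F \<sigma>) g) (AMap (ftor_comp J F \<sigma>) f)"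
    using HomD(1)[OF f] HomD(1)[OF g] HomD(1)[OF cat_comp[OF J f g]]
    by (simp add: ftor_comp_simps ftorD(4)[OF S f g] preftorD(4)[OF F ftorD(2)[OF S f] ftorD(2)[OF S g]])
qed (simp_all add: ftor_comp_simps ftorD(1)[OF S] preftorD(1)[OF F])

lemma spx_nerve: "\<sigma> \<in> spx (nerve A) k \<longleftrightarrow> is_ftor (ordcat k) A \<sigma>"
  by (simp add: nerve_def)

lemma act_nerve: "act (nerve A) m n \<theta> \<sigma> = ftor_comp (ordcat m) \<sigma> (ordftor m \<theta>)"
  by (simp add: nerve_def)

lemma ordftor_id: "ordftor n (\<lambda>i\<in>{..n}. i) = fid (ordcat n)"
  by (rule ftor.equality) (auto simp: ordftor_def fid_def ordcat_simps fun_eq_iff)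

lemma ordftor_compose:
  assumes "\<phi> \<in> dhom k m"
  shows "ordftor k (compose {..k} \<theta> \<phi>) = ftor_comp (ordcat k) (ordftor m \<theta>) (ordftor k \<phi>)"
  by (rule ftor.equality)
    (use dhomD[OF assms] in \<open>auto simp: ordftor_def ftor_comp_def ordcat_simps fun_eq_iff compose_def\<close>)

lemma is_sset_nerve: "is_sset (nerve A)"
  unfolding is_sset_def
proof (intro conjI allI ballI)
  fix m n \<theta> assume "\<theta> \<in> dhom m n"
  then show "act (nerve A) m n \<theta> \<in> spx (nerve A) n \<rightarrow> spx (nerve A) m"
    using is_ftor_comp[OF category_ordcat is_ftor_ordftor] by (auto simp: spx_nerve act_nerve)
next
  fix n \<sigma> assume "\<sigma> \<in> spx (nerve A) n"
  then show "act (nerve A) n n (\<lambda>i\<in>{..n}. i) \<sigma> = \<sigma>"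
    by (simp add: spx_nerve act_nerve ordftor_id ftor_comp_fid category_ordcat del: restrict_apply)
next
  fix k m n \<phi> \<theta> \<sigma> assume \<phi>: "\<phi> \<in> dhom k m"
  show "act (nerve A) k n (compose {..k} \<theta> \<phi>) \<sigma> = act (nerve A) k m \<phi> (act (nerve A) m n \<theta> \<sigma>)"
    unfolding act_nerve ordftor_compose[OF \<phi>]
    by (rule ftor_comp_assoc[OF category_ordcat is_ftor_ordftor[OF \<phi>], symmetric])
qed

lemma nerve_map_apply: "\<sigma> \<in> spx (nerve A) k \<Longrightarrow> nerve_map A F k \<sigma> = ftor_comp (ordcat k) F \<sigma>"
  "\<sigma> \<notin> spx (nerve A) k \<Longrightarrow> nerve_map A F k \<sigma> = undefined"
  by (simp_all add: nerve_map_def)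

lemma nerve_map_in:
  assumes F: "preftor A B F"
  shows "nerve_map A F \<in> smaps (nerve A) (nerve B)"
proof (rule smapsI)
  fix n \<sigma> assume s: "\<sigma> \<in> spx (nerve A) n"
  show "nerve_map A F n \<sigma> \<in> spx (nerve B) n"
    unfolding nerve_map_apply(1)[OF s] unfolding spx_nerve
    by (rule is_ftor_comp_pre[OF category_ordcat s[unfolded spx_nerve] F])
  fix m \<theta> assume \<theta>: "\<theta> \<in> dhom m n"
  show "nerve_map A F m (act (nerve A) m n \<theta> \<sigma>) = act (nerve B) m n \<theta> (nerve_map A F n \<sigma>)"
    unfolding nerve_map_apply(1)[OF s] nerve_map_apply(1)[OF is_ssetD(1)[OF is_sset_nerve \<theta> s]]
    unfolding act_nerve by (rule ftor_comp_assoc[OF category_ordcat is_ftor_ordftor[OF \<theta>], symmetric])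
qed (simp add: nerve_map_apply)

subsection \<open>The homotopy of nerves given by a natural transformation\<close>

definition pretrans :: "('o, 'm) cat \<Rightarrow> ('p, 'n) cat \<Rightarrow> ('o, 'm, 'p, 'n) ftor \<Rightarrow> ('o, 'm, 'p, 'n) ftor \<Rightarrow> ('o \<Rightarrow> 'n) \<Rightarrow> bool" where
  "pretrans A B F F' \<beta> \<longleftrightarrow> preftor A B F \<and> preftor A B F' \<and> (\<forall>a\<in>Ob A. \<beta> a \<in> Hom B (OMap F a) (OMap F' a)) \<and>
     (\<forall>a b. \<forall>f\<in>Hom A a b. Comp B (AMap F' f) (\<beta> a) = Comp B (\<beta> b) (AMap F f))"

text \<open>At \<open>\<sigma>\<close> and \<open>\<tau> : [k] \<rightarrow> [1]\<close> the homotopy is the chain \<open>F \<sigma>\<close> until the jump of \<open>\<tau>\<close> and the chain \<open>F' \<sigma>\<close> after it;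
  the arrows across the jump involve \<open>\<beta>\<close>.\<close>

definition nerve_homotopy ::
  "('p, 'n) cat \<Rightarrow> ('o, 'm, 'p, 'n) ftor \<Rightarrow> ('o, 'm, 'p, 'n) ftor \<Rightarrow> ('o \<Rightarrow> 'n) \<Rightarrow> nat \<Rightarrow>
    (nat, nat \<times> nat, 'o, 'm) ftor \<times> (nat \<Rightarrow> nat) \<Rightarrow> (nat, nat \<times> nat, 'p, 'n) ftor" where
  "nerve_homotopy B F F' \<beta> k = (\<lambda>(\<sigma>, \<tau>). \<lparr>OMap = \<lambda>i\<in>{..k}. if \<tau> i = 0 then OMap F (OMap \<sigma> i) else OMap F' (OMap \<sigma> i),
     AMap = \<lambda>x\<in>Ar (ordcat k). if \<tau> (snd x) = 0 then AMap F (AMap \<sigma> x)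
       else if \<tau> (fst x) = 0 then Comp B (\<beta> (OMap \<sigma> (snd x))) (AMap F (AMap \<sigma> x)) else AMap F' (AMap \<sigma> x)\<rparr>)"

context
  fixes A :: "('o, 'm) cat" and B :: "('p, 'n) cat" and F F' \<beta>
  assumes B: "category B" and t: "pretrans A B F F' \<beta>"
begin

lemma pre_F: "preftor A B F" "preftor A B F'"
  and \<beta>_in: "a \<in> Ob A \<Longrightarrow> \<beta> a \<in> Hom B (OMap F a) (OMap F' a)"
  and \<beta>_nat: "f \<in> Hom A a b \<Longrightarrow> Comp B (AMap F' f) (\<beta> a) = Comp B (\<beta> b) (AMap F f)"
  using t unfolding pretrans_def by blast+

lemma nerve_homotopy_in:
  assumes s: "is_ftor (ordcat k) A \<sigma>" and \<tau>: "\<tau> \<in> dhom k (Suc 0)"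
  shows "is_ftor (ordcat k) B (nerve_homotopy B F F' \<beta> k (\<sigma>, \<tau>))"
proof (rule is_ftorI)
  let ?H = "nerve_homotopy B F F' \<beta> k (\<sigma>, \<tau>)"
  have so: "OMap \<sigma> i \<in> Ob A" if "i \<le> k" for i using ftorD(1)[OF s] that by (simp add: ordcat_simps)
  have sa: "AMap \<sigma> (i, j) \<in> Hom A (OMap \<sigma> i) (OMap \<sigma> j)" if "i \<le> j" "j \<le> k" for i j
    by (rule ftorD(2)[OF s]) (use that in \<open>simp add: ordcat_simps\<close>)
  have mono: "\<tau> j = 0 \<Longrightarrow> \<tau> i = 0" if "i \<le> j" "j \<le> k" for i j using dhomD(2)[OF \<tau> that] by simp
  {
    fix x assume "x \<in> Ar (ordcat k)"
    then obtain i j where x: "x = (i, j)" "i \<le> j" "j \<le> k" by (cases x) (auto simp: ordcat_simps)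
    then have ik: "i \<le> k" by simp
    show "AMap ?H x \<in> Hom B (OMap ?H (Dom (ordcat k) x)) (OMap ?H (Cod (ordcat k) x))"
      using preftorD(3)[OF pre_F(1) sa[OF x(2,3)]] preftorD(3)[OF pre_F(2) sa[OF x(2,3)]]
        cat_comp[OF B preftorD(3)[OF pre_F(1) sa[OF x(2,3)]] \<beta>_in[OF so[OF x(3)]]] mono[OF x(2,3)] x ik
      by (auto simp: nerve_homotopy_def ordcat_simps)
  next
    fix i assume "i \<in> Ob (ordcat k)"
    then have i: "i \<le> k" by (simp add: ordcat_simps)
    have "AMap \<sigma> (i, i) = Id A (OMap \<sigma> i)" using ftorD(3)[OF s, of i] i by (simp add: ordcat_simps)
    then show "AMap ?H (Id (ordcat k) i) = Id B (OMap ?H i)"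
      using i preftorD(2)[OF pre_F(1) so[OF i]] preftorD(2)[OF pre_F(2) so[OF i]]
      by (simp add: nerve_homotopy_def ordcat_simps)
  next
    fix x y a b c assume "x \<in> Hom (ordcat k) a b" "y \<in> Hom (ordcat k) b c"
    then have xy: "x = (a, b)" "y = (b, c)" "a \<le> b" "b \<le> c" "c \<le> k" by (auto simp: ordcat_simps)
    then have bk: "b \<le> k" and ac: "a \<le> c" by simp_all
    let ?f = "AMap \<sigma> (a, b)" and ?g = "AMap \<sigma> (b, c)"
    note f = sa[OF xy(3) bk] and g = sa[OF xy(4,5)]
    have gf: "AMap \<sigma> (a, c) = Comp A ?g ?f"
      using ftorD(4)[OF s, of "(a, b)" a b "(b, c)" c] xy bk by (simp add: ordcat_simps)
    note Ff = preftorD(3)[OF pre_F(1) f] and Fg = preftorD(3)[OF pre_F(1) g] and F'g = preftorD(3)[OF pre_F(2) g]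
    have c1: "Comp B (\<beta> (OMap \<sigma> c)) (Comp B (AMap F ?g) (AMap F ?f)) = Comp B (Comp B (\<beta> (OMap \<sigma> c)) (AMap F ?g)) (AMap F ?f)"
      by (rule cat_assoc[OF B Ff Fg \<beta>_in[OF so[OF xy(5)]]])
    have c2: "Comp B (\<beta> (OMap \<sigma> c)) (Comp B (AMap F ?g) (AMap F ?f)) = Comp B (AMap F' ?g) (Comp B (\<beta> (OMap \<sigma> b)) (AMap F ?f))"
      unfolding c1 \<beta>_nat[OF g, symmetric] by (rule cat_assoc[OF B Ff \<beta>_in[OF so[OF bk]] F'g, symmetric])
    show "AMap ?H (Comp (ordcat k) y x) = Comp B (AMap ?H y) (AMap ?H x)"
      using mono[OF xy(3) bk] mono[OF xy(4,5)] xy bk ac c1 c2 gf preftorD(4)[OF pre_F(1) f g] preftorD(4)[OF pre_F(2) f g]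
      by (auto simp: nerve_homotopy_def ordcat_simps)
  }
  fix i assume "i \<in> Ob (ordcat k)"
  then show "OMap ?H i \<in> Ob B"
    using preftorD(1)[OF pre_F(1) so] preftorD(1)[OF pre_F(2) so] by (simp add: nerve_homotopy_def ordcat_simps)
qed (auto simp: nerve_homotopy_def ordcat_simps)

lemma nerve_homotopy_ends:
  "nerve_homotopy B F F' \<beta> k (\<sigma>, \<lambda>_\<in>{..k}. 0) = ftor_comp (ordcat k) F \<sigma>"
  "nerve_homotopy B F F' \<beta> k (\<sigma>, \<lambda>_\<in>{..k}. 1) = ftor_comp (ordcat k) F' \<sigma>"
  by (rule ftor.equality; auto simp: nerve_homotopy_def ftor_comp_def ordcat_simps fun_eq_iff)+

lemma nerve_homotopy_act:
  assumes \<theta>: "\<theta> \<in> dhom m n"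
  shows "nerve_homotopy B F F' \<beta> m (ftor_comp (ordcat m) \<sigma> (ordftor m \<theta>), compose {..m} \<tau> \<theta>) =
    ftor_comp (ordcat m) (nerve_homotopy B F F' \<beta> n (\<sigma>, \<tau>)) (ordftor m \<theta>)"
  by (rule ftor.equality)
    (use dhomD[OF \<theta>] in \<open>auto simp: nerve_homotopy_def ftor_comp_def ordcat_simps fun_eq_iff compose_def ordftor_def\<close>)

lemma nerve_homotopy_functorial:
  assumes s: "is_ftor (ordcat k) A \<sigma>" and K: "preftor B B' K"
    and o: "\<And>a. a \<in> Ob A \<Longrightarrow> OMap K (OMap F a) = OMap E (OMap L a) \<and> OMap K (OMap F' a) = OMap E' (OMap L a) \<and>
      AMap K (\<beta> a) = \<beta>' (OMap L a)"
    and a: "\<And>f. f \<in> Ar A \<Longrightarrow> AMap K (AMap F f) = AMap E (AMap L f) \<and> AMap K (AMap F' f) = AMap E' (AMap L f)"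
  shows "nerve_homotopy B' E E' \<beta>' k (ftor_comp (ordcat k) L \<sigma>, \<tau>) = ftor_comp (ordcat k) K (nerve_homotopy B F F' \<beta> k (\<sigma>, \<tau>))"
proof (rule ftor.equality)
  have so: "OMap \<sigma> i \<in> Ob A" if "i \<le> k" for i using ftorD(1)[OF s] that by (simp add: ordcat_simps)
  show "OMap (nerve_homotopy B' E E' \<beta>' k (ftor_comp (ordcat k) L \<sigma>, \<tau>)) = OMap (ftor_comp (ordcat k) K (nerve_homotopy B F F' \<beta> k (\<sigma>, \<tau>)))"
    using o[OF so] by (auto simp: nerve_homotopy_def ftor_comp_def ordcat_simps fun_eq_iff)
  show "AMap (nerve_homotopy B' E E' \<beta>' k (ftor_comp (ordcat k) L \<sigma>, \<tau>)) = AMap (ftor_comp (ordcat k) K (nerve_homotopy B F F' \<beta> k (\<sigma>, \<tau>)))"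
  proof
    fix x
    show "AMap (nerve_homotopy B' E E' \<beta>' k (ftor_comp (ordcat k) L \<sigma>, \<tau>)) x = AMap (ftor_comp (ordcat k) K (nerve_homotopy B F F' \<beta> k (\<sigma>, \<tau>))) x"
    proof (cases "x \<in> Ar (ordcat k)")
      case True
      then obtain i j where x: "x = (i, j)" "i \<le> j" "j \<le> k" by (cases x) (auto simp: ordcat_simps)
      have f: "AMap \<sigma> x \<in> Hom A (OMap \<sigma> i) (OMap \<sigma> j)"
        by (rule ftorD(2)[OF s]) (use x in \<open>simp add: ordcat_simps\<close>)
      have "AMap K (Comp B (\<beta> (OMap \<sigma> j)) (AMap F (AMap \<sigma> x))) = Comp B' (\<beta>' (OMap L (OMap \<sigma> j))) (AMap E (AMap L (AMap \<sigma> x)))"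
        using preftorD(4)[OF K preftorD(3)[OF pre_F(1) f] \<beta>_in[OF so[OF x(3)]]] o[OF so[OF x(3)]] a[OF HomD(1)[OF f]] by simp
      then show ?thesis
        using True x a[OF HomD(1)[OF f]] by (simp add: nerve_homotopy_def ftor_comp_def ordcat_simps)
    next
      case False
      then show ?thesis by (simp add: nerve_homotopy_def ftor_comp_def)
    qed
  qed
qed (simp add: nerve_homotopy_def ftor_comp_def)

end

subsection \<open>Chains\<close>

lemma category_chain_cat: "relative_category C W \<Longrightarrow> category (chain_cat C W n)"
  unfolding chain_cat_def by (rule category_ftor_cat[OF category_ordcat])

lemma chain_cat_simps:
  "X \<in> Ob (chain_cat C W n) \<longleftrightarrow> is_ftor (ordcat n) C X"
  "a \<in> Hom (chain_cat C W n) X Y \<longleftrightarrow> is_ftor (ordcat n) C X \<and> is_ftor (ordcat n) C Y \<and>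
     (\<exists>\<alpha>. a = Arr X Y \<alpha> \<and> nat_trans (ordcat n) C X Y \<alpha> \<and> (\<forall>i\<le>n. \<alpha> i \<in> W))"
  "Id (chain_cat C W n) X = Arr X X (\<lambda>j\<in>{..n}. Id C (OMap X j))"
  "Comp (chain_cat C W n) b a = Arr (src a) (tgt b) (\<lambda>j\<in>{..n}. Comp C (mor b j) (mor a j))"
  by (cases a; auto simp: chain_cat_def ftor_cat_simps Hom_def ordcat_simps)+

lemma chain_pull_simps:
  "OMap (chain_pull m \<theta>) X = ftor_comp (ordcat m) X (ordftor m \<theta>)"
  "AMap (chain_pull m \<theta>) a = Arr (ftor_comp (ordcat m) (src a) (ordftor m \<theta>)) (ftor_comp (ordcat m) (tgt a) (ordftor m \<theta>)) (\<lambda>i\<in>{..m}. mor a (\<theta> i))"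
  by (simp_all add: chain_pull_def Let_def)

lemma chain_push_simps:
  "OMap (chain_push n F) X = ftor_comp (ordcat n) F X"
  "AMap (chain_push n F) a = Arr (ftor_comp (ordcat n) F (src a)) (ftor_comp (ordcat n) F (tgt a)) (\<lambda>i\<in>{..n}. AMap F (mor a i))"
  by (simp_all add: chain_push_def Let_def)

lemma preftorI:
  assumes "\<And>a. a \<in> Ob A \<Longrightarrow> OMap F a \<in> Ob B" "\<And>a. a \<in> Ob A \<Longrightarrow> AMap F (Id A a) = Id B (OMap F a)"
    "\<And>f a b. f \<in> Hom A a b \<Longrightarrow> AMap F f \<in> Hom B (OMap F a) (OMap F b)"
    "\<And>f g a b c. f \<in> Hom A a b \<Longrightarrow> g \<in> Hom A b c \<Longrightarrow> AMap F (Comp A g f) = Comp B (AMap F g) (AMap F f)"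
  shows "preftor A B F"
  unfolding preftor_def using assms by blast

lemma preftor_chain_pull:
  assumes \<theta>: "\<theta> \<in> dhom m n"
  shows "preftor (chain_cat C W n) (chain_cat C W m) (chain_pull m \<theta>)"
proof (rule preftorI)
  note po = is_ftor_comp[OF category_ordcat is_ftor_ordftor[OF \<theta>]]
  have le: "\<theta> i \<le> n" if "i \<le> m" for i using dhomD(1)[OF \<theta> that] .
  {
    fix X assume "X \<in> Ob (chain_cat C W n)"
    then show "OMap (chain_pull m \<theta>) X \<in> Ob (chain_cat C W m)" by (simp add: chain_cat_simps chain_pull_simps po)
    show "AMap (chain_pull m \<theta>) (Id (chain_cat C W n) X) = Id (chain_cat C W m) (OMap (chain_pull m \<theta>) X)"
      using le by (auto simp: chain_cat_simps chain_pull_simps fun_eq_iff ftor_comp_def ordcat_simps ordftor_simps)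
  next
    fix a X Y assume "a \<in> Hom (chain_cat C W n) X Y"
    then obtain \<alpha> where a: "a = Arr X Y \<alpha>" "is_ftor (ordcat n) C X" "is_ftor (ordcat n) C Y" "nat_trans (ordcat n) C X Y \<alpha>" "\<forall>i\<le>n. \<alpha> i \<in> W"
      by (auto simp: chain_cat_simps)
    have "nat_trans (ordcat m) C (ftor_comp (ordcat m) X (ordftor m \<theta>)) (ftor_comp (ordcat m) Y (ordftor m \<theta>)) (\<lambda>i\<in>{..m}. \<alpha> (\<theta> i))"
    proof (rule nat_transI)
      fix i assume "i \<in> Ob (ordcat m)"
      then show "(\<lambda>i\<in>{..m}. \<alpha> (\<theta> i)) i \<in> Hom C (OMap (ftor_comp (ordcat m) X (ordftor m \<theta>)) i) (OMap (ftor_comp (ordcat m) Y (ordftor m \<theta>)) i)"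
        using nat_transD(1)[OF a(4), of "\<theta> i"] le by (simp add: ordcat_simps ftor_comp_simps ordftor_simps)
    next
      fix f i j assume "f \<in> Hom (ordcat m) i j"
      then have f: "f = (i, j)" "i \<le> j" "j \<le> m" by (simp_all add: ordcat_simps)
      then have "i \<le> m" by simp
      then show "Comp C (AMap (ftor_comp (ordcat m) Y (ordftor m \<theta>)) f) ((\<lambda>i\<in>{..m}. \<alpha> (\<theta> i)) i) =
          Comp C ((\<lambda>i\<in>{..m}. \<alpha> (\<theta> i)) j) (AMap (ftor_comp (ordcat m) X (ordftor m \<theta>)) f)"
        using nat_transD(2)[OF a(4), of "(\<theta> i, \<theta> j)" "\<theta> i" "\<theta> j"] f le dhomD(2)[OF \<theta>, of i j]
        by (simp add: ordcat_simps ftor_comp_simps ordftor_simps)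
    qed (simp add: ordcat_simps)
    then show "AMap (chain_pull m \<theta>) a \<in> Hom (chain_cat C W m) (OMap (chain_pull m \<theta>) X) (OMap (chain_pull m \<theta>) Y)"
      using a le by (simp add: chain_cat_simps chain_pull_simps po)
  next
    fix a b X Y Z assume "a \<in> Hom (chain_cat C W n) X Y" "b \<in> Hom (chain_cat C W n) Y Z"
    then show "AMap (chain_pull m \<theta>) (Comp (chain_cat C W n) b a) = Comp (chain_cat C W m) (AMap (chain_pull m \<theta>) b) (AMap (chain_pull m \<theta>) a)"
      using le by (auto simp: chain_cat_simps chain_pull_simps fun_eq_iff)
  }
qed

lemma preftor_chain_push:
  assumes C: "relative_category C W" and F: "is_ftor C D F" and FW: "AMap F ` W \<subseteq> V"
  shows "preftor (chain_cat C W n) (chain_cat D V n) (chain_push n F)"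
proof (rule preftorI)
  note po = is_ftor_comp[OF category_ordcat _ F]
  {
    fix X assume "X \<in> Ob (chain_cat C W n)"
    then have X: "is_ftor (ordcat n) C X" by (simp add: chain_cat_simps)
    then show "OMap (chain_push n F) X \<in> Ob (chain_cat D V n)" by (simp add: chain_cat_simps chain_push_simps po)
    show "AMap (chain_push n F) (Id (chain_cat C W n) X) = Id (chain_cat D V n) (OMap (chain_push n F) X)"
      using ftorD(1)[OF X] ftorD(3)[OF F] by (auto simp: chain_cat_simps chain_push_simps fun_eq_iff ftor_comp_def ordcat_simps)
  next
    fix a X Y assume "a \<in> Hom (chain_cat C W n) X Y"
    then obtain \<alpha> where a: "a = Arr X Y \<alpha>" "is_ftor (ordcat n) C X" "is_ftor (ordcat n) C Y" "nat_trans (ordcat n) C X Y \<alpha>" "\<forall>i\<le>n. \<alpha> i \<in> W"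
      by (auto simp: chain_cat_simps)
    have "nat_trans (ordcat n) D (ftor_comp (ordcat n) F X) (ftor_comp (ordcat n) F Y) (\<lambda>i\<in>{..n}. AMap F (\<alpha> i))"
    proof (rule nat_transI)
      fix i assume i: "i \<in> Ob (ordcat n)"
      show "(\<lambda>i\<in>{..n}. AMap F (\<alpha> i)) i \<in> Hom D (OMap (ftor_comp (ordcat n) F X) i) (OMap (ftor_comp (ordcat n) F Y) i)"
        using ftorD(2)[OF F nat_transD(1)[OF a(4) i]] i by (simp add: ftor_comp_simps ordcat_simps)
    next
      fix f i j assume f: "f \<in> Hom (ordcat n) i j"
      then have ij: "i \<in> Ob (ordcat n)" "j \<in> Ob (ordcat n)" "i \<le> n" "j \<le> n" by (auto simp: ordcat_simps)
      show "Comp D (AMap (ftor_comp (ordcat n) F Y) f) ((\<lambda>i\<in>{..n}. AMap F (\<alpha> i)) i) =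
          Comp D ((\<lambda>i\<in>{..n}. AMap F (\<alpha> i)) j) (AMap (ftor_comp (ordcat n) F X) f)"
        using ftorD(4)[OF F nat_transD(1)[OF a(4) ij(1)] ftorD(2)[OF a(3) f]] ftorD(4)[OF F ftorD(2)[OF a(2) f] nat_transD(1)[OF a(4) ij(2)]]
          nat_transD(2)[OF a(4) f] HomD(1)[OF f] ij by (simp add: ftor_comp_simps)
    qed (simp add: ordcat_simps)
    then show "AMap (chain_push n F) a \<in> Hom (chain_cat D V n) (OMap (chain_push n F) X) (OMap (chain_push n F) Y)"
      using a po FW by (auto simp: chain_cat_simps chain_push_simps)
  next
    fix a b X Y Z assume "a \<in> Hom (chain_cat C W n) X Y" "b \<in> Hom (chain_cat C W n) Y Z"
    then obtain \<alpha> \<beta> where a: "a = Arr X Y \<alpha>" "nat_trans (ordcat n) C X Y \<alpha>" and b: "b = Arr Y Z \<beta>" "nat_trans (ordcat n) C Y Z \<beta>"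
      by (auto simp: chain_cat_simps)
    have "AMap F (Comp C (\<beta> i) (\<alpha> i)) = Comp D (AMap F (\<beta> i)) (AMap F (\<alpha> i))" if "i \<le> n" for i
      using ftorD(4)[OF F nat_transD(1)[OF a(2)] nat_transD(1)[OF b(2)], of i] that by (simp add: ordcat_simps)
    then show "AMap (chain_push n F) (Comp (chain_cat C W n) b a) = Comp (chain_cat D V n) (AMap (chain_push n F) b) (AMap (chain_push n F) a)"
      using a b by (auto simp: chain_cat_simps chain_push_simps fun_eq_iff)
  }
qed

lemma Ncl_simps: "lev (Ncl C W) n = nerve (chain_cat C W n)" "hact (Ncl C W) m n \<theta> = nerve_map (chain_cat C W n) (chain_pull m \<theta>)"
  by (simp_all add: Ncl_def)

lemma nerve_map_comp:
  assumes "preftor A B F" "\<sigma> \<in> spx (nerve A) k"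
  shows "nerve_map B G k (nerve_map A F k \<sigma>) = ftor_comp (ordcat k) G (ftor_comp (ordcat k) F \<sigma>)"
  using smapsD(1)[OF nerve_map_in[OF assms(1)] assms(2)] assms(2) by (simp add: nerve_map_apply)

lemma nerve_ftor_comp_eqI:
  assumes s: "is_ftor (ordcat k) A \<sigma>"
    and "\<And>a. a \<in> Ob A \<Longrightarrow> OMap G (OMap F a) = OMap G' (OMap F' a)" "\<And>f. f \<in> Ar A \<Longrightarrow> AMap G (AMap F f) = AMap G' (AMap F' f)"
  shows "ftor_comp (ordcat k) G (ftor_comp (ordcat k) F \<sigma>) = ftor_comp (ordcat k) G' (ftor_comp (ordcat k) F' \<sigma>)"
  by (rule ftor.equality) (use assms(2)[OF ftorD(1)[OF s]] assms(3)[OF ftorD(7)[OF s]] in \<open>auto simp: ftor_comp_def fun_eq_iff\<close>)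

lemma nerve_ftor_comp_idI:
  assumes s: "is_ftor (ordcat k) A \<sigma>"
    and "\<And>a. a \<in> Ob A \<Longrightarrow> OMap G a = a" "\<And>f. f \<in> Ar A \<Longrightarrow> AMap G f = f"
  shows "ftor_comp (ordcat k) G \<sigma> = \<sigma>"
  by (rule ftor.equality) (use assms(2)[OF ftorD(1)[OF s]] assms(3)[OF ftorD(7)[OF s]] ftorD(5,6)[OF s] in \<open>auto simp: ftor_comp_def fun_eq_iff\<close>)

lemma chain_cat_Ar:
  assumes "relative_category C W" "a \<in> Ar (chain_cat C W n)"
  obtains X Y \<alpha> where "a = Arr X Y \<alpha>" "is_ftor (ordcat n) C X" "is_ftor (ordcat n) C Y" "nat_trans (ordcat n) C X Y \<alpha>"
  using cat_Ar[OF category_chain_cat[OF assms(1)] assms(2)] by (auto simp: chain_cat_simps)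

lemma is_bsset_Ncl:
  assumes C: "relative_category C W"
  shows "is_bsset (Ncl C W)"
  unfolding is_bsset_def Ncl_simps
proof (intro conjI allI ballI)
  show "is_sset (nerve (chain_cat C W n))" for n by (rule is_sset_nerve)
  show "nerve_map (chain_cat C W n) (chain_pull m \<theta>) \<in> smaps (nerve (chain_cat C W n)) (nerve (chain_cat C W m))"
    if "\<theta> \<in> dhom m n" for m n \<theta> by (rule nerve_map_in[OF preftor_chain_pull[OF that]])
  fix n k \<sigma> assume s: "\<sigma> \<in> spx (nerve (chain_cat C W n)) k"
  show "nerve_map (chain_cat C W n) (chain_pull n (\<lambda>i\<in>{..n}. i)) k \<sigma> = \<sigma>"
    unfolding nerve_map_apply(1)[OF s]
  proof (rule nerve_ftor_comp_idI[OF s[unfolded spx_nerve]])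
    fix X assume "X \<in> Ob (chain_cat C W n)"
    then show "OMap (chain_pull n (\<lambda>i\<in>{..n}. i)) X = X"
      unfolding chain_pull_simps ordftor_id by (intro ftor_comp_fid(2)[OF category_ordcat]) (simp add: chain_cat_simps)
  next
    fix a assume "a \<in> Ar (chain_cat C W n)"
    then obtain X Y \<alpha> where a: "a = Arr X Y \<alpha>" "is_ftor (ordcat n) C X" "is_ftor (ordcat n) C Y" "nat_trans (ordcat n) C X Y \<alpha>"
      by (rule chain_cat_Ar[OF C])
    have "(\<lambda>i\<in>{..n}. \<alpha> ((\<lambda>i\<in>{..n}. i) i)) = \<alpha>" using nat_transD(3)[OF a(4)] by (auto simp: fun_eq_iff ordcat_simps)
    then show "AMap (chain_pull n (\<lambda>i\<in>{..n}. i)) a = a"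
      unfolding chain_pull_simps ordftor_id a(1) arr.sel
      using ftor_comp_fid(2)[OF category_ordcat a(2)] ftor_comp_fid(2)[OF category_ordcat a(3)] by metis
  qed
next
  fix l m n k \<phi> \<theta> \<sigma> assume \<phi>: "\<phi> \<in> dhom l m" and \<theta>: "\<theta> \<in> dhom m n" and s: "\<sigma> \<in> spx (nerve (chain_cat C W n)) k"
  have pull: "ftor_comp (ordcat l) X (ordftor l (compose {..l} \<theta> \<phi>)) = ftor_comp (ordcat l) (ftor_comp (ordcat m) X (ordftor m \<theta>)) (ordftor l \<phi>)" for X :: "('a, 'b) chain_ob"
    unfolding ordftor_compose[OF \<phi>] by (rule ftor_comp_assoc[OF category_ordcat is_ftor_ordftor[OF \<phi>], symmetric])
  have pull_mor: "(\<lambda>i\<in>{..l}. (\<lambda>i\<in>{..m}. \<alpha> (\<theta> i)) (\<phi> i)) = (\<lambda>i\<in>{..l}. \<alpha> (compose {..l} \<theta> \<phi> i))" for \<alpha> :: "nat \<Rightarrow> 'b"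
    using dhomD(1)[OF \<phi>] by (auto simp: fun_eq_iff compose_def)
  have "ftor_comp (ordcat k) (chain_pull l \<phi>) (ftor_comp (ordcat k) (chain_pull m \<theta>) \<sigma>) =
      ftor_comp (ordcat k) (chain_pull l (compose {..l} \<theta> \<phi>)) (ftor_comp (ordcat k) \<lparr>OMap = \<lambda>a. a, AMap = \<lambda>f. f\<rparr> \<sigma>)"
    by (rule nerve_ftor_comp_eqI[OF s[unfolded spx_nerve]])
      (simp_all only: chain_pull_simps arr.sel ftor.select_convs pull pull_mor)
  also have "ftor_comp (ordcat k) \<lparr>OMap = \<lambda>a. a, AMap = \<lambda>f. f\<rparr> \<sigma> = \<sigma>"
    by (rule nerve_ftor_comp_idI[OF s[unfolded spx_nerve]]) simp_all
  finally show "nerve_map (chain_cat C W n) (chain_pull l (compose {..l} \<theta> \<phi>)) k \<sigma> =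
      nerve_map (chain_cat C W m) (chain_pull l \<phi>) k (nerve_map (chain_cat C W n) (chain_pull m \<theta>) k \<sigma>)"
    unfolding nerve_map_comp[OF preftor_chain_pull[OF \<theta>] s] unfolding nerve_map_apply(1)[OF s] ..
qed

lemma push_pull:
  assumes "\<theta> \<in> dhom m n"
  shows "OMap (chain_push m F) (OMap (chain_pull m \<theta>) X) = OMap (chain_pull m \<theta>) (OMap (chain_push n F) X)"
    "AMap (chain_push m F) (AMap (chain_pull m \<theta>) a) = AMap (chain_pull m \<theta>) (AMap (chain_push n F) a)"
proof -
  have p: "ftor_comp (ordcat m) F (ftor_comp (ordcat m) X (ordftor m \<theta>)) = ftor_comp (ordcat m) (ftor_comp (ordcat n) F X) (ordftor m \<theta>)" for X
    by (rule ftor_comp_assoc[OF category_ordcat is_ftor_ordftor[OF assms], symmetric])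
  show "OMap (chain_push m F) (OMap (chain_pull m \<theta>) X) = OMap (chain_pull m \<theta>) (OMap (chain_push n F) X)"
    "AMap (chain_push m F) (AMap (chain_pull m \<theta>) a) = AMap (chain_pull m \<theta>) (AMap (chain_push n F) a)"
    using dhomD(1)[OF assms] by (auto simp: chain_push_simps chain_pull_simps p fun_eq_iff)
qed

lemma Ncl_map_in:
  assumes F: "relative_functor C W D V F"
  shows "Ncl_map C W F \<in> bmaps (Ncl C W) (Ncl D V)"
proof -
  have C: "relative_category C W" and F': "is_ftor C D F" "AMap F ` W \<subseteq> V" using F by (auto simp: relative_functor_def)
  note pf = preftor_chain_push[OF C F']
  have "Ncl_map C W F n \<in> smaps (lev (Ncl C W) n) (lev (Ncl D V) n)" for n
    unfolding Ncl_simps Ncl_map_def by (rule nerve_map_in[OF pf])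
  moreover have "Ncl_map C W F m k (hact (Ncl C W) m n \<theta> k \<sigma>) = hact (Ncl D V) m n \<theta> k (Ncl_map C W F n k \<sigma>)"
    if \<theta>: "\<theta> \<in> dhom m n" and s: "\<sigma> \<in> spx (lev (Ncl C W) n) k" for m n k \<theta> \<sigma>
  proof -
    note s' = s[unfolded Ncl_simps]
    show ?thesis
      unfolding Ncl_simps Ncl_map_def nerve_map_comp[OF preftor_chain_pull[OF \<theta>] s'] nerve_map_comp[OF pf s']
      by (rule nerve_ftor_comp_eqI[OF s'[unfolded spx_nerve]]) (simp_all add: push_pull[OF \<theta>])
  qed
  ultimately show ?thesis unfolding bmaps_def by blast
qed

definition chain_trans :: "('o, 'm, 'p, 'n) ftor \<Rightarrow> ('o, 'm, 'p, 'n) ftor \<Rightarrow> ('o \<Rightarrow> 'n) \<Rightarrow> nat \<Rightarrow> ('o, 'm) chain_ob \<Rightarrow> ('p, 'n) chain_ar" where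
  "chain_trans P P' \<alpha> n X = Arr (ftor_comp (ordcat n) P X) (ftor_comp (ordcat n) P' X) (\<lambda>i\<in>{..n}. \<alpha> (OMap X i))"

lemma pretrans_chain_trans:
  assumes P: "relative_functor C W D V P" and P': "relative_functor C W D V P'"
    and \<alpha>: "nat_trans C D P P' \<alpha>" "\<And>a. a \<in> Ob C \<Longrightarrow> \<alpha> a \<in> V"
  shows "pretrans (chain_cat C W n) (chain_cat D V n) (chain_push n P) (chain_push n P') (chain_trans P P' \<alpha> n)"
  unfolding pretrans_def
proof (intro conjI allI ballI)
  have C: "relative_category C W" and Pf: "is_ftor C D P" "AMap P ` W \<subseteq> V" and P'f: "is_ftor C D P'" "AMap P' ` W \<subseteq> V"
    using P P' by (auto simp: relative_functor_def)
  show "preftor (chain_cat C W n) (chain_cat D V n) (chain_push n P)" by (rule preftor_chain_push[OF C Pf])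
  show "preftor (chain_cat C W n) (chain_cat D V n) (chain_push n P')" by (rule preftor_chain_push[OF C P'f])
  {
    fix X assume "X \<in> Ob (chain_cat C W n)"
    then have X: "is_ftor (ordcat n) C X" by (simp add: chain_cat_simps)
    have "nat_trans (ordcat n) D (ftor_comp (ordcat n) P X) (ftor_comp (ordcat n) P' X) (\<lambda>i\<in>{..n}. \<alpha> (OMap X i))"
    proof (rule nat_transI)
      fix i assume i: "i \<in> Ob (ordcat n)"
      then show "(\<lambda>i\<in>{..n}. \<alpha> (OMap X i)) i \<in> Hom D (OMap (ftor_comp (ordcat n) P X) i) (OMap (ftor_comp (ordcat n) P' X) i)"
        using nat_transD(1)[OF \<alpha>(1) ftorD(1)[OF X i]] by (simp add: ftor_comp_simps ordcat_simps)
    next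
      fix f i j assume f: "f \<in> Hom (ordcat n) i j"
      then have "i \<in> Ob (ordcat n)" "j \<in> Ob (ordcat n)" "i \<le> n" "j \<le> n" by (auto simp: ordcat_simps)
      then show "Comp D (AMap (ftor_comp (ordcat n) P' X) f) ((\<lambda>i\<in>{..n}. \<alpha> (OMap X i)) i) =
          Comp D ((\<lambda>i\<in>{..n}. \<alpha> (OMap X i)) j) (AMap (ftor_comp (ordcat n) P X) f)"
        using nat_transD(2)[OF \<alpha>(1) ftorD(2)[OF X f]] HomD(1)[OF f] by (simp add: ftor_comp_simps)
    qed (simp add: ordcat_simps)
    then show "chain_trans P P' \<alpha> n X \<in> Hom (chain_cat D V n) (OMap (chain_push n P) X) (OMap (chain_push n P') X)"
      using is_ftor_comp[OF category_ordcat X Pf(1)] is_ftor_comp[OF category_ordcat X P'f(1)] ftorD(1)[OF X] \<alpha>(2)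
      by (simp add: chain_trans_def chain_cat_simps chain_push_simps ordcat_simps)
  }
  fix X Y a assume "a \<in> Hom (chain_cat C W n) X Y"
  then obtain \<gamma> where a: "a = Arr X Y \<gamma>" "nat_trans (ordcat n) C X Y \<gamma>" by (auto simp: chain_cat_simps)
  have "Comp D (AMap P' (\<gamma> i)) (\<alpha> (OMap X i)) = Comp D (\<alpha> (OMap Y i)) (AMap P (\<gamma> i))" if "i \<le> n" for i
    using nat_transD(2)[OF \<alpha>(1) nat_transD(1)[OF a(2)], of i] that by (simp add: ordcat_simps)
  then show "Comp (chain_cat D V n) (AMap (chain_push n P') a) (chain_trans P P' \<alpha> n X) =
      Comp (chain_cat D V n) (chain_trans P P' \<alpha> n Y) (AMap (chain_push n P) a)"
    using a by (auto simp: chain_cat_simps chain_push_simps chain_trans_def fun_eq_iff)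
qed

text \<open>Whiskering with \<open>\<alpha>\<close> is a natural transformation between the functors of chains of length \<open>n\<close>, since the
  components of \<open>\<alpha>\<close> lie in \<open>V\<close>.  The resulting homotopies of nerves are compatible in \<open>n\<close>.\<close>

theorem bihomotopy_of_natural_transformation:
  assumes P: "relative_functor C W D V P" and P': "relative_functor C W D V P'"
    and \<alpha>: "nat_trans C D P P' \<alpha>" "\<And>a. a \<in> Ob C \<Longrightarrow> \<alpha> a \<in> V"
  shows "\<exists>B. bihomotopy (Ncl C W) (Ncl D V) B (Ncl_map C W P) (Ncl_map C W P')"
proof -
  have C: "relative_category C W" and D: "relative_category D V" using P by (auto simp: relative_functor_def)
  note t = pretrans_chain_trans[OF P P' \<alpha>] and cD = category_chain_cat[OF D]
  let ?NH = "\<lambda>n. nerve_homotopy (chain_cat D V n) (chain_push n P) (chain_push n P') (chain_trans P P' \<alpha> n)"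
  define B where "B n k = (\<lambda>p\<in>spx (nerve (chain_cat C W n)) k \<times> dhom k 1. ?NH n k p)" for n k
  have B: "B n k (\<sigma>, \<tau>) = ?NH n k (\<sigma>, \<tau>)" if "\<sigma> \<in> spx (nerve (chain_cat C W n)) k" "\<tau> \<in> dhom k (Suc 0)" for n k \<sigma> \<tau>
    using that by (simp add: B_def)
  have "B \<in> bmaps (btimes (Ncl C W) (Delta 1)) (Ncl D V)"
  proof (rule cylinder_mapsI)
    fix n k \<sigma> \<tau> assume "\<sigma> \<in> spx (lev (Ncl C W) n) k" and "\<tau> \<in> dhom k 1"
    then have s: "\<sigma> \<in> spx (nerve (chain_cat C W n)) k" and \<tau>: "\<tau> \<in> dhom k (Suc 0)" by (simp_all add: Ncl_simps)
    note s' = s[unfolded spx_nerve]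
    show "B n k (\<sigma>, \<tau>) \<in> spx (lev (Ncl D V) n) k"
      unfolding B[OF s \<tau>] Ncl_simps spx_nerve by (rule nerve_homotopy_in[OF cD t s' \<tau>])
    {
      fix i \<theta> assume \<theta>: "\<theta> \<in> dhom i k"
      show "B n i (act (lev (Ncl C W) n) i k \<theta> \<sigma>, compose {..i} \<tau> \<theta>) = act (lev (Ncl D V) n) i k \<theta> (B n k (\<sigma>, \<tau>))"
        unfolding Ncl_simps B[OF s \<tau>] B[OF is_ssetD(1)[OF is_sset_nerve \<theta> s] dhom_compose[OF \<theta> \<tau>]]
        unfolding act_nerve
        by (rule nerve_homotopy_act[OF cD t \<theta>])
    next
      fix m \<theta> assume \<theta>: "\<theta> \<in> dhom m n"
      note pull = preftor_chain_pull[OF \<theta>]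
      have s2: "nerve_map (chain_cat C W n) (chain_pull m \<theta>) k \<sigma> \<in> spx (nerve (chain_cat C W m)) k"
        by (rule smapsD(1)[OF nerve_map_in[OF pull] s])
      have h: "?NH n k (\<sigma>, \<tau>) \<in> spx (nerve (chain_cat D V n)) k"
        unfolding spx_nerve by (rule nerve_homotopy_in[OF cD t s' \<tau>])
      have p: "ftor_comp (ordcat m) F (ftor_comp (ordcat m) X (ordftor m \<theta>)) = ftor_comp (ordcat m) (ftor_comp (ordcat n) F X) (ordftor m \<theta>)" for F X
        by (rule ftor_comp_assoc[OF category_ordcat is_ftor_ordftor[OF \<theta>], symmetric])
      have "AMap (chain_pull m \<theta>) (chain_trans P P' \<alpha> n X) = chain_trans P P' \<alpha> m (OMap (chain_pull m \<theta>) X)" for X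
        using dhomD(1)[OF \<theta>] by (auto simp: chain_pull_simps chain_trans_def p fun_eq_iff ftor_comp_simps ordcat_simps ordftor_simps)
      then show "B m k (hact (Ncl C W) m n \<theta> k \<sigma>, \<tau>) = hact (Ncl D V) m n \<theta> k (B n k (\<sigma>, \<tau>))"
        unfolding Ncl_simps B[OF s \<tau>] B[OF s2 \<tau>] unfolding nerve_map_apply(1)[OF s] nerve_map_apply(1)[OF h]
        by (intro nerve_homotopy_functorial[OF cD t s' pull]) (simp_all add: push_pull[OF \<theta>])
    }
  qed (auto simp: B_def Ncl_simps)
  moreover have "B n k (\<sigma>, \<lambda>_\<in>{..k}. 0) = Ncl_map C W P n k \<sigma> \<and> B n k (\<sigma>, \<lambda>_\<in>{..k}. 1) = Ncl_map C W P' n k \<sigma>"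
    if "\<sigma> \<in> spx (lev (Ncl C W) n) k" for n k \<sigma>
  proof -
    have s: "\<sigma> \<in> spx (nerve (chain_cat C W n)) k" using that by (simp add: Ncl_simps)
    have c: "(\<lambda>_\<in>{..k}. 0) \<in> dhom k (Suc 0)" "(\<lambda>_\<in>{..k}. 1) \<in> dhom k (Suc 0)" by (rule dhomI; simp)+
    show ?thesis
      unfolding B[OF s c(1)] B[OF s c(2)] Ncl_map_def nerve_map_apply(1)[OF s]
      by (intro conjI nerve_homotopy_ends[OF cD t])
  qed
  ultimately show ?thesis unfolding bihomotopy_def by blast
qed

lemma Ncl_map_fid:
  assumes C: "relative_category C W" and s: "\<sigma> \<in> spx (lev (Ncl C W) n) k"
  shows "Ncl_map C W (fid C) n k \<sigma> = \<sigma>"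
proof -
  note s' = s[unfolded Ncl_simps]
  show ?thesis
    unfolding Ncl_map_def nerve_map_apply(1)[OF s']
  proof (rule nerve_ftor_comp_idI[OF s'[unfolded spx_nerve]])
    fix X assume "X \<in> Ob (chain_cat C W n)"
    then show "OMap (chain_push n (fid C)) X = X" by (simp add: chain_push_simps chain_cat_simps ftor_comp_fid(1))
  next
    fix a assume "a \<in> Ar (chain_cat C W n)"
    then obtain X Y \<alpha> where a: "a = Arr X Y \<alpha>" "is_ftor (ordcat n) C X" "is_ftor (ordcat n) C Y" "nat_trans (ordcat n) C X Y \<alpha>"
      by (rule chain_cat_Ar[OF C])
    have "(\<lambda>i\<in>{..n}. AMap (fid C) (\<alpha> i)) = \<alpha>"
      using nat_transD(3)[OF a(4)] HomD(1)[OF nat_transD(1)[OF a(4)]] by (auto simp: fun_eq_iff ordcat_simps fid_simps)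
    then show "AMap (chain_push n (fid C)) a = a" using a by (simp add: chain_push_simps ftor_comp_fid(1))
  qed
qed

lemma Ncl_map_comp:
  assumes F: "relative_functor C W D V F" and s: "\<sigma> \<in> spx (lev (Ncl C W) n) k"
  shows "Ncl_map C W (ftor_comp C G F) n k \<sigma> = Ncl_map D V G n k (Ncl_map C W F n k \<sigma>)"
proof -
  have C: "relative_category C W" and F': "is_ftor C D F" "AMap F ` W \<subseteq> V" using F by (auto simp: relative_functor_def)
  note s' = s[unfolded Ncl_simps]
  \<comment> \<open>The composite with an identity is inserted in order to compare two composites of two maps.\<close>
  have "ftor_comp (ordcat k) (chain_push n (ftor_comp C G F)) (ftor_comp (ordcat k) \<lparr>OMap = \<lambda>a. a, AMap = \<lambda>f. f\<rparr> \<sigma>) =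
      ftor_comp (ordcat k) (chain_push n G) (ftor_comp (ordcat k) (chain_push n F) \<sigma>)"
  proof (rule nerve_ftor_comp_eqI[OF s'[unfolded spx_nerve]])
    have p: "ftor_comp (ordcat n) (ftor_comp C G F) X = ftor_comp (ordcat n) G (ftor_comp (ordcat n) F X)" if "is_ftor (ordcat n) C X" for X
      by (rule ftor_comp_assoc[OF category_ordcat that])
    show "OMap (chain_push n (ftor_comp C G F)) (OMap \<lparr>OMap = \<lambda>a. a, AMap = \<lambda>f. f\<rparr> X) = OMap (chain_push n G) (OMap (chain_push n F) X)"
      if "X \<in> Ob (chain_cat C W n)" for X using that p by (simp add: chain_push_simps chain_cat_simps)
    fix a assume "a \<in> Ar (chain_cat C W n)"
    then obtain X Y \<alpha> where a: "a = Arr X Y \<alpha>" "is_ftor (ordcat n) C X" "is_ftor (ordcat n) C Y" "nat_trans (ordcat n) C X Y \<alpha>"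
      by (rule chain_cat_Ar[OF C])
    have "AMap (ftor_comp C G F) (\<alpha> i) = AMap G (AMap F (\<alpha> i))" if "i \<le> n" for i
      using HomD(1)[OF nat_transD(1)[OF a(4), of i]] that by (simp add: ordcat_simps ftor_comp_simps)
    then show "AMap (chain_push n (ftor_comp C G F)) (AMap \<lparr>OMap = \<lambda>a. a, AMap = \<lambda>f. f\<rparr> a) = AMap (chain_push n G) (AMap (chain_push n F) a)"
      using a p by (auto simp: chain_push_simps fun_eq_iff)
  qed
  also have "ftor_comp (ordcat k) \<lparr>OMap = \<lambda>a. a, AMap = \<lambda>f. f\<rparr> \<sigma> = \<sigma>"
    by (rule nerve_ftor_comp_idI[OF s'[unfolded spx_nerve]]) simp_all
  finally show ?thesis
    unfolding Ncl_map_def nerve_map_comp[OF preftor_chain_push[OF C F'] s'] unfolding nerve_map_apply(1)[OF s'] .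
qed

theorem equivalences_of_natural_transformations:
  assumes F: "relative_functor C W D V F" and G: "relative_functor D V C W G"
    and \<eta>: "nat_trans C C (fid C) (ftor_comp C G F) \<eta>" "\<And>a. a \<in> Ob C \<Longrightarrow> \<eta> a \<in> W"
    and \<epsilon>: "nat_trans D D (ftor_comp D F G) (fid D) \<epsilon>" "\<And>b. b \<in> Ob D \<Longrightarrow> \<epsilon> b \<in> V"
  shows "equivalence_of_homotopy_theories TYPE('w) C W D V F" "equivalence_of_homotopy_theories TYPE('w) D V C W G"
proof -
  have C: "relative_category C W" and D: "relative_category D V" using F by (auto simp: relative_functor_def)
  have id: "relative_functor C W C W (fid C)" if C: "relative_category C W" for C :: "('x, 'y) cat" and W
    using C is_ftor_fid[of C] by (auto simp: relative_functor_def relative_category_def fid_def)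
  have comp: "relative_functor A X A X (ftor_comp A G F)" if "relative_functor A X B Y F" "relative_functor B Y A X G"
    for A :: "('x, 'y) cat" and X and B :: "('z, 't) cat" and Y F G
  proof -
    have "X \<subseteq> Ar A" using that by (auto simp: relative_functor_def relative_category_def)
    then show ?thesis using that is_ftor_comp[of A B F A G]
      by (auto simp: relative_functor_def relative_category_def ftor_comp_def subset_iff image_subset_iff)
  qed
  obtain B where "bihomotopy (Ncl C W) (Ncl C W) B (Ncl_map C W (fid C)) (Ncl_map C W (ftor_comp C G F))"
    using bihomotopy_of_natural_transformation[OF id[OF C] comp[OF F G] \<eta>] by blast
  then have B: "bihomotopy (Ncl C W) (Ncl C W) B (\<lambda>n j x. x) (\<lambda>n j x. Ncl_map D V G n j (Ncl_map C W F n j x))"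
    using Ncl_map_fid[OF C] Ncl_map_comp[OF F, of _ _ _ G] by (simp add: bihomotopy_def)
  obtain B' where "bihomotopy (Ncl D V) (Ncl D V) B' (Ncl_map D V (ftor_comp D F G)) (Ncl_map D V (fid D))"
    using bihomotopy_of_natural_transformation[OF comp[OF G F] id[OF D] \<epsilon>] by blast
  then have B': "bihomotopy (Ncl D V) (Ncl D V) B' (\<lambda>n j x. Ncl_map C W F n j (Ncl_map D V G n j x)) (\<lambda>n j x. x)"
    using Ncl_map_fid[OF D] Ncl_map_comp[OF G, of _ _ _ F] by (simp add: bihomotopy_def)
  show "equivalence_of_homotopy_theories TYPE('w) C W D V F" "equivalence_of_homotopy_theories TYPE('w) D V C W G"
    unfolding equivalence_of_homotopy_theories_def
    by (rule css_weak_equivalence_of_bihomotopy_inverse[OF is_bsset_Ncl[OF C] is_bsset_Ncl[OF D] Ncl_map_in[OF F] Ncl_map_in[OF G] B B'])+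
qed

section \<open>Stable equivalences\<close>

text \<open>The closure properties of a spectrum on which composition of maps of spectra rests.\<close>

definition wf_symsp :: "'a symsp \<Rightarrow> bool" where
  "wf_symsp A \<longleftrightarrow> (\<forall>n. bp A n \<in> spx (sp A n) 0) \<and>
     (\<forall>n m p. \<forall>\<theta>\<in>dhom m p. \<forall>x\<in>spx (sp A n) p. act (sp A n) m p \<theta> x \<in> spx (sp A n) m) \<and>
     (\<forall>n k \<pi>. \<forall>x\<in>spx (sp A n) k. \<pi> permutes {..<n} \<longrightarrow> sig A n \<pi> k x \<in> spx (sp A n) k) \<and>
     (\<forall>n k. \<forall>s\<le>k. \<forall>x\<in>spx (sp A n) k. str A n k s x \<in> spx (sp A (Suc n)) k)"

lemma wf_symspD:
  assumes "wf_symsp A"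
  shows "bp A n \<in> spx (sp A n) 0" "\<theta> \<in> dhom m p \<Longrightarrow> x \<in> spx (sp A n) p \<Longrightarrow> act (sp A n) m p \<theta> x \<in> spx (sp A n) m"
    "\<pi> permutes {..<n} \<Longrightarrow> x \<in> spx (sp A n) k \<Longrightarrow> sig A n \<pi> k x \<in> spx (sp A n) k"
    "s \<le> k \<Longrightarrow> x \<in> spx (sp A n) k \<Longrightarrow> str A n k s x \<in> spx (sp A (Suc n)) k"
  using assms unfolding wf_symsp_def by blast+

lemma const_dhom: "(\<lambda>_\<in>{..k}. 0) \<in> dhom k 0"
  by (rule dhomI) auto

lemma base_in: "wf_symsp A \<Longrightarrow> base A n k \<in> spx (sp A n) k"
  unfolding base_def by (intro wf_symspD const_dhom)

lemma spmapsD: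
  assumes "f \<in> spmaps A B"
  shows "f n \<in> smaps (sp A n) (sp B n)" "f n 0 (bp A n) = bp B n"
    "\<pi> permutes {..<n} \<Longrightarrow> x \<in> spx (sp A n) k \<Longrightarrow> f n k (sig A n \<pi> k x) = sig B n \<pi> k (f n k x)"
    "s \<le> k \<Longrightarrow> x \<in> spx (sp A n) k \<Longrightarrow> f (Suc n) k (str A n k s x) = str B n k s (f n k x)"
  using assms unfolding spmaps_def by blast+

lemma spmaps_in: "f \<in> spmaps A B \<Longrightarrow> x \<in> spx (sp A n) k \<Longrightarrow> f n k x \<in> spx (sp B n) k"
  by (rule smapsD(1)[OF spmapsD(1)])

lemma spmaps_base: "wf_symsp A \<Longrightarrow> f \<in> spmaps A B \<Longrightarrow> f n k (base A n k) = base B n k"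
  unfolding base_def by (simp only: smapsD(2)[OF spmapsD(1) const_dhom wf_symspD(1)] spmapsD(2))

lemma spcomp_apply: "x \<in> spx (sp A n) k \<Longrightarrow> spcomp A g f n k x = g n k (f n k x)"
  "x \<notin> spx (sp A n) k \<Longrightarrow> spcomp A g f n k x = undefined"
  by (simp_all add: spcomp_def smap_comp_apply)

lemma spcomp_in:
  assumes A: "wf_symsp A" and f: "f \<in> spmaps A B" and g: "g \<in> spmaps B E"
  shows "spcomp A g f \<in> spmaps A E"
proof -
  have "spcomp A g f n \<in> smaps (sp A n) (sp E n)" for n
  proof (rule smapsI)
    fix k x assume x: "x \<in> spx (sp A n) k"
    show "spcomp A g f n k x \<in> spx (sp E n) k"
      using spmaps_in[OF g spmaps_in[OF f x]] by (simp add: spcomp_apply(1)[OF x])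
    fix m \<theta> assume \<theta>: "\<theta> \<in> dhom m k"
    show "spcomp A g f n m (act (sp A n) m k \<theta> x) = act (sp E n) m k \<theta> (spcomp A g f n k x)"
      using smapsD(2)[OF spmapsD(1)[OF f] \<theta> x] smapsD(2)[OF spmapsD(1)[OF g] \<theta> spmaps_in[OF f x]]
      by (simp add: spcomp_apply(1)[OF x] spcomp_apply(1)[OF wf_symspD(2)[OF A \<theta> x]])
  qed (simp add: spcomp_apply)
  moreover have "spcomp A g f n 0 (bp A n) = bp E n" for n
    by (simp add: spcomp_apply(1)[OF wf_symspD(1)[OF A]] spmapsD(2)[OF f] spmapsD(2)[OF g])
  moreover have "spcomp A g f n k (sig A n \<pi> k x) = sig E n \<pi> k (spcomp A g f n k x)"
    if x: "x \<in> spx (sp A n) k" and p: "\<pi> permutes {..<n}" for n k \<pi> x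
    using spmapsD(3)[OF f p x] spmapsD(3)[OF g p spmaps_in[OF f x]]
    by (simp add: spcomp_apply(1)[OF x] spcomp_apply(1)[OF wf_symspD(3)[OF A p x]])
  moreover have "spcomp A g f (Suc n) k (str A n k s x) = str E n k s (spcomp A g f n k x)"
    if x: "x \<in> spx (sp A n) k" and s: "s \<le> k" for n k s x
    using spmapsD(4)[OF f s x] spmapsD(4)[OF g s spmaps_in[OF f x]]
    by (simp add: spcomp_apply(1)[OF x] spcomp_apply(1)[OF wf_symspD(4)[OF A s x]])
  ultimately show ?thesis unfolding spmaps_def by blast
qed

lemma spcomp_assoc: "f \<in> spmaps A B \<Longrightarrow> spcomp A (spcomp B h g) f = spcomp A h (spcomp A g f)"
  using spmaps_in[of f A B] by (auto simp: fun_eq_iff spcomp_def smap_comp_def compose_def)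

lemma spcomp_ident:
  assumes "v \<in> spmaps B E" "\<And>n k x. x \<in> spx (sp B n) k \<Longrightarrow> f n k x = x"
  shows "spcomp B v f = v"
  using assms smapsD(3)[OF spmapsD(1)[OF assms(1)]] by (auto simp: fun_eq_iff spcomp_def smap_comp_def compose_def)

lemma sphomotopy_precomp:
  assumes A: "wf_symsp A" and f: "f \<in> spmaps A B" and uv: "sphomotopy B E u v"
  shows "sphomotopy A E (spcomp A u f) (spcomp A v f)"
proof -
  have u: "u \<in> spmaps B E" and v: "v \<in> spmaps B E" using uv by (auto simp: sphomotopy_def)
  obtain H where H: "(\<forall>n. H n \<in> smaps (sprod (sp B n) (Delta 1)) (sp E n)) \<and>
     (\<forall>n k. \<forall>\<theta>\<in>dhom k 1. H n k (base B n k, \<theta>) = base E n k) \<and>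
     (\<forall>n k \<pi>. \<forall>x\<in>spx (sp B n) k. \<forall>\<theta>\<in>dhom k 1. \<pi> permutes {..<n} \<longrightarrow>
        H n k (sig B n \<pi> k x, \<theta>) = sig E n \<pi> k (H n k (x, \<theta>))) \<and>
     (\<forall>n k. \<forall>s\<le>k. \<forall>x\<in>spx (sp B n) k. \<forall>\<theta>\<in>dhom k 1.
        H (Suc n) k (str B n k s x, \<theta>) = str E n k s (H n k (x, \<theta>))) \<and>
     (\<forall>n k. \<forall>x\<in>spx (sp B n) k.
        H n k (x, \<lambda>_\<in>{..k}. 0) = u n k x \<and> H n k (x, \<lambda>_\<in>{..k}. 1) = v n k x)"
    using uv unfolding sphomotopy_def by (elim conjE exE) (rule that, (rule conjI, assumption)+, assumption)
  have H1: "H n \<in> smaps (sprod (sp B n) (Delta 1)) (sp E n)" for n using H by (elim conjE) (erule spec)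
  have H2: "H n k (base B n k, \<theta>) = base E n k" if "\<theta> \<in> dhom k 1" for n k \<theta>
    using H that by (elim conjE) blast
  have H3: "H n k (sig B n \<pi> k x, \<theta>) = sig E n \<pi> k (H n k (x, \<theta>))"
    if "x \<in> spx (sp B n) k" "\<theta> \<in> dhom k 1" "\<pi> permutes {..<n}" for n k \<pi> x \<theta>
    using H that by (elim conjE) blast
  have H4: "H (Suc n) k (str B n k s x, \<theta>) = str E n k s (H n k (x, \<theta>))"
    if "s \<le> k" "x \<in> spx (sp B n) k" "\<theta> \<in> dhom k 1" for n k s x \<theta>
    using H that by (elim conjE) blast
  have H5: "H n k (x, \<lambda>_\<in>{..k}. 0) = u n k x \<and> H n k (x, \<lambda>_\<in>{..k}. 1) = v n k x"
    if "x \<in> spx (sp B n) k" for n k x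
    using H that by (elim conjE) blast
  define H' where "H' n k = (\<lambda>(x, \<theta>)\<in>spx (sp A n) k \<times> dhom k 1. H n k (f n k x, \<theta>))" for n k
  have H': "H' n k (x, \<theta>) = H n k (f n k x, \<theta>)" if "x \<in> spx (sp A n) k" "\<theta> \<in> dhom k 1" for n k x \<theta>
    using that by (simp add: H'_def)
  have "H' n \<in> smaps (sprod (sp A n) (Delta 1)) (sp E n)" for n
  proof (rule smapsI)
    fix k p assume "p \<in> spx (sprod (sp A n) (Delta 1)) k"
    then obtain x \<theta> where p: "p = (x, \<theta>)" "x \<in> spx (sp A n) k" "\<theta> \<in> dhom k 1" by (auto simp: sprod_def Delta_def)
    have fx: "(f n k x, \<theta>) \<in> spx (sprod (sp B n) (Delta 1)) k"
      using p spmaps_in[OF f] by (simp add: sprod_def Delta_def)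
    show "H' n k p \<in> spx (sp E n) k" unfolding p(1) H'[OF p(2,3)] by (rule smapsD(1)[OF H1 fx])
    fix m \<phi> assume \<phi>: "\<phi> \<in> dhom m k"
    have "act (sprod (sp A n) (Delta 1)) m k \<phi> p = (act (sp A n) m k \<phi> x, compose {..m} \<theta> \<phi>)"
      by (simp add: p sprod_def Delta_def)
    moreover have "act (sprod (sp B n) (Delta 1)) m k \<phi> (f n k x, \<theta>) = (act (sp B n) m k \<phi> (f n k x), compose {..m} \<theta> \<phi>)"
      by (simp add: sprod_def Delta_def)
    ultimately show "H' n m (act (sprod (sp A n) (Delta 1)) m k \<phi> p) = act (sp E n) m k \<phi> (H' n k p)"
      using smapsD(2)[OF H1 \<phi> fx] H'[OF wf_symspD(2)[OF A \<phi> p(2)] dhom_compose[OF \<phi> p(3)]] H'[OF p(2,3)]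
        smapsD(2)[OF spmapsD(1)[OF f] \<phi> p(2)] p(1) by simp
  qed (auto simp: H'_def sprod_def Delta_def)
  moreover have "H' n k (base A n k, \<theta>) = base E n k" if "\<theta> \<in> dhom k 1" for n k \<theta>
    using H'[OF base_in[OF A] that] H2[OF that] spmaps_base[OF A f] by simp
  moreover have "H' n k (sig A n \<pi> k x, \<theta>) = sig E n \<pi> k (H' n k (x, \<theta>))"
    if "x \<in> spx (sp A n) k" "\<theta> \<in> dhom k 1" "\<pi> permutes {..<n}" for n k \<pi> x \<theta>
    using H'[OF wf_symspD(3)[OF A that(3,1)] that(2)] H'[OF that(1,2)] H3[OF spmaps_in[OF f that(1)] that(2,3)]
      spmapsD(3)[OF f that(3,1)] by simp
  moreover have "H' (Suc n) k (str A n k s x, \<theta>) = str E n k s (H' n k (x, \<theta>))"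
    if "s \<le> k" "x \<in> spx (sp A n) k" "\<theta> \<in> dhom k 1" for n k s x \<theta>
    using H'[OF wf_symspD(4)[OF A that(1,2)] that(3)] H'[OF that(2,3)] H4[OF that(1) spmaps_in[OF f that(2)] that(3)]
      spmapsD(4)[OF f that(1,2)] by simp
  moreover have "H' n k (x, \<lambda>_\<in>{..k}. 0) = spcomp A u f n k x \<and> H' n k (x, \<lambda>_\<in>{..k}. 1) = spcomp A v f n k x"
    if x: "x \<in> spx (sp A n) k" for n k x
  proof -
    have c: "(\<lambda>_\<in>{..k}. 0) \<in> dhom k 1" "(\<lambda>_\<in>{..k}. 1) \<in> dhom k 1" by (rule dhomI; simp)+
    show ?thesis unfolding H'[OF x c(1)] H'[OF x c(2)] spcomp_apply(1)[OF x] by (rule H5[OF spmaps_in[OF f x]])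
  qed
  ultimately show ?thesis
    unfolding sphomotopy_def using spcomp_in[OF A f u] spcomp_in[OF A f v] by blast
qed

lemma equivclp_map:
  assumes "\<And>x y. r x y \<Longrightarrow> s (g x) (g y)" "equivclp r x y"
  shows "equivclp s (g x) (g y)"
  using assms(2)
proof (induction rule: equivclp_induct)
  case (step y z)
  then have "equivclp s (g y) (g z)" using assms(1) r_into_equivclp equivclp_sym by metis
  with step show ?case using equivclp_trans by metis
qed simp

lemma sphomotopic_precomp:
  assumes "wf_symsp A" "f \<in> spmaps A B" "sphomotopic B E u v"
  shows "sphomotopic A E (spcomp A u f) (spcomp A v f)"
  using assms(3) unfolding sphomotopic_def by (rule equivclp_map[rotated]) (rule sphomotopy_precomp[OF assms(1,2)])

lemma sphomotopic_refl: "sphomotopic A E u u" and sphomotopic_trans: "sphomotopic A E u v \<Longrightarrow> sphomotopic A E v w \<Longrightarrow> sphomotopic A E u w"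
  unfolding sphomotopic_def by (simp, rule equivclp_trans)

text \<open>Precomposition respects homotopy, so that the bijections \<open>[C, E] \<rightarrow> [B, E]\<close> and \<open>[B, E] \<rightarrow> [A, E]\<close> compose.\<close>

lemma stable_equivalence_comp:
  assumes A: "wf_symsp A" and B: "wf_symsp B" and f: "stable_equivalence A B f" and g: "stable_equivalence B C g"
  shows "stable_equivalence A C (spcomp A g f)"
  unfolding stable_equivalence_def
proof (intro conjI allI impI ballI)
  have f': "f \<in> spmaps A B" and g': "g \<in> spmaps B C" using f g by (auto simp: stable_equivalence_def)
  show "spcomp A g f \<in> spmaps A C" by (rule spcomp_in[OF A f' g'])
  fix E :: "'a set symsp" assume E: "injective_symsp E" "omega_spectrum E"
  {
    fix u assume u: "u \<in> spmaps A E"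
    obtain v where v: "v \<in> spmaps B E" "sphomotopic A E (spcomp A v f) u" using f E u unfolding stable_equivalence_def by blast
    obtain w where w: "w \<in> spmaps C E" "sphomotopic B E (spcomp B w g) v" using g E v(1) unfolding stable_equivalence_def by blast
    have "sphomotopic A E (spcomp A w (spcomp A g f)) u"
      using sphomotopic_trans[OF sphomotopic_precomp[OF A f' w(2)] v(2)] by (simp add: spcomp_assoc[OF f'])
    then show "\<exists>w\<in>spmaps C E. sphomotopic A E (spcomp A w (spcomp A g f)) u" using w(1) by blast
  }
  fix w w' assume w: "w \<in> spmaps C E" "w' \<in> spmaps C E" and
    h: "sphomotopic A E (spcomp A w (spcomp A g f)) (spcomp A w' (spcomp A g f))"
  have "sphomotopic A E (spcomp A (spcomp B w g) f) (spcomp A (spcomp B w' g) f)" using h by (simp add: spcomp_assoc[OF f'])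
  then have "sphomotopic B E (spcomp B w g) (spcomp B w' g)"
    using f E spcomp_in[OF B g' w(1)] spcomp_in[OF B g' w(2)] unfolding stable_equivalence_def by blast
  then show "sphomotopic C E w w'" using g E w unfolding stable_equivalence_def by blast
qed

lemma stable_equivalence_iso:
  assumes A: "wf_symsp A" and B: "wf_symsp B" and f: "f \<in> spmaps A B" and g: "g \<in> spmaps B A"
    and gf: "\<And>n k x. x \<in> spx (sp A n) k \<Longrightarrow> g n k (f n k x) = x" and fg: "\<And>n k x. x \<in> spx (sp B n) k \<Longrightarrow> f n k (g n k x) = x"
  shows "stable_equivalence A B f"
  unfolding stable_equivalence_def
proof (intro conjI allI impI ballI)
  fix E :: "'a set symsp"
  have 1: "spcomp A (spcomp B u g) f = u" if "u \<in> spmaps A E" for u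
    unfolding spcomp_assoc[OF f] by (rule spcomp_ident[OF that]) (simp add: spcomp_apply gf)
  have 2: "spcomp B (spcomp A v f) g = v" if "v \<in> spmaps B E" for v
    unfolding spcomp_assoc[OF g] by (rule spcomp_ident[OF that]) (simp add: spcomp_apply fg)
  show "\<exists>v\<in>spmaps B E. sphomotopic A E (spcomp A v f) u" if u: "u \<in> spmaps A E" for u
    using spcomp_in[OF B g u] 1[OF u] sphomotopic_refl by metis
  fix v v' assume v: "v \<in> spmaps B E" "v' \<in> spmaps B E" and "sphomotopic A E (spcomp A v f) (spcomp A v' f)"
  then have "sphomotopic B E (spcomp B (spcomp A v f) g) (spcomp B (spcomp A v' f) g)"
    by (intro sphomotopic_precomp[OF B g])
  then show "sphomotopic B E v v'" using 2 v by simp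
qed (rule f)

subsection \<open>The spectrum of a diagram of simplicial sets\<close>

text \<open>The properties of a diagram that make its spectrum well formed.  They are shared by diagrams of small
  simplicial sets and by the nerves of diagrams of small categories, whose simplices are functors.
  The unique vertex in degree \<open>0\<close> provides the base vertices.\<close>

definition gamma_sset :: "('a sset, 'a sset_map) gamma_ob \<Rightarrow> bool" where
  "gamma_sset X \<longleftrightarrow> (\<forall>n. is_sset (OMap X n)) \<and>
     (\<forall>m n. \<forall>\<phi>\<in>pmaps m n. mor (AMap X (Arr m n \<phi>)) \<in> smaps (OMap X m) (OMap X n)) \<and> (\<exists>!x. x \<in> spx (OMap X 0) 0)"

definition gamma_map :: "('a sset, 'a sset_map) gamma_ob \<Rightarrow> ('a sset, 'a sset_map) gamma_ob \<Rightarrow> (nat \<Rightarrow> nat \<Rightarrow> 'a \<Rightarrow> 'a) \<Rightarrow> bool" where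
  "gamma_map X Y f \<longleftrightarrow> (\<forall>n. f n \<in> smaps (OMap X n) (OMap Y n)) \<and>
     (\<forall>m n k. \<forall>\<phi>\<in>pmaps m n. \<forall>x\<in>spx (OMap X m) k.
        f n k (mor (AMap X (Arr m n \<phi>)) k x) = mor (AMap Y (Arr m n \<phi>)) k (f m k x))"

lemma circ_act_pmaps: "\<theta> \<in> dhom q p \<Longrightarrow> circ_act q p \<theta> \<in> pmaps p q"
proof (rule pmapsI)
  assume \<theta>: "\<theta> \<in> dhom q p"
  fix x assume x: "x \<le> p"
  show "circ_act q p \<theta> x \<le> q"
  proof (cases "x \<le> \<theta> 0 \<or> \<theta> q < x")
    case False
    then have "(LEAST j. x \<le> \<theta> j) \<le> q" by (intro Least_le) simp
    then show ?thesis using x False by (simp add: circ_act_def)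
  qed (use x in \<open>simp add: circ_act_def\<close>)
qed (auto simp: circ_act_def)

text \<open>If all \<open>v i\<close> are positive, then the numbers \<open>v i - 1\<close> are the digits in base \<open>q\<close> of a number less
  than \<open>q ^ m\<close>.\<close>

lemma smash_enc_le:
  assumes "\<And>i. i < m \<Longrightarrow> v i \<le> q"
  shows "smash_enc m q v \<le> q ^ m"
proof (cases "\<exists>i<m. v i = 0")
  case False
  have "(\<Sum>i<m. (v i - 1) * q ^ (m - 1 - i)) + 1 \<le> q ^ m"
    using assms False
  proof (induction m arbitrary: v)
    case (Suc m)
    have IH: "(\<Sum>i<m. (v (Suc i) - 1) * q ^ (m - 1 - i)) + 1 \<le> q ^ m"
      by (rule Suc.IH) (use Suc.prems in auto)
    have v0: "v 0 \<noteq> 0" "v 0 \<le> q" using Suc.prems by auto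
    have "(\<Sum>i<Suc m. (v i - 1) * q ^ (Suc m - 1 - i)) = (v 0 - 1) * q ^ m + (\<Sum>i<m. (v (Suc i) - 1) * q ^ (m - 1 - i))"
      by (subst sum.lessThan_Suc_shift) simp
    then have "(\<Sum>i<Suc m. (v i - 1) * q ^ (Suc m - 1 - i)) + 1 \<le> (v 0 - 1) * q ^ m + q ^ m" using IH by simp
    also have "\<dots> = v 0 * q ^ m" using v0 by (cases "v 0") auto
    also have "\<dots> \<le> q ^ Suc m" using v0 by simp
    finally show ?case .
  qed simp
  then show ?thesis using False by (simp add: smash_enc_def)
qed (simp add: smash_enc_def)

lemma smash_dec_le:
  assumes "x \<noteq> 0" "x \<le> p ^ m" "i < m"
  shows "smash_dec m p x i \<le> p"
proof -
  have "p \<noteq> 0"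
  proof
    assume "p = 0"
    then show False using assms by (cases m) auto
  qed
  then have "(x - 1) div p ^ (m - 1 - i) mod p < p" by simp
  then show ?thesis by (simp add: smash_dec_def)
qed

lemma smash_pow_pmaps: "\<phi> \<in> pmaps p q \<Longrightarrow> smash_pow m p q \<phi> \<in> pmaps (p ^ m) (q ^ m)"
proof (rule pmapsI)
  fix x assume "\<phi> \<in> pmaps p q" "x \<le> p ^ m"
  then show "smash_pow m p q \<phi> x \<le> q ^ m"
    using smash_enc_le[of m "\<lambda>i. \<phi> (smash_dec m p x i)" q] pmapsD(1)[of \<phi> p q] smash_dec_le[of x p m]
    by (auto simp: smash_pow_def)
qed (simp_all add: smash_pow_def)

lemma smash_perm_pmaps:
  assumes "\<pi> permutes {..<m}"
  shows "smash_perm m p \<pi> \<in> pmaps (p ^ m) (p ^ m)"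
proof (rule pmapsI)
  fix x assume "x \<le> p ^ m"
  moreover have "inv_into UNIV \<pi> i < m" if "i < m" for i
    using permutes_in_image[OF permutes_inv[OF assms], of i] that by simp
  ultimately show "smash_perm m p \<pi> x \<le> p ^ m" by (auto simp: smash_perm_def intro!: smash_enc_le smash_dec_le)
qed (auto simp: smash_perm_def)

lemma smash_cons_pmaps:
  assumes "s \<le> p"
  shows "smash_cons m p s \<in> pmaps (p ^ m) (p ^ Suc m)"
proof (rule pmapsI)
  fix x assume x: "x \<le> p ^ m"
  show "smash_cons m p s x \<le> p ^ Suc m"
  proof (cases "s = 0 \<or> x = 0")
    case False
    then have "(s - 1) * p ^ m + x \<le> (s - 1) * p ^ m + p ^ m" using x by simp
    also have "\<dots> = s * p ^ m" using False by (cases s) auto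
    also have "\<dots> \<le> p ^ Suc m" using assms by simp
    finally show ?thesis using x False by (simp add: smash_cons_def)
  qed (use x in \<open>simp add: smash_cons_def\<close>)
qed (auto simp: smash_cons_def)

lemma KF_simps:
  "spx (sp (KF X) m) p = spx (OMap X (p ^ m)) p"
  "act (sp (KF X) m) q p \<theta> x = act (OMap X (q ^ m)) q p \<theta>
     (mor (AMap X (Arr (p ^ m) (q ^ m) (smash_pow m p q (circ_act q p \<theta>)))) p x)"
  "bp (KF X) m = mor (AMap X (Arr 0 (0 ^ m) (pzero 0))) 0 (THE x. x \<in> spx (OMap X 0) 0)"
  "x \<in> spx (OMap X (p ^ m)) p \<Longrightarrow> sig (KF X) m \<pi> p x = mor (AMap X (Arr (p ^ m) (p ^ m) (smash_perm m p \<pi>))) p x"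
  "str (KF X) m p s x = mor (AMap X (Arr (p ^ m) (p ^ Suc m) (smash_cons m p s))) p x"
  by (simp_all add: KF_def Let_def)

lemma gamma_ssetD:
  assumes "gamma_sset X"
  shows "is_sset (OMap X n)" "\<phi> \<in> pmaps m n \<Longrightarrow> mor (AMap X (Arr m n \<phi>)) \<in> smaps (OMap X m) (OMap X n)"
    "(THE x. x \<in> spx (OMap X 0) 0) \<in> spx (OMap X 0) 0" "x \<in> spx (OMap X 0) 0 \<Longrightarrow> (THE x. x \<in> spx (OMap X 0) 0) = x"
proof -
  have e: "\<exists>!x. x \<in> spx (OMap X 0) 0" using assms by (simp add: gamma_sset_def)
  show "(THE x. x \<in> spx (OMap X 0) 0) \<in> spx (OMap X 0) 0" by (rule theI'[OF e])
  show "x \<in> spx (OMap X 0) 0 \<Longrightarrow> (THE x. x \<in> spx (OMap X 0) 0) = x" by (rule the1_equality[OF e])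
qed (use assms in \<open>auto simp: gamma_sset_def\<close>)

lemma wf_KF:
  assumes X: "gamma_sset X"
  shows "wf_symsp (KF X)"
  unfolding wf_symsp_def
proof (intro conjI allI ballI impI)
  note g = gamma_ssetD[OF X]
  show "bp (KF X) n \<in> spx (sp (KF X) n) 0" for n
    unfolding KF_simps by (rule smapsD(1)[OF g(2)[OF pzero_in] g(3)])
  show "act (sp (KF X) n) m p \<theta> x \<in> spx (sp (KF X) n) m" if "\<theta> \<in> dhom m p" "x \<in> spx (sp (KF X) n) p" for n m p \<theta> x
    using that unfolding KF_simps
    by (intro is_ssetD(1)[OF g(1)] smapsD(1)[OF g(2)[OF smash_pow_pmaps[OF circ_act_pmaps]]])
  show "sig (KF X) n \<pi> k x \<in> spx (sp (KF X) n) k" if "x \<in> spx (sp (KF X) n) k" "\<pi> permutes {..<n}" for n k \<pi> x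
    using that smapsD(1)[OF g(2)[OF smash_perm_pmaps[OF that(2)]]] by (simp add: KF_simps)
  show "str (KF X) n k s x \<in> spx (sp (KF X) (Suc n)) k" if "s \<le> k" "x \<in> spx (sp (KF X) n) k" for n k s x
    using that unfolding KF_simps by (intro smapsD(1)[OF g(2)[OF smash_cons_pmaps]])
qed

lemma KF_map_in:
  assumes X: "gamma_sset X" and Y: "gamma_sset Y" and f: "gamma_map X Y f"
  shows "(\<lambda>m p. f (p ^ m) p) \<in> spmaps (KF X) (KF Y)"
proof -
  note gX = gamma_ssetD[OF X] and gY = gamma_ssetD[OF Y]
  have fs: "f n \<in> smaps (OMap X n) (OMap Y n)" for n using f by (simp add: gamma_map_def)
  have fn: "f n k (mor (AMap X (Arr m n \<phi>)) k x) = mor (AMap Y (Arr m n \<phi>)) k (f m k x)"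
    if "\<phi> \<in> pmaps m n" "x \<in> spx (OMap X m) k" for m n k \<phi> x using f that by (simp add: gamma_map_def)
  have "(\<lambda>p. f (p ^ m) p) \<in> smaps (sp (KF X) m) (sp (KF Y) m)" for m
  proof (rule smapsI)
    fix p x assume "x \<in> spx (sp (KF X) m) p"
    then have x: "x \<in> spx (OMap X (p ^ m)) p" by (simp add: KF_simps)
    show "f (p ^ m) p x \<in> spx (sp (KF Y) m) p" unfolding KF_simps by (rule smapsD(1)[OF fs x])
    fix q \<theta> assume \<theta>: "\<theta> \<in> dhom q p"
    note \<phi> = smash_pow_pmaps[OF circ_act_pmaps[OF \<theta>], of m]
    show "f (q ^ m) q (act (sp (KF X) m) q p \<theta> x) = act (sp (KF Y) m) q p \<theta> (f (p ^ m) p x)"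
      unfolding KF_simps smapsD(2)[OF fs \<theta> smapsD(1)[OF gX(2)[OF \<phi>] x]] fn[OF \<phi> x] ..
  next
    fix p x assume "x \<notin> spx (sp (KF X) m) p"
    then show "f (p ^ m) p x = undefined" using smapsD(3)[OF fs] by (simp add: KF_simps)
  qed
  moreover have "f (0 ^ m) 0 (bp (KF X) m) = bp (KF Y) m" for m
    unfolding KF_simps fn[OF pzero_in gX(3)] gY(4)[OF smapsD(1)[OF fs gX(3)]] ..
  moreover have "f (k ^ n) k (sig (KF X) n \<pi> k x) = sig (KF Y) n \<pi> k (f (k ^ n) k x)"
    if "x \<in> spx (sp (KF X) n) k" "\<pi> permutes {..<n}" for n k \<pi> x
  proof -
    have x: "x \<in> spx (OMap X (k ^ n)) k" using that by (simp add: KF_simps)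
    show ?thesis unfolding KF_simps(4)[OF x] KF_simps(4)[OF smapsD(1)[OF fs x]] by (rule fn[OF smash_perm_pmaps[OF that(2)] x])
  qed
  moreover have "f (k ^ Suc n) k (str (KF X) n k s x) = str (KF Y) n k s (f (k ^ n) k x)"
    if "x \<in> spx (sp (KF X) n) k" "s \<le> k" for n k s x
    using that unfolding KF_simps by (intro fn[OF smash_cons_pmaps])
  ultimately show ?thesis unfolding spmaps_def by blast
qed

subsection \<open>Classes of morphisms created by a functor to spectra\<close>

locale spectrum_functor =
  fixes D :: "('o, 'm) cat" and Kob :: "'o \<Rightarrow> 'a symsp" and Kar :: "'m \<Rightarrow> nat \<Rightarrow> nat \<Rightarrow> 'a \<Rightarrow> 'a"
  assumes D: "category D" and wf: "\<And>X. X \<in> Ob D \<Longrightarrow> wf_symsp (Kob X)"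
    and Kar_in: "\<And>f X Y. f \<in> Hom D X Y \<Longrightarrow> Kar f \<in> spmaps (Kob X) (Kob Y)"
    and Kar_comp: "\<And>f g X Y Z. f \<in> Hom D X Y \<Longrightarrow> g \<in> Hom D Y Z \<Longrightarrow> Kar (Comp D g f) = spcomp (Kob X) (Kar g) (Kar f)"
    and Kar_id: "\<And>X n k x. X \<in> Ob D \<Longrightarrow> x \<in> spx (sp (Kob X) n) k \<Longrightarrow> Kar (Id D X) n k x = x"
begin

definition stable :: "'m set" where
  "stable = {f \<in> Ar D. stable_equivalence (Kob (Dom D f)) (Kob (Cod D f)) (Kar f)}"

lemma stable_iff: "f \<in> Hom D X Y \<Longrightarrow> f \<in> stable \<longleftrightarrow> stable_equivalence (Kob X) (Kob Y) (Kar f)"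
  by (auto simp: stable_def Hom_def)

lemma stable_iso:
  assumes f: "f \<in> Hom D X Y" and g: "g \<in> Hom D Y X" and "Comp D g f = Id D X" "Comp D f g = Id D Y"
  shows "f \<in> stable"
  unfolding stable_iff[OF f]
proof (rule stable_equivalence_iso[OF wf wf Kar_in[OF f] Kar_in[OF g]])
  note XY = cat_Ob[OF D f]
  show "X \<in> Ob D" "Y \<in> Ob D" using XY .
  show "Kar g n k (Kar f n k x) = x" if "x \<in> spx (sp (Kob X) n) k" for n k x
    using Kar_id[OF XY(1) that] Kar_comp[OF f g] spcomp_apply(1)[OF that] assms(3) by metis
  show "Kar f n k (Kar g n k x) = x" if "x \<in> spx (sp (Kob Y) n) k" for n k x
    using Kar_id[OF XY(2) that] Kar_comp[OF g f] spcomp_apply(1)[OF that] assms(4) by metis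
qed

lemma stable_comp:
  assumes f: "f \<in> Hom D X Y" and g: "g \<in> Hom D Y Z" and "f \<in> stable" "g \<in> stable"
  shows "Comp D g f \<in> stable"
  unfolding stable_iff[OF cat_comp[OF D f g]] Kar_comp[OF f g]
  by (rule stable_equivalence_comp[OF wf wf]) (use assms cat_Ob[OF D f] stable_iff in auto)

lemma relative_category_stable: "relative_category D stable"
  unfolding relative_category_def
proof (intro conjI ballI impI)
  show "category D" by (rule D)
  show "stable \<subseteq> Ar D" by (auto simp: stable_def)
  show "Id D a \<in> stable" if "a \<in> Ob D" for a
    using cat_id[OF D that] cat_idl[OF D cat_id[OF D that]] by (intro stable_iso) auto
  show "Comp D g f \<in> stable" if "f \<in> stable" "g \<in> stable" "Dom D g = Cod D f" for f g
    using that by (intro stable_comp[of f "Dom D f" "Cod D f" g "Cod D g"]) (auto simp: stable_def Hom_def)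
qed

end

section \<open>The adjunction as an equivalence of homotopy theories\<close>

lemma relative_category_created:
  assumes C: "category C" and D: "relative_category D V" and F: "is_ftor C D F"
  shows "relative_category C (created C F V)"
  unfolding relative_category_def
proof (intro conjI ballI impI)
  have V: "\<And>a. a \<in> Ob D \<Longrightarrow> Id D a \<in> V" "\<And>f g. f \<in> V \<Longrightarrow> g \<in> V \<Longrightarrow> Dom D g = Cod D f \<Longrightarrow> Comp D g f \<in> V"
    using D unfolding relative_category_def by blast+
  show "category C" by (rule C)
  show "created C F V \<subseteq> Ar C" by (auto simp: created_def)
  show "Id C a \<in> created C F V" if "a \<in> Ob C" for a
    using HomD(1)[OF cat_id[OF C that]] V(1)[OF ftorD(1)[OF F that]] by (simp add: created_def ftorD(3)[OF F that])
  fix f g assume "f \<in> created C F V" "g \<in> created C F V" and gf: "Dom C g = Cod C f"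
  then have f: "f \<in> Ar C" "AMap F f \<in> V" and g: "g \<in> Ar C" "AMap F g \<in> V" by (auto simp: created_def)
  have g': "g \<in> Hom C (Cod C f) (Cod C g)" using cat_Ar[OF C g(1)] gf by simp
  show "Comp C g f \<in> created C F V"
    using HomD(1)[OF cat_comp[OF C cat_Ar[OF C f(1)] g']] V(2)[OF f(2) g(2)] gf
    by (simp add: created_def ftorD(4)[OF F cat_Ar[OF C f(1)] g'] ftorD(8)[OF F g(1)] ftorD(9)[OF F f(1)])
qed

context pointed_category
begin

text \<open>The stable morphisms include the unit, which is invertible.  By the triangle identity
  they include the restriction of the counit, and by naturality of the unit the restriction of \<open>L x\<close> is conjugate to \<open>x\<close>.\<close>

theorem adjoint_equivalence_of_spectrum_functor:
  assumes colims: "has_countable_colimits TYPE((nat \<times> gar) option) C"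
    and K: "spectrum_functor Gam Kob Kar" and S: "S = spectrum_functor.stable Gam Kob Kar"
  shows "adjoint_equivalence_of_homotopy_theories TYPE('w) Gam S Gst (created Gst (i_pull C T) S) (LL C T) (i_pull C T)"
proof -
  interpret K: spectrum_functor Gam Kob Kar by (rule K)
  let ?L = "LL C T" and ?R = "i_pull C T"
  let ?V = "created Gst ?R S"
  note cat = category_Gam category_Gst
  obtain q \<iota> where lan: "lan ?L q \<iota>" using lan_of_is_L[OF is_L_LL[OF colims]] by blast
  obtain \<eta> \<epsilon> where L: "is_ftor Gam Gst ?L" and R: "is_ftor Gst Gam ?R"
    and \<eta>: "nat_trans Gam Gam (fid Gam) (ftor_comp Gam ?R ?L) \<eta>" and \<epsilon>: "nat_trans Gst Gst (ftor_comp Gst ?L ?R) (fid Gst) \<epsilon>"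
    and tL: "\<And>X. X \<in> Ob Gam \<Longrightarrow> Comp Gst (\<epsilon> (OMap ?L X)) (AMap ?L (\<eta> X)) = Id Gst (OMap ?L X)"
    and tR: "\<And>Y. Y \<in> Ob Gst \<Longrightarrow> Comp Gam (AMap ?R (\<epsilon> Y)) (\<eta> (OMap ?R Y)) = Id Gam (OMap ?R Y)"
    and iso: "\<And>X. X \<in> Ob Gam \<Longrightarrow> \<exists>r\<in>Hom Gam (OMap ?R (OMap ?L X)) X. Comp Gam r (\<eta> X) = Id Gam X \<and>
       Comp Gam (\<eta> X) r = Id Gam (OMap ?R (OMap ?L X))"
    using lan_adjunction[OF lan] by blast
  have \<eta>_in: "\<eta> X \<in> Hom Gam X (OMap ?R (OMap ?L X))" if X: "X \<in> Ob Gam" for X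
    using nat_transD(1)[OF \<eta> X] X by (simp add: fid_simps ftor_comp_simps)
  have \<epsilon>_in: "\<epsilon> Y \<in> Hom Gst (OMap ?L (OMap ?R Y)) Y" if Y: "Y \<in> Ob Gst" for Y
    using nat_transD(1)[OF \<epsilon> Y] Y by (simp add: fid_simps ftor_comp_simps)
  have relS: "relative_category Gam S" unfolding S by (rule K.relative_category_stable)
  have relV: "relative_category Gst ?V" by (rule relative_category_created[OF cat(2) relS R])
  have \<eta>_S: "\<eta> X \<in> S" if X: "X \<in> Ob Gam" for X
  proof -
    obtain r where r: "r \<in> Hom Gam (OMap ?R (OMap ?L X)) X" "Comp Gam r (\<eta> X) = Id Gam X"
      "Comp Gam (\<eta> X) r = Id Gam (OMap ?R (OMap ?L X))" using iso[OF X] by blast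
    show ?thesis unfolding S by (rule K.stable_iso[OF \<eta>_in[OF X] r])
  qed
  have \<epsilon>_V: "\<epsilon> Y \<in> ?V" if Y: "Y \<in> Ob Gst" for Y
  proof -
    have RY: "OMap ?R Y \<in> Ob Gam" by (rule ftorD(1)[OF R Y])
    let ?e = "\<eta> (OMap ?R Y)"
    obtain r where r: "r \<in> Hom Gam (OMap ?R (OMap ?L (OMap ?R Y))) (OMap ?R Y)"
      "Comp Gam ?e r = Id Gam (OMap ?R (OMap ?L (OMap ?R Y)))" using iso[OF RY] by blast
    note e = \<eta>_in[OF RY] and R\<epsilon> = ftorD(2)[OF R \<epsilon>_in[OF Y]]
    have "AMap ?R (\<epsilon> Y) = Comp Gam (AMap ?R (\<epsilon> Y)) (Comp Gam ?e r)"
      using cat_idr[OF cat(1) R\<epsilon>] r(2) by simp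
    also have "\<dots> = r"
      unfolding cat_assoc[OF cat(1) r(1) e R\<epsilon>] tR[OF Y] by (rule cat_idl[OF cat(1) r(1)])
    finally have "Comp Gam ?e (AMap ?R (\<epsilon> Y)) = Id Gam (OMap ?R (OMap ?L (OMap ?R Y)))" using r(2) by simp
    then have "AMap ?R (\<epsilon> Y) \<in> S" unfolding S by (rule K.stable_iso[OF R\<epsilon> e _ tR[OF Y]])
    then show ?thesis using HomD(1)[OF \<epsilon>_in[OF Y]] by (simp add: created_def)
  qed
  have L_V: "AMap ?L x \<in> ?V" if xS: "x \<in> S" for x
  proof -
    have "x \<in> Ar Gam" using xS relS by (auto simp: relative_category_def)
    then obtain X Y where x: "x \<in> Hom Gam X Y" using cat_Ar[OF cat(1)] by blast
    note XY = cat_Ob[OF cat(1) x]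
    obtain r where r: "r \<in> Hom Gam (OMap ?R (OMap ?L X)) X" "Comp Gam r (\<eta> X) = Id Gam X"
      "Comp Gam (\<eta> X) r = Id Gam (OMap ?R (OMap ?L X))" using iso[OF XY(1)] by blast
    note Lx = ftorD(2)[OF L x]
    note RLx = ftorD(2)[OF R Lx] and eX = \<eta>_in[OF XY(1)] and eY = \<eta>_in[OF XY(2)]
    have nat: "Comp Gam (AMap ?R (AMap ?L x)) (\<eta> X) = Comp Gam (\<eta> Y) x"
      using nat_transD(2)[OF \<eta> x] HomD(1)[OF x] by (simp add: fid_simps ftor_comp_simps)
    have "AMap ?R (AMap ?L x) = Comp Gam (AMap ?R (AMap ?L x)) (Comp Gam (\<eta> X) r)"
      using cat_idr[OF cat(1) RLx] r(3) by simp
    also have "\<dots> = Comp Gam (Comp Gam (\<eta> Y) x) r" unfolding cat_assoc[OF cat(1) r(1) eX RLx] nat ..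
    also have "\<dots> \<in> S"
    proof -
      have rS: "r \<in> S" unfolding S by (rule K.stable_iso[OF r(1) eX r(3,2)])
      have "Comp Gam (\<eta> Y) x \<in> S"
        using K.stable_comp[OF x eY] xS \<eta>_S[OF XY(2)] unfolding S by blast
      then show ?thesis using K.stable_comp[OF r(1) cat_comp[OF cat(1) x eY]] rS unfolding S by blast
    qed
    finally show ?thesis using HomD(1)[OF Lx] by (simp add: created_def)
  qed
  have relL: "relative_functor Gam S Gst ?V ?L"
    unfolding relative_functor_def using relS relV L L_V by blast
  have relR: "relative_functor Gst ?V Gam S ?R"
    unfolding relative_functor_def using relS relV R by (auto simp: created_def)
  have "adjunction Gam Gst ?L ?R" unfolding adjunction_def using L R \<eta> \<epsilon> tL tR by blast
  then show ?thesis
    unfolding adjoint_equivalence_of_homotopy_theories_def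
    using relL relR equivalences_of_natural_transformations[OF relL relR \<eta> \<eta>_S \<epsilon> \<epsilon>_V] by blast
qed

end

subsection \<open>Vertices of terminal objects\<close>

text \<open>The vertices of \<open>T\<close> are the maps from the one-point simplicial set to \<open>T\<close>.\<close>

lemma terminal_sset_vertex:
  assumes U: "universe \<U>" and T: "terminal_object (SSET \<U>) T"
  shows "\<exists>!x. x \<in> spx T 0"
proof -
  define Q :: "'a sset" where "Q = \<lparr>spx = \<lambda>_. {undefined}, act = \<lambda>_ _ _ _. undefined\<rparr>"
  have Q: "small_sset \<U> Q"
    using universe_countable[OF U, of "{undefined}"] by (auto simp: Q_def small_sset_def is_sset_def)
  have T': "small_sset \<U> T" "is_sset T" and ex1: "\<exists>!f. f \<in> Hom (SSET \<U>) Q T"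
    using T Q by (auto simp: terminal_object_def SSET_simps(1) small_sset_def)
  define point where "point x n = (\<lambda>_\<in>{undefined :: 'a}. act T n 0 (\<lambda>_\<in>{..n}. 0) x)" for x n
  have c: "compose {..m} (\<lambda>_\<in>{..n}. 0) \<theta> = (\<lambda>_\<in>{..m}. 0)" if "\<theta> \<in> dhom m n" for m n \<theta>
    using dhomD(1)[OF that] by (auto simp: compose_def)
  have point: "Arr Q T (point x) \<in> Hom (SSET \<U>) Q T" if x: "x \<in> spx T 0" for x
  proof -
    have "point x \<in> smaps Q T"
    proof (rule smapsI)
      fix m n \<theta> y assume \<theta>: "\<theta> \<in> dhom m n"
      show "point x m (act Q m n \<theta> y) = act T m n \<theta> (point x n y)" if "y \<in> spx Q n"
        using is_ssetD(3)[OF T'(2) \<theta> const_dhom x] that by (simp add: point_def Q_def c[OF \<theta>])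
    qed (use is_ssetD(1)[OF T'(2) const_dhom x] in \<open>auto simp: point_def Q_def\<close>)
    then show ?thesis using Q T'(1) by (simp add: SSET_simps(2))
  qed
  obtain f where "f \<in> Hom (SSET \<U>) Q T" using ex1 by blast
  then have ex: "\<exists>x. x \<in> spx T 0" using smapsD(1)[of _ Q T undefined 0] by (auto simp: SSET_simps(2) Q_def)
  have "x = y" if x: "x \<in> spx T 0" and y: "y \<in> spx T 0" for x y
  proof -
    have z: "(\<lambda>_\<in>{..0::nat}. 0) = (\<lambda>i\<in>{..0}. i)" by auto
    have "point z 0 undefined = z" if "z \<in> spx T 0" for z
      using is_ssetD(2)[OF T'(2) that] unfolding point_def z[symmetric] by simp
    moreover have "point x = point y" using ex1 point[OF x] point[OF y] by (metis arr.inject)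
    ultimately show ?thesis using x y by metis
  qed
  with ex show ?thesis by blast
qed

text \<open>The vertices of the nerve of \<open>T\<close> are the functors to \<open>T\<close> from a category with one morphism; such a
  category is small, whereas \<open>ordcat 0\<close> has another type.\<close>

lemma terminal_cat_vertex:
  assumes U: "universe \<U>" and T: "terminal_object (CAT \<U>) T"
  shows "\<exists>!x. x \<in> spx (nerve T) 0"
proof -
  define Q :: "'a small_cat" where
    "Q = \<lparr>Ob = {undefined}, Ar = {undefined}, Dom = \<lambda>_. undefined, Cod = \<lambda>_. undefined, Id = \<lambda>_. undefined,
       Comp = \<lambda>_ _. undefined\<rparr>"
  have cQ: "category Q" by (auto simp: Q_def category_def Hom_def)
  then have Q: "small_category \<U> Q"
    using universe_countable[OF U, of "{undefined}"] by (auto simp: small_category_def) (auto simp: Q_def)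
  have ex1: "\<exists>!f. f \<in> Hom (CAT \<U>) Q T" and T': "small_category \<U> T"
    using T Q by (auto simp: terminal_object_def CAT_simps(1))
  define K :: "('a, 'a, nat, nat \<times> nat) ftor" where "K = \<lparr>OMap = \<lambda>_\<in>{undefined}. 0, AMap = \<lambda>_\<in>{undefined}. (0, 0)\<rparr>"
  define K' :: "(nat, nat \<times> nat, 'a, 'a) ftor" where "K' = \<lparr>OMap = \<lambda>_. undefined, AMap = \<lambda>_. undefined\<rparr>"
  have K: "is_ftor Q (ordcat 0) K" by (rule is_ftorI) (auto simp: K_def Q_def ordcat_def Hom_def)
  have K': "is_ftor (ordcat 0) Q K'" by (rule is_ftorI) (auto simp: K'_def Q_def ordcat_def Hom_def)
  have in_CAT: "Arr Q T (ftor_comp Q x K) \<in> Hom (CAT \<U>) Q T" if "x \<in> spx (nerve T) 0" for x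
    using is_ftor_comp[OF cQ K that[unfolded spx_nerve]] Q T' by (simp add: CAT_simps(2))
  obtain F where "is_ftor Q T F" using ex1 by (auto simp: CAT_simps(2))
  then have "ftor_comp (ordcat 0) F K' \<in> spx (nerve T) 0"
    unfolding spx_nerve by (intro is_ftor_comp[OF category_ordcat K'])
  moreover have "x = y" if x: "x \<in> spx (nerve T) 0" and y: "y \<in> spx (nerve T) 0" for x y
  proof -
    have "ftor_comp Q x K = ftor_comp Q y K" using ex1 in_CAT[OF x] in_CAT[OF y] by (metis arr.inject)
    then have "OMap (ftor_comp Q x K) undefined = OMap (ftor_comp Q y K) undefined"
      "AMap (ftor_comp Q x K) undefined = AMap (ftor_comp Q y K) undefined" by simp_all
    then have "OMap x 0 = OMap y 0" "AMap x (0, 0) = AMap y (0, 0)" by (simp_all add: ftor_comp_def Q_def K_def)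
    then show ?thesis
      using x y unfolding spx_nerve by (intro ftor_eqI[of "ordcat 0" T x T y]) (auto simp: ordcat_def)
  qed
  ultimately show ?thesis by blast
qed

subsection \<open>The spectra of diagrams of small simplicial sets and of small categories\<close>

lemma spcomp_KF: "spcomp (KF X) g f m p = compose (spx (OMap X (p ^ m)) p) (g m p) (f m p)"
  by (simp add: spcomp_def smap_comp_def KF_simps)

theorem spectrum_functor_SSET:
  assumes U: "universe \<U>" and P: "terminal_object (SSET \<U>) P"
  shows "spectrum_functor (Gamma_diag (SSET \<U>) P) KF KF_map"
proof -
  interpret pointed_category "SSET \<U>" P by (rule pointed_category.intro[OF category_SSET P])
  have ob: "gamma_sset X" if X: "X \<in> Ob Gam" for X
  proof -
    have X': "pointed_diagram X" using X by (simp add: Gam_simps)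
    have "is_sset (OMap X n)" for n using X_Ob[OF X', of n] by (simp add: SSET_simps(1) small_sset_def)
    moreover have "mor (AMap X (Arr m n \<phi>)) \<in> smaps (OMap X m) (OMap X n)" if "\<phi> \<in> pmaps m n" for m n \<phi>
      using X_in[OF X', of "Arr m n \<phi>" m n] that by (auto simp: SSET_simps(2) FF_simps)
    moreover have "\<exists>!x. x \<in> spx (OMap X 0) 0" unfolding X_0[OF X'] by (rule terminal_sset_vertex[OF U P])
    ultimately show ?thesis unfolding gamma_sset_def by blast
  qed
  have ar: "mor x n = Arr (OMap X n) (OMap Y n) (mor (mor x n)) \<and> mor (mor x n) \<in> smaps (OMap X n) (OMap Y n)"
    if "x \<in> Hom Gam X Y" for x X Y n
    using Gam_HomD(6)[OF that, of n] by (auto simp: SSET_simps(2))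
  have map: "gamma_map X Y (\<lambda>n. mor (mor x n))" if x: "x \<in> Hom Gam X Y" for x X Y
  proof -
    note X = Gam_HomD(1,2)[OF x]
    have "mor (mor x n) k (mor (AMap X (Arr m n \<phi>)) k y) = mor (AMap Y (Arr m n \<phi>)) k (mor (mor x m) k y)"
      if p: "\<phi> \<in> pmaps m n" and y: "y \<in> spx (OMap X m) k" for m n k \<phi> y
    proof -
      have a: "Arr m n \<phi> \<in> Hom FF m n" using p by (simp add: FF_simps)
      obtain F F' where F: "AMap X (Arr m n \<phi>) = Arr (OMap X m) (OMap X n) F" "AMap Y (Arr m n \<phi>) = Arr (OMap Y m) (OMap Y n) F'"
        using X_in[OF X(1) a] X_in[OF X(2) a] by (auto simp: SSET_simps(2))
      have "smap_comp (OMap X m) F' (mor (mor x m)) = smap_comp (OMap X m) (mor (mor x n)) F"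
        using Gam_HomD(7)[OF x a] ar[OF x, of m] unfolding F SSET_simps(6) by (metis arr.sel(1) arr.sel(3))
      then show ?thesis using smap_comp_apply(1)[OF y] F by (metis arr.sel(3))
    qed
    then show ?thesis unfolding gamma_map_def using ar[OF x] by blast
  qed
  show ?thesis
  proof
    show "category Gam" by (rule category_Gam)
    show "wf_symsp (KF X)" if "X \<in> Ob Gam" for X by (rule wf_KF[OF ob[OF that]])
    show "KF_map x \<in> spmaps (KF X) (KF Y)" if x: "x \<in> Hom Gam X Y" for x X Y
      unfolding KF_map_def using KF_map_in[OF ob ob map[OF x]] cat_Ob[OF category_Gam x] by blast
    show "KF_map (Comp Gam y x) = spcomp (KF X) (KF_map y) (KF_map x)" if x: "x \<in> Hom Gam X Y" and y: "y \<in> Hom Gam Y Z" for x y X Y Z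
    proof (intro ext)
      fix m p s
      have "mor (Comp Gam y x) (p ^ m) = Comp (SSET \<U>) (mor y (p ^ m)) (mor x (p ^ m))" by (simp add: Gam_simps(6) FF_simps(1))
      moreover have "src (mor x (p ^ m)) = OMap X (p ^ m)" using ar[OF x, of "p ^ m"] by (metis arr.sel(1))
      ultimately show "KF_map (Comp Gam y x) m p s = spcomp (KF X) (KF_map y) (KF_map x) m p s"
        unfolding spcomp_KF KF_map_def by (simp add: SSET_simps(6) smap_comp_def)
    qed
    show "KF_map (Id Gam X) n k x = x" if "x \<in> spx (sp (KF X) n) k" for X n k x
      using that by (simp add: KF_map_def Gam_simps(5) FF_simps(1) SSET_simps(5) sid_def KF_simps)
  qed
qed

lemma preftor_of_ftor: "is_ftor A B F \<Longrightarrow> preftor A B F"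
  by (rule preftorI) (auto simp: ftorD)

theorem spectrum_functor_CAT:
  assumes U: "universe \<U>" and T: "terminal_object (CAT \<U>) T"
  shows "spectrum_functor (Gamma_diag (CAT \<U>) T) (\<lambda>X. KF (nerve_gamma X)) (\<lambda>x. KF_map (nerve_gamma_ar x))"
proof -
  interpret pointed_category "CAT \<U>" T by (rule pointed_category.intro[OF category_CAT T])
  have NX: "OMap (nerve_gamma X) n = nerve (OMap X n)" for X :: "('a small_cat, 'a small_ftor) gamma_ob" and n
    by (simp add: nerve_gamma_def FF_simps(1))
  have NA: "mor (AMap (nerve_gamma X) (Arr m n \<phi>)) = nerve_map (OMap X m) (mor (AMap X (Arr m n \<phi>)))"
    and XA: "is_ftor (OMap X m) (OMap X n) (mor (AMap X (Arr m n \<phi>)))"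
    and XE: "AMap X (Arr m n \<phi>) = Arr (OMap X m) (OMap X n) (mor (AMap X (Arr m n \<phi>)))"
    if "pointed_diagram X" "\<phi> \<in> pmaps m n" for X m n \<phi>
  proof -
    have a: "Arr m n \<phi> \<in> Hom FF m n" using that by (simp add: FF_simps)
    show "is_ftor (OMap X m) (OMap X n) (mor (AMap X (Arr m n \<phi>)))"
      and e: "AMap X (Arr m n \<phi>) = Arr (OMap X m) (OMap X n) (mor (AMap X (Arr m n \<phi>)))"
      using X_in[OF that(1) a] by (auto simp: CAT_simps(2))
    show "mor (AMap (nerve_gamma X) (Arr m n \<phi>)) = nerve_map (OMap X m) (mor (AMap X (Arr m n \<phi>)))"
      using HomD(1)[OF a] by (subst e) (simp add: nerve_gamma_def nerve_ar_def, metis arr.sel(1) e)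
  qed
  have ob: "gamma_sset (nerve_gamma X)" if X: "X \<in> Ob Gam" for X
  proof -
    have X': "pointed_diagram X" using X by (simp add: Gam_simps)
    have "\<exists>!x. x \<in> spx (OMap (nerve_gamma X) 0) 0" unfolding NX X_0[OF X'] by (rule terminal_cat_vertex[OF U T])
    moreover have "mor (AMap (nerve_gamma X) (Arr m n \<phi>)) \<in> smaps (OMap (nerve_gamma X) m) (OMap (nerve_gamma X) n)"
      if "\<phi> \<in> pmaps m n" for m n \<phi>
      unfolding NX NA[OF X' that] by (rule nerve_map_in[OF preftor_of_ftor[OF XA[OF X' that]]])
    ultimately show ?thesis unfolding gamma_sset_def NX using is_sset_nerve by blast
  qed
  have ar: "mor x n = Arr (OMap X n) (OMap Y n) (mor (mor x n)) \<and> is_ftor (OMap X n) (OMap Y n) (mor (mor x n))"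
    if "x \<in> Hom Gam X Y" for x X Y n
    using Gam_HomD(6)[OF that, of n] by (auto simp: CAT_simps(2))
  have cat: "category (OMap X n)" if "pointed_diagram X" for X n
    using X_Ob[OF that, of n] by (simp add: CAT_simps(1) small_category_def)
  have mm: "mor (mor (nerve_gamma_ar x) n) = nerve_map (OMap X n) (mor (mor x n))" if "x \<in> Hom Gam X Y" for x X Y n
    using ar[OF that, of n] by (simp add: nerve_gamma_ar_def nerve_ar_def FF_simps(1)) (metis arr.sel(1))
  have map: "gamma_map (nerve_gamma X) (nerve_gamma Y) (\<lambda>n. mor (mor (nerve_gamma_ar x) n))" if x: "x \<in> Hom Gam X Y" for x X Y
  proof -
    note X = Gam_HomD(1,2)[OF x]
    have in_s: "nerve_map (OMap X n) (mor (mor x n)) \<in> smaps (nerve (OMap X n)) (nerve (OMap Y n))" for n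
      using nerve_map_in[OF preftor_of_ftor] ar[OF x] by blast
    have "nerve_map (OMap X n) (mor (mor x n)) k (nerve_map (OMap X m) (mor (AMap X (Arr m n \<phi>))) k s)
        = nerve_map (OMap Y m) (mor (AMap Y (Arr m n \<phi>))) k (nerve_map (OMap X m) (mor (mor x m)) k s)"
      if p: "\<phi> \<in> pmaps m n" and s: "s \<in> spx (nerve (OMap X m)) k" for m n k \<phi> s
    proof -
      let ?F = "mor (AMap X (Arr m n \<phi>))" and ?F' = "mor (AMap Y (Arr m n \<phi>))"
      have a: "Arr m n \<phi> \<in> Hom FF m n" using p by (simp add: FF_simps)
      have eq: "ftor_comp (OMap X m) ?F' (mor (mor x m)) = ftor_comp (OMap X m) (mor (mor x n)) ?F"
        using Gam_HomD(7)[OF x a] ar[OF x, of m] XE[OF X(1) p] unfolding CAT_simps(6) by (metis arr.sel(1) arr.sel(3))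
      have s': "is_ftor (ordcat k) (OMap X m) s" using s by (simp add: spx_nerve)
      have "nerve_map (OMap X n) (mor (mor x n)) k (nerve_map (OMap X m) ?F k s) = ftor_comp (ordcat k) (mor (mor x n)) (ftor_comp (ordcat k) ?F s)"
        unfolding nerve_map_apply(1)[OF smapsD(1)[OF nerve_map_in[OF preftor_of_ftor[OF XA[OF X(1) p]]] s]]
        unfolding nerve_map_apply(1)[OF s] ..
      also have "\<dots> = ftor_comp (ordcat k) ?F' (ftor_comp (ordcat k) (mor (mor x m)) s)"
        unfolding ftor_comp_assoc[OF category_ordcat s', symmetric] eq ..
      also have "\<dots> = nerve_map (OMap Y m) ?F' k (nerve_map (OMap X m) (mor (mor x m)) k s)"
        unfolding nerve_map_apply(1)[OF smapsD(1)[OF in_s s]] unfolding nerve_map_apply(1)[OF s] ..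
      finally show ?thesis .
    qed
    then show ?thesis unfolding gamma_map_def mm[OF x] NX using in_s NA[OF X(1)] NA[OF X(2)] by simp
  qed
  show ?thesis
  proof
    show "category Gam" by (rule category_Gam)
    show "wf_symsp (KF (nerve_gamma X))" if "X \<in> Ob Gam" for X by (rule wf_KF[OF ob[OF that]])
    show "KF_map (nerve_gamma_ar x) \<in> spmaps (KF (nerve_gamma X)) (KF (nerve_gamma Y))" if x: "x \<in> Hom Gam X Y" for x X Y
      unfolding KF_map_def using KF_map_in[OF ob ob map[OF x]] cat_Ob[OF category_Gam x] by blast
    show "KF_map (nerve_gamma_ar (Comp Gam y x)) = spcomp (KF (nerve_gamma X)) (KF_map (nerve_gamma_ar y)) (KF_map (nerve_gamma_ar x))"
      if x: "x \<in> Hom Gam X Y" and y: "y \<in> Hom Gam Y Z" for x y X Y Z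
    proof (intro ext)
      fix m p :: nat and s
      let ?n = "p ^ m"
      have yx: "mor (mor (Comp Gam y x) ?n) = ftor_comp (OMap X ?n) (mor (mor y ?n)) (mor (mor x ?n))"
        using ar[OF x, of ?n] by (simp add: Gam_simps(6) FF_simps(1) CAT_simps(6)) (metis arr.sel(1))
      have "nerve_map (OMap X ?n) (ftor_comp (OMap X ?n) (mor (mor y ?n)) (mor (mor x ?n))) p s =
        compose (spx (nerve (OMap X ?n)) p) (nerve_map (OMap Y ?n) (mor (mor y ?n)) p) (nerve_map (OMap X ?n) (mor (mor x ?n)) p) s"
      proof (cases "s \<in> spx (nerve (OMap X ?n)) p")
        case True
        have "nerve_map (OMap X ?n) (mor (mor x ?n)) p s \<in> spx (nerve (OMap Y ?n)) p"
          using smapsD(1)[OF nerve_map_in[OF preftor_of_ftor] True] ar[OF x] by blast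
        then show ?thesis using True ftor_comp_assoc[OF category_ordcat, of p "OMap X ?n" s]
          by (simp add: compose_def nerve_map_apply(1) spx_nerve)
      qed (simp add: compose_def nerve_map_apply(2))
      then show "KF_map (nerve_gamma_ar (Comp Gam y x)) m p s =
        spcomp (KF (nerve_gamma X)) (KF_map (nerve_gamma_ar y)) (KF_map (nerve_gamma_ar x)) m p s"
        unfolding spcomp_KF KF_map_def mm[OF x] mm[OF y] mm[OF cat_comp[OF category_Gam x y]] NX yx .
    qed
    show "KF_map (nerve_gamma_ar (Id Gam X)) n k s = s" if X: "X \<in> Ob Gam" and "s \<in> spx (sp (KF (nerve_gamma X)) n) k" for X n k s
    proof -
      have s: "s \<in> spx (nerve (OMap X (k ^ n))) k" using that(2) by (simp add: KF_simps NX)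
      have "mor (mor (Id Gam X) (k ^ n)) = fid (OMap X (k ^ n))" by (simp add: Gam_simps(5) FF_simps(1) CAT_simps(5))
      then show ?thesis
        unfolding KF_map_def mm[OF cat_id[OF category_Gam X]]
        using ftor_comp_fid(1)[OF s[unfolded spx_nerve]] by (simp add: nerve_map_apply(1)[OF s])
    qed
  qed
qed

theorem corollary4p2:
  fixes \<U> :: "'u set set" and T :: "'u small_cat" and P :: "'u sset"
  assumes "universe \<U>"
    and "terminal_object (CAT \<U>) T"
    and "terminal_object (SSET \<U>) P"
  shows "adjoint_equivalence_of_homotopy_theories TYPE('w)
           (Gamma_diag (CAT \<U>) T) (S_cat \<U> T) (Gstar_diag (CAT \<U>) T) (Si_cat \<U> T)
           (LL (CAT \<U>) T) (i_pull (CAT \<U>) T)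
       \<and> adjoint_equivalence_of_homotopy_theories TYPE('w)
           (Gamma_diag (SSET \<U>) P) (S_sset \<U> P) (Gstar_diag (SSET \<U>) P) (Si_sset \<U> P)
           (LL (SSET \<U>) P) (i_pull (SSET \<U>) P)"
proof
  note cat = spectrum_functor_CAT[OF assms(1,2)]
  interpret C: pointed_category "CAT \<U>" T by (rule pointed_category.intro[OF category_CAT assms(2)])
  have "S_cat \<U> T = spectrum_functor.stable (Gamma_diag (CAT \<U>) T) (\<lambda>X. KF (nerve_gamma X)) (\<lambda>x. KF_map (nerve_gamma_ar x))"
    unfolding spectrum_functor.stable_def[OF cat] S_cat_def
    by (simp add: gamma_stable_def nerve_gamma_ar_def C.Gam_simps(3,4))
  then show "adjoint_equivalence_of_homotopy_theories TYPE('w)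
           (Gamma_diag (CAT \<U>) T) (S_cat \<U> T) (Gstar_diag (CAT \<U>) T) (Si_cat \<U> T)
           (LL (CAT \<U>) T) (i_pull (CAT \<U>) T)"
    unfolding Si_cat_def
    by (rule C.adjoint_equivalence_of_spectrum_functor[OF has_countable_colimits_CAT[OF assms(1)] cat])
  note sset = spectrum_functor_SSET[OF assms(1,3)]
  interpret S: pointed_category "SSET \<U>" P by (rule pointed_category.intro[OF category_SSET assms(3)])
  have "S_sset \<U> P = spectrum_functor.stable (Gamma_diag (SSET \<U>) P) KF KF_map"
    unfolding spectrum_functor.stable_def[OF sset] S_sset_def by (simp add: gamma_stable_def S.Gam_simps(3,4))
  then show "adjoint_equivalence_of_homotopy_theories TYPE('w)
           (Gamma_diag (SSET \<U>) P) (S_sset \<U> P) (Gstar_diag (SSET \<U>) P) (Si_sset \<U> P)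
           (LL (SSET \<U>) P) (i_pull (SSET \<U>) P)"
    unfolding Si_sset_def
    by (rule S.adjoint_equivalence_of_spectrum_functor[OF has_countable_colimits_SSET[OF assms(1)] sset])
qed

end
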